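(* Assume that the collections $\Theta_\delta$ satisfy, for some constants $0<m\le M$, for all $\delta\in\Delta$, $z\in X^\delta$ and $\mathbf c=(c_\lambda)_{\lambda\in J_\delta}\subset\mathbb R$, $$m^2\|z+\mathbf c^\top\Theta_\delta\|_X^2\le \|z\|_X^2+\|\mathbf c\|^2\le M^2\|z+\mathbf c^\top\Theta_\delta\|_X^2 .$$ Let the constants $\gamma_\Delta$ and $\kappa_\Delta$ be as defined in the context, and consider the adaptive algorithm given in the context, with parameters $\omega>0$, $\vartheta\in(0,1]$, $0<\xi<1$ and tolerance $\varepsilon>0$. For constants $\vartheta$, $\omega/\vartheta$, $\xi/\vartheta$, $(\frac{\kappa_\Delta}{\gamma_\Delta}-1)/\omega$ sufficiently small, with additionally $\omega$ and $\frac{\kappa_\Delta}{\gamma_\Delta}-1$ sufficiently small dependent on $\vartheta$ with $\max(\frac{\kappa_\Delta}{\gamma_\Delta}-1,\omega)\downarrow 0$ when $\vartheta\downarrow 0$, there exists a constant $\breve\rho<1$ such that between any two successive passings of the until-clause of the algorithm the value of $\vartheta\|u-\tilde u^\delta\|_X+\eta(\delta)$ decreases with at least a factor $\breve\rho$. For any $\varepsilon>0$, the algorithm terminates, and at termination it holds that $\|u-\tilde u^\delta\|_X+\eta(\delta)\lesssim\varepsilon$.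
   Context: **Continuous problem.** $V,H$ are separable real Hilbert spaces with $V\hookrightarrow H$ densely; $V\hookrightarrow H\simeq H'\hookrightarrow V'$; $I=(0,T)$. For a.e. $t\in I$, $a(t;\cdot,\cdot)$ is a symmetric bilinear form on $V\times V$, measurable in $t$, with $|a(t;\eta,\zeta)|\lesssim\|\eta\|_V\|\zeta\|_V$ and $a(t;\eta,\eta)\gtrsim\|\eta\|_V^2$ uniformly in a.e. $t$. $X:=L_2(I;V)\cap H^1(I;V')$, $Y:=L_2(I;V)$, $(Bw)(v):=\int_I\langle\frac{dw}{dt}(t),v(t)\rangle+a(t;w(t),v(t))\,dt$, $(Aw)(v):=\int_I a(t;w(t),v(t))\,dt$, $\gamma_t w:=w(t,\cdot)\in H$, and $(\gamma_0'v)(w):=\langle v,\gamma_0w\rangle_H$. For $(g,u_0)\in Y'\times H$, $u\in X$ is the unique solution of $Bu=g$, $\gamma_0u=u_0$. Norms: $\|v\|_Y^2:=(Av)(v)$, $\|\cdot\|_{Y'}$ the dual norm, $\|w\|_X^2:=\|w\|_Y^2+\|\partial_tw\|_{Y'}^2+\|\gamma_Tw\|_H^2$. Put $S:=B'A^{-1}B+\gamma_0'\gamma_0$, $f:=B'A^{-1}g+\gamma_0'u_0$, so that $Su=f$. **Trial and test spaces.** $(X^\delta)_{\delta\in\Delta}$, $(Y^\delta)_{\delta\in\Delta}$ are collections of closed subspaces of $X$ and $Y$; $\delta\preceq\tilde\delta$ means $X^\delta\subseteq X^{\tilde\delta}$; $E_X^\delta:X^\delta\to X$, $E_Y^\delta:Y^\delta\to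 Y$ are the embeddings. It is assumed that $X^\delta\subseteq Y^\delta$ and $$1\ge\gamma_\Delta:=\inf_{\delta\in\Delta}\inf_{0\ne w\in X^\delta}\sup_{0\ne v\in Y^\delta}\frac{(\partial_tw)(v)}{\|\partial_tw\|_{Y'}\|v\|_Y}>0.$$ For each $\delta\in\Delta$, $K_Y^\delta=(K_Y^\delta)'$ is a boundedly invertible operator $(Y^\delta)'\to Y^\delta$, and $\kappa_\Delta\ge1$ is a constant with $\frac{((K_Y^{\delta})^{-1}v)(v)}{(Av)(v)}\in[\kappa_\Delta^{-1},\kappa_\Delta]$ for all $\delta\in\Delta$, $0\neq v\in Y^\delta$. **Saturation (standing assumption).** There are subspaces ${}^\delta G\times{}^\delta U_0\subseteq Y'\times H$ ($\delta\in\Delta$), a mapping $\Delta\to\Delta:\delta\mapsto\underline\delta$ with $\underline\delta\succeq\delta$, and a fixed constant $\zeta<1$ such that for all $\delta\in\Delta$: whenever the data lie in ${}^\delta G\times{}^\delta U_0$, the corresponding solution $u$ satisfies $\|u-u_{\underline\delta}\|_X\le\zeta\|u-u_\delta\|_X$, where $u_\delta\in X^\delta$ solves $(Su_\delta)(v)=f(v)$ for all $v\in X^\delta$. (It is understood that $Y^{\underline{\delta}}\supseteq Y^\delta$.) **Data approximation (standing assumption).** There are available maps: $\delta\mapsto({}^\delta g,{}^\delta u_0)\in{}^\delta G\times{}^\delta U_0$; $\eta:\Delta\to\mathbb R$ with $\|g-{}^\delta g\|_{Y'}+\|u_0-{}^\delta u_0\|_H\le\eta(\delta)$ and $\eta(\tilde\delta)\le\eta(\delta)$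 when $\tilde\delta\succeq\delta$; and $\mathbb R_{>0}\to\Delta:\varepsilon\mapsto\delta(\varepsilon)$ with $\eta(\delta(\varepsilon))\le\varepsilon$. **Complement functions.** For each $\delta$, $\Theta_\delta=\{\theta_\lambda:\lambda\in J_\delta\}\subseteq X^{\underline\delta}$ is such that $X^\delta+\mathrm{span}\,\Theta_\delta=X^{\underline\delta}$. For $J\subseteq J_\delta$, $\Theta_\delta|_J:=\{\theta_\lambda:\lambda\in J\}$ and $\mathbf c|_J$ is the restriction of a vector to $J$; $\|\cdot\|$ on vectors is the Euclidean norm. **Discrete systems.** $S^{\underline\delta\delta}:=(E_X^\delta)'(B'E_Y^{\underline\delta}K_Y^{\underline\delta}(E_Y^{\underline\delta})'B+\gamma_0'\gamma_0)E_X^\delta$, $f^\delta:=(E_X^\delta)'(B'E_Y^{\underline\delta}K_Y^{\underline\delta}(E_Y^{\underline\delta})'\,{}^\delta g+\gamma_0'\,{}^\delta u_0)$, and $u^\delta\in X^\delta$ is the solution of $S^{\underline\delta\delta}u^\delta=f^\delta$. For an approximation $\tilde u^\delta\in X^\delta$ of $u^\delta$, its residual vector is $$\tilde{\mathbf r}^\delta:=\Big(\big[B'E_Y^{\underline\delta}K_Y^{\underline\delta}(E_Y^{\underline\delta})'({}^\delta g-B\tilde u^\delta)+\gamma_0'({}^\delta u_0-\gamma_0\tilde u^\delta)\big](\theta_\lambda)\Big)_{\lambda\in J_\delta}.$$ $K_X^\delta=(K_X^\delta)'$ is a boundedly invertible operator $(X^\delta)'\to X^\delta$ with $((K_X^\delta)^{-1}w)(w)\eqsim\|w\|_X^2$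 for $w\in X^\delta$, uniformly in $\delta\in\Delta$. **Algorithm.** Let $\omega>0$, $\vartheta\in(0,1]$, $0<\xi<1$ be constants, and $\varepsilon>0$. Initialize $\delta:=\delta_{\rm init}\in\Delta$ and $t_\delta\eqsim\|g\|_{Y'}+\|u_0\|_H$. Repeat (outer loop): 1. (Inner loop) do: compute $\tilde u^\delta\in X^\delta$ with $\tilde t_\delta:=\sqrt{(f^\delta-S^{\underline\delta\delta}\tilde u^\delta)(K_X^\delta(f^\delta-S^{\underline\delta\delta}\tilde u^\delta))}\le t_\delta/2$; set $t_\delta:=\tilde t_\delta$; if $e_\delta:=\|\tilde{\mathbf r}^\delta\|+\eta(\delta)+t_\delta\le\varepsilon$ then stop the algorithm; until $t_\delta\le\xi e_\delta$ (the until-clause). 2. If $\eta(\delta)>\omega\|\tilde{\mathbf r}^\delta\|$, select $\tilde\delta\in\Delta$ such that $X^{\tilde\delta}\supseteq X^\delta$ is a (near-smallest) space with $\eta(\tilde\delta)\le\eta(\delta)/2$. Otherwise, determine $\delta\preceq\tilde\delta\preceq\underline\delta$ such that $X^{\tilde\delta}$ is a (near-smallest) space that, for some $J\subseteq J_\delta$ with $\|\tilde{\mathbf r}^\delta|_J\|\ge\vartheta\|\tilde{\mathbf r}^\delta\|$, contains $X^\delta+\mathrm{span}\,\Theta_\delta|_J$. 3. Set $t_{\tilde\delta}:=e_\delta$, $\delta:=\tilde\delta$. **Convention.** $C\lesssim D$ means that $C$ is bounded by a multiple of $D$ independently of parameters on which $C,D$ may depend (in particular $\delta$ and $\varepsilon$);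 $C\eqsim D$ means $C\lesssim D$ and $D\lesssim C$.
   Formalization: The smallness threshold for ξ/ϑ may depend on the value of ω/ϑ; with a threshold independent of ω the claim fails, since an inexact solve can raise ϑ‖u−ũ‖ by about ϑξ²/2, which exceeds the decrease of η when ω is much smaller than ϑξ². *)

theory Defs
  imports "HOL-Analysis.Analysis"
begin

section \<open>The Hilbert space of square integrable functions on the real line\<close>

text \<open>Values lie in a separable Hilbert space, so Borel measurable functions are strongly
  measurable and the quotient below is the Bochner space.\<close>

definition sq_integrable :: "(real \<Rightarrow> 'v::{real_inner, banach, second_countable_topology}) \<Rightarrow> bool" where
  "sq_integrable f \<longleftrightarrow> f \<in> borel_measurable lborel \<and> integrable lborel (\<lambda>t. (norm (f t))\<^sup>2)"

definition l2rel :: "(real \<Rightarrow> 'v::{real_inner, banach, second_countable_topology}) \<Rightarrow> (real \<Rightarrow> 'v) \<Rightarrow> bool" where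
  "l2rel f g \<longleftrightarrow> sq_integrable f \<and> sq_integrable g \<and> (AE t in lborel. f t = g t)"

lemma sq_integrable_zero: "sq_integrable (\<lambda>_. 0)"
  by (simp add: sq_integrable_def)

lemma sq_integrable_add:
  assumes "sq_integrable f" "sq_integrable g"
  shows "sq_integrable (\<lambda>t. f t + g t)"
proof -
  have mf [measurable]: "f \<in> borel_measurable lborel" and mg [measurable]: "g \<in> borel_measurable lborel"
    using assms by (auto simp: sq_integrable_def)
  have bnd: "(norm (f t + g t))\<^sup>2 \<le> 2 * (norm (f t))\<^sup>2 + 2 * (norm (g t))\<^sup>2" for t
  proof -
    have "(norm (f t + g t))\<^sup>2 \<le> (norm (f t) + norm (g t))\<^sup>2"
      by (intro power_mono norm_triangle_ineq) auto
    also have "\<dots> \<le> 2 * (norm (f t))\<^sup>2 + 2 * (norm (g t))\<^sup>2"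
      using sum_squares_bound[of "norm (f t)" "norm (g t)"] by (simp add: power2_sum)
    finally show ?thesis .
  qed
  have "integrable lborel (\<lambda>t. 2 * (norm (f t))\<^sup>2 + 2 * (norm (g t))\<^sup>2)"
    using assms by (auto simp: sq_integrable_def)
  then have "integrable lborel (\<lambda>t. (norm (f t + g t))\<^sup>2)"
    by (rule Bochner_Integration.integrable_bound) (use bnd in auto)
  then show ?thesis
    by (simp add: sq_integrable_def)
qed

lemma sq_integrable_scaleR:
  "sq_integrable f \<Longrightarrow> sq_integrable (\<lambda>t. c *\<^sub>R f t)"
  by (auto simp: sq_integrable_def power_mult_distrib)

lemma integrable_inner_sq_integrable:
  assumes "sq_integrable f" "sq_integrable g"
  shows "integrable lborel (\<lambda>t. f t \<bullet> g t)"
proof -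
  have mf [measurable]: "f \<in> borel_measurable lborel" and mg [measurable]: "g \<in> borel_measurable lborel"
    using assms by (auto simp: sq_integrable_def)
  have bnd: "\<bar>f t \<bullet> g t\<bar> \<le> (norm (f t))\<^sup>2 + (norm (g t))\<^sup>2" for t
  proof -
    have "\<bar>f t \<bullet> g t\<bar> \<le> norm (f t) * norm (g t)"
      by (rule Cauchy_Schwarz_ineq2)
    also have "\<dots> \<le> (norm (f t))\<^sup>2 + (norm (g t))\<^sup>2"
      using sum_squares_bound[of "norm (f t)" "norm (g t)"]
        mult_nonneg_nonneg[OF norm_ge_zero[of "f t"] norm_ge_zero[of "g t"]]
      by linarith
    finally show ?thesis .
  qed
  have "integrable lborel (\<lambda>t. (norm (f t))\<^sup>2 + (norm (g t))\<^sup>2)"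
    using assms by (auto simp: sq_integrable_def)
  then show ?thesis
    by (rule Bochner_Integration.integrable_bound) (use bnd in auto)
qed

lemma part_equivp_l2rel:
  "part_equivp (l2rel :: (real \<Rightarrow> 'v::{real_inner, banach, second_countable_topology}) \<Rightarrow> _)"
proof (rule part_equivpI)
  show "\<exists>f :: real \<Rightarrow> 'v. l2rel f f"
    by (rule exI[of _ "\<lambda>_. 0"]) (simp add: l2rel_def sq_integrable_zero)
  show "symp (l2rel :: (real \<Rightarrow> 'v) \<Rightarrow> _)"
  proof (rule sympI)
    fix f g :: "real \<Rightarrow> 'v"
    assume fg: "l2rel f g"
    then have "AE t in lborel. f t = g t"
      by (simp add: l2rel_def)
    then have "AE t in lborel. g t = f t"
      by eventually_elim simp
    with fg show "l2rel g f"
      by (simp add: l2rel_def)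
  qed
  show "transp (l2rel :: (real \<Rightarrow> 'v) \<Rightarrow> _)"
  proof (rule transpI)
    fix f g h :: "real \<Rightarrow> 'v"
    assume fg: "l2rel f g" and gh: "l2rel g h"
    then have "AE t in lborel. f t = g t" "AE t in lborel. g t = h t"
      by (simp_all add: l2rel_def)
    then have "AE t in lborel. f t = h t"
      by eventually_elim simp
    with fg gh show "l2rel f h"
      by (simp add: l2rel_def)
  qed
qed

quotient_type (overloaded) 'v l2 =
  "real \<Rightarrow> 'v::{real_inner, banach, second_countable_topology}" / partial: l2rel
  by (rule part_equivp_l2rel)

instantiation l2 :: ("{real_inner, banach, second_countable_topology}") real_inner
begin

lift_definition zero_l2 :: "'a l2" is "\<lambda>_. 0"
  by (simp add: l2rel_def sq_integrable_zero)

lift_definition plus_l2 :: "'a l2 \<Rightarrow> 'a l2 \<Rightarrow> 'a l2" is "\<lambda>f g t. f t + g t"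
  by (auto simp: l2rel_def intro: sq_integrable_add)

lift_definition scaleR_l2 :: "real \<Rightarrow> 'a l2 \<Rightarrow> 'a l2" is "\<lambda>c f t. c *\<^sub>R f t"
  by (auto simp: l2rel_def intro: sq_integrable_scaleR)

lift_definition uminus_l2 :: "'a l2 \<Rightarrow> 'a l2" is "\<lambda>f t. - f t"
  by (auto simp: l2rel_def sq_integrable_def)

definition minus_l2 :: "'a l2 \<Rightarrow> 'a l2 \<Rightarrow> 'a l2" where
  "minus_l2 v w = v + - w"

lift_definition inner_l2 :: "'a l2 \<Rightarrow> 'a l2 \<Rightarrow> real" is "\<lambda>f g. \<integral>t. f t \<bullet> g t \<partial>lborel"
proof -
  fix f f' g g' :: "real \<Rightarrow> 'a"
  assume "l2rel f f'" "l2rel g g'"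
  then have [measurable]: "f \<in> borel_measurable lborel" "f' \<in> borel_measurable lborel"
      "g \<in> borel_measurable lborel" "g' \<in> borel_measurable lborel"
    and "AE t in lborel. f t = f' t" "AE t in lborel. g t = g' t"
    by (auto simp: l2rel_def sq_integrable_def)
  then show "(\<integral>t. f t \<bullet> g t \<partial>lborel) = (\<integral>t. f' t \<bullet> g' t \<partial>lborel)"
    by (intro integral_cong_AE) auto
qed

definition norm_l2 :: "'a l2 \<Rightarrow> real" where
  "norm_l2 w = sqrt (w \<bullet> w)"

definition sgn_l2 :: "'a l2 \<Rightarrow> 'a l2" where
  "sgn_l2 w = inverse (norm w) *\<^sub>R w"

definition dist_l2 :: "'a l2 \<Rightarrow> 'a l2 \<Rightarrow> real" where
  "dist_l2 v w = norm (v - w)"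

definition uniformity_l2 :: "('a l2 \<times> 'a l2) filter" where
  "uniformity_l2 = (INF e\<in>{0<..}. principal {(v, w). dist v w < e})"

definition open_l2 :: "'a l2 set \<Rightarrow> bool" where
  "open_l2 U \<longleftrightarrow> (\<forall>v\<in>U. eventually (\<lambda>(v', w). v' = v \<longrightarrow> w \<in> U) uniformity)"

instance
proof
  fix u v w :: "'a l2" and a b :: real
  show "u + v + w = u + (v + w)"
    by transfer (auto simp: l2rel_def ac_simps intro!: sq_integrable_add)
  show "v + w = w + v"
    by transfer (auto simp: l2rel_def ac_simps intro!: sq_integrable_add)
  show "0 + w = w"
    by transfer (auto simp: l2rel_def)
  show "- w + w = 0"
    by transfer (auto simp: l2rel_def sq_integrable_zero)
  show "v - w = v + - w"
    by (rule minus_l2_def)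
  show "a *\<^sub>R (v + w) = a *\<^sub>R v + a *\<^sub>R w"
    by transfer (auto simp: l2rel_def scaleR_add_right intro!: sq_integrable_add sq_integrable_scaleR)
  show "(a + b) *\<^sub>R w = a *\<^sub>R w + b *\<^sub>R w"
    by transfer (auto simp: l2rel_def scaleR_add_left intro!: sq_integrable_add sq_integrable_scaleR)
  show "a *\<^sub>R b *\<^sub>R w = (a * b) *\<^sub>R w"
    by transfer (auto simp: l2rel_def intro!: sq_integrable_scaleR)
  show "1 *\<^sub>R w = w"
    by transfer (auto simp: l2rel_def)
  show "dist v w = norm (v - w)"
    by (rule dist_l2_def)
  show "sgn w = inverse (norm w) *\<^sub>R w"
    by (rule sgn_l2_def)
  show "(uniformity :: ('a l2 \<times> 'a l2) filter) = (INF e\<in>{0<..}. principal {(v, w). dist v w < e})"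
    by (rule uniformity_l2_def)
  show "open U = (\<forall>v\<in>U. eventually (\<lambda>(v', w). v' = v \<longrightarrow> w \<in> U) uniformity)" for U :: "'a l2 set"
    by (rule open_l2_def)
  show "v \<bullet> w = w \<bullet> v"
    by transfer (simp add: inner_commute)
  show "(u + v) \<bullet> w = u \<bullet> w + v \<bullet> w"
    by transfer (auto simp: l2rel_def inner_add_left integrable_inner_sq_integrable)
  show "(a *\<^sub>R v) \<bullet> w = a * (v \<bullet> w)"
    by transfer (auto simp: l2rel_def)
  show "0 \<le> w \<bullet> w"
    by transfer auto
  show "w \<bullet> w = 0 \<longleftrightarrow> w = 0"
  proof transfer
    fix f :: "real \<Rightarrow> 'a"
    assume "l2rel f f"
    then have f: "sq_integrable f"
      by (simp add: l2rel_def)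
    have "(\<integral>t. f t \<bullet> f t \<partial>lborel) = 0 \<longleftrightarrow> (AE t in lborel. f t \<bullet> f t = 0)"
      by (rule integral_nonneg_eq_0_iff_AE) (auto intro: integrable_inner_sq_integrable f)
    then show "(\<integral>t. f t \<bullet> f t \<partial>lborel) = 0 \<longleftrightarrow> l2rel f (\<lambda>_. 0)"
      using f by (simp add: l2rel_def sq_integrable_zero)
  qed
  show "norm w = sqrt (w \<bullet> w)"
    by (rule norm_l2_def)
qed

end


section \<open>Duals of normed subspaces\<close>

text \<open>A bounded functional on a subspace \<open>Z\<close> is represented by the function that is 0 off \<open>Z\<close>,
  so that equality of functionals is equality of functions.\<close>

definition restr :: "'a set \<Rightarrow> ('a \<Rightarrow> real) \<Rightarrow> 'a \<Rightarrow> real" where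
  "restr Z F = (\<lambda>v. if v \<in> Z then F v else 0)"

definition dual_space :: "('a::real_vector \<Rightarrow> real) \<Rightarrow> 'a set \<Rightarrow> ('a \<Rightarrow> real) set" where
  "dual_space N Z = {F. (\<forall>v\<in>Z. \<forall>w\<in>Z. F (v + w) = F v + F w) \<and>
     (\<forall>c. \<forall>v\<in>Z. F (c *\<^sub>R v) = c * F v) \<and>
     (\<exists>C. \<forall>v\<in>Z. \<bar>F v\<bar> \<le> C * N v) \<and> (\<forall>v. v \<notin> Z \<longrightarrow> F v = 0)}"

definition dual_norm :: "('a::real_vector \<Rightarrow> real) \<Rightarrow> 'a set \<Rightarrow> ('a \<Rightarrow> real) \<Rightarrow> real" where
  "dual_norm N Z F = (SUP v\<in>{v\<in>Z. N v \<le> 1}. \<bar>F v\<bar>)"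

definition functional_subspace :: "('a \<Rightarrow> real) set \<Rightarrow> bool" where
  "functional_subspace L \<longleftrightarrow> (\<lambda>_. 0) \<in> L \<and> (\<forall>F\<in>L. \<forall>G\<in>L. (\<lambda>v. F v + G v) \<in> L) \<and>
     (\<forall>c. \<forall>F\<in>L. (\<lambda>v. c * F v) \<in> L)"

definition closed_in_norm :: "('a::real_vector \<Rightarrow> real) \<Rightarrow> 'a set \<Rightarrow> 'a set \<Rightarrow> bool" where
  "closed_in_norm N X Z \<longleftrightarrow>
     (\<forall>s w. (\<forall>n. s n \<in> Z) \<and> w \<in> X \<and> (\<lambda>n. N (s n - w)) \<longlonglongrightarrow> 0 \<longrightarrow> w \<in> Z)"

definition sym_bdd_invertible :: "('a::real_vector \<Rightarrow> real) \<Rightarrow> 'a set \<Rightarrow> (('a \<Rightarrow> real) \<Rightarrow> 'a) \<Rightarrow> bool" where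
  "sym_bdd_invertible N Z K \<longleftrightarrow> bij_betw K (dual_space N Z) Z \<and>
     (\<forall>F\<in>dual_space N Z. \<forall>G\<in>dual_space N Z. K (\<lambda>v. F v + G v) = K F + K G) \<and>
     (\<forall>c. \<forall>F\<in>dual_space N Z. K (\<lambda>v. c * F v) = c *\<^sub>R K F) \<and>
     (\<exists>C. \<forall>F\<in>dual_space N Z. N (K F) \<le> C * dual_norm N Z F \<and> dual_norm N Z F \<le> C * N (K F)) \<and>
     (\<forall>F\<in>dual_space N Z. \<forall>G\<in>dual_space N Z. F (K G) = G (K F))"

abbreviation dual_inv :: "('a::real_vector \<Rightarrow> real) \<Rightarrow> 'a set \<Rightarrow> (('a \<Rightarrow> real) \<Rightarrow> 'a) \<Rightarrow> 'a \<Rightarrow> 'a \<Rightarrow> real" where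
  "dual_inv N Z K \<equiv> the_inv_into (dual_space N Z) K"


section \<open>The parabolic problem\<close>

record ('v, 'h) evolution =
  horizon :: real
  emb :: "'v \<Rightarrow> 'h"
  aform :: "real \<Rightarrow> 'v \<Rightarrow> 'v \<Rightarrow> real"

abbreviation ivl :: "('v, 'h) evolution \<Rightarrow> real set" where
  "ivl P \<equiv> {0<..<horizon P}"

definition evolution_problem ::
    "('v::{real_inner, banach, second_countable_topology},
      'h::{real_inner, banach, second_countable_topology}) evolution \<Rightarrow> bool" where
  "evolution_problem P \<longleftrightarrow> 0 < horizon P \<and>
     bounded_linear (emb P) \<and> inj (emb P) \<and> closure (range (emb P)) = UNIV \<and>
     (\<forall>\<eta> \<zeta>. (\<lambda>t. aform P t \<eta> \<zeta>) \<in> borel_measurable (lebesgue_on (ivl P))) \<and>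
     (\<exists>C c. 0 < c \<and> (AE t in lebesgue. t \<in> ivl P \<longrightarrow>
        bilinear (aform P t) \<and>
        (\<forall>\<eta> \<zeta>. aform P t \<eta> \<zeta> = aform P t \<zeta> \<eta>) \<and>
        (\<forall>\<eta> \<zeta>. \<bar>aform P t \<eta> \<zeta>\<bar> \<le> C * norm \<eta> * norm \<zeta>) \<and>
        (\<forall>\<eta>. aform P t \<eta> \<eta> \<ge> c * (norm \<eta>)\<^sup>2)))"

text \<open>\<open>L\<^sub>2(I;V)\<close> is identified, by extension by zero, with the closed subspace of those classes on
  the real line that vanish almost everywhere outside \<open>I\<close>.\<close>

definition Yspace :: "('v::{real_inner, banach, second_countable_topology}, 'h) evolution \<Rightarrow> 'v l2 set" where
  "Yspace P = {v. AE t in lborel. t \<notin> ivl P \<longrightarrow> rep_l2 v t = 0}"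

definition test_function :: "('v, 'h) evolution \<Rightarrow> (real \<Rightarrow> real) \<Rightarrow> (real \<Rightarrow> real) \<Rightarrow> bool" where
  "test_function P \<phi> \<phi>' \<longleftrightarrow> (\<forall>t. (\<phi> has_real_derivative \<phi>' t) (at t)) \<and> continuous_on UNIV \<phi>' \<and>
     (\<exists>K. compact K \<and> K \<subseteq> ivl P \<and> (\<forall>t. t \<notin> K \<longrightarrow> \<phi> t = 0))"

text \<open>The derivative lies in \<open>L\<^sub>2(I;V')\<close>; since \<open>V'\<close> is separable, Borel measurability
  for the norm topology is strong measurability. An element \<open>\<eta>\<close> of \<open>V\<close> acts on \<open>V\<close> through the
  Gelfand triple as \<open>\<zeta> \<mapsto> \<langle>\<eta>,\<zeta>\<rangle>\<^sub>H\<close>, and the identity in \<open>V'\<close> defining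
  the weak derivative is written out by testing with every \<open>\<zeta>\<close> in \<open>V\<close>.\<close>

definition weak_derivative ::
    "('v::{real_inner, banach, second_countable_topology}, 'h::real_inner) evolution \<Rightarrow>
     'v l2 \<Rightarrow> (real \<Rightarrow> ('v \<Rightarrow>\<^sub>L real)) \<Rightarrow> bool" where
  "weak_derivative P w d \<longleftrightarrow>
     set_borel_measurable lborel (ivl P) d \<and>
     set_integrable lborel (ivl P) (\<lambda>t. (norm (d t))\<^sup>2) \<and>
     (\<forall>\<phi> \<phi>'. test_function P \<phi> \<phi>' \<longrightarrow> (\<forall>\<zeta>.
        (LINT t:ivl P|lborel. \<phi>' t * (emb P (rep_l2 w t) \<bullet> emb P \<zeta>)) =
        - (LINT t:ivl P|lborel. \<phi> t * blinfun_apply (d t) \<zeta>)))"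

definition Xspace :: "('v::{real_inner, banach, second_countable_topology}, 'h::real_inner) evolution \<Rightarrow> 'v l2 set" where
  "Xspace P = {w \<in> Yspace P. \<exists>d. weak_derivative P w d}"

definition wderiv ::
    "('v::{real_inner, banach, second_countable_topology}, 'h::real_inner) evolution \<Rightarrow>
     'v l2 \<Rightarrow> real \<Rightarrow> ('v \<Rightarrow>\<^sub>L real)" where
  "wderiv P w = (SOME d. weak_derivative P w d)"

text \<open>\<open>\<gamma>\<^sub>s w\<close>, taken from the representative of \<open>w\<close> in \<open>C([0,T];H)\<close>.\<close>

definition trace ::
    "('v::{real_inner, banach, second_countable_topology}, 'h::real_inner) evolution \<Rightarrow> real \<Rightarrow> 'v l2 \<Rightarrow> 'h" where
  "trace P s w = (THE h. \<exists>\<omega>. continuous_on {0..horizon P} \<omega> \<and>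
     (AE t in lborel. t \<in> ivl P \<longrightarrow> \<omega> t = emb P (rep_l2 w t)) \<and> h = \<omega> s)"

definition dt_op ::
    "('v::{real_inner, banach, second_countable_topology}, 'h::real_inner) evolution \<Rightarrow> 'v l2 \<Rightarrow> 'v l2 \<Rightarrow> real" where
  "dt_op P w = restr (Yspace P) (\<lambda>v. LINT t:ivl P|lebesgue. blinfun_apply (wderiv P w t) (rep_l2 v t))"

definition A_op ::
    "('v::{real_inner, banach, second_countable_topology}, 'h) evolution \<Rightarrow> 'v l2 \<Rightarrow> 'v l2 \<Rightarrow> real" where
  "A_op P w = restr (Yspace P) (\<lambda>v. LINT t:ivl P|lebesgue. aform P t (rep_l2 w t) (rep_l2 v t))"

definition B_op ::
    "('v::{real_inner, banach, second_countable_topology}, 'h::real_inner) evolution \<Rightarrow> 'v l2 \<Rightarrow> 'v l2 \<Rightarrow> real" where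
  "B_op P w = restr (Yspace P) (\<lambda>v. LINT t:ivl P|lebesgue.
     blinfun_apply (wderiv P w t) (rep_l2 v t) + aform P t (rep_l2 w t) (rep_l2 v t))"

definition Ynorm :: "('v::{real_inner, banach, second_countable_topology}, 'h) evolution \<Rightarrow> 'v l2 \<Rightarrow> real" where
  "Ynorm P v = sqrt (A_op P v v)"

abbreviation Ydual ::
    "('v::{real_inner, banach, second_countable_topology}, 'h) evolution \<Rightarrow> ('v l2 \<Rightarrow> real) set" where
  "Ydual P \<equiv> dual_space (Ynorm P) (Yspace P)"

abbreviation Ydual_norm ::
    "('v::{real_inner, banach, second_countable_topology}, 'h) evolution \<Rightarrow> ('v l2 \<Rightarrow> real) \<Rightarrow> real" where
  "Ydual_norm P \<equiv> dual_norm (Ynorm P) (Yspace P)"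

definition Xnorm ::
    "('v::{real_inner, banach, second_countable_topology}, 'h::real_inner) evolution \<Rightarrow> 'v l2 \<Rightarrow> real" where
  "Xnorm P w = sqrt ((Ynorm P w)\<^sup>2 + (Ydual_norm P (dt_op P w))\<^sup>2 + (norm (trace P (horizon P) w))\<^sup>2)"

definition A_inv ::
    "('v::{real_inner, banach, second_countable_topology}, 'h) evolution \<Rightarrow> ('v l2 \<Rightarrow> real) \<Rightarrow> 'v l2" where
  "A_inv P G = (THE y. y \<in> Yspace P \<and> A_op P y = G)"

text \<open>The adjoints are unfolded: \<open>(B'y)(z) = (Bz)(y)\<close> and
  \<open>(\<gamma>\<^sub>0'h)(z) = \<langle>h, \<gamma>\<^sub>0 z\<rangle>\<^sub>H\<close>.\<close>

definition S_op ::
    "('v::{real_inner, banach, second_countable_topology}, 'h::real_inner) evolution \<Rightarrow> 'v l2 \<Rightarrow> 'v l2 \<Rightarrow> real" where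
  "S_op P w = restr (Xspace P) (\<lambda>z. B_op P z (A_inv P (B_op P w)) + trace P 0 w \<bullet> trace P 0 z)"

definition S_rhs ::
    "('v::{real_inner, banach, second_countable_topology}, 'h::real_inner) evolution \<Rightarrow>
     ('v l2 \<Rightarrow> real) \<Rightarrow> 'h \<Rightarrow> 'v l2 \<Rightarrow> real" where
  "S_rhs P g u0 = restr (Xspace P) (\<lambda>z. B_op P z (A_inv P g) + u0 \<bullet> trace P 0 z)"

definition solves ::
    "('v::{real_inner, banach, second_countable_topology}, 'h::real_inner) evolution \<Rightarrow>
     ('v l2 \<Rightarrow> real) \<Rightarrow> 'h \<Rightarrow> 'v l2 \<Rightarrow> bool" where
  "solves P g u0 u \<longleftrightarrow> u \<in> Xspace P \<and> B_op P u = g \<and> trace P 0 u = u0"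


section \<open>Discretization\<close>

text \<open>The index set \<open>\<Delta>\<close> is the (nonempty) type \<open>'d\<close>; \<open>\<delta> \<preceq> \<delta>'\<close> is
  \<open>trial D \<delta> \<subseteq> trial D \<delta>'\<close>. The field \<open>up\<close> is the map written with an underlined
  \<open>\<delta>\<close>, \<open>KY\<close> and \<open>KX\<close> the operators on the duals of the test and trial spaces, \<open>Gdat\<close>
  and \<open>Udat\<close> the spaces of data for which saturation holds, \<open>ind\<close> the index sets
  \<open>J\<^sub>\<delta>\<close>, and \<open>compl_fun\<close> gives the functions \<open>\<theta>\<^sub>\<lambda>\<close>.\<close>

record (overloaded) ('d, 'l, 'v, 'h) discretization =
  trial :: "'d \<Rightarrow> 'v l2 set"
  test :: "'d \<Rightarrow> 'v l2 set"
  up :: "'d \<Rightarrow> 'd"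
  KY :: "'d \<Rightarrow> ('v l2 \<Rightarrow> real) \<Rightarrow> 'v l2"
  KX :: "'d \<Rightarrow> ('v l2 \<Rightarrow> real) \<Rightarrow> 'v l2"
  Gdat :: "'d \<Rightarrow> ('v l2 \<Rightarrow> real) set"
  Udat :: "'d \<Rightarrow> 'h set"
  ind :: "'d \<Rightarrow> 'l set"
  compl_fun :: "'d \<Rightarrow> 'l \<Rightarrow> 'v l2"

text \<open>Trial functions with vanishing time derivative, for which the quotient reads 0/0, are left
  out of the infimum.\<close>

definition gamma_const ::
    "('v::{real_inner, banach, second_countable_topology}, 'h::real_inner) evolution \<Rightarrow>
     ('d, 'l, 'v, 'h) discretization \<Rightarrow> ereal" where
  "gamma_const P D =
     (INF \<delta>. INF w\<in>{w \<in> trial D \<delta>. dt_op P w \<noteq> (\<lambda>_. 0)}. SUP v\<in>test D \<delta> - {0}.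
        ereal (dt_op P w v / (Ydual_norm P (dt_op P w) * Ynorm P v)))"

definition trial_test_spaces ::
    "('v::{real_inner, banach, second_countable_topology}, 'h::real_inner) evolution \<Rightarrow>
     ('d, 'l, 'v, 'h) discretization \<Rightarrow> bool" where
  "trial_test_spaces P D \<longleftrightarrow> (\<forall>\<delta>.
       trial D \<delta> \<subseteq> Xspace P \<and> subspace (trial D \<delta>) \<and> closed_in_norm (Xnorm P) (Xspace P) (trial D \<delta>) \<and>
       test D \<delta> \<subseteq> Yspace P \<and> subspace (test D \<delta>) \<and> closed (test D \<delta>) \<and>
       trial D \<delta> \<subseteq> test D \<delta> \<and>
       trial D \<delta> \<subseteq> trial D (up D \<delta>) \<and> test D \<delta> \<subseteq> test D (up D \<delta>)) \<and>
     0 < gamma_const P D \<and> gamma_const P D \<le> 1"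

definition test_preconditioner ::
    "('v::{real_inner, banach, second_countable_topology}, 'h::real_inner) evolution \<Rightarrow>
     ('d, 'l, 'v, 'h) discretization \<Rightarrow> real \<Rightarrow> bool" where
  "test_preconditioner P D \<kappa> \<longleftrightarrow> 1 \<le> \<kappa> \<and> (\<forall>\<delta>.
     sym_bdd_invertible (Ynorm P) (test D \<delta>) (KY D \<delta>) \<and>
     (\<forall>v \<in> test D \<delta> - {0}.
        dual_inv (Ynorm P) (test D \<delta>) (KY D \<delta>) v v / A_op P v v \<in> {1 / \<kappa>..\<kappa>}))"

definition trial_preconditioner ::
    "('v::{real_inner, banach, second_countable_topology}, 'h::real_inner) evolution \<Rightarrow>
     ('d, 'l, 'v, 'h) discretization \<Rightarrow> real \<Rightarrow> real \<Rightarrow> bool" where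
  "trial_preconditioner P D k\<^sub>1 k\<^sub>2 \<longleftrightarrow> (\<forall>\<delta>.
     sym_bdd_invertible (Xnorm P) (trial D \<delta>) (KX D \<delta>) \<and>
     (\<forall>w \<in> trial D \<delta>.
        k\<^sub>1 * (Xnorm P w)\<^sup>2 \<le> dual_inv (Xnorm P) (trial D \<delta>) (KX D \<delta>) w w \<and>
        dual_inv (Xnorm P) (trial D \<delta>) (KX D \<delta>) w w \<le> k\<^sub>2 * (Xnorm P w)\<^sup>2))"

definition galerkin ::
    "('v::{real_inner, banach, second_countable_topology}, 'h::real_inner) evolution \<Rightarrow>
     ('d, 'l, 'v, 'h) discretization \<Rightarrow> 'd \<Rightarrow> ('v l2 \<Rightarrow> real) \<Rightarrow> 'h \<Rightarrow> 'v l2 \<Rightarrow> bool" where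
  "galerkin P D \<delta> g u0 w \<longleftrightarrow> w \<in> trial D \<delta> \<and> (\<forall>v\<in>trial D \<delta>. S_op P w v = S_rhs P g u0 v)"

definition saturation ::
    "('v::{real_inner, banach, second_countable_topology}, 'h::real_inner) evolution \<Rightarrow>
     ('d, 'l, 'v, 'h) discretization \<Rightarrow> real \<Rightarrow> bool" where
  "saturation P D \<zeta> \<longleftrightarrow> (\<forall>\<delta>.
     Gdat D \<delta> \<subseteq> Ydual P \<and> functional_subspace (Gdat D \<delta>) \<and> subspace (Udat D \<delta>) \<and>
     (\<forall>g\<in>Gdat D \<delta>. \<forall>u0\<in>Udat D \<delta>. \<forall>u w w'.
        solves P g u0 u \<and> galerkin P D \<delta> g u0 w \<and> galerkin P D (up D \<delta>) g u0 w' \<longrightarrow>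
        Xnorm P (u - w') \<le> \<zeta> * Xnorm P (u - w)))"

definition complement_functions ::
    "('v::{real_inner, banach, second_countable_topology}, 'h::real_inner) evolution \<Rightarrow>
     ('d, 'l, 'v, 'h) discretization \<Rightarrow> bool" where
  "complement_functions P D \<longleftrightarrow> (\<forall>\<delta>. finite (ind D \<delta>) \<and>
     {z + y |z y. z \<in> trial D \<delta> \<and> y \<in> span (compl_fun D \<delta> ` ind D \<delta>)} = trial D (up D \<delta>))"

definition stable_complement ::
    "('v::{real_inner, banach, second_countable_topology}, 'h::real_inner) evolution \<Rightarrow>
     ('d, 'l, 'v, 'h) discretization \<Rightarrow> real \<Rightarrow> real \<Rightarrow> bool" where
  "stable_complement P D m M \<longleftrightarrow> (\<forall>\<delta>. \<forall>z\<in>trial D \<delta>. \<forall>c.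
     (let y = z + (\<Sum>l\<in>ind D \<delta>. c l *\<^sub>R compl_fun D \<delta> l);
          s = (Xnorm P z)\<^sup>2 + (L2_set c (ind D \<delta>))\<^sup>2
      in m\<^sup>2 * (Xnorm P y)\<^sup>2 \<le> s \<and> s \<le> M\<^sup>2 * (Xnorm P y)\<^sup>2))"

text \<open>\<open>rhs\<close>, \<open>ini\<close> are the exact data; \<open>rhs_appr\<close>, \<open>ini_appr\<close> their approximations with
  error bound \<open>osc\<close> (the function \<open>\<eta>\<close>); \<open>osc_sel\<close> is the map
  \<open>\<epsilon> \<mapsto> \<delta>(\<epsilon>)\<close>.\<close>

record (overloaded) ('d, 'v, 'h) data =
  rhs :: "'v l2 \<Rightarrow> real"
  ini :: 'h
  rhs_appr :: "'d \<Rightarrow> 'v l2 \<Rightarrow> real"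
  ini_appr :: "'d \<Rightarrow> 'h"
  osc :: "'d \<Rightarrow> real"
  osc_sel :: "real \<Rightarrow> 'd"

definition admissible_data ::
    "('v::{real_inner, banach, second_countable_topology}, 'h::real_inner) evolution \<Rightarrow>
     ('d, 'l, 'v, 'h) discretization \<Rightarrow> ('d, 'v, 'h) data \<Rightarrow> bool" where
  "admissible_data P D d \<longleftrightarrow> rhs d \<in> Ydual P \<and>
     (\<forall>\<delta>. rhs_appr d \<delta> \<in> Gdat D \<delta> \<and> ini_appr d \<delta> \<in> Udat D \<delta> \<and>
        Ydual_norm P (\<lambda>v. rhs d v - rhs_appr d \<delta> v) + norm (ini d - ini_appr d \<delta>) \<le> osc d \<delta>) \<and>
     (\<forall>\<delta> \<delta>'. trial D \<delta> \<subseteq> trial D \<delta>' \<longrightarrow> osc d \<delta>' \<le> osc d \<delta>) \<and>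
     (\<forall>\<epsilon>>0. osc d (osc_sel d \<epsilon>) \<le> \<epsilon>)"


section \<open>Discrete systems and the adaptive algorithm\<close>

text \<open>\<open>lift_res P D \<delta> F y\<close> is \<open>(B' E\<^sub>Y K\<^sub>Y E\<^sub>Y' F)(y)\<close>, with \<open>E\<^sub>Y\<close>, \<open>K\<^sub>Y\<close> taken at the
  index \<open>up D \<delta>\<close>.\<close>

definition lift_res ::
    "('v::{real_inner, banach, second_countable_topology}, 'h::real_inner) evolution \<Rightarrow>
     ('d, 'l, 'v, 'h) discretization \<Rightarrow> 'd \<Rightarrow> ('v l2 \<Rightarrow> real) \<Rightarrow> 'v l2 \<Rightarrow> real" where
  "lift_res P D \<delta> F y = B_op P y (KY D (up D \<delta>) (restr (test D (up D \<delta>)) F))"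

definition S_disc ::
    "('v::{real_inner, banach, second_countable_topology}, 'h::real_inner) evolution \<Rightarrow>
     ('d, 'l, 'v, 'h) discretization \<Rightarrow> 'd \<Rightarrow> 'v l2 \<Rightarrow> 'v l2 \<Rightarrow> real" where
  "S_disc P D \<delta> w = restr (trial D \<delta>)
     (\<lambda>z. lift_res P D \<delta> (B_op P w) z + trace P 0 w \<bullet> trace P 0 z)"

definition f_disc ::
    "('v::{real_inner, banach, second_countable_topology}, 'h::real_inner) evolution \<Rightarrow>
     ('d, 'l, 'v, 'h) discretization \<Rightarrow> ('d, 'v, 'h) data \<Rightarrow> 'd \<Rightarrow> 'v l2 \<Rightarrow> real" where
  "f_disc P D d \<delta> = restr (trial D \<delta>)
     (\<lambda>z. lift_res P D \<delta> (rhs_appr d \<delta>) z + ini_appr d \<delta> \<bullet> trace P 0 z)"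

definition residual_vec ::
    "('v::{real_inner, banach, second_countable_topology}, 'h::real_inner) evolution \<Rightarrow>
     ('d, 'l, 'v, 'h) discretization \<Rightarrow> ('d, 'v, 'h) data \<Rightarrow> 'd \<Rightarrow> 'v l2 \<Rightarrow> 'l \<Rightarrow> real" where
  "residual_vec P D d \<delta> w l =
     lift_res P D \<delta> (\<lambda>v. rhs_appr d \<delta> v - B_op P w v) (compl_fun D \<delta> l) +
     (ini_appr d \<delta> - trace P 0 w) \<bullet> trace P 0 (compl_fun D \<delta> l)"

definition alg_est ::
    "('v::{real_inner, banach, second_countable_topology}, 'h::real_inner) evolution \<Rightarrow>
     ('d, 'l, 'v, 'h) discretization \<Rightarrow> ('d, 'v, 'h) data \<Rightarrow> 'd \<Rightarrow> 'v l2 \<Rightarrow> real" where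
  "alg_est P D d \<delta> w =
     (let F = (\<lambda>z. f_disc P D d \<delta> z - S_disc P D \<delta> w z) in sqrt (F (KX D \<delta> F)))"

definition total_est ::
    "('v::{real_inner, banach, second_countable_topology}, 'h::real_inner) evolution \<Rightarrow>
     ('d, 'l, 'v, 'h) discretization \<Rightarrow> ('d, 'v, 'h) data \<Rightarrow> 'd \<Rightarrow> 'v l2 \<Rightarrow> real" where
  "total_est P D d \<delta> w =
     L2_set (residual_vec P D d \<delta> w) (ind D \<delta>) + osc d \<delta> + alg_est P D d \<delta> w"

text \<open>Step 2 of the algorithm, with bulk parameter \<open>\<theta>\<close>. No (near-)minimality of the selected
  space is imposed, so every selection rule is covered.\<close>

definition refines ::
    "('v::{real_inner, banach, second_countable_topology}, 'h::real_inner) evolution \<Rightarrow>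
     ('d, 'l, 'v, 'h) discretization \<Rightarrow> ('d, 'v, 'h) data \<Rightarrow> real \<Rightarrow> real \<Rightarrow> 'd \<Rightarrow> 'v l2 \<Rightarrow> 'd \<Rightarrow> bool" where
  "refines P D d \<omega> \<theta> \<delta> w \<delta>' \<longleftrightarrow>
     (let r = residual_vec P D d \<delta> w in
      if osc d \<delta> > \<omega> * L2_set r (ind D \<delta>)
      then trial D \<delta> \<subseteq> trial D \<delta>' \<and> osc d \<delta>' \<le> osc d \<delta> / 2
      else trial D \<delta> \<subseteq> trial D \<delta>' \<and> trial D \<delta>' \<subseteq> trial D (up D \<delta>) \<and>
        (\<exists>J \<subseteq> ind D \<delta>. L2_set r J \<ge> \<theta> * L2_set r (ind D \<delta>) \<and>
           {z + y |z y. z \<in> trial D \<delta> \<and> y \<in> span (compl_fun D \<delta> ` J)} \<subseteq> trial D \<delta>'))"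

text \<open>An iterate records one pass through the body of the inner loop: the current index, the value
  of \<open>t\<^sub>\<delta>\<close> at entry, and the computed approximation.\<close>

record (overloaded) ('d, 'v) iterate =
  idx :: 'd
  tol :: real
  app :: "'v l2"

definition valid_iterate ::
    "('v::{real_inner, banach, second_countable_topology}, 'h::real_inner) evolution \<Rightarrow>
     ('d, 'l, 'v, 'h) discretization \<Rightarrow> ('d, 'v, 'h) data \<Rightarrow> ('d, 'v) iterate \<Rightarrow> bool" where
  "valid_iterate P D d i \<longleftrightarrow> app i \<in> trial D (idx i) \<and> alg_est P D d (idx i) (app i) \<le> tol i / 2"

definition stops ::
    "('v::{real_inner, banach, second_countable_topology}, 'h::real_inner) evolution \<Rightarrow>
     ('d, 'l, 'v, 'h) discretization \<Rightarrow> ('d, 'v, 'h) data \<Rightarrow> real \<Rightarrow> ('d, 'v) iterate \<Rightarrow> bool" where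
  "stops P D d \<epsilon> i \<longleftrightarrow> total_est P D d (idx i) (app i) \<le> \<epsilon>"

definition passes_until ::
    "('v::{real_inner, banach, second_countable_topology}, 'h::real_inner) evolution \<Rightarrow>
     ('d, 'l, 'v, 'h) discretization \<Rightarrow> ('d, 'v, 'h) data \<Rightarrow> real \<Rightarrow> real \<Rightarrow> ('d, 'v) iterate \<Rightarrow> bool" where
  "passes_until P D d \<xi> \<epsilon> i \<longleftrightarrow> \<not> stops P D d \<epsilon> i \<and>
     alg_est P D d (idx i) (app i) \<le> \<xi> * total_est P D d (idx i) (app i)"

definition next_iterate ::
    "('v::{real_inner, banach, second_countable_topology}, 'h::real_inner) evolution \<Rightarrow>
     ('d, 'l, 'v, 'h) discretization \<Rightarrow> ('d, 'v, 'h) data \<Rightarrow> real \<Rightarrow> real \<Rightarrow> real \<Rightarrow> real \<Rightarrow>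
     ('d, 'v) iterate \<Rightarrow> ('d, 'v) iterate \<Rightarrow> bool" where
  "next_iterate P D d \<omega> \<theta> \<xi> \<epsilon> i i' \<longleftrightarrow> \<not> stops P D d \<epsilon> i \<and>
     (if passes_until P D d \<xi> \<epsilon> i
      then refines P D d \<omega> \<theta> (idx i) (app i) (idx i') \<and> tol i' = total_est P D d (idx i) (app i)
      else idx i' = idx i \<and> tol i' = alg_est P D d (idx i) (app i))"

definition alg_run ::
    "('v::{real_inner, banach, second_countable_topology}, 'h::real_inner) evolution \<Rightarrow>
     ('d, 'l, 'v, 'h) discretization \<Rightarrow> ('d, 'v, 'h) data \<Rightarrow> real \<Rightarrow> real \<Rightarrow> real \<Rightarrow> real \<Rightarrow>
     'd \<Rightarrow> real \<Rightarrow> (nat \<Rightarrow> ('d, 'v) iterate) \<Rightarrow> nat \<Rightarrow> bool" where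
  "alg_run P D d \<omega> \<theta> \<xi> \<epsilon> \<delta>\<^sub>0 t\<^sub>0 s n \<longleftrightarrow> idx (s 0) = \<delta>\<^sub>0 \<and> tol (s 0) = t\<^sub>0 \<and>
     (\<forall>k\<le>n. valid_iterate P D d (s k)) \<and>
     (\<forall>k<n. next_iterate P D d \<omega> \<theta> \<xi> \<epsilon> (s k) (s (Suc k)))"

definition initial_tol ::
    "('v::{real_inner, banach, second_countable_topology}, 'h::real_inner) evolution \<Rightarrow>
     ('d, 'v, 'h) data \<Rightarrow> real \<Rightarrow> bool" where
  "initial_tol P d t\<^sub>0 \<longleftrightarrow> (\<exists>c\<^sub>1>0. \<exists>c\<^sub>2>0.
     c\<^sub>1 * (Ydual_norm P (rhs d) + norm (ini d)) \<le> t\<^sub>0 \<and>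
     t\<^sub>0 \<le> c\<^sub>2 * (Ydual_norm P (rhs d) + norm (ini d)))"

text \<open>The instruction of step 2 to halve \<open>\<eta>\<close> can be carried out.\<close>

definition osc_halving_possible ::
    "('d, 'l, 'v, 'h) discretization \<Rightarrow> ('d, 'v, 'h) data \<Rightarrow> bool" where
  "osc_halving_possible D d \<longleftrightarrow> (\<forall>\<delta>. osc d \<delta> > 0 \<longrightarrow>
     (\<exists>\<delta>'. trial D \<delta> \<subseteq> trial D \<delta>' \<and> osc d \<delta>' \<le> osc d \<delta> / 2))"

text \<open>Every execution is finite, and an execution that has not reached the stopping criterion can
  be continued, as long as step 2 can be carried out.\<close>

definition alg_terminates ::
    "('v::{real_inner, banach, second_countable_topology}, 'h::real_inner) evolution \<Rightarrow>
     ('d, 'l, 'v, 'h) discretization \<Rightarrow> ('d, 'v, 'h) data \<Rightarrow> real \<Rightarrow> real \<Rightarrow> real \<Rightarrow> real \<Rightarrow>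
     'd \<Rightarrow> real \<Rightarrow> bool" where
  "alg_terminates P D d \<omega> \<theta> \<xi> \<epsilon> \<delta>\<^sub>0 t\<^sub>0 \<longleftrightarrow>
     (\<nexists>s. \<forall>n. alg_run P D d \<omega> \<theta> \<xi> \<epsilon> \<delta>\<^sub>0 t\<^sub>0 s n) \<and>
     (\<exists>s. alg_run P D d \<omega> \<theta> \<xi> \<epsilon> \<delta>\<^sub>0 t\<^sub>0 s 0) \<and>
     (osc_halving_possible D d \<longrightarrow>
       (\<forall>s n. alg_run P D d \<omega> \<theta> \<xi> \<epsilon> \<delta>\<^sub>0 t\<^sub>0 s n \<and> \<not> stops P D d \<epsilon> (s n) \<longrightarrow>
         (\<exists>i. alg_run P D d \<omega> \<theta> \<xi> \<epsilon> \<delta>\<^sub>0 t\<^sub>0 (s(Suc n := i)) (Suc n))))"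

end

theory Submission
  imports Defs
begin

text \<open>Because of \<open>(\<partial>\<^sub>t w)(z) + (\<partial>\<^sub>t z)(w) = \<langle>\<gamma>\<^sub>T w, \<gamma>\<^sub>T z\<rangle> - \<langle>\<gamma>\<^sub>0 w, \<gamma>\<^sub>0 z\<rangle>\<close>, the
  operator \<open>S\<close> is the Riesz operator of the Hilbert space \<open>X\<close>, so that the exact Galerkin solutions are
  the orthogonal projections of \<open>u\<close>, and saturation and Pythagoras make the residual an estimator of the
  error. Replacing \<open>A\<inverse>\<close> by the preconditioner on the test space changes \<open>\<langle>w,z\<rangle>\<close> in \<open>X\<close>, for discrete
  \<open>z\<close> and arbitrary \<open>w\<close>, by at most \<open>2 (\<kappa>/\<gamma> - 1)\<^sup>1\<^sup>/\<^sup>2 \<parallel>w\<parallel> \<parallel>z\<parallel>\<close>: by symmetry of the preconditioner the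
  error can be put on the discrete argument, where the inf-sup condition applies. Between two passings of the until-clause
  either the data error dominates and is halved, or the bulk criterion yields a component of the error, of
  relative size proportional to \<open>\<vartheta>\<close>, that the new Galerkin solution captures by Pythagoras; the weight
  \<open>\<vartheta>\<close> in front of the error keeps the growth of one term below the decrease of the other.

  Traces and the energy identity are obtained from the operator \<open>C = i\<^sup>*i\<close> on \<open>V\<close>, with \<open>i\<close> the
  embedding of \<open>V\<close> in \<open>H\<close>: for \<open>w \<in> X\<close> the function \<open>C w\<close> is the primitive of an element of
  \<open>L\<^sub>2(I;V)\<close>, and the iterates of a Landweber method for \<open>C\<close> applied to it converge uniformly in
  \<open>H\<close> to a continuous representative of \<open>w\<close>.\<close>

section \<open>Symmetric positive semidefinite forms on subspaces\<close>

text \<open>Saturation is assumed only for the approximate data, and these change with the index.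
  Every index \<delta> is therefore given its own exact solution \<open>uh \<delta>\<close>, whose
  existence is the reason for proving well-posedness. Errors at two indices are comparable only up
  to the sum of the two data errors, and this growth is what the weight \<theta> and the bounds on
  \<omega> have to absorb.

  The size conditions reflect a quadratic effect. The deviation of a computed approximation from the
  Galerkin solution is orthogonal to the Galerkin error, so a relative deviation
  \<open>y = del + b * \<xi>\<close> worsens the error only by the factor
  \<open>1 + 2 * y\<^sup>2\<close>. Since \<open>del\<^sup>2\<close> is a multiple of
  \<kappa>/\<gamma> - 1, it is this quantity itself, not its root, that is weighed against \<omega>.

  The spaces Y and X and the test and trial spaces are subsets of one type with several competing
  norms. Hence the Hilbert space theory is developed for semidefinite forms on a carrier set, with
  completeness as a property of the pair.\<close>

locale form_on =
  fixes Z :: "'a::real_vector set" and a :: "'a \<Rightarrow> 'a \<Rightarrow> real"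
  assumes sub: "subspace Z"
    and add_left: "\<And>u v w. u \<in> Z \<Longrightarrow> v \<in> Z \<Longrightarrow> w \<in> Z \<Longrightarrow> a (u + v) w = a u w + a v w"
    and scale_left: "\<And>c u v. u \<in> Z \<Longrightarrow> v \<in> Z \<Longrightarrow> a (c *\<^sub>R u) v = c * a u v"
    and sym: "\<And>u v. u \<in> Z \<Longrightarrow> v \<in> Z \<Longrightarrow> a u v = a v u"
    and nonneg: "\<And>u. u \<in> Z \<Longrightarrow> 0 \<le> a u u"
begin

lemma mem [simp]:
  "0 \<in> Z" "u \<in> Z \<Longrightarrow> v \<in> Z \<Longrightarrow> u + v \<in> Z" "u \<in> Z \<Longrightarrow> c *\<^sub>R u \<in> Z"
  "u \<in> Z \<Longrightarrow> v \<in> Z \<Longrightarrow> u - v \<in> Z" "u \<in> Z \<Longrightarrow> - u \<in> Z"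
  using sub by (auto simp: subspace_0 subspace_add subspace_scale subspace_diff subspace_neg)

lemma add_right: "u \<in> Z \<Longrightarrow> v \<in> Z \<Longrightarrow> w \<in> Z \<Longrightarrow> a w (u + v) = a w u + a w v"
  using add_left[of u v w] sym[of w] by auto

lemma scale_right: "u \<in> Z \<Longrightarrow> v \<in> Z \<Longrightarrow> a u (c *\<^sub>R v) = c * a u v"
  using scale_left[of v u c] sym[of u] by auto

lemma minus_left: "u \<in> Z \<Longrightarrow> v \<in> Z \<Longrightarrow> a (- u) v = - a u v"
  using scale_left[of u v "-1"] by simp

lemma minus_right: "u \<in> Z \<Longrightarrow> v \<in> Z \<Longrightarrow> a u (- v) = - a u v"
  using scale_right[of u v "-1"] by simp

lemma diff_left: "u \<in> Z \<Longrightarrow> v \<in> Z \<Longrightarrow> w \<in> Z \<Longrightarrow> a (u - v) w = a u w - a v w"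
  using add_left[of u "- v" w] minus_left[of v w] by simp

lemma diff_right: "u \<in> Z \<Longrightarrow> v \<in> Z \<Longrightarrow> w \<in> Z \<Longrightarrow> a w (u - v) = a w u - a w v"
  using diff_left[of u v w] sym[of w] by auto

lemma zero_left: "u \<in> Z \<Longrightarrow> a 0 u = 0"
  using scale_left[of u u 0] by simp

lemma zero_right: "u \<in> Z \<Longrightarrow> a u 0 = 0"
  using zero_left sym[of u 0] by simp

lemmas bilin = add_left add_right scale_left scale_right diff_left diff_right
  minus_left minus_right zero_left zero_right

lemma sq_add: "u \<in> Z \<Longrightarrow> v \<in> Z \<Longrightarrow> a (u + v) (u + v) = a u u + 2 * a u v + a v v"
  using sym[of u v] by (simp add: bilin)

lemma sq_diff: "u \<in> Z \<Longrightarrow> v \<in> Z \<Longrightarrow> a (u - v) (u - v) = a u u - 2 * a u v + a v v"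
  using sym[of u v] by (simp add: bilin)

lemma cauchy_schwarz_sq:
  assumes "u \<in> Z" "v \<in> Z" shows "(a u v)\<^sup>2 \<le> a u u * a v v"
proof -
  have pos: "0 \<le> a u u - 2 * t * a u v + t\<^sup>2 * a v v" for t
    using nonneg[of "u - t *\<^sub>R v"] sq_diff[of u "t *\<^sub>R v"] assms
    by (simp add: bilin power2_eq_square)
  show ?thesis
  proof (cases "a v v = 0")
    case True
    have "a u v = 0"
    proof (rule ccontr)
      assume "a u v \<noteq> 0"
      \<comment> \<open>With \<open>a v v = 0\<close> the polynomial is affine in \<open>t\<close>;
        this \<open>t\<close> gives it the value -1.\<close>
      then show False using pos[of "(a u u + 1) / (2 * a u v)"] True by simp
    qed
    with True show ?thesis by simp
  next
    case False
    then have "a v v > 0" using nonneg[OF assms(2)] by simp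
    then show ?thesis using pos[of "a u v / a v v"]
      by (simp add: power2_eq_square field_simps)
  qed
qed

lemma cauchy_schwarz:
  assumes "u \<in> Z" "v \<in> Z" shows "\<bar>a u v\<bar> \<le> sqrt (a u u) * sqrt (a v v)"
  using real_sqrt_le_mono[OF cauchy_schwarz_sq[OF assms]] by (simp add: real_sqrt_mult)

lemma norm_triangle:
  assumes "u \<in> Z" "v \<in> Z" shows "sqrt (a (u + v) (u + v)) \<le> sqrt (a u u) + sqrt (a v v)"
proof -
  have "a (u + v) (u + v) \<le> (sqrt (a u u) + sqrt (a v v))\<^sup>2"
    using sq_add[OF assms] cauchy_schwarz[OF assms] nonneg assms
    by (simp add: power2_sum)
  then show ?thesis
    by (metis nonneg assms(1,2) add_nonneg_nonneg real_le_lsqrt real_sqrt_ge_zero)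
qed

lemma norm_scale: "u \<in> Z \<Longrightarrow> sqrt (a (c *\<^sub>R u) (c *\<^sub>R u)) = \<bar>c\<bar> * sqrt (a u u)"
  by (simp add: bilin real_sqrt_mult flip: mult.assoc power2_eq_square)

lemma norm_minus: "u \<in> Z \<Longrightarrow> v \<in> Z \<Longrightarrow> sqrt (a (u - v) (u - v)) = sqrt (a (v - u) (v - u))"
  using norm_scale[of "u - v" "-1"] by simp

lemma norm_triangle_diff:
  assumes "u \<in> Z" "v \<in> Z" "w \<in> Z"
  shows "sqrt (a (u - w) (u - w)) \<le> sqrt (a (u - v) (u - v)) + sqrt (a (v - w) (v - w))"
  using norm_triangle[of "u - v" "v - w"] assms by simp

lemma dual_bound:
  assumes "w \<in> Z" "\<And>v. v \<in> Z \<Longrightarrow> F v = a w v" "v \<in> Z"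
  shows "\<bar>F v\<bar> \<le> sqrt (a w w) * sqrt (a v v)"
  using cauchy_schwarz[of w v] assms by simp

text \<open>The supremum over the unit ball is attained at the normalised representer; a representer
  of seminorm 0 cannot be normalised and is a case of its own.\<close>

lemma dual_norm_rep:
  assumes N: "\<And>v. v \<in> Z \<Longrightarrow> N v = sqrt (a v v)" and w: "w \<in> Z"
    and F: "\<And>v. v \<in> Z \<Longrightarrow> F v = a w v"
  shows "dual_norm N Z F = sqrt (a w w)"
  unfolding dual_norm_def
proof (rule antisym)
  have bd: "\<bar>F v\<bar> \<le> sqrt (a w w)" if "v \<in> Z" "N v \<le> 1" for v
    using dual_bound[OF w F that(1)] mult_left_mono[of "sqrt (a v v)" 1 "sqrt (a w w)"] that
      nonneg[OF w] N by fastforce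
  have ne: "0 \<in> {v \<in> Z. N v \<le> 1}" by (simp add: N bilin)
  then show "(SUP v\<in>{v \<in> Z. N v \<le> 1}. \<bar>F v\<bar>) \<le> sqrt (a w w)"
    by (intro cSUP_least) (use bd in blast)+
  have bdd: "bdd_above ((\<lambda>v. \<bar>F v\<bar>) ` {v \<in> Z. N v \<le> 1})"
    by (rule bdd_aboveI2[of _ _ "sqrt (a w w)"]) (auto intro: bd)
  show "sqrt (a w w) \<le> (SUP v\<in>{v \<in> Z. N v \<le> 1}. \<bar>F v\<bar>)"
  proof (cases "a w w = 0")
    case True
    then show ?thesis using cSUP_upper[OF ne bdd] by simp
  next
    case False
    with nonneg[OF w] have p: "a w w > 0" by simp
    define v where "v = (1 / sqrt (a w w)) *\<^sub>R w"
    have v: "v \<in> {v \<in> Z. N v \<le> 1}" using p w by (simp add: v_def N norm_scale)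
    have "F v = sqrt (a w w)" using p w by (simp add: v_def F bilin real_div_sqrt)
    then show ?thesis using cSUP_upper[OF v bdd] p by simp
  qed
qed

lemma rep_in_dual_space:
  assumes N: "\<And>v. v \<in> Z \<Longrightarrow> N v = sqrt (a v v)" and w: "w \<in> Z"
  shows "restr Z (a w) \<in> dual_space N Z"
proof -
  have "\<bar>a w v\<bar> \<le> sqrt (a w w) * N v" if "v \<in> Z" for v
    using cauchy_schwarz[OF w that] N[OF that] by simp
  then have "\<exists>C. \<forall>v\<in>Z. \<bar>restr Z (a w) v\<bar> \<le> C * N v" by (auto simp: restr_def)
  moreover have "restr Z (a w) (u + v) = restr Z (a w) u + restr Z (a w) v"
    "restr Z (a w) (c *\<^sub>R u) = c * restr Z (a w) u" if "u \<in> Z" "v \<in> Z" for u v c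
    using that w by (auto simp: restr_def bilin)
  moreover have "restr Z (a w) v = 0" if "v \<notin> Z" for v
    using that by (simp add: restr_def)
  ultimately show ?thesis
    unfolding dual_space_def by blast
qed

lemma form_on_subspace:
  assumes "subspace Z'" "Z' \<subseteq> Z" shows "form_on Z' a"
proof
  show "subspace Z'" by (rule assms(1))
qed (simp_all add: subsetD[OF assms(2)] add_left scale_left nonneg, simp add: subsetD[OF assms(2)] sym)

end

text \<open>Squared distances avoid roots. The limit is determined only up to the kernel of
  \<open>a\<close>, as suits a seminorm.\<close>

definition form_complete :: "'a::real_vector set \<Rightarrow> ('a \<Rightarrow> 'a \<Rightarrow> real) \<Rightarrow> bool" where
  "form_complete Z a \<longleftrightarrow> (\<forall>s. (\<forall>n. s n \<in> Z) \<and>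
     (\<forall>e>0. \<exists>N. \<forall>i\<ge>N. \<forall>j\<ge>N. a (s i - s j) (s i - s j) < e) \<longrightarrow>
     (\<exists>w\<in>Z. (\<lambda>n. a (s n - w) (s n - w)) \<longlonglongrightarrow> 0))"

lemma form_completeD:
  assumes "form_complete Z a" "\<And>n :: nat. s n \<in> Z"
    and "\<forall>e>0. \<exists>N. \<forall>i\<ge>N. \<forall>j\<ge>N. a (s i - s j) (s i - s j) < e"
  shows "\<exists>w\<in>Z. (\<lambda>n. a (s n - w) (s n - w)) \<longlonglongrightarrow> 0"
  using assms unfolding form_complete_def by simp

lemma form_complete_equiv:
  assumes "subspace Z" "form_complete Z b" "0 < c"
    and "\<And>v. v \<in> Z \<Longrightarrow> c * b v v \<le> a v v" "\<And>v. v \<in> Z \<Longrightarrow> a v v \<le> C * b v v"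
    and nonneg: "\<And>v. v \<in> Z \<Longrightarrow> 0 \<le> a v v"
  shows "form_complete Z a"
  unfolding form_complete_def
proof (intro allI impI, elim conjE)
  fix s :: "nat \<Rightarrow> _" assume s: "\<forall>n. s n \<in> Z" and C: "\<forall>e>0. \<exists>N. \<forall>i\<ge>N. \<forall>j\<ge>N. a (s i - s j) (s i - s j) < e"
  have d: "u - v \<in> Z" if "u \<in> Z" "v \<in> Z" for u v using assms(1) that by (rule subspace_diff)
  have "\<forall>e>0. \<exists>N. \<forall>i\<ge>N. \<forall>j\<ge>N. b (s i - s j) (s i - s j) < e"
  proof (intro allI impI)
    fix e :: real assume "e > 0"
    then obtain N where N: "\<forall>i\<ge>N. \<forall>j\<ge>N. a (s i - s j) (s i - s j) < c * e"
      using C assms(3) by (meson mult_pos_pos)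
    show "\<exists>N. \<forall>i\<ge>N. \<forall>j\<ge>N. b (s i - s j) (s i - s j) < e"
    proof (intro exI[of _ N] allI impI)
      fix i j assume "i \<ge> N" "j \<ge> N"
      then have "c * b (s i - s j) (s i - s j) < c * e"
        using N assms(4)[of "s i - s j"] d s by (meson le_less_trans)
      then show "b (s i - s j) (s i - s j) < e" using assms(3) by simp
    qed
  qed
  then obtain w where w: "w \<in> Z" "(\<lambda>n. b (s n - w) (s n - w)) \<longlonglongrightarrow> 0"
    using assms(2) s unfolding form_complete_def by blast
  have "(\<lambda>n. a (s n - w) (s n - w)) \<longlonglongrightarrow> 0"
    by (rule tendsto_sandwich[OF _ _ tendsto_const tendsto_mult_right_zero[OF w(2), of C]])
      (use nonneg assms(5) d s w(1) in auto)
  with w show "\<exists>w\<in>Z. (\<lambda>n. a (s n - w) (s n - w)) \<longlonglongrightarrow> 0" by blast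
qed

context form_on
begin

text \<open>The representer minimises the energy \<open>a v v - 2 * F v\<close>, and minimising
  sequences are Cauchy by the parallelogram law.\<close>

theorem riesz:
  assumes compl: "form_complete Z a"
    and Fadd: "\<And>u v. u \<in> Z \<Longrightarrow> v \<in> Z \<Longrightarrow> F (u + v) = F u + F v"
    and Fscale: "\<And>c v. v \<in> Z \<Longrightarrow> F (c *\<^sub>R v) = c * F v"
    and Fbd: "\<And>v. v \<in> Z \<Longrightarrow> \<bar>F v\<bar> \<le> C * sqrt (a v v)"
  shows "\<exists>w\<in>Z. \<forall>v\<in>Z. F v = a w v"
proof -
  define J where "J v = a v v - 2 * F v" for v
  have lb: "- C\<^sup>2 \<le> J v" if "v \<in> Z" for v
  proof -
    have "0 \<le> (sqrt (a v v) - C)\<^sup>2" by simp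
    then have "- C\<^sup>2 \<le> a v v - 2 * (C * sqrt (a v v))"
      using nonneg[OF that] by (simp add: power2_diff mult.commute)
    then show ?thesis using Fbd[OF that] by (simp add: J_def)
  qed
  define I where "I = Inf (J ` Z)"
  have bdd: "bdd_below (J ` Z)" by (rule bdd_belowI2) (rule lb)
  have I_le: "I \<le> J v" if "v \<in> Z" for v unfolding I_def using bdd that by (rule cINF_lower)
  have "\<exists>v\<in>Z. J v < I + 1 / (Suc n)" for n
    using cInf_lessD[of "J ` Z" "I + 1 / Suc n"] mem(1) unfolding I_def by fastforce
  then obtain s where s: "\<And>n. s n \<in> Z" "\<And>n. J (s n) < I + 1 / Suc n" by metis
  \<comment> \<open>Parallelogram law; the linear part cancels, so two nearly minimal vectors must
    be close to each other.\<close>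
  have mid: "a (u - v) (u - v) = 2 * J u + 2 * J v - 4 * J ((1/2) *\<^sub>R (u + v))" if "u \<in> Z" "v \<in> Z" for u v
    using that sym[of u v] by (simp add: J_def bilin Fadd Fscale field_simps)
  have dist: "a (s i - s j) (s i - s j) \<le> 2 / Suc i + 2 / Suc j" for i j
    using mid[OF s(1) s(1), of i j] I_le[of "(1/2) *\<^sub>R (s i + s j)"] s(1) s(2)[of i] s(2)[of j]
    by simp
  have "\<forall>e>0. \<exists>N. \<forall>i\<ge>N. \<forall>j\<ge>N. a (s i - s j) (s i - s j) < e"
  proof (intro allI impI)
    fix e :: real assume "e > 0"
    then obtain N where N: "4 / real (Suc N) < e"
      using reals_Archimedean[of "e/4"] by (auto simp: field_simps)
    show "\<exists>N. \<forall>i\<ge>N. \<forall>j\<ge>N. a (s i - s j) (s i - s j) < e"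
    proof (intro exI[of _ N] allI impI)
      fix i j assume "i \<ge> N" "j \<ge> N"
      then have "2 / real (Suc i) \<le> 2 / Suc N" "2 / real (Suc j) \<le> 2 / Suc N"
        by (auto intro!: divide_left_mono)
      then show "a (s i - s j) (s i - s j) < e" using dist[of i j] N by simp
    qed
  qed
  then obtain w where w: "w \<in> Z" and lim: "(\<lambda>n. a (s n - w) (s n - w)) \<longlonglongrightarrow> 0"
    using compl s(1) unfolding form_complete_def by blast
  have lim': "(\<lambda>n. sqrt (a (s n - w) (s n - w))) \<longlonglongrightarrow> 0"
    using tendsto_real_sqrt[OF lim] by simp
  have Jw: "J w \<le> I"
  proof -
    \<comment> \<open>The energy at \<open>w\<close> is expanded about \<open>s n\<close>; what
      remains is linear in the distance and tends to 0.\<close>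
    have e: "J w \<le> I + 1 / Suc n + (2 * sqrt (a w w) + 2 * C) * sqrt (a (s n - w) (s n - w))" for n
    proof -
      have "J w = J (s n) - a (s n - w) (s n - w) - 2 * a w (s n - w) + 2 * F (s n - w)"
        using s(1)[of n] w sym[of w "s n"] Fadd[of "s n" "- w"] Fscale[of w "-1"]
        by (simp add: J_def bilin)
      moreover have "\<bar>a w (s n - w)\<bar> \<le> sqrt (a w w) * sqrt (a (s n - w) (s n - w))"
        using s(1) w by (intro cauchy_schwarz) auto
      moreover have "\<bar>F (s n - w)\<bar> \<le> C * sqrt (a (s n - w) (s n - w))"
        using s(1) w by (intro Fbd) auto
      moreover have "0 \<le> a (s n - w) (s n - w)" using s(1) w by (intro nonneg) auto
      ultimately show ?thesis using s(2)[of n] by (simp add: algebra_simps)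
    qed
    have "(\<lambda>n. I + 1 / Suc n + (2 * sqrt (a w w) + 2 * C) * sqrt (a (s n - w) (s n - w)))
        \<longlonglongrightarrow> I + 0 + (2 * sqrt (a w w) + 2 * C) * 0"
      by (intro tendsto_intros lim' LIMSEQ_Suc[OF lim_1_over_n])
    then show ?thesis using e by (intro LIMSEQ_le_const[of _ I]) auto
  qed
  have "F v = a w v" if v: "v \<in> Z" for v
  proof (rule ccontr)
    assume ne: "F v \<noteq> a w v"
    have q: "0 \<le> t\<^sup>2 * a v v + 2 * t * (a w v - F v)" for t
    proof -
      have "J w \<le> J (w + t *\<^sub>R v)" using Jw I_le[of "w + t *\<^sub>R v"] w v by auto
      then show ?thesis using w v sym[of v w]
        by (simp add: J_def bilin Fadd Fscale power2_eq_square algebra_simps)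
    qed
    \<comment> \<open>The quadratic in \<open>q\<close> would be negative at
      \<open>t = - D / (a v v + 1)\<close>, a near-minimiser that exists even if
      \<open>a v v = 0\<close>.\<close>
    define D where "D = a w v - F v"
    have "D \<noteq> 0" using ne by (simp add: D_def)
    have p: "a v v + 1 > 0" using nonneg[OF v] by simp
    have "(D / (a v v + 1))\<^sup>2 * a v v - 2 * D\<^sup>2 / (a v v + 1) < 0"
    proof -
      have "(D / (a v v + 1))\<^sup>2 * a v v \<le> D\<^sup>2 / (a v v + 1)"
      proof -
        have "(D / (a v v + 1))\<^sup>2 * a v v \<le> (D / (a v v + 1))\<^sup>2 * (a v v + 1)"
          by (intro mult_left_mono) auto
        also have "\<dots> = D\<^sup>2 / (a v v + 1)" using p by (simp add: power2_eq_square)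
        finally show ?thesis .
      qed
      moreover have "D\<^sup>2 / (a v v + 1) > 0" using p \<open>D \<noteq> 0\<close> by simp
      ultimately show ?thesis by simp
    qed
    with q[of "- D / (a v v + 1)"] show False
      by (simp add: D_def[symmetric] power2_eq_square)
  qed
  with w show ?thesis by blast
qed

text \<open>A converse of the Riesz theorem: the functionals \<open>a (s n)\<close> of a Cauchy
  sequence converge in the dual norm, and a representer of their limit is a limit of the sequence.
  It turns the bijectivity of a preconditioner into completeness.\<close>

lemma complete_if_riesz:
  assumes rep: "\<And>F. (\<And>u v. u \<in> Z \<Longrightarrow> v \<in> Z \<Longrightarrow> F (u + v) = F u + F v) \<Longrightarrow>
      (\<And>c v. v \<in> Z \<Longrightarrow> F (c *\<^sub>R v) = c * F v) \<Longrightarrow>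
      (\<exists>C. \<forall>v\<in>Z. \<bar>F v\<bar> \<le> C * sqrt (a v v)) \<Longrightarrow> \<exists>w\<in>Z. \<forall>v\<in>Z. F v = a w v"
  shows "form_complete Z a"
  unfolding form_complete_def
proof (intro allI impI, elim conjE)
  fix s :: "nat \<Rightarrow> _" assume s: "\<forall>n. s n \<in> Z" and C: "\<forall>e>0. \<exists>N. \<forall>i\<ge>N. \<forall>j\<ge>N. a (s i - s j) (s i - s j) < e"
  have small: "\<exists>N. \<forall>i\<ge>N. \<forall>j\<ge>N. \<forall>v\<in>Z. \<bar>a (s i) v - a (s j) v\<bar> \<le> e * sqrt (a v v)" if "e > 0" for e
  proof -
    obtain N where N: "\<forall>i\<ge>N. \<forall>j\<ge>N. a (s i - s j) (s i - s j) < e\<^sup>2"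
      using C[rule_format, of "e\<^sup>2"] \<open>e > 0\<close> by auto
    show ?thesis
    proof (intro exI[of _ N] allI impI ballI)
      fix i j v assume ij: "i \<ge> N" "j \<ge> N" and v: "v \<in> Z"
      have "\<bar>a (s i) v - a (s j) v\<bar> \<le> sqrt (a (s i - s j) (s i - s j)) * sqrt (a v v)"
        using cauchy_schwarz[of "s i - s j" v] s v by (simp add: bilin)
      also have "sqrt (a (s i - s j) (s i - s j)) \<le> e"
        using N ij that by (intro real_le_lsqrt) (auto intro: less_imp_le)
      finally show "\<bar>a (s i) v - a (s j) v\<bar> \<le> e * sqrt (a v v)"
        using nonneg[OF v] by (simp add: mult_right_mono)
    qed
  qed
  have conv: "convergent (\<lambda>n. a (s n) v)" if v: "v \<in> Z" for v
  proof (rule Cauchy_convergent, rule metric_CauchyI)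
    fix e :: real assume "e > 0"
    \<comment> \<open>The added 1 keeps the quotient meaningful when
      \<open>a v v = 0\<close>.\<close>
    define d where "d = e / (2 * (sqrt (a v v) + 1))"
    have p: "sqrt (a v v) + 1 > 0" using nonneg[OF v] by (simp add: add_nonneg_pos)
    then have "d > 0" using \<open>e > 0\<close> by (simp add: d_def)
    then obtain N where N: "\<forall>i\<ge>N. \<forall>j\<ge>N. \<forall>v\<in>Z. \<bar>a (s i) v - a (s j) v\<bar> \<le> d * sqrt (a v v)"
      using small by blast
    have "d * sqrt (a v v) \<le> d * (sqrt (a v v) + 1)" using \<open>d > 0\<close> by simp
    also have "\<dots> = e / 2" using nonzero_mult_div_cancel_right[of "sqrt (a v v) + 1" "e / 2"] p by (simp add: d_def)
    finally show "\<exists>N. \<forall>i\<ge>N. \<forall>j\<ge>N. dist (a (s i) v) (a (s j) v) < e"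
      using N v \<open>e > 0\<close> by (fastforce simp: dist_real_def intro!: exI[of _ N])
  qed
  define F where "F v = lim (\<lambda>n. a (s n) v)" for v
  have F: "(\<lambda>n. a (s n) v) \<longlonglongrightarrow> F v" if "v \<in> Z" for v
    using conv[OF that] by (simp add: F_def convergent_LIMSEQ_iff)
  have near: "\<exists>N. \<forall>i\<ge>N. \<forall>v\<in>Z. \<bar>a (s i) v - F v\<bar> \<le> e * sqrt (a v v)" if "e > 0" for e
  proof -
    obtain N where N: "\<forall>i\<ge>N. \<forall>j\<ge>N. \<forall>v\<in>Z. \<bar>a (s i) v - a (s j) v\<bar> \<le> e * sqrt (a v v)"
      using small[OF \<open>e > 0\<close>] by blast
    show ?thesis
    proof (intro exI[of _ N] allI impI ballI)
      fix i v assume "i \<ge> N" "v \<in> Z"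
      have "(\<lambda>j. \<bar>a (s i) v - a (s j) v\<bar>) \<longlonglongrightarrow> \<bar>a (s i) v - F v\<bar>"
        by (intro tendsto_intros F \<open>v \<in> Z\<close>)
      then show "\<bar>a (s i) v - F v\<bar> \<le> e * sqrt (a v v)"
        by (rule LIMSEQ_le_const2) (use N \<open>i \<ge> N\<close> \<open>v \<in> Z\<close> in auto)
    qed
  qed
  have "\<exists>w\<in>Z. \<forall>v\<in>Z. F v = a w v"
  proof (rule rep)
    show "F (u + v) = F u + F v" if "u \<in> Z" "v \<in> Z" for u v
      using tendsto_add[OF F[OF that(1)] F[OF that(2)]] F[of "u + v"] that s
      by (intro LIMSEQ_unique[of "\<lambda>n. a (s n) (u + v)"]) (auto simp: bilin)
    show "F (c *\<^sub>R v) = c * F v" if "v \<in> Z" for c v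
      using tendsto_mult[OF tendsto_const F[OF that]] F[of "c *\<^sub>R v"] that s
      by (intro LIMSEQ_unique[of "\<lambda>n. a (s n) (c *\<^sub>R v)"]) (auto simp: bilin)
    obtain N where N: "\<forall>i\<ge>N. \<forall>v\<in>Z. \<bar>a (s i) v - F v\<bar> \<le> 1 * sqrt (a v v)" using near[of 1] by auto
    show "\<exists>C. \<forall>v\<in>Z. \<bar>F v\<bar> \<le> C * sqrt (a v v)"
    proof (intro exI[of _ "sqrt (a (s N) (s N)) + 1"] ballI)
      fix v assume v: "v \<in> Z"
      show "\<bar>F v\<bar> \<le> (sqrt (a (s N) (s N)) + 1) * sqrt (a v v)"
        using N[rule_format, of N v] v cauchy_schwarz[of "s N" v] s by (simp add: algebra_simps)
    qed
  qed
  then obtain w where w: "w \<in> Z" "\<And>v. v \<in> Z \<Longrightarrow> F v = a w v" by blast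
  have "(\<lambda>n. a (s n - w) (s n - w)) \<longlonglongrightarrow> 0"
  proof (rule LIMSEQ_I)
    fix r :: real assume "r > 0"
    obtain N where N: "\<forall>i\<ge>N. \<forall>v\<in>Z. \<bar>a (s i) v - F v\<bar> \<le> (sqrt r / 2) * sqrt (a v v)"
      using near[of "sqrt r / 2"] \<open>r > 0\<close> by auto
    show "\<exists>no. \<forall>n\<ge>no. norm (a (s n - w) (s n - w) - 0) < r"
    proof (intro exI[of _ N] allI impI)
      fix n assume "n \<ge> N"
      define q where "q = sqrt (a (s n - w) (s n - w))"
      have d: "s n - w \<in> Z" using s w by simp
      have qq: "a (s n - w) (s n - w) = q * q" using nonneg[OF d] by (simp add: q_def)
      have q0: "q \<ge> 0" using nonneg[OF d] by (simp add: q_def)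
      \<comment> \<open>Testing with \<open>s n - w\<close> itself turns the dual estimate into an
        estimate of the distance.\<close>
      have e1: "a (s n) (s n - w) - F (s n - w) = a (s n - w) (s n - w)"
        unfolding w(2)[OF d] using diff_left[OF s[rule_format] w(1) d, of n] by linarith
      have "q * q \<le> (sqrt r / 2) * q"
        using abs_le_D1[OF N[rule_format, OF \<open>n \<ge> N\<close> d]]
        unfolding q_def[symmetric] e1 qq[symmetric] .
      then have "q \<le> sqrt r / 2" using q0 by (cases "q = 0") (use \<open>r > 0\<close> in auto)
      then have "q < sqrt r" using real_sqrt_gt_zero[OF \<open>r > 0\<close>] by linarith
      then have "q * q < r" using q0 \<open>r > 0\<close> by (metis mult_strict_mono' real_sqrt_mult_self abs_of_pos)
      then show "norm (a (s n - w) (s n - w) - 0) < r" using qq q0 by simp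
    qed
  qed
  with w show "\<exists>w\<in>Z. (\<lambda>n. a (s n - w) (s n - w)) \<longlonglongrightarrow> 0" by blast
qed

text \<open>The inverse of \<open>K\<close> is a second form on \<open>Z\<close>. Symmetry of
  \<open>K\<close> becomes symmetry of the form, and this yields linearity on the left, because
  functionals are linear on the right by definition.\<close>

lemma precond_form:
  assumes N: "\<And>v. v \<in> Z \<Longrightarrow> N v = sqrt (a v v)" and K: "sym_bdd_invertible N Z K"
    and c: "0 < c" "\<And>v. v \<in> Z \<Longrightarrow> c * a v v \<le> dual_inv N Z K v v"
  shows "form_on Z (dual_inv N Z K)"
    and "F \<in> dual_space N Z \<Longrightarrow> K F \<in> Z"
    and "F \<in> dual_space N Z \<Longrightarrow> dual_inv N Z K (K F) = F"
    and "w \<in> Z \<Longrightarrow> dual_inv N Z K w \<in> dual_space N Z"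
    and "w \<in> Z \<Longrightarrow> K (dual_inv N Z K w) = w"
proof -
  have bij: "bij_betw K (dual_space N Z) Z"
    using K unfolding sym_bdd_invertible_def by blast
  show KF: "K F \<in> Z" if "F \<in> dual_space N Z" for F using bij that by (rule bij_betwE[rule_format])
  show KK: "dual_inv N Z K (K F) = F" if "F \<in> dual_space N Z" for F
    using bij that by (simp add: the_inv_into_f_f bij_betw_def)
  show dm: "dual_inv N Z K w \<in> dual_space N Z" if "w \<in> Z" for w
    using bij_betwE[OF bij_betw_the_inv_into[OF bij]] that by blast
  show Kd: "K (dual_inv N Z K w) = w" if "w \<in> Z" for w
    using bij that by (rule f_the_inv_into_f_bij_betw)
  have lin: "F (u + v) = F u + F v" "F (c *\<^sub>R u) = c * F u" if "F \<in> dual_space N Z" "u \<in> Z" "v \<in> Z" for F u v c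
    using that by (auto simp: dual_space_def)
  have symm: "F (K G) = G (K F)" if "F \<in> dual_space N Z" "G \<in> dual_space N Z" for F G
    using K that by (auto simp: sym_bdd_invertible_def)
  have ds: "dual_inv N Z K u v = dual_inv N Z K v u" if "u \<in> Z" "v \<in> Z" for u v
    using symm[OF dm[OF that(1)] dm[OF that(2)]] Kd that by simp
  show "form_on Z (dual_inv N Z K)"
  proof
    show "subspace Z" by (rule sub)
    show "dual_inv N Z K (u + v) w = dual_inv N Z K u w + dual_inv N Z K v w"
      if "u \<in> Z" "v \<in> Z" "w \<in> Z" for u v w
      using that lin(1)[OF dm[of w], of u v] by (simp add: ds[of w])
    show "dual_inv N Z K (c *\<^sub>R u) v = c * dual_inv N Z K u v" if "u \<in> Z" "v \<in> Z" for u v c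
      using that lin(2)[OF dm[of v], of u u c] by (simp add: ds[of v])
    show "dual_inv N Z K u v = dual_inv N Z K v u" if "u \<in> Z" "v \<in> Z" for u v using that by (rule ds)
    show "0 \<le> dual_inv N Z K u u" if "u \<in> Z" for u
      using c that nonneg[OF that] by (meson less_imp_le mult_nonneg_nonneg order_trans)
  qed
qed

text \<open>Every bounded functional \<open>F\<close> is represented by \<open>K F\<close> in the
  form of the preconditioner. That form is therefore complete, and the norm equivalence passes
  completeness on to \<open>a\<close>. The test and trial spaces get their completeness in this
  way.\<close>

lemma precond_complete:
  assumes N: "\<And>v. v \<in> Z \<Longrightarrow> N v = sqrt (a v v)" and K: "sym_bdd_invertible N Z K"
    and c: "0 < c" "\<And>v. v \<in> Z \<Longrightarrow> c * a v v \<le> dual_inv N Z K v v"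
    and C: "\<And>v. v \<in> Z \<Longrightarrow> dual_inv N Z K v v \<le> C * a v v"
  shows "form_complete Z a"
proof -
  interpret b: form_on Z "dual_inv N Z K" by (rule precond_form(1)[OF N K c])
  have pf: "K F \<in> Z" "dual_inv N Z K (K F) = F" if "F \<in> dual_space N Z" for F
    using that precond_form(2)[of N K c F, OF N K c] precond_form(3)[of N K c F, OF N K c] by blast+
  have bc: "form_complete Z (dual_inv N Z K)"
  proof (rule b.complete_if_riesz)
    fix F assume F: "\<And>u v. u \<in> Z \<Longrightarrow> v \<in> Z \<Longrightarrow> F (u + v) = F u + F v"
      "\<And>c v. v \<in> Z \<Longrightarrow> F (c *\<^sub>R v) = c * F v" "\<exists>B. \<forall>v\<in>Z. \<bar>F v\<bar> \<le> B * sqrt (dual_inv N Z K v v)"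
    then obtain B where B: "\<And>v. v \<in> Z \<Longrightarrow> \<bar>F v\<bar> \<le> B * sqrt (dual_inv N Z K v v)" by blast
    have "\<bar>F v\<bar> \<le> (\<bar>B\<bar> * sqrt C) * N v" if v: "v \<in> Z" for v
    proof -
      have "\<bar>F v\<bar> \<le> \<bar>B\<bar> * sqrt (dual_inv N Z K v v)"
        using B[OF v] b.nonneg[OF v]
        by (meson abs_ge_self mult_right_mono order_trans real_sqrt_ge_zero)
      also have "\<dots> \<le> \<bar>B\<bar> * sqrt (C * a v v)"
        using C[OF v] by (intro mult_left_mono) auto
      finally show ?thesis using v by (simp add: N real_sqrt_mult)
    qed
    then have R: "restr Z F \<in> dual_space N Z"
      using F(1,2) by (auto simp: dual_space_def restr_def)
    show "\<exists>w\<in>Z. \<forall>v\<in>Z. F v = dual_inv N Z K w v"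
      using pf[OF R] by (intro bexI[of _ "K (restr Z F)"]) (auto simp: restr_def)
  qed
  show ?thesis
  proof (cases "C \<le> 0")
    case True
    \<comment> \<open>A constant \<open>C \<le> 0\<close> forces the form to vanish, and then every
      sequence converges to 0.\<close>
    have z: "a v v = 0" if v: "v \<in> Z" for v
    proof -
      have "C * a v v \<le> 0" using True nonneg[OF v] by (simp add: mult_nonpos_nonneg)
      then have "c * a v v \<le> 0" using c(2)[OF v] C[OF v] by linarith
      then show ?thesis using c(1) nonneg[OF v] by (simp add: mult_le_0_iff)
    qed
    show ?thesis unfolding form_complete_def
    proof (intro allI impI, elim conjE)
      fix s :: "nat \<Rightarrow> 'a" assume "\<forall>n. s n \<in> Z"
      then show "\<exists>w\<in>Z. (\<lambda>n. a (s n - w) (s n - w)) \<longlonglongrightarrow> 0"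
        by (intro bexI[of _ 0]) (auto simp: z)
    qed
  next
    case False
    show ?thesis
    proof (rule form_complete_equiv[OF sub bc, of "1 / C" a "1 / c"])
      show "1 / C * dual_inv N Z K v v \<le> a v v" if "v \<in> Z" for v
        using C[OF that] False by (simp add: field_simps)
      show "a v v \<le> 1 / c * dual_inv N Z K v v" if "v \<in> Z" for v
        using c(2)[OF that] c(1) by (simp add: field_simps)
    qed (use False nonneg in auto)
  qed
qed

end

lemma form_on_inner: "subspace Z \<Longrightarrow> form_on Z (\<bullet>)"
  by unfold_locales (auto simp: inner_add_left, simp add: inner_commute)

lemma riesz_hilbert:
  fixes F :: "'v::{real_inner, banach} \<Rightarrow> real"
  assumes "bounded_linear F"
  shows "\<exists>w. \<forall>v. F v = w \<bullet> v"
proof -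
  interpret F: bounded_linear F by (rule assms)
  interpret i: form_on "UNIV :: 'v set" "(\<bullet>)" by (rule form_on_inner) simp
  have "form_complete (UNIV :: 'v set) (\<bullet>)"
    unfolding form_complete_def
  proof (intro allI impI, elim conjE)
    fix s :: "nat \<Rightarrow> 'v" assume C: "\<forall>e>0. \<exists>N. \<forall>i\<ge>N. \<forall>j\<ge>N. (s i - s j) \<bullet> (s i - s j) < e"
    have "Cauchy s"
    proof (rule metric_CauchyI)
      fix e :: real assume "e > 0"
      then obtain N where N: "\<forall>i\<ge>N. \<forall>j\<ge>N. (s i - s j) \<bullet> (s i - s j) < e\<^sup>2"
        using C zero_less_power by blast
      then show "\<exists>N. \<forall>i\<ge>N. \<forall>j\<ge>N. dist (s i) (s j) < e"
        using \<open>e > 0\<close> power_less_imp_less_base[of _ 2 e]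
        by (intro exI[of _ N]) (auto simp: dist_norm power2_norm_eq_inner[symmetric])
    qed
    then obtain w where "s \<longlonglongrightarrow> w" using convergent_eq_Cauchy by blast
    then have "(\<lambda>n. (s n - w) \<bullet> (s n - w)) \<longlonglongrightarrow> (w - w) \<bullet> (w - w)" by (intro tendsto_intros)
    then show "\<exists>w\<in>UNIV. (\<lambda>n. (s n - w) \<bullet> (s n - w)) \<longlonglongrightarrow> 0" by auto
  qed
  then have "\<exists>w\<in>UNIV. \<forall>v\<in>UNIV. F v = w \<bullet> v"
    by (rule i.riesz[where C = "onorm F"])
      (use onorm[OF assms] in \<open>auto simp: F.add F.scaleR norm_eq_sqrt_inner[symmetric]\<close>)
  then show ?thesis by simp
qed

section \<open>Primitives and integration by parts\<close>

text \<open>Dynkin's argument: open intervals are stable under intersection and generate the Borel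
  sets, and the sets over which \<open>f\<close> integrates to 0 form a Dynkin system.\<close>

lemma AE_zero_if_interval_integrals_zero:
  fixes f :: "real \<Rightarrow> 'v::{banach, second_countable_topology}"
  assumes f: "integrable lborel f"
    and z: "\<And>a b. a < b \<Longrightarrow> (LINT t:{a<..<b}|lborel. f t) = 0"
  shows "AE t in lborel. f t = 0"
proof -
  have z': "(LINT t:{a<..<b}|lborel. f t) = 0" for a b
    using z[of a b] by (cases "a < b") (auto simp: set_lebesgue_integral_def)
  have [measurable]: "f \<in> borel_measurable lborel" using f by auto
  \<comment> \<open>The integral over the whole line is needed for complements; bounded intervals
    exhaust it.\<close>
  have UNIV: "(LINT t|lborel. f t) = 0"
  proof -
    have "(\<lambda>n. LINT t:{- real n<..<real n}|lborel. f t) \<longlonglongrightarrow> (LINT t|lborel. f t)"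
      unfolding set_lebesgue_integral_def
    proof (rule integral_dominated_convergence[where w = "\<lambda>t. norm (f t)"])
      show "AE t in lborel. (\<lambda>n. indicator {- real n<..<real n} t *\<^sub>R f t) \<longlonglongrightarrow> f t"
      proof (rule AE_I2)
        fix t :: real
        obtain N where "\<bar>t\<bar> < real N" using reals_Archimedean2 by blast
        then have "\<forall>n\<ge>N. indicator {- real n<..<real n} t *\<^sub>R f t = f t" by (auto simp: indicator_def)
        then show "(\<lambda>n. indicator {- real n<..<real n} t *\<^sub>R f t) \<longlonglongrightarrow> f t"
          by (intro tendsto_eventually) (auto simp: eventually_sequentially)
      qed
    qed (use f in \<open>auto simp: indicator_def\<close>)
    then show ?thesis by (simp add: z' LIMSEQ_const_iff)
  qed
  have "(LINT t:A|lborel. f t) = 0" if "A \<in> sets lborel" for A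
  proof -
    define G :: "real set set" where "G = range (\<lambda>(a, b). {a<..<b})"
    have G: "sigma_sets UNIV G = sets borel"
    proof -
      have "sets (borel :: real measure) = sigma_sets UNIV (range (\<lambda>(a, b). box a b))"
        by (subst borel_eq_box) (rule sets_measure_of, simp)
      then show ?thesis by (simp only: G_def box_real)
    qed
    have "Int_stable G"
    proof (rule Int_stableI)
      fix X Y assume "X \<in> G" "Y \<in> G"
      then obtain a b c d where "X = {a<..<b}" "Y = {c<..<d}" by (auto simp: G_def)
      then have "X \<inter> Y = {max a c<..<min b d}" by auto
      then show "X \<inter> Y \<in> G" by (auto simp: G_def)
    qed
    moreover have "G \<subseteq> Pow UNIV" by simp
    moreover have "A \<in> sigma_sets UNIV G"
      using that by (simp add: G)
    ultimately show ?thesis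
    proof (induction rule: sigma_sets_induct_disjoint)
      case (basic A)
      then show ?case using z' by (auto simp: G_def)
    next
      case empty
      then show ?case by (simp add: set_lebesgue_integral_def)
    next
      case (compl A)
      have [measurable]: "A \<in> sets borel"
        using compl(1) by (simp add: G)
      have "(LINT t:UNIV - A|lborel. f t) = (LINT t|lborel. f t - indicator A t *\<^sub>R f t)"
        unfolding set_lebesgue_integral_def
        by (rule Bochner_Integration.integral_cong) (auto simp: indicator_def)
      also have "\<dots> = (LINT t|lborel. f t) - (LINT t:A|lborel. f t)"
        unfolding set_lebesgue_integral_def using f
        by (intro Bochner_Integration.integral_diff integrable_mult_indicator) auto
      finally show ?case using compl UNIV by simp
    next
      case (union A)
      have [measurable]: "A i \<in> sets borel" for i
        using union(2) by (auto simp: G)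
      have "(LINT t:(\<Union>i. A i)|lborel. f t) = (\<Sum>i. LINT t:A i|lborel. f t)"
        using union(1) f
        by (intro lebesgue_integral_countable_add)
          (auto simp: disjoint_family_on_def set_integrable_def intro!: integrable_mult_indicator)
      then show ?case using union(3) by simp
    qed
  qed
  then show ?thesis by (intro sigma_finite_measure.density_zero[OF sigma_finite_lborel] f) auto
qed

text \<open>The primitive starting at 0. For negative \<open>t\<close> the interval is empty and the
  value is 0.\<close>

definition primitive :: "(real \<Rightarrow> 'v::{banach, second_countable_topology}) \<Rightarrow> real \<Rightarrow> 'v" where
  "primitive f t = (LINT s:{0..t}|lborel. f s)"

lemma continuous_primitive:
  fixes f :: "real \<Rightarrow> 'v::{banach, second_countable_topology}"
  assumes f: "integrable lborel f"
  shows "continuous_on S (primitive f)"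
proof -
  have [measurable]: "f \<in> borel_measurable lborel" using f by auto
  show ?thesis
  proof (rule continuous_on_sequentiallyI)
    fix u and x :: real assume u: "u \<longlonglongrightarrow> x"
    show "(\<lambda>n. primitive f (u n)) \<longlonglongrightarrow> primitive f x"
      unfolding primitive_def set_lebesgue_integral_def
    proof (rule integral_dominated_convergence[where w = "\<lambda>t. norm (f t)"])
      show "AE s in lborel. (\<lambda>n. indicator {0..u n} s *\<^sub>R f s) \<longlonglongrightarrow> indicator {0..x} s *\<^sub>R f s"
        using AE_lborel_singleton[of x]
      proof eventually_elim
        case (elim s)
        have "eventually (\<lambda>n. indicator {0..u n} s *\<^sub>R f s = indicator {0..x} s *\<^sub>R f s) sequentially"
        proof (cases "s < x")
          case True
          show ?thesis using order_tendstoD(1)[OF u True]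
            by eventually_elim (use True in \<open>auto simp: indicator_def\<close>)
        next
          case False
          with elim have "x < s" by simp
          show ?thesis using order_tendstoD(2)[OF u \<open>x < s\<close>]
            by eventually_elim (use \<open>x < s\<close> in \<open>auto simp: indicator_def\<close>)
        qed
        then show ?case by (rule tendsto_eventually)
      qed
    qed (use f in \<open>auto simp: indicator_def\<close>)
  qed
qed

lemma primitive_0 [simp]: "primitive f 0 = 0"
  unfolding primitive_def set_lebesgue_integral_def
proof (rule integral_eq_zero_AE)
  show "AE s in lborel. indicator {0..0} s *\<^sub>R f s = 0"
    using AE_lborel_singleton[of "0::real"] by eventually_elim (auto simp: indicator_def)
qed

lemma norm_primitive_le:
  assumes "integrable lborel f" shows "norm (primitive f t) \<le> (LINT s|lborel. norm (f s))"
proof -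
  have "norm (primitive f t) \<le> (LINT s|lborel. norm (indicator {0..t} s *\<^sub>R f s))"
    unfolding primitive_def set_lebesgue_integral_def by (rule integral_norm_bound)
  also have "\<dots> \<le> (LINT s|lborel. norm (f s))"
    using assms by (intro integral_mono integrable_norm integrable_mult_indicator) (auto simp: indicator_def)
  finally show ?thesis .
qed

lemma primitive_measurable [measurable]:
  assumes "integrable lborel f" shows "primitive f \<in> borel_measurable borel"
  using continuous_primitive[OF assms, of UNIV] by (rule borel_measurable_continuous_onI)

lemma primitive_diff:
  assumes f: "integrable lborel f" and "0 \<le> a" "a \<le> b"
  shows "primitive f b - primitive f a = (LINT s:{a<..<b}|lborel. f s)"
proof -
  have i: "integrable lborel (\<lambda>s. indicator A s *\<^sub>R f s)" if "A \<in> sets borel" for A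
    using f that by (intro integrable_mult_indicator) auto
  have [measurable]: "f \<in> borel_measurable lborel" using f by auto
  have "primitive f b - primitive f a = (LINT s|lborel. indicator {0..b} s *\<^sub>R f s - indicator {0..a} s *\<^sub>R f s)"
    unfolding primitive_def set_lebesgue_integral_def
    by (rule Bochner_Integration.integral_diff[symmetric]) (auto intro: i)
  also have "\<dots> = (LINT s:{a<..<b}|lborel. f s)"
    unfolding set_lebesgue_integral_def
    by (rule integral_cong_AE)
      (use AE_lborel_singleton[of b] in \<open>auto elim!: eventually_mono simp: indicator_def\<close>, use assms in auto)
  finally show ?thesis .
qed

text \<open>Fubini on the square over \<open>{0..T}\<close>: the first integral covers the triangle
  below the diagonal, the second the one above it, and the diagonal is a null set.\<close>

theorem integral_by_parts_primitives:
  fixes f g :: "real \<Rightarrow> 'v::{real_inner, banach, second_countable_topology}"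
  assumes f: "integrable lborel f" and g: "integrable lborel g" and "0 \<le> T"
  shows "(LINT t:{0..T}|lborel. f t \<bullet> primitive g t) + (LINT t:{0..T}|lborel. primitive f t \<bullet> g t) =
    primitive f T \<bullet> primitive g T"
proof -
  define f1 where "f1 = (\<lambda>t. indicator {0..T} t *\<^sub>R f t)"
  define g1 where "g1 = (\<lambda>t. indicator {0..T} t *\<^sub>R g t)"
  have f1: "integrable lborel f1" and g1: "integrable lborel g1"
    unfolding f1_def g1_def using f g by (auto intro: integrable_mult_indicator)
  have [measurable]: "f1 \<in> borel_measurable borel" "g1 \<in> borel_measurable borel"
    using f1 g1 by (auto dest: borel_measurable_integrable)
  have prod: "integrable (lborel \<Otimes>\<^sub>M lborel) (\<lambda>(x, y). f1 x \<bullet> g1 y)"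
  proof (rule lborel_pair.Fubini_integrable)
    show "(\<lambda>(x, y). f1 x \<bullet> g1 y) \<in> borel_measurable (lborel \<Otimes>\<^sub>M lborel)" by measurable
    have b: "norm (LINT y|lborel. norm (f1 x \<bullet> g1 y)) \<le> norm (norm (f1 x) * (LINT y|lborel. norm (g1 y)))" for x
    proof -
      have "(LINT y|lborel. norm (f1 x \<bullet> g1 y)) \<le> (LINT y|lborel. norm (f1 x) * norm (g1 y))"
        using g1 by (intro integral_mono integrable_norm) (auto simp: Cauchy_Schwarz_ineq2)
      then show ?thesis by (simp add: abs_of_nonneg)
    qed
    show "integrable lborel (\<lambda>x. LINT y|lborel. norm (case (x, y) of (x, y) \<Rightarrow> f1 x \<bullet> g1 y))"
    proof (rule Bochner_Integration.integrable_bound)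
      show "integrable lborel (\<lambda>x. norm (f1 x) * (LINT y|lborel. norm (g1 y)))"
        using f1 by simp
      show "(\<lambda>x. LINT y|lborel. norm (case (x, y) of (x, y) \<Rightarrow> f1 x \<bullet> g1 y)) \<in> borel_measurable lborel"
        unfolding prod.case by (intro lborel.borel_measurable_lebesgue_integral) measurable
    qed (use b in simp)
    show "AE x in lborel. integrable lborel (\<lambda>y. case (x, y) of (x, y) \<Rightarrow> f1 x \<bullet> g1 y)"
      using g1 by auto
  qed
  have lo: "integrable (lborel \<Otimes>\<^sub>M lborel) (\<lambda>(x, y). indicator {..x} y *\<^sub>R (f1 x \<bullet> g1 y))"
  proof -
    have "{z :: real \<times> real. snd z \<le> fst z} \<in> sets (lborel \<Otimes>\<^sub>M lborel)"
      unfolding lborel_prod by (auto intro!: borel_closed closed_Collect_le continuous_intros)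
    from integrable_mult_indicator[OF this prod] show ?thesis
      by (rule Bochner_Integration.integrable_cong[THEN iffD1, rotated -1]) (auto simp: indicator_def)
  qed
  have hi: "integrable (lborel \<Otimes>\<^sub>M lborel) (\<lambda>(x, y). indicator {..y} x *\<^sub>R (f1 x \<bullet> g1 y))"
  proof -
    have "{z :: real \<times> real. fst z \<le> snd z} \<in> sets (lborel \<Otimes>\<^sub>M lborel)"
      unfolding lborel_prod by (auto intro!: borel_closed closed_Collect_le continuous_intros)
    from integrable_mult_indicator[OF this prod] show ?thesis
      by (rule Bochner_Integration.integrable_cong[THEN iffD1, rotated -1]) (auto simp: indicator_def)
  qed
  \<comment> \<open>Since \<open>g1\<close> vanishes below 0, the inner integral over the half-line
    \<open>{..x}\<close> is the primitive of \<open>g\<close>.\<close>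
  have G: "(LINT y|lborel. indicator {..x} y *\<^sub>R (f1 x \<bullet> g1 y)) = indicator {0..T} x *\<^sub>R (f x \<bullet> primitive g x)" for x
  proof -
    have "(LINT y|lborel. indicator {..x} y *\<^sub>R (f1 x \<bullet> g1 y)) = (LINT y|lborel. f1 x \<bullet> (indicator {..x} y *\<^sub>R g1 y))"
      by (simp add: indicator_def)
    also have "\<dots> = f1 x \<bullet> (LINT y|lborel. indicator {..x} y *\<^sub>R g1 y)"
      using g1 by (intro integral_inner_right integrable_mult_indicator) auto
    also have "\<dots> = indicator {0..T} x *\<^sub>R (f x \<bullet> primitive g x)"
    proof (cases "x \<in> {0..T}")
      case True
      have "(\<lambda>y. indicator {..x} y *\<^sub>R g1 y) = (\<lambda>y. indicator {0..x} y *\<^sub>R g y)"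
        using True by (auto simp: g1_def indicator_def)
      then show ?thesis using True by (simp add: f1_def primitive_def set_lebesgue_integral_def)
    qed (simp add: f1_def)
    finally show ?thesis .
  qed
  have F: "(LINT x|lborel. indicator {..y} x *\<^sub>R (f1 x \<bullet> g1 y)) = indicator {0..T} y *\<^sub>R (primitive f y \<bullet> g y)" for y
  proof -
    have "(LINT x|lborel. indicator {..y} x *\<^sub>R (f1 x \<bullet> g1 y)) = (LINT x|lborel. (indicator {..y} x *\<^sub>R f1 x) \<bullet> g1 y)"
      by (simp add: indicator_def)
    also have "\<dots> = (LINT x|lborel. indicator {..y} x *\<^sub>R f1 x) \<bullet> g1 y"
      using f1 by (intro integral_inner_left integrable_mult_indicator) auto
    also have "\<dots> = indicator {0..T} y *\<^sub>R (primitive f y \<bullet> g y)"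
    proof (cases "y \<in> {0..T}")
      case True
      have "(\<lambda>x. indicator {..y} x *\<^sub>R f1 x) = (\<lambda>x. indicator {0..y} x *\<^sub>R f x)"
        using True by (auto simp: f1_def indicator_def)
      then show ?thesis using True by (simp add: g1_def primitive_def set_lebesgue_integral_def)
    qed (simp add: g1_def)
    finally show ?thesis .
  qed
  have A: "(LINT t:{0..T}|lborel. f t \<bullet> primitive g t) =
      (LINT x|lborel. LINT y|lborel. indicator {..x} y *\<^sub>R (f1 x \<bullet> g1 y))"
    unfolding set_lebesgue_integral_def by (simp only: G)
  have B: "(LINT t:{0..T}|lborel. primitive f t \<bullet> g t) =
      (LINT x|lborel. LINT y|lborel. indicator {..y} x *\<^sub>R (f1 x \<bullet> g1 y))"
    unfolding set_lebesgue_integral_def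
    by (subst lborel_pair.Fubini_integral[OF hi, symmetric]) (simp only: F)
  have A': "\<dots> = integral\<^sup>L (lborel \<Otimes>\<^sub>M lborel) (\<lambda>(x, y). indicator {..y} x *\<^sub>R (f1 x \<bullet> g1 y))"
    using lborel_pair.integral_fst'[OF hi] by simp
  have B': "(LINT x|lborel. LINT y|lborel. indicator {..x} y *\<^sub>R (f1 x \<bullet> g1 y)) =
      integral\<^sup>L (lborel \<Otimes>\<^sub>M lborel) (\<lambda>(x, y). indicator {..x} y *\<^sub>R (f1 x \<bullet> g1 y))"
    using lborel_pair.integral_fst'[OF lo] by simp
  have "(LINT t:{0..T}|lborel. f t \<bullet> primitive g t) + (LINT t:{0..T}|lborel. primitive f t \<bullet> g t) =
      integral\<^sup>L (lborel \<Otimes>\<^sub>M lborel) (\<lambda>z. (case z of (x, y) \<Rightarrow> indicator {..x} y *\<^sub>R (f1 x \<bullet> g1 y)) +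
        (case z of (x, y) \<Rightarrow> indicator {..y} x *\<^sub>R (f1 x \<bullet> g1 y)))"
    unfolding A B A' B' using lo hi by (intro Bochner_Integration.integral_add[symmetric])
  also have "\<dots> = (LINT x|lborel. LINT y|lborel. indicator {..x} y *\<^sub>R (f1 x \<bullet> g1 y) + indicator {..y} x *\<^sub>R (f1 x \<bullet> g1 y))"
    using lborel_pair.integral_fst'[OF Bochner_Integration.integrable_add[OF lo hi]] by simp
  also have "\<dots> = (LINT x|lborel. LINT y|lborel. f1 x \<bullet> g1 y)"
  proof (rule Bochner_Integration.integral_cong)
    fix x
    show "(LINT y|lborel. indicator {..x} y *\<^sub>R (f1 x \<bullet> g1 y) + indicator {..y} x *\<^sub>R (f1 x \<bullet> g1 y)) =
        (LINT y|lborel. f1 x \<bullet> g1 y)"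
    proof (rule integral_cong_AE)
      show "AE y in lborel. indicator {..x} y *\<^sub>R (f1 x \<bullet> g1 y) + indicator {..y} x *\<^sub>R (f1 x \<bullet> g1 y) = f1 x \<bullet> g1 y"
        using AE_lborel_singleton[of x] by eventually_elim (auto simp: indicator_def)
    qed (unfold indicator_def atMost_iff, measurable)
  qed simp
  also have "\<dots> = (LINT x|lborel. f1 x \<bullet> (LINT y|lborel. g1 y))"
    using g1 by simp
  also have "\<dots> = (LINT x|lborel. f1 x) \<bullet> (LINT y|lborel. g1 y)"
    using f1 by simp
  also have "\<dots> = primitive f T \<bullet> primitive g T"
    by (simp add: primitive_def set_lebesgue_integral_def f1_def g1_def)
  finally show ?thesis .
qed

section \<open>The space of square integrable functions\<close>

lemma l2rel_rep: "l2rel (rep_l2 w) (rep_l2 w)"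
  by (rule Quotient_rep_reflp[OF Quotient_l2])

lemma sq_integrable_rep [simp]: "sq_integrable (rep_l2 w)"
  using l2rel_rep[of w] by (simp add: l2rel_def)

lemma rep_l2_measurable [measurable]: "rep_l2 w \<in> borel_measurable borel"
  using sq_integrable_rep[of w] by (simp add: sq_integrable_def)

lemma integrable_norm_sq_rep: "integrable lborel (\<lambda>t. (norm (rep_l2 w t))\<^sup>2)"
  using sq_integrable_rep[of w] by (simp add: sq_integrable_def)

lemma abs_rep_l2 [simp]: "abs_l2 (rep_l2 w) = w"
  by (rule Quotient_abs_rep[OF Quotient_l2])

lemma l2rel_refl: "sq_integrable f \<Longrightarrow> l2rel f f"
  by (simp add: l2rel_def)

lemma rep_abs_l2: "sq_integrable f \<Longrightarrow> AE t in lborel. rep_l2 (abs_l2 f) t = f t"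
  using Quotient_rep_abs[OF Quotient_l2 l2rel_refl] by (auto simp: l2rel_def)

lemma l2_eqI:
  assumes "AE t in lborel. rep_l2 v t = rep_l2 w t" shows "v = w"
proof -
  have "l2rel (rep_l2 v) (rep_l2 w)" using assms by (simp add: l2rel_def)
  then have "abs_l2 (rep_l2 v) = abs_l2 (rep_l2 w)" by (rule Quotient_rel_abs[OF Quotient_l2])
  then show ?thesis by simp
qed

lemma rep_add: "AE t in lborel. rep_l2 (v + w) t = rep_l2 v t + rep_l2 w t"
proof -
  have "v + w = abs_l2 (\<lambda>t. rep_l2 v t + rep_l2 w t)"
    using plus_l2.abs_eq[OF l2rel_rep[of v] l2rel_rep[of w]] by simp
  then show ?thesis by (simp add: rep_abs_l2 sq_integrable_add)
qed

lemma rep_scaleR: "AE t in lborel. rep_l2 (c *\<^sub>R w) t = c *\<^sub>R rep_l2 w t"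
proof -
  have "c *\<^sub>R w = abs_l2 (\<lambda>t. c *\<^sub>R rep_l2 w t)"
    using scaleR_l2.abs_eq[OF l2rel_rep[of w]] by simp
  then show ?thesis by (simp add: rep_abs_l2 sq_integrable_scaleR)
qed

lemma rep_zero: "AE t in lborel. rep_l2 0 t = 0"
  using rep_scaleR[of 0 0] by simp

lemma rep_diff: "AE t in lborel. rep_l2 (v - w) t = rep_l2 v t - rep_l2 w t"
  using rep_add[of v "(-1) *\<^sub>R w"] rep_scaleR[of "-1" w] by eventually_elim simp

lemma inner_rep: "v \<bullet> w = (\<integral>t. rep_l2 v t \<bullet> rep_l2 w t \<partial>lborel)"
  using inner_l2.abs_eq[OF l2rel_rep[of v] l2rel_rep[of w]] by simp

lemma integrable_inner_rep: "integrable lborel (\<lambda>t. rep_l2 v t \<bullet> rep_l2 w t)"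
  by (intro integrable_inner_sq_integrable) auto

lemma sq_integrable_bound:
  assumes "sq_integrable f" "g \<in> borel_measurable borel" "\<And>t. norm (g t) \<le> C * norm (f t)"
  shows "sq_integrable g"
  unfolding sq_integrable_def
proof
  show "g \<in> borel_measurable lborel" using assms(2) by simp
  have "integrable lborel (\<lambda>t. C\<^sup>2 * (norm (f t))\<^sup>2)" using assms(1) by (auto simp: sq_integrable_def)
  moreover have "(norm (g t))\<^sup>2 \<le> C\<^sup>2 * (norm (f t))\<^sup>2" for t
    using power_mono[OF assms(3)[of t], of 2] by (simp add: power_mult_distrib)
  ultimately show "integrable lborel (\<lambda>t. (norm (g t))\<^sup>2)"
    using assms(2) by - (erule Bochner_Integration.integrable_bound, simp_all)
qed

lemma sq_integrable_if_bounded: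
  assumes "f \<in> borel_measurable borel" "\<And>t. norm (f t) \<le> C" "\<And>t. t \<notin> {a..b::real} \<Longrightarrow> f t = 0"
  shows "sq_integrable f"
  unfolding sq_integrable_def
proof
  show "f \<in> borel_measurable lborel" using assms(1) by simp
  have "integrable lborel (\<lambda>t. C\<^sup>2 * indicator {a..b} t)"
    by (intro integrable_mult_right) (auto simp: integrable_indicator_iff emeasure_lborel_Icc_eq)
  moreover have "(norm (f t))\<^sup>2 \<le> C\<^sup>2 * indicator {a..b} t" for t
    using assms(3)[of t] power_mono[OF assms(2)[of t], of 2] by (auto simp: indicator_def)
  ultimately show "integrable lborel (\<lambda>t. (norm (f t))\<^sup>2)"
    using assms(1) by - (erule Bochner_Integration.integrable_bound, simp_all)
qed

lemma norm_le_sq: "0 < e \<Longrightarrow> (x::real) \<le> e + x\<^sup>2 / e"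
proof -
  assume "0 < e"
  have "0 \<le> (x - e)\<^sup>2" by simp
  then have "2 * (x * e) \<le> x\<^sup>2 + e\<^sup>2" by (simp add: power2_diff)
  then have "x * e \<le> x\<^sup>2 + e\<^sup>2" using zero_le_power2[of x] zero_le_power2[of e] by linarith
  then show ?thesis using \<open>0 < e\<close> by (simp add: field_simps power2_eq_square)
qed

lemma Yspace_AE: "w \<in> Yspace P \<Longrightarrow> AE t in lborel. t \<notin> ivl P \<longrightarrow> rep_l2 w t = 0"
  by (simp add: Yspace_def)

lemma subspace_Yspace: "subspace (Yspace P)"
proof (rule subspaceI)
  show "0 \<in> Yspace P" using rep_zero unfolding Yspace_def by (auto elim: eventually_mono)
  show "v + w \<in> Yspace P" if "v \<in> Yspace P" "w \<in> Yspace P" for v w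
    using rep_add[of v w] Yspace_AE[OF that(1)] Yspace_AE[OF that(2)] unfolding Yspace_def mem_Collect_eq
    by eventually_elim simp
  show "c *\<^sub>R w \<in> Yspace P" if "w \<in> Yspace P" for w c
    using rep_scaleR[of c w] Yspace_AE[OF that] unfolding Yspace_def mem_Collect_eq
    by eventually_elim simp
qed

lemma abs_in_Yspace:
  assumes "sq_integrable f" "\<And>t. t \<notin> ivl P \<Longrightarrow> f t = 0" shows "abs_l2 f \<in> Yspace P"
  using rep_abs_l2[OF assms(1)] unfolding Yspace_def mem_Collect_eq
  by eventually_elim (use assms(2) in metis)

text \<open>The weighted Young inequality \<open>norm_le_sq\<close>, integrated over the bounded
  interval, takes the place of Cauchy-Schwarz; the free weight \<open>e\<close> is later tuned to
  make both terms small.\<close>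

lemma L1_bound_Yspace:
  assumes "w \<in> Yspace P" "0 < e" "0 < horizon P"
  shows "integrable lborel (rep_l2 w)"
    and "(LINT t|lborel. norm (rep_l2 w t)) \<le> e * horizon P + (w \<bullet> w) / e"
proof -
  have g: "integrable lborel (\<lambda>t. e * indicator (ivl P) t + (norm (rep_l2 w t))\<^sup>2 / e)"
    using assms(3) integrable_norm_sq_rep[of w] by (intro Bochner_Integration.integrable_add integrable_mult_right integrable_divide)
      (auto simp: integrable_indicator_iff)
  have le: "AE t in lborel. norm (rep_l2 w t) \<le> e * indicator (ivl P) t + (norm (rep_l2 w t))\<^sup>2 / e"
    using Yspace_AE[OF assms(1)]
  proof eventually_elim
    case (elim t)
    then show ?case using norm_le_sq[OF assms(2), of "norm (rep_l2 w t)"] assms(2)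
      by (cases "t \<in> ivl P") auto
  qed
  show i: "integrable lborel (rep_l2 w)"
    by (rule Bochner_Integration.integrable_bound[OF g]) (use le assms(2) in \<open>auto elim!: eventually_mono\<close>)
  have "(LINT t|lborel. norm (rep_l2 w t)) \<le> (LINT t|lborel. e * indicator (ivl P) t + (norm (rep_l2 w t))\<^sup>2 / e)"
    using i g le by (intro integral_mono_AE) auto
  also have "\<dots> = e * horizon P + (w \<bullet> w) / e"
    using assms(3) integrable_norm_sq_rep[of w]
    by (subst Bochner_Integration.integral_add) (auto simp: integrable_indicator_iff inner_rep power2_norm_eq_inner)
  finally show "(LINT t|lborel. norm (rep_l2 w t)) \<le> e * horizon P + (w \<bullet> w) / e" .
qed

text \<open>Riesz-Fischer. On a bounded interval a sequence that is Cauchy in mean square is Cauchy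
  in mean, hence has an almost everywhere convergent subsequence, and Fatou's lemma turns pointwise
  into mean square convergence.\<close>

theorem Yspace_complete_inner:
  fixes P :: "('v::{real_inner, banach, second_countable_topology}, 'h) evolution"
  assumes T: "0 < horizon P"
  shows "form_complete (Yspace P) (\<bullet>)"
  unfolding form_complete_def
proof (intro allI impI, elim conjE)
  fix s :: "nat \<Rightarrow> 'v l2"
  assume s: "\<forall>n. s n \<in> Yspace P"
    and C: "\<forall>e>0. \<exists>N. \<forall>i\<ge>N. \<forall>j\<ge>N. (s i - s j) \<bullet> (s i - s j) < e"
  define f where "f n = rep_l2 (s n)" for n
  have [measurable]: "f n \<in> borel_measurable borel" for n unfolding f_def by measurable
  have sY: "s i - s j \<in> Yspace P" for i j using s subspace_diff[OF subspace_Yspace] by blast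
  have fi: "integrable lborel (f n)" for n unfolding f_def using L1_bound_Yspace(1)[OF s[rule_format, of n], of 1] T by simp
  have fd: "(LINT t|lborel. norm (f i t - f j t)) = (LINT t|lborel. norm (rep_l2 (s i - s j) t))" for i j
    using rep_diff[of "s i" "s j"] by (intro integral_cong_AE) (auto simp: f_def elim: eventually_mono)
  have small: "\<exists>N. \<forall>i\<ge>N. \<forall>j\<ge>N. (LINT t|lborel. norm (f i t - f j t)) < e" if "e > 0" for e
  proof -
    \<comment> \<open>With this weight the first term of the bound in \<open>L1_bound_Yspace\<close>
      is \<open>e / 2\<close>.\<close>
    define d where "d = e / (2 * horizon P)"
    have "d > 0" using T that by (simp add: d_def)
    then obtain N where N: "\<forall>i\<ge>N. \<forall>j\<ge>N. (s i - s j) \<bullet> (s i - s j) < d * e / 2"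
      using C[rule_format, of "d * e / 2"] \<open>e > 0\<close> by auto
    have "(LINT t|lborel. norm (f i t - f j t)) < e" if "i \<ge> N" "j \<ge> N" for i j
    proof -
      have "(LINT t|lborel. norm (f i t - f j t)) \<le> d * horizon P + ((s i - s j) \<bullet> (s i - s j)) / d"
        unfolding fd by (rule L1_bound_Yspace(2)[OF sY \<open>d > 0\<close> T])
      also have "d * horizon P = e / 2" using T by (simp add: d_def)
      also have "((s i - s j) \<bullet> (s i - s j)) / d < e / 2"
        using N that \<open>d > 0\<close> by (simp add: field_simps)
      finally show ?thesis by simp
    qed
    then show ?thesis by blast
  qed
  obtain r where r: "strict_mono r" "AE t in lborel. Cauchy (\<lambda>i. f (r i) t)"
    using cauchy_L1_AE_cauchy_subseq[OF fi small] by blast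
  define g where "g t = lim (\<lambda>i. f (r i) t)" for t
  have [measurable]: "g \<in> borel_measurable borel"
    unfolding g_def by (intro borel_measurable_lim_metric) measurable
  have lim: "AE t in lborel. (\<lambda>i. f (r i) t) \<longlonglongrightarrow> g t"
    using r(2) by eventually_elim (simp add: g_def Cauchy_convergent_iff convergent_LIMSEQ_iff)
  have nn: "(\<integral>\<^sup>+t. ennreal ((norm (f i t - f j t))\<^sup>2) \<partial>lborel) = ennreal ((s i - s j) \<bullet> (s i - s j))" for i j
  proof -
    have "(\<integral>\<^sup>+t. ennreal ((norm (f i t - f j t))\<^sup>2) \<partial>lborel) = (\<integral>\<^sup>+t. ennreal ((norm (rep_l2 (s i - s j) t))\<^sup>2) \<partial>lborel)"
      using rep_diff[of "s i" "s j"] by (intro nn_integral_cong_AE) (auto simp: f_def elim: eventually_mono)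
    also have "\<dots> = ennreal (LINT t|lborel. (norm (rep_l2 (s i - s j) t))\<^sup>2)"
      by (rule nn_integral_eq_integral[OF integrable_norm_sq_rep]) auto
    finally show ?thesis by (simp add: inner_rep power2_norm_eq_inner)
  qed
  have fatou: "\<exists>N. \<forall>n\<ge>N. (\<integral>\<^sup>+t. ennreal ((norm (f n t - g t))\<^sup>2) \<partial>lborel) \<le> ennreal e" if "e > 0" for e
  proof -
    obtain N where N: "\<forall>i\<ge>N. \<forall>j\<ge>N. (s i - s j) \<bullet> (s i - s j) < e" using C[rule_format, OF \<open>e > 0\<close>] by blast
    have "(\<integral>\<^sup>+t. ennreal ((norm (f n t - g t))\<^sup>2) \<partial>lborel) \<le> ennreal e" if "n \<ge> N" for n
    proof -
      have "(\<integral>\<^sup>+t. ennreal ((norm (f n t - g t))\<^sup>2) \<partial>lborel) =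
          (\<integral>\<^sup>+t. liminf (\<lambda>j. ennreal ((norm (f n t - f (r j) t))\<^sup>2)) \<partial>lborel)"
      proof (rule nn_integral_cong_AE)
        show "AE t in lborel. ennreal ((norm (f n t - g t))\<^sup>2) = liminf (\<lambda>j. ennreal ((norm (f n t - f (r j) t))\<^sup>2))"
          using lim
        proof eventually_elim
          case (elim t)
          then have "(\<lambda>j. ennreal ((norm (f n t - f (r j) t))\<^sup>2)) \<longlonglongrightarrow> ennreal ((norm (f n t - g t))\<^sup>2)"
            by (intro tendsto_intros tendsto_ennrealI)
          from lim_imp_Liminf[OF _ this] show ?case by simp
        qed
      qed
      also have "\<dots> \<le> liminf (\<lambda>j. \<integral>\<^sup>+t. ennreal ((norm (f n t - f (r j) t))\<^sup>2) \<partial>lborel)"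
        by (rule nn_integral_liminf) measurable
      also have "\<dots> \<le> ennreal e"
      proof (rule Liminf_le)
        have "eventually (\<lambda>j. j \<ge> N) sequentially" by (rule eventually_ge_at_top)
        then show "\<forall>\<^sub>F j in sequentially. (\<integral>\<^sup>+t. ennreal ((norm (f n t - f (r j) t))\<^sup>2) \<partial>lborel) \<le> ennreal e"
        proof eventually_elim
          case (elim j)
          then have "r j \<ge> N" using seq_suble[OF r(1), of j] by simp
          then show ?case using N that unfolding nn by (intro ennreal_leI) (auto intro: less_imp_le)
        qed
      qed simp
      finally show ?thesis .
    qed
    then show ?thesis by blast
  qed
  have sqd: "sq_integrable (\<lambda>t. f n t - g t)" if "(\<integral>\<^sup>+t. ennreal ((norm (f n t - g t))\<^sup>2) \<partial>lborel) \<le> ennreal e" for n e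
    unfolding sq_integrable_def using that
    by (auto intro!: integrableI_bounded simp: le_less_trans)
  obtain N1 where N1: "(\<integral>\<^sup>+t. ennreal ((norm (f N1 t - g t))\<^sup>2) \<partial>lborel) \<le> ennreal 1" using fatou[of 1] by auto
  \<comment> \<open>The limit is one member of the sequence minus its square integrable distance
    from the limit.\<close>
  have "sq_integrable (\<lambda>t. f N1 t + (-1) *\<^sub>R (f N1 t - g t))"
    by (intro sq_integrable_add sq_integrable_scaleR sqd[OF N1]) (simp add: f_def)
  then have g: "sq_integrable g" by simp
  define w where "w = abs_l2 g"
  have wg: "AE t in lborel. rep_l2 w t = g t" unfolding w_def using rep_abs_l2[OF g] .
  have "AE t in lborel. \<forall>n. t \<notin> ivl P \<longrightarrow> f n t = 0"
    unfolding AE_all_countable f_def using Yspace_AE s by blast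
  then have "w \<in> Yspace P" unfolding Yspace_def mem_Collect_eq using wg lim
  proof eventually_elim
    case (elim t)
    then show ?case using LIMSEQ_unique[of "\<lambda>i. f (r i) t" "g t" 0] by auto
  qed
  moreover have "(\<lambda>n. (s n - w) \<bullet> (s n - w)) \<longlonglongrightarrow> 0"
  proof (rule LIMSEQ_I)
    fix e :: real assume "e > 0"
    obtain N where N: "\<forall>n\<ge>N. (\<integral>\<^sup>+t. ennreal ((norm (f n t - g t))\<^sup>2) \<partial>lborel) \<le> ennreal (e/2)"
      using fatou[of "e/2"] \<open>e > 0\<close> by auto
    have "(s n - w) \<bullet> (s n - w) \<le> e/2" if "n \<ge> N" for n
    proof -
      have "ennreal ((s n - w) \<bullet> (s n - w)) = (\<integral>\<^sup>+t. ennreal ((norm (rep_l2 (s n - w) t))\<^sup>2) \<partial>lborel)"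
        by (subst nn_integral_eq_integral[OF integrable_norm_sq_rep]) (auto simp: inner_rep power2_norm_eq_inner)
      also have "\<dots> = (\<integral>\<^sup>+t. ennreal ((norm (f n t - g t))\<^sup>2) \<partial>lborel)"
        using rep_diff[of "s n" w] wg by (intro nn_integral_cong_AE, eventually_elim) (simp add: f_def)
      also have "\<dots> \<le> ennreal (e/2)" using N that by simp
      finally show ?thesis using \<open>e > 0\<close> by (simp add: ennreal_le_iff)
    qed
    then show "\<exists>N. \<forall>n\<ge>N. norm ((s n - w) \<bullet> (s n - w) - 0) < e"
      using \<open>e > 0\<close> by (fastforce intro!: exI[of _ N])
  qed
  ultimately show "\<exists>w\<in>Yspace P. (\<lambda>n. (s n - w) \<bullet> (s n - w)) \<longlonglongrightarrow> 0" by blast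
qed

section \<open>The parabolic problem\<close>

text \<open>The form is measurable in time only for fixed arguments. With simple functions inserted,
  finitely many pairs of arguments occur; continuity of the bilinear maps carries measurability over
  to the limit.\<close>

lemma measurable_bilinear_integrand:
  fixes f g :: "real \<Rightarrow> 'v::{real_normed_vector, second_countable_topology}"
  assumes bil: "\<And>t. bounded_bilinear (af t)"
    and meas: "\<And>\<eta> \<zeta>. (\<lambda>t. af t \<eta> \<zeta>) \<in> borel_measurable lebesgue"
    and f: "f \<in> borel_measurable lebesgue" and g: "g \<in> borel_measurable lebesgue"
  shows "(\<lambda>t. af t (f t) (g t) :: real) \<in> borel_measurable lebesgue"
proof -
  obtain F where F: "\<And>i. simple_function lebesgue (F i)" "\<And>t. (\<lambda>i. F i t) \<longlonglongrightarrow> f t"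
    using borel_measurable_implies_sequence_metric[OF f, of 0] by auto
  obtain G where G: "\<And>i. simple_function lebesgue (G i)" "\<And>t. (\<lambda>i. G i t) \<longlonglongrightarrow> g t"
    using borel_measurable_implies_sequence_metric[OF g, of 0] by auto
  have simple: "(\<lambda>t. af t (F i t) (G i t)) \<in> borel_measurable lebesgue" for i
  proof -
    define h where "h t = (F i t, G i t)" for t
    have h: "simple_function lebesgue h" unfolding h_def using F(1) G(1) by (intro simple_function_Pair)
    have fin: "finite (range h)" using h by (simp add: simple_function_def)
    have hc: "h \<in> measurable lebesgue (count_space (range h))"
      using h fin by (subst measurable_count_space_eq2) (auto simp: simple_function_def)
    have "(\<lambda>t. (\<lambda>p t. af t (fst p) (snd p)) (h t) t) \<in> borel_measurable lebesgue"
      by (rule measurable_compose_countable'[OF _ hc]) (use meas fin in \<open>auto intro: countable_finite\<close>)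
    then show ?thesis by (simp add: h_def)
  qed
  show ?thesis
  proof (rule borel_measurable_LIMSEQ_metric[OF simple])
    show "(\<lambda>i. af t (F i t) (G i t)) \<longlonglongrightarrow> af t (f t) (g t)" for t
      by (rule bounded_bilinear.tendsto[OF bil F(2) G(2)])
  qed
qed

locale parabolic =
  fixes P :: "('v::{real_inner, banach, second_countable_topology},
    'h::{real_inner, banach, second_countable_topology}) evolution"
  assumes ep: "evolution_problem P"
begin

abbreviation "T \<equiv> horizon P"
abbreviation "Y \<equiv> Yspace P"

lemma T_pos: "0 < T"
  using ep by (simp add: evolution_problem_def)

lemma emb_facts: "bounded_linear (emb P)" "inj (emb P)" "closure (range (emb P)) = UNIV"
  using ep by (auto simp: evolution_problem_def)

sublocale emb: bounded_linear "emb P" by (rule emb_facts)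

text \<open>The assumptions on the form hold only for almost every time. Putting 0 at the
  exceptional times and off the interval makes all of them except coercivity hold everywhere;
  measurability survives because Lebesgue measure is complete.\<close>

lemma aform_modification:
  obtains af :: "real \<Rightarrow> 'v \<Rightarrow> 'v \<Rightarrow> real" and C c :: real where "0 < c" "0 \<le> C"
    "\<And>t. bounded_bilinear (af t)" "\<And>t \<eta> \<zeta>. af t \<eta> \<zeta> = af t \<zeta> \<eta>"
    "\<And>t \<eta> \<zeta>. \<bar>af t \<eta> \<zeta>\<bar> \<le> C * norm \<eta> * norm \<zeta>" "\<And>t \<eta>. 0 \<le> af t \<eta> \<eta>"
    "AE t in lebesgue. t \<in> ivl P \<longrightarrow> (\<forall>\<eta>. c * (norm \<eta>)\<^sup>2 \<le> af t \<eta> \<eta>)"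
    "\<And>\<eta> \<zeta>. (\<lambda>t. af t \<eta> \<zeta>) \<in> borel_measurable lebesgue"
    "AE t in lebesgue. \<forall>\<eta> \<zeta>. af t \<eta> \<zeta> = indicator (ivl P) t *\<^sub>R aform P t \<eta> \<zeta>"
proof -
  obtain C0 c where c: "0 < c" and ae: "AE t in lebesgue. t \<in> ivl P \<longrightarrow> bilinear (aform P t) \<and>
        (\<forall>\<eta> \<zeta>. aform P t \<eta> \<zeta> = aform P t \<zeta> \<eta>) \<and>
        (\<forall>\<eta> \<zeta>. \<bar>aform P t \<eta> \<zeta>\<bar> \<le> C0 * norm \<eta> * norm \<zeta>) \<and>
        (\<forall>\<eta>. aform P t \<eta> \<eta> \<ge> c * (norm \<eta>)\<^sup>2)"
    using ep unfolding evolution_problem_def by blast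
  define C where "C = \<bar>C0\<bar>"
  define good where "good t \<longleftrightarrow> t \<in> ivl P \<and> bilinear (aform P t) \<and>
        (\<forall>\<eta> \<zeta>. aform P t \<eta> \<zeta> = aform P t \<zeta> \<eta>) \<and>
        (\<forall>\<eta> \<zeta>. \<bar>aform P t \<eta> \<zeta>\<bar> \<le> C0 * norm \<eta> * norm \<zeta>) \<and>
        (\<forall>\<eta>. aform P t \<eta> \<eta> \<ge> c * (norm \<eta>)\<^sup>2)" for t
  define af where "af t \<eta> \<zeta> = (if good t then aform P t \<eta> \<zeta> else 0)" for t \<eta> \<zeta>
  have C0: "C0 * norm \<eta> * norm \<zeta> \<le> C * norm \<eta> * norm \<zeta>" for \<eta> \<zeta> :: 'v
    unfolding C_def by (intro mult_right_mono) auto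
  have bound: "\<bar>af t \<eta> \<zeta>\<bar> \<le> C * norm \<eta> * norm \<zeta>" for t \<eta> \<zeta>
  proof (cases "good t")
    case True
    then have "\<bar>aform P t \<eta> \<zeta>\<bar> \<le> C0 * norm \<eta> * norm \<zeta>" by (simp add: good_def)
    then show ?thesis using C0[of \<eta> \<zeta>] True by (simp add: af_def)
  qed (simp add: af_def C_def)
  have bil: "bounded_bilinear (af t)" for t
  proof (cases "good t")
    case True
    then have b: "bilinear (aform P t)" by (simp add: good_def)
    show ?thesis
    proof
      show "af t (a + a') b = af t a b + af t a' b" "af t a (b + b') = af t a b + af t a b'"
        "af t (r *\<^sub>R a) b = r *\<^sub>R af t a b" "af t a (r *\<^sub>R b) = r *\<^sub>R af t a b" for a a' b b' r
        using True b by (auto simp: af_def bilinear_ladd bilinear_radd bilinear_lmul bilinear_rmul)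
      show "\<exists>K. \<forall>a b. norm (af t a b) \<le> norm a * norm b * K"
        using bound[of t] by (intro exI[of _ C]) (simp add: mult.assoc mult.commute mult.left_commute)
    qed
  next
    case False
    then have "af t = (\<lambda>_ _. 0)" by (simp add: af_def fun_eq_iff)
    then show ?thesis by (auto intro!: bounded_bilinear.intro exI[of _ 0])
  qed
  have eq: "AE t in lebesgue. \<forall>\<eta> \<zeta>. af t \<eta> \<zeta> = indicator (ivl P) t *\<^sub>R aform P t \<eta> \<zeta>"
    using ae by eventually_elim (auto simp: af_def good_def indicator_def)
  have nonneg: "0 \<le> af t \<eta> \<eta>" for t \<eta>
  proof (cases "good t")
    case True
    then have "c * (norm \<eta>)\<^sup>2 \<le> aform P t \<eta> \<eta>" by (simp add: good_def)
    moreover have "0 \<le> c * (norm \<eta>)\<^sup>2" using c by simp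
    ultimately show ?thesis using True by (simp add: af_def)
  qed (simp add: af_def)
  have coer: "AE t in lebesgue. t \<in> ivl P \<longrightarrow> (\<forall>\<eta>. c * (norm \<eta>)\<^sup>2 \<le> af t \<eta> \<eta>)"
    using ae by eventually_elim (auto simp: af_def good_def)
  have meas: "(\<lambda>t. af t \<eta> \<zeta>) \<in> borel_measurable lebesgue" for \<eta> \<zeta>
  proof (rule borel_measurable_AE)
    have "(\<lambda>t. aform P t \<eta> \<zeta>) \<in> borel_measurable (lebesgue_on (ivl P))"
      using ep unfolding evolution_problem_def by blast
    then show "(\<lambda>t. if t \<in> ivl P then aform P t \<eta> \<zeta> else 0) \<in> borel_measurable lebesgue"
      by (subst borel_measurable_if) auto
    show "AE t in lebesgue. (if t \<in> ivl P then aform P t \<eta> \<zeta> else 0) = af t \<eta> \<zeta>"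
      using eq by eventually_elim (auto simp: indicator_def)
  qed
  have sym: "af t \<eta> \<zeta> = af t \<zeta> \<eta>" for t \<eta> \<zeta> by (simp add: af_def good_def)
  have "0 \<le> C" by (simp add: C_def)
  show ?thesis by (rule that[of c C af]) (fact c \<open>0 \<le> C\<close> bil sym bound nonneg coer meas eq)+
qed

text \<open>Representatives of classes add and scale only up to null sets, hence the almost
  everywhere form of the algebraic properties.\<close>

lemma aform_integral:
  obtains af :: "'v l2 \<Rightarrow> 'v l2 \<Rightarrow> real \<Rightarrow> real" and C c :: real where "0 < c" "0 \<le> C"
    "\<And>w v. integrable lebesgue (af w v)"
    "\<And>w v. AE t in lebesgue. af w v t = indicator (ivl P) t *\<^sub>R aform P t (rep_l2 w t) (rep_l2 v t)"
    "\<And>u v w. AE t in lebesgue. af (u + v) w t = af u w t + af v w t"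
    "\<And>r u v. AE t in lebesgue. af (r *\<^sub>R u) v t = r * af u v t"
    "\<And>u v. AE t in lebesgue. af u v t = af v u t"
    "\<And>u t. 0 \<le> af u u t" "\<And>u t. af u u t \<le> C * (norm (rep_l2 u t))\<^sup>2"
    "\<And>u. u \<in> Y \<Longrightarrow> AE t in lebesgue. c * (norm (rep_l2 u t))\<^sup>2 \<le> af u u t"
proof (rule aform_modification)
  fix b :: "real \<Rightarrow> 'v \<Rightarrow> 'v \<Rightarrow> real" and C c :: real
  assume b: "0 < c" "0 \<le> C"
    "\<And>t. bounded_bilinear (b t)" "\<And>t \<eta> \<zeta>. b t \<eta> \<zeta> = b t \<zeta> \<eta>"
    "\<And>t \<eta> \<zeta>. \<bar>b t \<eta> \<zeta>\<bar> \<le> C * norm \<eta> * norm \<zeta>" "\<And>t \<eta>. 0 \<le> b t \<eta> \<eta>"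
    and coer: "AE t in lebesgue. t \<in> ivl P \<longrightarrow> (\<forall>\<eta>. c * (norm \<eta>)\<^sup>2 \<le> b t \<eta> \<eta>)"
    and meas: "\<And>\<eta> \<zeta>. (\<lambda>t. b t \<eta> \<zeta>) \<in> borel_measurable lebesgue"
    and eq: "AE t in lebesgue. \<forall>\<eta> \<zeta>. b t \<eta> \<zeta> = indicator (ivl P) t *\<^sub>R aform P t \<eta> \<zeta>"
  define af where "af w v t = b t (rep_l2 w t) (rep_l2 v t)" for w v t
  have m: "af w v \<in> borel_measurable lebesgue" for w v
    unfolding af_def[abs_def]
    by (rule measurable_bilinear_integrand[OF b(3) meas]) (rule measurable_completion, simp)+
  have i: "integrable lebesgue (af w v)" for w v
  proof (rule Bochner_Integration.integrable_bound[OF _ m])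
    have "integrable lborel (\<lambda>t. C * (norm (rep_l2 w t))\<^sup>2 + C * (norm (rep_l2 v t))\<^sup>2)"
      using integrable_norm_sq_rep by (intro Bochner_Integration.integrable_add integrable_mult_right)
    then show "integrable lebesgue (\<lambda>t. C * (norm (rep_l2 w t))\<^sup>2 + C * (norm (rep_l2 v t))\<^sup>2)"
      by (subst integrable_completion) auto
    have "\<bar>af w v t\<bar> \<le> C * (norm (rep_l2 w t))\<^sup>2 + C * (norm (rep_l2 v t))\<^sup>2" for t
    proof -
      have "norm (rep_l2 w t) * norm (rep_l2 v t) \<le> (norm (rep_l2 w t))\<^sup>2 + (norm (rep_l2 v t))\<^sup>2"
        using sum_squares_bound[of "norm (rep_l2 w t)" "norm (rep_l2 v t)"]
          mult_nonneg_nonneg[OF norm_ge_zero[of "rep_l2 w t"] norm_ge_zero[of "rep_l2 v t"]] by linarith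
      from mult_left_mono[OF this b(2)] show ?thesis
        using b(5)[of t "rep_l2 w t" "rep_l2 v t"] by (simp add: af_def algebra_simps)
    qed
    then show "AE t in lebesgue. norm (af w v t) \<le> norm (C * (norm (rep_l2 w t))\<^sup>2 + C * (norm (rep_l2 v t))\<^sup>2)"
      using b(2) by (intro AE_I2) auto
  qed
  have add: "AE t in lebesgue. af (u + v) w t = af u w t + af v w t" for u v w
    using AE_completion[OF rep_add[of u v]]
    by eventually_elim (simp add: af_def bounded_bilinear.add_left[OF b(3)])
  have sc: "AE t in lebesgue. af (r *\<^sub>R u) v t = r * af u v t" for r u v
    using AE_completion[OF rep_scaleR[of r u]]
    by eventually_elim (simp add: af_def bounded_bilinear.scaleR_left[OF b(3)])
  have eq': "AE t in lebesgue. af w v t = indicator (ivl P) t *\<^sub>R aform P t (rep_l2 w t) (rep_l2 v t)" for w v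
    using eq by eventually_elim (simp add: af_def)
  have up: "af u u t \<le> C * (norm (rep_l2 u t))\<^sup>2" for u t
    using b(5)[of t "rep_l2 u t" "rep_l2 u t"] by (simp add: af_def power2_eq_square mult.assoc)
  have lo: "AE t in lebesgue. c * (norm (rep_l2 u t))\<^sup>2 \<le> af u u t" if "u \<in> Y" for u
    using coer AE_completion[OF Yspace_AE[OF that]]
    by eventually_elim (auto simp: af_def b(6))
  have sym: "AE t in lebesgue. af u v t = af v u t" for u v
    by (intro AE_I2) (simp add: af_def b(4))
  have nn: "0 \<le> af u u t" for u t by (simp add: af_def b(6))
  show ?thesis by (rule that[of c C af]) (fact b(1,2) i eq' add sc sym nn up lo | rule lo, assumption)+
qed

lemma aform_integrable:
  "set_integrable lebesgue (ivl P) (\<lambda>t. aform P t (rep_l2 w t) (rep_l2 v t))"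
proof (rule aform_integral)
  fix af :: "'v l2 \<Rightarrow> 'v l2 \<Rightarrow> real \<Rightarrow> real" and C c :: real
  assume i: "\<And>w v. integrable lebesgue (af w v)"
    and eq: "\<And>w v. AE t in lebesgue. af w v t = indicator (ivl P) t *\<^sub>R aform P t (rep_l2 w t) (rep_l2 v t)"
  show ?thesis
    unfolding set_integrable_def
    by (rule integrable_cong_AE_imp[OF i[of w v] borel_measurable_AE[OF borel_measurable_integrable[OF i] eq]])
      (use eq[of w v] in \<open>eventually_elim, simp\<close>)
qed

text \<open>The equivalence of the energy norm with the norm of \<open>L2\<close> is the route by
  which \<open>A_complete\<close> gets completeness.\<close>

lemma A_op_form_bounds: "form_on Y (A_op P) \<and> (\<exists>c>0. \<exists>C. \<forall>v\<in>Y. c * (v \<bullet> v) \<le> A_op P v v \<and> A_op P v v \<le> C * (v \<bullet> v))"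
proof (rule aform_integral)
  fix af :: "'v l2 \<Rightarrow> 'v l2 \<Rightarrow> real \<Rightarrow> real" and C c :: real
  assume c: "0 < c" "0 \<le> C"
    and i: "\<And>w v. integrable lebesgue (af w v)"
    and eq: "\<And>w v. AE t in lebesgue. af w v t = indicator (ivl P) t *\<^sub>R aform P t (rep_l2 w t) (rep_l2 v t)"
    and add: "\<And>u v w. AE t in lebesgue. af (u + v) w t = af u w t + af v w t"
    and sc: "\<And>r u v. AE t in lebesgue. af (r *\<^sub>R u) v t = r * af u v t"
    and sym: "\<And>u v. AE t in lebesgue. af u v t = af v u t"
    and nn: "\<And>u t. 0 \<le> af u u t" and up: "\<And>u t. af u u t \<le> C * (norm (rep_l2 u t))\<^sup>2"
    and lo: "\<And>u. u \<in> Y \<Longrightarrow> AE t in lebesgue. c * (norm (rep_l2 u t))\<^sup>2 \<le> af u u t"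
  note m = borel_measurable_integrable[OF i]
  have A: "A_op P w v = (LINT t|lebesgue. af w v t)" if "v \<in> Y" for w v
  proof -
    have "(\<lambda>t. indicator (ivl P) t *\<^sub>R aform P t (rep_l2 w t) (rep_l2 v t)) \<in> borel_measurable lebesgue"
      by (rule borel_measurable_AE[OF m eq])
    then have "(LINT t:ivl P|lebesgue. aform P t (rep_l2 w t) (rep_l2 v t)) = (LINT t|lebesgue. af w v t)"
      unfolding set_lebesgue_integral_def
      by (rule integral_cong_AE[OF _ m]) (use eq[of w v] in \<open>eventually_elim, simp\<close>)
    then show ?thesis using that by (simp add: A_op_def restr_def)
  qed
  have form: "form_on Y (A_op P)"
  proof
    show "subspace Y" by (rule subspace_Yspace)
    show "A_op P (u + v) w = A_op P u w + A_op P v w" if "w \<in> Y" for u v w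
      using i m add[of u v w] that
      by (simp add: A integral_cong_AE[of _ _ "\<lambda>t. af u w t + af v w t"])
    show "A_op P (r *\<^sub>R u) v = r * A_op P u v" if "v \<in> Y" for u v r
      using i m sc[of r u v] that
      by (simp add: A integral_cong_AE[of _ _ "\<lambda>t. r * af u v t"])
    show "A_op P u v = A_op P v u" if "u \<in> Y" "v \<in> Y" for u v
      using integral_cong_AE[OF m m sym, of u v] that by (simp add: A)
    show "0 \<le> A_op P u u" if "u \<in> Y" for u
      using nn that by (simp add: A)
  qed
  have il: "integrable lebesgue (\<lambda>t. (norm (rep_l2 v t))\<^sup>2)" for v :: "'v l2"
    using integrable_norm_sq_rep[of v] by (subst integrable_completion) auto
  have l: "(LINT t|lebesgue. (norm (rep_l2 v t))\<^sup>2) = v \<bullet> v" for v :: "'v l2"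
    by (subst integral_completion) (auto simp: inner_rep power2_norm_eq_inner)
  have "c * (v \<bullet> v) \<le> A_op P v v" if "v \<in> Y" for v
  proof -
    have "c * (v \<bullet> v) = (LINT t|lebesgue. c * (norm (rep_l2 v t))\<^sup>2)" by (simp add: l)
    also have "\<dots> \<le> (LINT t|lebesgue. af v v t)"
      using lo[OF that] by (intro integral_mono_AE i integrable_mult_right il)
    finally show ?thesis using that by (simp add: A)
  qed
  moreover have "A_op P v v \<le> C * (v \<bullet> v)" if "v \<in> Y" for v
  proof -
    have "(LINT t|lebesgue. af v v t) \<le> (LINT t|lebesgue. C * (norm (rep_l2 v t))\<^sup>2)"
      by (intro integral_mono i integrable_mult_right il up)
    then show ?thesis using that by (simp add: A l)
  qed
  ultimately show ?thesis using form c(1) by blast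
qed

lemmas A_op_form = A_op_form_bounds[THEN conjunct1]
lemmas A_op_bounds = A_op_form_bounds[THEN conjunct2]

sublocale A: form_on Y "A_op P" by (rule A_op_form)
sublocale L: form_on Y "(\<bullet>)" by (rule form_on_inner[OF subspace_Yspace])

lemma A_complete: "form_complete Y (A_op P)"
proof -
  obtain c C where c: "c > 0" "\<And>v. v \<in> Y \<Longrightarrow> c * (v \<bullet> v) \<le> A_op P v v"
    "\<And>v. v \<in> Y \<Longrightarrow> A_op P v v \<le> C * (v \<bullet> v)"
    using A_op_bounds by blast
  show ?thesis
    by (rule form_complete_equiv[where b = "(\<bullet>)" and a = "A_op P" and c = c and C = C, OF subspace_Yspace Yspace_complete_inner[OF T_pos] c A.nonneg])
qed

lemma Ynorm_sq: "v \<in> Y \<Longrightarrow> (Ynorm P v)\<^sup>2 = A_op P v v"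
  by (simp add: Ynorm_def A.nonneg)

lemma A_definite: "v \<in> Y \<Longrightarrow> A_op P v v = 0 \<Longrightarrow> v = 0"
proof -
  assume v: "v \<in> Y" "A_op P v v = 0"
  obtain c where "c > 0" "c * (v \<bullet> v) \<le> A_op P v v" using A_op_bounds v by blast
  then show ?thesis using v by (simp add: mult_le_0_iff) (metis inner_ge_zero inner_eq_zero_iff order_antisym)
qed

text \<open>Existence is the Riesz theorem for the energy form; definiteness makes the description
  in \<open>A_inv\<close> unique.\<close>

lemma A_inv:
  assumes "G \<in> Ydual P"
  shows A_inv_mem: "A_inv P G \<in> Y" and A_op_A_inv: "A_op P (A_inv P G) = G"
proof -
  have "\<exists>C. \<forall>v\<in>Y. \<bar>G v\<bar> \<le> C * sqrt (A_op P v v)"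
    using assms by (auto simp: dual_space_def Ynorm_def)
  then obtain C where "\<And>v. v \<in> Y \<Longrightarrow> \<bar>G v\<bar> \<le> C * sqrt (A_op P v v)" by blast
  then have "\<exists>w\<in>Y. \<forall>v\<in>Y. G v = A_op P w v"
    using assms by (intro A.riesz[OF A_complete]) (auto simp: dual_space_def)
  then obtain w where w: "w \<in> Y" "\<And>v. v \<in> Y \<Longrightarrow> G v = A_op P w v" by blast
  have wG: "A_op P w = G"
  proof
    fix v show "A_op P w v = G v"
      using w assms by (cases "v \<in> Y") (auto simp: A_op_def restr_def dual_space_def)
  qed
  have "A_inv P G = w"
    unfolding A_inv_def
  proof (rule the_equality)
    fix y assume y: "y \<in> Y \<and> A_op P y = G"
    then have "A_op P (y - w) (y - w) = 0" using w(1) wG A.diff_left[of y w "y - w"] by simp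
    then show "y = w" using A_definite[of "y - w"] y w(1) by simp
  qed (use w wG in blast)
  then show "A_inv P G \<in> Y" "A_op P (A_inv P G) = G" using w wG by auto
qed

lemma A_op_in_Ydual: "w \<in> Y \<Longrightarrow> A_op P w \<in> Ydual P"
proof -
  have "restr Y (A_op P w) = A_op P w" by (simp add: fun_eq_iff restr_def A_op_def)
  then show "w \<in> Y \<Longrightarrow> A_op P w \<in> Ydual P"
    using A.rep_in_dual_space[of "Ynorm P" w] by (simp add: Ynorm_def)
qed

lemma A_inv_A_op: "w \<in> Y \<Longrightarrow> A_inv P (A_op P w) = w"
proof -
  assume w: "w \<in> Y"
  let ?y = "A_inv P (A_op P w)"
  have "A_op P (?y - w) (?y - w) = 0"
    using A.diff_left[of ?y w "?y - w"] A_inv[OF A_op_in_Ydual[OF w]] w by simp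
  then show ?thesis using A_definite[of "?y - w"] A_inv_mem[OF A_op_in_Ydual[OF w]] w by simp
qed

lemma Ydual_norm_eq:
  assumes "G \<in> Ydual P" shows "(Ydual_norm P G)\<^sup>2 = A_op P (A_inv P G) (A_inv P G)"
  using A.dual_norm_rep[of "Ynorm P" "A_inv P G" G] A_inv[OF assms] A.nonneg[of "A_inv P G"]
  by (simp add: Ynorm_def)

text \<open>A functional on \<open>Y\<close> has two representers, one in the energy form and one in
  the inner product of \<open>L2\<close>. The X-norm is expressed with the first kind, the weak
  derivative with the second.\<close>

lemma Ydual_riesz_inner:
  assumes "G \<in> Ydual P" obtains y where "y \<in> Y" "\<And>v. v \<in> Y \<Longrightarrow> G v = y \<bullet> v"
proof -
  obtain c C where C: "\<And>v. v \<in> Y \<Longrightarrow> A_op P v v \<le> C * (v \<bullet> v)" using A_op_bounds by blast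
  obtain K where K: "\<And>v. v \<in> Y \<Longrightarrow> \<bar>G v\<bar> \<le> K * sqrt (A_op P v v)"
    using assms unfolding dual_space_def Ynorm_def by blast
  have "\<bar>G v\<bar> \<le> (\<bar>K\<bar> * sqrt \<bar>C\<bar>) * sqrt (v \<bullet> v)" if "v \<in> Y" for v
  proof -
    have "A_op P v v \<le> \<bar>C\<bar> * (v \<bullet> v)"
      using C[OF that] mult_right_mono[OF abs_ge_self[of C] inner_ge_zero[of v]] by linarith
    then have "\<bar>K\<bar> * sqrt (A_op P v v) \<le> \<bar>K\<bar> * sqrt (\<bar>C\<bar> * (v \<bullet> v))"
      by (intro mult_left_mono) auto
    moreover have "K * sqrt (A_op P v v) \<le> \<bar>K\<bar> * sqrt (A_op P v v)"
      using A.nonneg[OF that] by (intro mult_right_mono) auto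
    ultimately show ?thesis using K[OF that] by (simp add: real_sqrt_mult)
  qed
  then have "\<exists>w\<in>Y. \<forall>v\<in>Y. G v = w \<bullet> v"
    using assms by (intro L.riesz[OF Yspace_complete_inner[OF T_pos]]) (auto simp: dual_space_def)
  then show ?thesis using that by blast
qed

lemma inner_in_Ydual:
  assumes "y \<in> Y" shows "restr Y (\<lambda>v. y \<bullet> v) \<in> Ydual P"
proof -
  obtain c where c: "c > 0" "\<And>v. v \<in> Y \<Longrightarrow> c * (v \<bullet> v) \<le> A_op P v v" using A_op_bounds by blast
  have "\<bar>y \<bullet> v\<bar> \<le> (norm y / sqrt c) * Ynorm P v" if "v \<in> Y" for v
  proof -
    have "sqrt c * norm v \<le> Ynorm P v"
      using real_sqrt_le_mono[OF c(2)[OF that]] by (simp add: Ynorm_def real_sqrt_mult norm_eq_sqrt_inner)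
    then have "norm y * (sqrt c * norm v) \<le> norm y * Ynorm P v" by (intro mult_left_mono) auto
    moreover have "\<bar>y \<bullet> v\<bar> \<le> norm y * norm v" by (rule Cauchy_Schwarz_ineq2)
    ultimately show ?thesis using c(1) by (simp add: field_simps) (smt (verit) mult.commute mult.left_commute mult_right_mono real_sqrt_gt_zero)
  qed
  then have "\<exists>C. \<forall>v\<in>Y. \<bar>y \<bullet> v\<bar> \<le> C * Ynorm P v" by blast
  then show ?thesis
    by (auto simp: dual_space_def restr_def inner_add_right)
qed

end

section \<open>Test functions and weak derivatives\<close>

text \<open>A continuous plateau on \<open>{a<..<b}\<close>; the subtracted 1 keeps its support at
  distance \<open>1 / Suc n\<close> from the end points. It serves as a building block for
  derivatives of test functions, for which continuity suffices.\<close>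

definition trapezoid :: "real \<Rightarrow> real \<Rightarrow> nat \<Rightarrow> real \<Rightarrow> real" where
  "trapezoid a b n t = max 0 (min 1 (real (Suc n) * min (t - a) (b - t) - 1))"

lemma trapezoid_bounds: "0 \<le> trapezoid a b n t" "trapezoid a b n t \<le> 1"
  by (auto simp: trapezoid_def)

lemma continuous_trapezoid: "continuous_on S (trapezoid a b n)"
  unfolding trapezoid_def by (intro continuous_intros)

lemma trapezoid_measurable [measurable]: "trapezoid a b n \<in> borel_measurable borel"
  by (rule borel_measurable_continuous_onI[OF continuous_trapezoid])

lemma trapezoid_support:
  assumes "0 \<le> a" "b \<le> T" "n \<le> N" "trapezoid a b n t \<noteq> 0"
  shows "t \<in> {1 / Suc N .. T - 1 / Suc N}"
proof -
  have p: "real (Suc n) * min (t - a) (b - t) > 1"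
    using assms(4) by (auto simp: trapezoid_def max_def min_def split: if_splits)
  then have "min (t - a) (b - t) > 1 / Suc n"
    by (simp only: pos_divide_less_eq of_nat_0_less_iff zero_less_Suc mult.commute)
  moreover have "1 / real (Suc N) \<le> 1 / Suc n" using assms(3) by (intro divide_left_mono) auto
  ultimately show ?thesis using assms(1,2) by auto
qed

lemma trapezoid_outside: "t \<notin> {a<..<b} \<Longrightarrow> trapezoid a b n t = 0"
proof -
  assume "t \<notin> {a<..<b}"
  then have "min (t - a) (b - t) \<le> 0" by auto
  then have "real (Suc n) * min (t - a) (b - t) \<le> 0" by (intro mult_nonneg_nonpos) auto
  then show ?thesis by (simp add: trapezoid_def)
qed

lemma trapezoid_tendsto: "(\<lambda>n. trapezoid a b n t) \<longlonglongrightarrow> indicator {a<..<b} t"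
proof (cases "t \<in> {a<..<b}")
  case True
  then have p: "min (t - a) (b - t) > 0" by simp
  obtain N where N: "2 / min (t - a) (b - t) < real N" using reals_Archimedean2 by blast
  have "trapezoid a b n t = 1" if "n \<ge> N" for n
  proof -
    have "2 / min (t - a) (b - t) < real (Suc n)" using N that by linarith
    then have "2 < real (Suc n) * min (t - a) (b - t)" using p by (simp only: pos_divide_less_eq)
    then show ?thesis by (simp add: trapezoid_def)
  qed
  then show ?thesis using True by (intro tendsto_eventually) (auto simp: eventually_sequentially)
next
  case False
  then show ?thesis by (simp add: trapezoid_outside)
qed

lemma trapezoid_integrable:
  fixes g :: "real \<Rightarrow> 'v::{banach, second_countable_topology}"
  assumes "integrable lborel g" shows "integrable lborel (\<lambda>t. trapezoid a b n t *\<^sub>R g t)"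
proof (rule Bochner_Integration.integrable_bound[OF assms])
  show "(\<lambda>t. trapezoid a b n t *\<^sub>R g t) \<in> borel_measurable lborel"
    using borel_measurable_integrable[OF assms] by simp
  show "AE t in lborel. norm (trapezoid a b n t *\<^sub>R g t) \<le> norm (g t)"
    by (intro AE_I2) (simp add: abs_of_nonneg trapezoid_bounds mult_left_le_one_le)
qed

lemma trapezoid_integral_tendsto:
  fixes g :: "real \<Rightarrow> 'v::{banach, second_countable_topology}"
  assumes "integrable lborel g"
  shows "(\<lambda>n. LINT t|lborel. trapezoid a b n t *\<^sub>R g t) \<longlonglongrightarrow> (LINT t:{a<..<b}|lborel. g t)"
  unfolding set_lebesgue_integral_def
proof (rule integral_dominated_convergence[where w = "\<lambda>t. norm (g t)"])
  show "AE t in lborel. (\<lambda>n. trapezoid a b n t *\<^sub>R g t) \<longlonglongrightarrow> indicator {a<..<b} t *\<^sub>R g t"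
    by (intro AE_I2 tendsto_intros trapezoid_tendsto)
  show "AE t in lborel. norm (trapezoid a b n t *\<^sub>R g t) \<le> norm (g t)" for n
    by (intro AE_I2) (simp add: abs_of_nonneg trapezoid_bounds mult_left_le_one_le)
qed (use assms borel_measurable_integrable[OF assms] in \<open>auto intro: integrable_norm\<close>)

lemma trapezoid_integrable': "integrable lborel (trapezoid a b n)"
proof (rule Bochner_Integration.integrable_bound[of lborel "indicator {a..b}" "trapezoid a b n"])
  show "integrable lborel (indicator {a..b} :: real \<Rightarrow> real)"
    by (simp add: integrable_indicator_iff emeasure_lborel_Icc_eq)
  show "AE t in lborel. norm (trapezoid a b n t) \<le> norm (indicator {a..b} t :: real)"
  proof (rule AE_I2)
    fix t show "norm (trapezoid a b n t) \<le> norm (indicator {a..b} t :: real)"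
    proof (cases "t \<in> {a<..<b}")
      case True
      then show ?thesis using trapezoid_bounds[of a b n t] by simp
    next
      case False
      then show ?thesis using trapezoid_outside[OF False, of n] by simp
    qed
  qed
qed simp

lemma trapezoid_integral_tendsto':
  assumes "a \<le> b"
  shows "(\<lambda>n. LINT t|lborel. trapezoid a b n t) \<longlonglongrightarrow> b - a"
proof -
  have i: "integrable lborel (indicator {a..b} :: real \<Rightarrow> real)"
    by (simp add: integrable_indicator_iff emeasure_lborel_Icc_eq)
  have e: "trapezoid a b n t *\<^sub>R indicator {a..b} t = trapezoid a b n t" for n t
  proof (cases "t \<in> {a<..<b}")
    case False
    then show ?thesis using trapezoid_outside[OF False, of n] by simp
  qed simp
  have l: "(LINT t:{a<..<b}|lborel. indicator {a..b} t) = (b - a :: real)"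
  proof -
    have "(LINT t:{a<..<b}|lborel. indicator {a..b} t :: real) = (LINT t|lborel. indicator {a<..<b} t)"
      unfolding set_lebesgue_integral_def by (rule Bochner_Integration.integral_cong) (auto simp: indicator_def)
    then show ?thesis using assms by (simp add: measure_def)
  qed
  show ?thesis using trapezoid_integral_tendsto[OF i, of a b] unfolding e l .
qed

text \<open>The primitive of a function of mean zero returns to 0 behind the support, so it has
  compact support itself.\<close>

lemma test_function_of_mean_zero:
  fixes \<psi> :: "real \<Rightarrow> real" and P :: "('v, 'h) evolution"
  assumes cont: "continuous_on UNIV \<psi>" and int: "integrable lborel \<psi>" and z: "(LINT t|lborel. \<psi> t) = 0"
    and p: "0 < p" and q: "q < horizon P" and supp: "\<And>t. t \<notin> {p..q} \<Longrightarrow> \<psi> t = 0"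
  shows "\<exists>\<phi>. test_function P \<phi> \<psi>"
proof -
  \<comment> \<open>The lower limit lies left of the support, so every point of the support is
    interior to \<open>{-1..horizon P + 1}\<close>, where the primitive is differentiated.\<close>
  define \<phi> where "\<phi> t = integral {-1..t} \<psi>" for t
  have c: "continuous_on S \<psi>" for S using cont by (rule continuous_on_subset) simp
  have eq: "\<phi> t = (LINT s:{-1..t}|lborel. \<psi> s)" for t
    unfolding \<phi>_def
    by (rule set_borel_integral_eq_integral(2)[symmetric])
      (use integrable_mult_indicator[OF _ int, of "{-1..t}"] in \<open>simp add: set_integrable_def\<close>)
  have zero: "\<phi> t = 0" if "t \<notin> {p..q}" for t
  proof (cases "t < p")
    case True
    then have "\<phi> t = (LINT s:{-1..t}|lborel. 0)"
      unfolding eq set_lebesgue_integral_def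
      by (intro Bochner_Integration.integral_cong) (auto simp: indicator_def supp)
    then show ?thesis by (simp add: set_lebesgue_integral_def)
  next
    case False
    then have "t > q" using that by simp
    have "indicator {-1..t} s *\<^sub>R \<psi> s = \<psi> s" for s
    proof (cases "s \<in> {p..q}")
      case True
      then show ?thesis using p \<open>t > q\<close> by simp
    next
      case False
      then show ?thesis using supp[OF False] by simp
    qed
    then show ?thesis unfolding eq set_lebesgue_integral_def by (simp only: z)
  qed
  have deriv: "(\<phi> has_real_derivative \<psi> t) (at t)" for t
  proof (cases "t \<in> {p..q}")
    case True
    have "(\<phi> has_real_derivative \<psi> t) (at t within {-1..horizon P + 1})"
      unfolding \<phi>_def using True p q by (intro integral_has_real_derivative c) auto
    moreover have "at t within {-1..horizon P + 1} = at t"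
      using True p q by (intro at_within_interior) (simp add: interior_atLeastAtMost_real)
    ultimately show ?thesis by simp
  next
    case False
    have "((\<lambda>_. 0) has_real_derivative \<psi> t) (at t)" using supp[OF False] by simp
    then show ?thesis
      by (rule has_field_derivative_transform_within_open[where S = "- {p..q}"])
        (use False zero in \<open>auto intro: open_Compl\<close>)
  qed
  have "compact {p..q}" "{p..q} \<subseteq> ivl P" using p q by auto
  then show ?thesis unfolding test_function_def using deriv cont zero by blast
qed

text \<open>A trapezoid minus the right multiple of one fixed trapezoid has mean zero, hence is the
  derivative of a test function. So all averages of \<open>g\<close> weighted by trapezoids
  coincide, and steepening the trapezoids gives the averages over intervals.\<close>

theorem du_bois_reymond:
  fixes g :: "real \<Rightarrow> 'v::{real_inner, banach, second_countable_topology}" and P :: "('v, 'h) evolution"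
  assumes T: "0 < horizon P" and g: "integrable lborel g"
    and z: "\<And>\<phi> \<phi>' \<zeta>. test_function P \<phi> \<phi>' \<Longrightarrow> (LINT t:ivl P|lborel. \<phi>' t * (g t \<bullet> \<zeta>)) = 0"
  shows "\<exists>c. AE t in lborel. t \<in> ivl P \<longrightarrow> g t = c"
proof -
  let ?T = "horizon P"
  obtain n0 where s0: "(LINT t|lborel. trapezoid 0 ?T n0 t) > 0"
    using order_tendstoD(1)[OF trapezoid_integral_tendsto'[of 0 ?T], of 0] T
    by (auto simp: eventually_sequentially)
  define s where "s = (LINT t|lborel. trapezoid 0 ?T n0 t)"
  \<comment> \<open>The average of \<open>g\<close> weighted by the reference trapezoid, whose mass
    \<open>s\<close> is positive by the choice of \<open>n0\<close>.\<close>
  define c where "c = (1 / s) *\<^sub>R (LINT t|lborel. trapezoid 0 ?T n0 t *\<^sub>R g t)"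
  have tr: "(LINT t|lborel. trapezoid a b n t *\<^sub>R g t) = (LINT t|lborel. trapezoid a b n t) *\<^sub>R c"
    if ab: "0 \<le> a" "b \<le> ?T" for a b n
  proof -
    define r where "r = (LINT t|lborel. trapezoid a b n t) / s"
    define \<psi> where "\<psi> t = trapezoid a b n t - r * trapezoid 0 ?T n0 t" for t
    \<comment> \<open>Both trapezoids vanish within distance \<open>1 / Suc N\<close> of the ends of
      the interval, which gives a common compact support.\<close>
    define N where "N = max n n0"
    have "\<exists>\<phi>. test_function P \<phi> \<psi>"
    proof (rule test_function_of_mean_zero)
      show "continuous_on UNIV \<psi>" unfolding \<psi>_def by (intro continuous_intros continuous_trapezoid)
      show "integrable lborel \<psi>" unfolding \<psi>_def
        by (intro Bochner_Integration.integrable_diff integrable_mult_right trapezoid_integrable')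
      have "(LINT t|lborel. \<psi> t) = (LINT t|lborel. trapezoid a b n t) - r * s"
        unfolding \<psi>_def s_def using trapezoid_integrable' by simp
      then show "(LINT t|lborel. \<psi> t) = 0" using s0 by (simp add: r_def s_def)
      show "0 < 1 / real (Suc N)" "?T - 1 / real (Suc N) < ?T" by auto
      show "\<psi> t = 0" if "t \<notin> {1 / real (Suc N) .. ?T - 1 / real (Suc N)}" for t
      proof -
        have "trapezoid a b n t = 0" "trapezoid 0 ?T n0 t = 0"
          using trapezoid_support[OF ab, of n N t] trapezoid_support[of 0 ?T ?T n0 N t] that
          unfolding N_def by (metis max.cobounded1, metis max.cobounded2 order_refl)
        then show ?thesis by (simp add: \<psi>_def)
      qed
    qed
    then obtain \<phi> where tf: "test_function P \<phi> \<psi>" by blast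
    have ti: "integrable lborel (\<lambda>t. trapezoid a' b' n' t *\<^sub>R g t)" for a' b' n'
      by (rule trapezoid_integrable[OF g])
    have gi: "integrable lborel (\<lambda>t. \<psi> t *\<^sub>R g t)"
      unfolding \<psi>_def scaleR_diff_left scaleR_scaleR[symmetric]
      by (intro Bochner_Integration.integrable_diff integrable_scaleR_right ti)
    have "(LINT t|lborel. \<psi> t *\<^sub>R g t) \<bullet> \<zeta> = 0" for \<zeta>
    proof -
      have "(LINT t|lborel. \<psi> t *\<^sub>R g t) \<bullet> \<zeta> = (LINT t|lborel. \<psi> t * (g t \<bullet> \<zeta>))"
        using gi by (subst integral_inner_left[symmetric]) auto
      also have "\<dots> = (LINT t:ivl P|lborel. \<psi> t * (g t \<bullet> \<zeta>))"
      proof -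
        have "\<psi> t = 0" if "t \<notin> ivl P" for t
        proof -
          have "t \<notin> {a<..<b}" using that ab by auto
          then have "trapezoid a b n t = 0" by (rule trapezoid_outside)
          then show ?thesis using trapezoid_outside[OF that, of n0] by (simp add: \<psi>_def)
        qed
        then have "indicator (ivl P) t *\<^sub>R (\<psi> t * (g t \<bullet> \<zeta>)) = \<psi> t * (g t \<bullet> \<zeta>)" for t
          by (cases "t \<in> ivl P") auto
        then show ?thesis unfolding set_lebesgue_integral_def by (simp only:)
      qed
      finally show ?thesis using z[OF tf, of \<zeta>] by simp
    qed
    then have "(LINT t|lborel. \<psi> t *\<^sub>R g t) = 0" using inner_eq_zero_iff by blast
    moreover have "(LINT t|lborel. \<psi> t *\<^sub>R g t) =
        (LINT t|lborel. trapezoid a b n t *\<^sub>R g t) - r *\<^sub>R (LINT t|lborel. trapezoid 0 ?T n0 t *\<^sub>R g t)"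
      unfolding \<psi>_def scaleR_diff_left scaleR_scaleR[symmetric]
      by (subst Bochner_Integration.integral_diff[OF ti integrable_scaleR_right[OF ti]])
        (simp only: integral_scaleR_right)
    ultimately show ?thesis by (simp add: r_def c_def)
  qed
  have ab: "(LINT t:{a<..<b}|lborel. g t) = (b - a) *\<^sub>R c" if "0 \<le> a" "a \<le> b" "b \<le> ?T" for a b
  proof (rule LIMSEQ_unique[OF trapezoid_integral_tendsto[OF g]])
    show "(\<lambda>n. LINT t|lborel. trapezoid a b n t *\<^sub>R g t) \<longlonglongrightarrow> (b - a) *\<^sub>R c"
      unfolding tr[OF that(1,3)] by (intro tendsto_intros trapezoid_integral_tendsto' that)
  qed
  define h where "h t = indicator (ivl P) t *\<^sub>R (g t - c)" for t
  have ic: "integrable lborel (\<lambda>t. indicator A t *\<^sub>R c)" if "A \<subseteq> ivl P" "A \<in> sets borel" for A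
  proof -
    have "emeasure lborel A \<le> emeasure lborel (ivl P)" using that by (intro emeasure_mono) auto
    also have "\<dots> < \<infinity>" using T by simp
    finally show ?thesis using that by (intro integrable_scaleR_left) (simp add: integrable_indicator_iff)
  qed
  have "AE t in lborel. h t = 0"
  proof (rule AE_zero_if_interval_integrals_zero)
    have "h = (\<lambda>t. indicator (ivl P) t *\<^sub>R g t - indicator (ivl P) t *\<^sub>R c)"
      by (auto simp: h_def fun_eq_iff scaleR_diff_right)
    then show "integrable lborel h"
      using g ic[of "ivl P"] by (auto intro!: Bochner_Integration.integrable_diff integrable_mult_indicator)
    fix a b :: real assume "a < b"
    \<comment> \<open>Only the part of \<open>{a<..<b}\<close> inside the time interval counts; it
      may be empty.\<close>
    define a' b' where "a' = max a 0" and "b' = min b ?T"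
    show "(LINT t:{a<..<b}|lborel. h t) = 0"
    proof (cases "a' < b'")
      case True
      have "(LINT t:{a<..<b}|lborel. h t) = (LINT t|lborel. indicator {a'<..<b'} t *\<^sub>R g t - indicator {a'<..<b'} t *\<^sub>R c)"
        unfolding set_lebesgue_integral_def
        by (rule Bochner_Integration.integral_cong) (auto simp: indicator_def h_def a'_def b'_def)
      also have "\<dots> = (LINT t:{a'<..<b'}|lborel. g t) - (LINT t|lborel. indicator {a'<..<b'} t *\<^sub>R c)"
        unfolding set_lebesgue_integral_def using g
        by (intro Bochner_Integration.integral_diff integrable_mult_indicator ic) (auto simp: a'_def b'_def)
      also have "(LINT t|lborel. indicator {a'<..<b'} t *\<^sub>R c) = (b' - a') *\<^sub>R c"
        using True by (simp add: measure_def)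
      finally show ?thesis using ab[of a' b'] True by (simp add: a'_def b'_def)
    next
      case False
      have "(LINT t:{a<..<b}|lborel. h t) = (LINT t:{a<..<b}|lborel. 0)"
        unfolding set_lebesgue_integral_def using False
        by (intro Bochner_Integration.integral_cong) (auto simp: indicator_def h_def a'_def b'_def)
      then show ?thesis by (simp add: set_lebesgue_integral_def)
    qed
  qed
  then have "AE t in lborel. t \<in> ivl P \<longrightarrow> g t = c"
    by eventually_elim (auto simp: h_def)
  then show ?thesis by blast
qed

lemma LINT_open_closed:
  fixes f :: "real \<Rightarrow> 'v::{banach, second_countable_topology}"
  assumes "f \<in> borel_measurable borel"
  shows "(LINT t:{a<..<b}|lborel. f t) = (LINT t:{a..b}|lborel. f t)"
  unfolding set_lebesgue_integral_def
proof (rule integral_cong_AE)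
  show "AE t in lborel. indicator {a<..<b} t *\<^sub>R f t = indicator {a..b} t *\<^sub>R f t"
    using AE_lborel_singleton[of a] AE_lborel_singleton[of b] by eventually_elim (auto simp: indicator_def)
qed (use assms in auto)

lemma test_function_facts:
  assumes "test_function P \<phi> \<phi>'" "0 < horizon P"
  shows "\<phi> 0 = 0" "\<phi> (horizon P) = 0" "continuous_on UNIV \<phi>" "continuous_on UNIV \<phi>'"
    "\<And>t. t \<in> {0..horizon P} \<Longrightarrow> primitive (\<lambda>t. indicator {0..horizon P} t * \<phi>' t) t = \<phi> t"
    "integrable lborel (\<lambda>t. indicator {0..horizon P} t * \<phi>' t)"
proof -
  have d: "\<And>t. (\<phi> has_real_derivative \<phi>' t) (at t)" and c': "continuous_on UNIV \<phi>'"
    using assms(1) by (auto simp: test_function_def)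
  obtain K where K: "K \<subseteq> ivl P" "\<And>t. t \<notin> K \<Longrightarrow> \<phi> t = 0" using assms(1) by (auto simp: test_function_def)
  show z: "\<phi> 0 = 0" by (rule K(2)) (use K(1) in auto)
  show "\<phi> (horizon P) = 0" by (rule K(2)) (use K(1) in auto)
  show "continuous_on UNIV \<phi>" using d by (meson DERIV_isCont continuous_at_imp_continuous_on)
  show "continuous_on UNIV \<phi>'" by (rule c')
  have i: "set_integrable lborel {0..t} \<phi>'" for t
    by (rule borel_integrable_atLeastAtMost') (rule continuous_on_subset[OF c'], simp)
  then show "integrable lborel (\<lambda>t. indicator {0..horizon P} t * \<phi>' t)"
    by (simp add: set_integrable_def)
  fix t assume t: "t \<in> {0..horizon P}"
  have "primitive (\<lambda>t. indicator {0..horizon P} t * \<phi>' t) t = (LINT s:{0..t}|lborel. \<phi>' s)"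
    unfolding primitive_def set_lebesgue_integral_def using t
    by (intro Bochner_Integration.integral_cong) (auto simp: indicator_def)
  also have "\<dots> = integral {0..t} \<phi>'" by (rule set_borel_integral_eq_integral(2)[OF i])
  also have "\<dots> = \<phi> t - \<phi> 0"
    using t d by (intro integral_unique fundamental_theorem_of_calculus)
      (auto simp: has_real_derivative_iff_has_vector_derivative[symmetric] intro: has_field_derivative_at_within)
  finally show "primitive (\<lambda>t. indicator {0..horizon P} t * \<phi>' t) t = \<phi> t" by (simp add: z)
qed

text \<open>Paired with \<zeta> everything is scalar, and integration by parts for primitives
  applies with \<phi> as the primitive of its derivative. The boundary term vanishes since \<phi> is
  0 at the horizon.\<close>

lemma test_function_by_parts:
  fixes y :: "real \<Rightarrow> 'v::{real_inner, banach, second_countable_topology}"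
  assumes "test_function P \<phi> \<phi>'" "0 < horizon P" and y: "integrable lborel y"
  shows "(LINT t:ivl P|lborel. \<phi>' t * (primitive y t \<bullet> \<zeta>)) = - (LINT t:ivl P|lborel. \<phi> t * (y t \<bullet> \<zeta>))"
proof -
  note tf = test_function_facts[OF assms(1,2)]
  define T where "T = horizon P"
  define f where "f = (\<lambda>t. indicator {0..T} t * \<phi>' t)"
  define k where "k t = y t \<bullet> \<zeta>" for t
  have k: "integrable lborel k" unfolding k_def using y by simp
  have [measurable]: "\<phi> \<in> borel_measurable borel" "\<phi>' \<in> borel_measurable borel"
    using tf(3,4) by (auto intro: borel_measurable_continuous_onI)
  have [measurable]: "y \<in> borel_measurable borel" "k \<in> borel_measurable borel"
    using borel_measurable_integrable[OF y] borel_measurable_integrable[OF k] by auto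
  note [measurable] = primitive_measurable[OF y] primitive_measurable[OF k]
  have pk: "primitive y t \<bullet> \<zeta> = primitive k t" for t
    unfolding primitive_def set_lebesgue_integral_def k_def
    using y by (subst integral_inner_left[symmetric]) (auto intro!: integrable_mult_indicator)
  have pf: "t \<in> {0..T} \<Longrightarrow> primitive f t = \<phi> t" for t using tf(5)[of t] by (simp add: f_def T_def)
  have "(LINT t:{0..T}|lborel. f t \<bullet> primitive k t) + (LINT t:{0..T}|lborel. primitive f t \<bullet> k t) =
      primitive f T \<bullet> primitive k T"
    using tf(6) k assms(2) by (intro integral_by_parts_primitives) (auto simp: f_def T_def)
  moreover have "primitive f T = 0" using pf[of T] tf(2) assms(2) by (simp add: T_def)
  moreover have "(LINT t:{0..T}|lborel. f t \<bullet> primitive k t) = (LINT t:{0..T}|lborel. \<phi>' t * primitive k t)"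
    by (rule set_lebesgue_integral_cong) (auto simp: f_def)
  moreover have "(LINT t:{0..T}|lborel. primitive f t \<bullet> k t) = (LINT t:{0..T}|lborel. \<phi> t * k t)"
    by (rule set_lebesgue_integral_cong) (auto simp: pf)
  ultimately have "(LINT t:{0..T}|lborel. \<phi>' t * primitive k t) = - (LINT t:{0..T}|lborel. \<phi> t * k t)" by simp
  then show ?thesis
    unfolding pk k_def[symmetric] T_def by (subst (1 2) LINT_open_closed) auto
qed

text \<open>Replaces functions with values in V' by functions with values in V, so that weak
  derivatives become elements of \<open>Y\<close>.\<close>

definition riesz_rep :: "('v::{real_inner, banach} \<Rightarrow>\<^sub>L real) \<Rightarrow> 'v" where
  "riesz_rep F = (SOME x. \<forall>v. blinfun_apply F v = x \<bullet> v)"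

lemma riesz_rep: "blinfun_apply F v = riesz_rep F \<bullet> v"
  using someI_ex[OF riesz_hilbert[OF blinfun.bounded_linear_right[of F]]]
  unfolding riesz_rep_def[symmetric] by (rule spec)

lemma inner_all_eqI: "(\<And>v. x \<bullet> v = y \<bullet> v) \<Longrightarrow> (x :: 'v::real_inner) = y"
  by (metis inner_diff_left inner_eq_zero_iff right_minus_eq)

lemma norm_riesz_rep: "norm (riesz_rep F) \<le> norm F"
proof (cases "riesz_rep F = 0")
  case False
  have "norm (riesz_rep F) * norm (riesz_rep F) = blinfun_apply F (riesz_rep F)"
    by (simp add: riesz_rep norm_eq_sqrt_inner)
  also have "\<dots> \<le> norm F * norm (riesz_rep F)"
    using norm_blinfun[of F "riesz_rep F"] by simp
  finally show ?thesis using False by simp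
qed simp

lemma bounded_linear_riesz_rep: "bounded_linear (riesz_rep :: ('v::{real_inner, banach} \<Rightarrow>\<^sub>L real) \<Rightarrow> 'v)"
proof (rule bounded_linear_intro[where K = 1])
  show "riesz_rep (F + G) = riesz_rep F + riesz_rep G" for F G :: "'v \<Rightarrow>\<^sub>L real"
    by (rule inner_all_eqI) (simp add: riesz_rep[symmetric] inner_add_left blinfun.add_left)
  show "riesz_rep (r *\<^sub>R F) = r *\<^sub>R riesz_rep F" for r and F :: "'v \<Rightarrow>\<^sub>L real"
    by (rule inner_all_eqI) (simp add: riesz_rep[symmetric] blinfun.scaleR_left)
qed (simp add: norm_riesz_rep)

context parabolic
begin

text \<open>\<open>wd w y\<close>: the element \<open>y\<close> of \<open>L\<^sub>2(I;V)\<close> represents the weak derivative of \<open>w\<close> with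
  respect to the inner product of \<open>V\<close>.\<close>

definition wd :: "'v l2 \<Rightarrow> 'v l2 \<Rightarrow> bool" where
  "wd w y \<longleftrightarrow> w \<in> Y \<and> y \<in> Y \<and> (\<forall>\<phi> \<phi>'. test_function P \<phi> \<phi>' \<longrightarrow> (\<forall>\<zeta>.
     (LINT t:ivl P|lborel. \<phi>' t * (emb P (rep_l2 w t) \<bullet> emb P \<zeta>)) =
     - (LINT t:ivl P|lborel. \<phi> t * (rep_l2 y t \<bullet> \<zeta>))))"

text \<open>The operator called \<open>C\<close> above: the pairing of \<eta> and \<zeta> in
  \<open>H\<close> becomes an inner product in \<open>V\<close>.\<close>

definition emb_sq :: "'v \<Rightarrow> 'v" where
  "emb_sq \<eta> = (SOME x. \<forall>\<zeta>. emb P \<eta> \<bullet> emb P \<zeta> = x \<bullet> \<zeta>)"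

lemma emb_sq_inner: "emb_sq \<eta> \<bullet> \<zeta> = emb P \<eta> \<bullet> emb P \<zeta>"
proof -
  have "bounded_linear (\<lambda>\<zeta>. emb P \<eta> \<bullet> emb P \<zeta>)"
    by (intro bounded_linear_inner_right_comp emb.bounded_linear_axioms)
  from someI_ex[OF riesz_hilbert[OF this]] show ?thesis
    unfolding emb_sq_def[symmetric] by simp
qed

lemma emb_sq_inner': "\<zeta> \<bullet> emb_sq \<eta> = emb P \<zeta> \<bullet> emb P \<eta>"
  using emb_sq_inner[of \<eta> \<zeta>] by (simp add: inner_commute)

lemma norm_emb: "\<exists>K>0. \<forall>\<eta>. norm (emb P \<eta>) \<le> K * norm \<eta>"
  using emb.pos_bounded by (simp add: mult.commute)

lemma bounded_linear_emb_sq: "bounded_linear emb_sq"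
proof -
  obtain K where K: "K > 0" "\<And>\<eta>. norm (emb P \<eta>) \<le> K * norm \<eta>" using norm_emb by blast
  show ?thesis
  proof (rule bounded_linear_intro[where K = "K * K"])
    show "emb_sq (x + y) = emb_sq x + emb_sq y" for x y
      by (rule inner_all_eqI) (simp add: emb_sq_inner inner_add_left emb.add)
    show "emb_sq (r *\<^sub>R x) = r *\<^sub>R emb_sq x" for r x
      by (rule inner_all_eqI) (simp add: emb_sq_inner emb.scaleR)
    show "norm (emb_sq x) \<le> norm x * (K * K)" for x
    proof (cases "emb_sq x = 0")
      case False
      have "norm (emb_sq x) * norm (emb_sq x) = emb P x \<bullet> emb P (emb_sq x)"
        by (metis emb_sq_inner norm_eq_sqrt_inner real_sqrt_mult_self inner_ge_zero abs_of_nonneg)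
      also have "\<dots> \<le> norm (emb P x) * norm (emb P (emb_sq x))" by (rule norm_cauchy_schwarz)
      also have "\<dots> \<le> (K * norm x) * (K * norm (emb_sq x))"
        using K by (intro mult_mono) auto
      finally have "norm (emb_sq x) * norm (emb_sq x) \<le> (norm x * (K * K)) * norm (emb_sq x)"
        by (simp add: ac_simps)
      then show ?thesis using False by simp
    qed (use K in simp)
  qed
qed

sublocale emb_sq: bounded_linear emb_sq by (rule bounded_linear_emb_sq)

lemma emb_sq_measurable [measurable]: "emb_sq \<in> borel_measurable borel"
  by (intro borel_measurable_continuous_onI linear_continuous_on bounded_linear_emb_sq)

lemma Y_integrable: "w \<in> Y \<Longrightarrow> integrable lborel (rep_l2 w)"
  using L1_bound_Yspace(1)[of w P 1] T_pos by simp

text \<open>The weak derivative identity says that \<open>emb_sq\<close> of \<open>w\<close>, minus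
  the primitive of \<open>y\<close>, is orthogonal to the derivatives of all test functions; such a
  function is constant.\<close>

lemma wd_emb_sq:
  assumes "wd w y"
  shows "\<exists>z. AE t in lborel. t \<in> ivl P \<longrightarrow> emb_sq (rep_l2 w t) = z + primitive (rep_l2 y) t"
proof -
  have w: "w \<in> Y" and y: "y \<in> Y" using assms by (auto simp: wd_def)
  have yi: "integrable lborel (rep_l2 y)" by (rule Y_integrable[OF y])
  \<comment> \<open>The primitive need not vanish beyond the horizon; the indicator makes
    \<open>g\<close> integrable on the line.\<close>
  define g where "g t = emb_sq (rep_l2 w t) - indicator (ivl P) t *\<^sub>R primitive (rep_l2 y) t" for t
  note [measurable] = primitive_measurable[OF yi]
  have i1: "integrable lborel (\<lambda>t. emb_sq (rep_l2 w t))"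
    using bounded_linear_emb_sq Y_integrable[OF w] by (rule integrable_bounded_linear)
  have i2: "integrable lborel (\<lambda>t. indicator (ivl P) t *\<^sub>R primitive (rep_l2 y) t)"
  proof (rule Bochner_Integration.integrable_bound)
    show "integrable lborel (\<lambda>t. indicator (ivl P) t * (LINT s|lborel. norm (rep_l2 y s)))"
      using T_pos by (intro integrable_mult_left) (simp add: integrable_indicator_iff)
    show "AE t in lborel. norm (indicator (ivl P) t *\<^sub>R primitive (rep_l2 y) t) \<le>
        norm (indicator (ivl P) t * (LINT s|lborel. norm (rep_l2 y s)))"
    proof (rule AE_I2)
      fix t show "norm (indicator (ivl P) t *\<^sub>R primitive (rep_l2 y) t) \<le>
          norm (indicator (ivl P) t * (LINT s|lborel. norm (rep_l2 y s)))"
        using order_trans[OF norm_primitive_le[OF yi, of t] abs_ge_self] by (cases "t \<in> ivl P") auto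
    qed
  qed simp
  have g: "integrable lborel g" unfolding g_def using i1 i2 by (rule Bochner_Integration.integrable_diff)
  have "\<exists>c. AE t in lborel. t \<in> ivl P \<longrightarrow> g t = c"
  proof (rule du_bois_reymond[OF T_pos g])
    fix \<phi> \<phi>' and \<zeta> :: 'v assume tf: "test_function P \<phi> \<phi>'"
    note tff = test_function_facts[OF tf T_pos]
    have "compact (\<phi>' ` {0..T})"
      by (intro compact_continuous_image continuous_on_subset[OF tff(4)]) auto
    from compact_imp_bounded[OF this] obtain M where "\<forall>x\<in>\<phi>' ` {0..T}. norm x \<le> M"
      unfolding bounded_iff by (rule exE)
    then have M: "norm (\<phi>' t) \<le> M" if "t \<in> {0..T}" for t using that by blast
    have [measurable]: "\<phi>' \<in> borel_measurable borel" using tff(4) by (rule borel_measurable_continuous_onI)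
    have si: "set_integrable lborel (ivl P) (\<lambda>t. \<phi>' t * (k t \<bullet> \<zeta>))" if k: "integrable lborel k" for k :: "real \<Rightarrow> 'v"
      unfolding set_integrable_def
    proof (rule Bochner_Integration.integrable_bound)
      show "integrable lborel (\<lambda>t. M * (norm (k t) * norm \<zeta>))"
        by (intro integrable_mult_right integrable_mult_left integrable_norm[OF k])
      show "(\<lambda>t. indicator (ivl P) t *\<^sub>R (\<phi>' t * (k t \<bullet> \<zeta>))) \<in> borel_measurable lborel"
        using borel_measurable_integrable[OF k] by simp
      show "AE t in lborel. norm (indicator (ivl P) t *\<^sub>R (\<phi>' t * (k t \<bullet> \<zeta>))) \<le> norm (M * (norm (k t) * norm \<zeta>))"
      proof (rule AE_I2)
        fix t
        show "norm (indicator (ivl P) t *\<^sub>R (\<phi>' t * (k t \<bullet> \<zeta>))) \<le> norm (M * (norm (k t) * norm \<zeta>))"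
        proof (cases "t \<in> ivl P")
          case True
          have "\<bar>\<phi>' t\<bar> * \<bar>k t \<bullet> \<zeta>\<bar> \<le> \<bar>M\<bar> * (norm (k t) * norm \<zeta>)"
            using M[of t] True by (intro mult_mono Cauchy_Schwarz_ineq2) auto
          then show ?thesis using True by (simp add: abs_mult)
        qed simp
      qed
    qed
    have "(LINT t:ivl P|lborel. \<phi>' t * (g t \<bullet> \<zeta>)) = (LINT t:ivl P|lborel. \<phi>' t * (emb_sq (rep_l2 w t) \<bullet> \<zeta>) -
        \<phi>' t * ((indicator (ivl P) t *\<^sub>R primitive (rep_l2 y) t) \<bullet> \<zeta>))"
      by (simp add: g_def inner_diff_left right_diff_distrib)
    also have "\<dots> = (LINT t:ivl P|lborel. \<phi>' t * (emb_sq (rep_l2 w t) \<bullet> \<zeta>)) -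
        (LINT t:ivl P|lborel. \<phi>' t * ((indicator (ivl P) t *\<^sub>R primitive (rep_l2 y) t) \<bullet> \<zeta>))"
      by (rule set_integral_diff(2)[OF si[OF i1] si[OF i2]])
    also have "(LINT t:ivl P|lborel. \<phi>' t * ((indicator (ivl P) t *\<^sub>R primitive (rep_l2 y) t) \<bullet> \<zeta>)) =
        (LINT t:ivl P|lborel. \<phi>' t * (primitive (rep_l2 y) t \<bullet> \<zeta>))"
      by (rule set_lebesgue_integral_cong) auto
    also have "\<dots> = - (LINT t:ivl P|lborel. \<phi> t * (rep_l2 y t \<bullet> \<zeta>))"
      by (rule test_function_by_parts[OF tf T_pos yi])
    also have "\<dots> = (LINT t:ivl P|lborel. \<phi>' t * (emb P (rep_l2 w t) \<bullet> emb P \<zeta>))"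
      using assms tf by (simp add: wd_def)
    finally show "(LINT t:ivl P|lborel. \<phi>' t * (g t \<bullet> \<zeta>)) = 0" by (simp add: emb_sq_inner)
  qed
  then obtain c where "AE t in lborel. t \<in> ivl P \<longrightarrow> g t = c" by blast
  then have "AE t in lborel. t \<in> ivl P \<longrightarrow> emb_sq (rep_l2 w t) = c + primitive (rep_l2 y) t"
    by eventually_elim (auto simp: g_def algebra_simps)
  then show ?thesis by blast
qed

text \<open>The set of agreement is closed, and it is dense because an interval of disagreement
  would be a null set.\<close>

lemma AE_eq_continuous:
  fixes f g :: "real \<Rightarrow> 'a::real_normed_vector"
  assumes "continuous_on {0..T} f" "continuous_on {0..T} g"
    and ae: "AE t in lborel. t \<in> ivl P \<longrightarrow> f t = g t" and t: "t \<in> {0..T}"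
  shows "f t = g t"
proof -
  have "closure {s \<in> ivl P. f s = g s} \<subseteq> {s \<in> {0..T}. f s = g s}"
  proof (rule closure_minimal)
    show "closed {s \<in> {0..T}. f s = g s}"
      using continuous_closed_preimage_constant[OF continuous_on_diff[OF assms(1,2)] closed_atLeastAtMost, of 0]
      by simp
  qed auto
  moreover have "t \<in> closure {s \<in> ivl P. f s = g s}"
  proof (rule ccontr)
    assume "t \<notin> closure {s \<in> ivl P. f s = g s}"
    then obtain e where e: "e > 0" "ball t e \<inter> {s \<in> ivl P. f s = g s} = {}"
      by (auto simp: closure_approachable disjoint_iff dist_commute)
    define a b where "a = max 0 (t - e)" and "b = min T (t + e)"
    have "a < b" using e(1) t T_pos by (auto simp: a_def b_def)
    have sub: "{a<..<b} \<subseteq> ball t e \<inter> ivl P" by (auto simp: a_def b_def dist_real_def)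
    have "AE s in lborel. s \<notin> {a<..<b}"
      using ae by eventually_elim (use e(2) sub in blast)
    then have "{a<..<b} \<in> null_sets lborel" by (subst (asm) AE_iff_null_sets[symmetric]) auto
    then show False using \<open>a < b\<close> by (simp add: null_sets_def)
  qed
  ultimately show ?thesis by blast
qed

text \<open>The primitive of \<open>y\<close> is constant almost everywhere, hence everywhere by
  continuity, so all integrals of \<open>y\<close> over intervals vanish.\<close>

lemma wd_zero: assumes "wd 0 y" shows "y = 0"
proof -
  have y: "y \<in> Y" using assms by (auto simp: wd_def)
  have yi: "integrable lborel (rep_l2 y)" by (rule Y_integrable[OF y])
  have rz: "AE t in lborel. rep_l2 (0 :: 'v l2) t = 0" by (rule rep_zero)
  obtain z where z: "AE t in lborel. t \<in> ivl P \<longrightarrow> emb_sq (rep_l2 0 t) = z + primitive (rep_l2 y) t"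
    using wd_emb_sq[OF assms] by blast
  have "AE t in lborel. t \<in> ivl P \<longrightarrow> primitive (rep_l2 y) t = - z"
    using z rz
  proof eventually_elim
    case (elim t)
    have "emb_sq (rep_l2 0 t) = 0" unfolding elim(2) by (rule emb_sq.zero)
    then show ?case using elim(1) by (metis add_eq_0_iff)
  qed
  note ae = this
  have c: "primitive (rep_l2 y) t = - z" if "t \<in> {0..T}" for t
    by (rule AE_eq_continuous[of "primitive (rep_l2 y)" "\<lambda>_. - z", OF continuous_primitive[OF yi]
        continuous_on_const ae that])
  have "AE t in lborel. rep_l2 y t = 0"
  proof (rule AE_zero_if_interval_integrals_zero[OF yi])
    fix a b :: real assume "a < b"
    define a' b' where "a' = max a 0" and "b' = min b T"
    have "AE t in lborel. indicator {a<..<b} t *\<^sub>R rep_l2 y t = indicator {a'<..<b'} t *\<^sub>R rep_l2 y t"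
      using Yspace_AE[OF y] by eventually_elim (auto simp: indicator_def a'_def b'_def)
    then have "(LINT t:{a<..<b}|lborel. rep_l2 y t) = (LINT t:{a'<..<b'}|lborel. rep_l2 y t)"
      unfolding set_lebesgue_integral_def by (intro integral_cong_AE) auto
    also have "\<dots> = 0"
    proof (cases "a' \<le> b'")
      case True
      then have "(LINT t:{a'<..<b'}|lborel. rep_l2 y t) = primitive (rep_l2 y) b' - primitive (rep_l2 y) a'"
        using primitive_diff[OF yi, of a' b'] by (simp add: a'_def)
      also have "\<dots> = 0" using True T_pos c[of a'] c[of b'] by (auto simp: a'_def b'_def)
      finally show ?thesis .
    qed (simp add: set_lebesgue_integral_def)
    finally show "(LINT t:{a<..<b}|lborel. rep_l2 y t) = 0" .
  qed
  with rz have "AE t in lborel. rep_l2 y t = rep_l2 0 t" by eventually_elim simp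
  then show ?thesis by (rule l2_eqI)
qed

text \<open>The function \<psi> \<otimes> \<zeta>, extended by zero off the time interval.\<close>

definition tens :: "(real \<Rightarrow> real) \<Rightarrow> 'v \<Rightarrow> 'v l2" where
  "tens \<psi> \<zeta> = abs_l2 (\<lambda>t. indicator (ivl P) t *\<^sub>R (\<psi> t *\<^sub>R \<zeta>))"

lemma sq_integrable_tens:
  assumes "continuous_on UNIV \<psi>"
  shows "sq_integrable (\<lambda>t. indicator (ivl P) t *\<^sub>R (\<psi> t *\<^sub>R \<zeta>))"
proof -
  have "compact (\<psi> ` {0..T})"
    by (intro compact_continuous_image continuous_on_subset[OF assms]) auto
  from compact_imp_bounded[OF this] obtain M where "\<forall>x\<in>\<psi> ` {0..T}. norm x \<le> M"
    unfolding bounded_iff by (rule exE)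
  then have M: "norm (\<psi> t) \<le> M" if "t \<in> {0..T}" for t using that by blast
  have [measurable]: "\<psi> \<in> borel_measurable borel" using assms by (rule borel_measurable_continuous_onI)
  show ?thesis
  proof (rule sq_integrable_if_bounded[where a = 0 and b = T and C = "\<bar>M\<bar> * norm \<zeta>"])
    show "norm (indicator (ivl P) t *\<^sub>R (\<psi> t *\<^sub>R \<zeta>)) \<le> \<bar>M\<bar> * norm \<zeta>" for t
    proof (cases "t \<in> ivl P")
      case True
      then have "\<bar>\<psi> t\<bar> \<le> \<bar>M\<bar>" using M[of t] by simp
      then show ?thesis using True by (simp add: mult_right_mono)
    qed simp
  qed auto
qed

lemma rep_tens:
  assumes "continuous_on UNIV \<psi>"
  shows "AE t in lborel. rep_l2 (tens \<psi> \<zeta>) t = indicator (ivl P) t *\<^sub>R (\<psi> t *\<^sub>R \<zeta>)"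
  unfolding tens_def by (rule rep_abs_l2[OF sq_integrable_tens[OF assms]])

lemma tens_in_Y: "continuous_on UNIV \<psi> \<Longrightarrow> tens \<psi> \<zeta> \<in> Y"
  unfolding tens_def by (rule abs_in_Yspace[OF sq_integrable_tens]) auto

lemma inner_tens:
  assumes "continuous_on UNIV \<psi>"
  shows "w \<bullet> tens \<psi> \<zeta> = (LINT t:ivl P|lborel. \<psi> t * (rep_l2 w t \<bullet> \<zeta>))"
proof -
  have [measurable]: "\<psi> \<in> borel_measurable borel" using assms by (rule borel_measurable_continuous_onI)
  show ?thesis
    unfolding inner_rep set_lebesgue_integral_def
  proof (rule integral_cong_AE)
    show "AE t in lborel. rep_l2 w t \<bullet> rep_l2 (tens \<psi> \<zeta>) t = indicator (ivl P) t *\<^sub>R (\<psi> t * (rep_l2 w t \<bullet> \<zeta>))"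
      using rep_tens[OF assms, of \<zeta>] by eventually_elim simp
  qed auto
qed

text \<open>Written as equations between inner products of \<open>L2\<close>, weak differentiability
  is visibly linear in the pair and stable under limits.\<close>

lemma wd_iff:
  "wd w y \<longleftrightarrow> w \<in> Y \<and> y \<in> Y \<and> (\<forall>\<phi> \<phi>' \<zeta>. test_function P \<phi> \<phi>' \<longrightarrow>
     w \<bullet> tens \<phi>' (emb_sq \<zeta>) = - (y \<bullet> tens \<phi> \<zeta>))"
  unfolding wd_def using test_function_facts(3,4)[OF _ T_pos]
  by (auto simp: inner_tens emb_sq_inner')

lemma wd_mem: "wd w y \<Longrightarrow> w \<in> Y" "wd w y \<Longrightarrow> y \<in> Y"
  by (auto simp: wd_def)

lemma wd_add: "wd w y \<Longrightarrow> wd w' y' \<Longrightarrow> wd (w + w') (y + y')"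
  unfolding wd_iff by (auto simp: inner_add_left)

lemma wd_scaleR: "wd w y \<Longrightarrow> wd (c *\<^sub>R w) (c *\<^sub>R y)"
  unfolding wd_iff by auto

lemma wd_diff: "wd w y \<Longrightarrow> wd w' y' \<Longrightarrow> wd (w - w') (y - y')"
  using wd_add[OF _ wd_scaleR[of w' y' "-1"], of w y] by simp

lemma wd_unique: "wd w y \<Longrightarrow> wd w y' \<Longrightarrow> y = y'"
  using wd_zero[of "y - y'"] wd_diff[of w y w y'] by simp

lemma l2_inner_tendsto:
  assumes "(\<lambda>n. (s n - w) \<bullet> (s n - w)) \<longlonglongrightarrow> 0"
  shows "(\<lambda>n. s n \<bullet> v) \<longlonglongrightarrow> (w \<bullet> v :: real)"
proof -
  have "(\<lambda>n. norm (s n - w)) \<longlonglongrightarrow> 0"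
    using tendsto_real_sqrt[OF assms] by (simp add: norm_eq_sqrt_inner)
  then have "s \<longlonglongrightarrow> w" by (simp add: tendsto_norm_zero_iff LIM_zero_iff)
  then show ?thesis by (intro tendsto_intros)
qed

lemma wd_limit:
  assumes "\<And>n. wd (s n) (r n)" "w \<in> Y" "y \<in> Y"
    "(\<lambda>n. (s n - w) \<bullet> (s n - w)) \<longlonglongrightarrow> 0" "(\<lambda>n. (r n - y) \<bullet> (r n - y)) \<longlonglongrightarrow> 0"
  shows "wd w y"
  unfolding wd_iff
proof (intro conjI allI impI assms(2,3))
  fix \<phi> \<phi>' \<zeta> assume tf: "test_function P \<phi> \<phi>'"
  have "(\<lambda>n. s n \<bullet> tens \<phi>' (emb_sq \<zeta>)) \<longlonglongrightarrow> - (y \<bullet> tens \<phi> \<zeta>)"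
    using tendsto_minus[OF l2_inner_tendsto[OF assms(5), of "tens \<phi> \<zeta>"]] assms(1) tf
    by (simp add: wd_iff)
  then show "w \<bullet> tens \<phi>' (emb_sq \<zeta>) = - (y \<bullet> tens \<phi> \<zeta>)"
    using l2_inner_tendsto[OF assms(4)] LIMSEQ_unique by blast
qed

text \<open>A weak derivative is prescribed on the time interval only; the indicator cuts it off so
  that its representer lies in \<open>Y\<close>.\<close>

lemma weak_derivative_imp_wd:
  assumes w: "w \<in> Y" and d: "weak_derivative P w d"
  defines "y \<equiv> abs_l2 (\<lambda>t. riesz_rep (indicator (ivl P) t *\<^sub>R d t))"
  shows "wd w y" and "AE t in lborel. t \<in> ivl P \<longrightarrow> riesz_rep (d t) = rep_l2 y t"
proof -
  define f where "f = (\<lambda>t. riesz_rep (indicator (ivl P) t *\<^sub>R d t))"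
  have dm: "(\<lambda>t. indicator (ivl P) t *\<^sub>R d t) \<in> borel_measurable borel"
    using d by (simp add: weak_derivative_def set_borel_measurable_def)
  have rm: "(riesz_rep :: ('v \<Rightarrow>\<^sub>L real) \<Rightarrow> 'v) \<in> borel_measurable borel"
    by (intro borel_measurable_continuous_onI linear_continuous_on bounded_linear_riesz_rep)
  have fm: "f \<in> borel_measurable borel" unfolding f_def using measurable_compose[OF dm rm] .
  have f0: "f t = 0" if "t \<notin> ivl P" for t
    using that linear_0[OF bounded_linear.linear[OF bounded_linear_riesz_rep]] by (simp add: f_def)
  have sq: "sq_integrable f"
    unfolding sq_integrable_def
  proof
    have i: "integrable lborel (\<lambda>t. indicator (ivl P) t *\<^sub>R (norm (d t))\<^sup>2)"
      using d by (simp add: weak_derivative_def set_integrable_def)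
    show "integrable lborel (\<lambda>t. (norm (f t))\<^sup>2)"
    proof (rule Bochner_Integration.integrable_bound[OF i])
      show "AE t in lborel. norm ((norm (f t))\<^sup>2) \<le> norm (indicator (ivl P) t *\<^sub>R (norm (d t))\<^sup>2)"
      proof (rule AE_I2)
        fix t show "norm ((norm (f t))\<^sup>2) \<le> norm (indicator (ivl P) t *\<^sub>R (norm (d t))\<^sup>2)"
          using power_mono[OF norm_riesz_rep[of "d t"] norm_ge_zero, of 2] f0[of t]
          by (cases "t \<in> ivl P") (auto simp: f_def)
      qed
    qed (use fm in simp)
  qed (use fm in simp)
  have y: "y = abs_l2 f" by (simp add: y_def f_def)
  have rep: "AE t in lborel. rep_l2 y t = f t" unfolding y by (rule rep_abs_l2[OF sq])
  show "AE t in lborel. t \<in> ivl P \<longrightarrow> riesz_rep (d t) = rep_l2 y t"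
    using rep by eventually_elim (simp add: f_def)
  have yY: "y \<in> Y" unfolding y by (rule abs_in_Yspace[OF sq f0])
  show "wd w y"
    unfolding wd_def
  proof (intro conjI allI impI w yY)
    fix \<phi> \<phi>' \<zeta> assume tf: "test_function P \<phi> \<phi>'"
    have [measurable]: "\<phi> \<in> borel_measurable borel"
      using test_function_facts(3)[OF tf T_pos] by (rule borel_measurable_continuous_onI)
    note [measurable] = fm
    have "(LINT t:ivl P|lborel. \<phi> t * blinfun_apply (d t) \<zeta>) = (LINT t:ivl P|lborel. \<phi> t * (f t \<bullet> \<zeta>))"
      by (rule set_lebesgue_integral_cong) (auto simp: riesz_rep f_def)
    also have "\<dots> = (LINT t:ivl P|lborel. \<phi> t * (rep_l2 y t \<bullet> \<zeta>))"
      unfolding set_lebesgue_integral_def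
      by (rule integral_cong_AE) (measurable, use rep in \<open>eventually_elim, simp\<close>)
    finally show "(LINT t:ivl P|lborel. \<phi>' t * (emb P (rep_l2 w t) \<bullet> emb P \<zeta>)) =
        - (LINT t:ivl P|lborel. \<phi> t * (rep_l2 y t \<bullet> \<zeta>))"
      using d tf by (simp add: weak_derivative_def)
  qed
qed

lemma wd_imp_weak_derivative:
  assumes "wd w y" shows "weak_derivative P w (\<lambda>t. blinfun_inner_right (rep_l2 y t))"
  unfolding weak_derivative_def
proof (intro conjI)
  have c: "(blinfun_inner_right :: 'v \<Rightarrow> _) \<in> borel_measurable borel"
    by (intro borel_measurable_continuous_onI linear_continuous_on bounded_linear_blinfun_inner_right)
  have m: "(\<lambda>t. blinfun_inner_right (rep_l2 y t)) \<in> borel_measurable borel"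
    by (rule measurable_compose[OF rep_l2_measurable c])
  show "set_borel_measurable lborel (ivl P) (\<lambda>t. blinfun_inner_right (rep_l2 y t))"
  proof -
    have "(\<lambda>t. blinfun_inner_right (indicator (ivl P) t *\<^sub>R rep_l2 y t)) \<in> borel_measurable borel"
      by (rule measurable_compose[OF _ c]) simp
    then show ?thesis
      by (simp add: set_borel_measurable_def bounded_linear_blinfun_inner_right
          linear_scale bounded_linear.linear)
  qed
  have nb: "norm (blinfun_inner_right x) \<le> norm x" for x :: 'v
    by (rule norm_blinfun_bound) (auto simp: blinfun_inner_right.rep_eq Cauchy_Schwarz_ineq2)
  show "set_integrable lborel (ivl P) (\<lambda>t. (norm (blinfun_inner_right (rep_l2 y t)))\<^sup>2)"
    unfolding set_integrable_def
  proof (rule Bochner_Integration.integrable_bound[OF integrable_norm_sq_rep[of y]])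
    show "(\<lambda>t. indicator (ivl P) t *\<^sub>R (norm (blinfun_inner_right (rep_l2 y t)))\<^sup>2) \<in> borel_measurable lborel"
      using m by (intro borel_measurable_scaleR borel_measurable_power borel_measurable_norm) auto
    show "AE t in lborel. norm (indicator (ivl P) t *\<^sub>R (norm (blinfun_inner_right (rep_l2 y t)))\<^sup>2)
        \<le> norm ((norm (rep_l2 y t))\<^sup>2)"
      using power_mono[OF nb norm_ge_zero, of _ 2] by (intro AE_I2) (auto simp: indicator_def)
  qed
  show "\<forall>\<phi> \<phi>'. test_function P \<phi> \<phi>' \<longrightarrow> (\<forall>\<zeta>.
        (LINT t:ivl P|lborel. \<phi>' t * (emb P (rep_l2 w t) \<bullet> emb P \<zeta>)) =
        - (LINT t:ivl P|lborel. \<phi> t * blinfun_apply (blinfun_inner_right (rep_l2 y t)) \<zeta>))"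
    using assms by (simp add: wd_def blinfun_inner_right.rep_eq)
qed

lemma Xspace_iff: "w \<in> Xspace P \<longleftrightarrow> (\<exists>y. wd w y)"
  using weak_derivative_imp_wd(1) wd_imp_weak_derivative wd_mem unfolding Xspace_def by blast

lemma Xspace_subset_Y: "Xspace P \<subseteq> Y"
  by (auto simp: Xspace_def)

text \<open>The choice made in \<open>wderiv\<close> is harmless: uniqueness of \<open>y\<close>
  fixes every possible choice almost everywhere.\<close>

lemma wderiv_AE:
  assumes "wd w y"
  shows "AE t in lborel. indicator (ivl P) t *\<^sub>R blinfun_apply (wderiv P w t) (rep_l2 v t) = rep_l2 y t \<bullet> rep_l2 v t"
proof -
  have w: "weak_derivative P w (wderiv P w)"
    unfolding wderiv_def using wd_imp_weak_derivative[OF assms] by (rule someI[of "weak_derivative P w"])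
  note f = weak_derivative_imp_wd[OF wd_mem(1)[OF assms] w]
  have "AE t in lborel. t \<in> ivl P \<longrightarrow> riesz_rep (wderiv P w t) = rep_l2 y t"
    using f(2) wd_unique[OF assms f(1)] by simp
  then show ?thesis using Yspace_AE[OF wd_mem(2)[OF assms]]
    by eventually_elim (auto simp: riesz_rep indicator_def)
qed

lemma wderiv_integral:
  assumes "wd w y"
  shows "set_integrable lebesgue (ivl P) (\<lambda>t. blinfun_apply (wderiv P w t) (rep_l2 v t))"
    and "(LINT t:ivl P|lebesgue. blinfun_apply (wderiv P w t) (rep_l2 v t)) = y \<bullet> v"
proof -
  have ae: "AE t in lebesgue. rep_l2 y t \<bullet> rep_l2 v t = indicator (ivl P) t *\<^sub>R blinfun_apply (wderiv P w t) (rep_l2 v t)"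
    using AE_completion[OF wderiv_AE[OF assms, of v]] by eventually_elim simp
  have i: "integrable lebesgue (\<lambda>t. rep_l2 y t \<bullet> rep_l2 v t)"
    using integrable_inner_rep[of y v] by (subst integrable_completion) auto
  note m = borel_measurable_AE[OF borel_measurable_integrable[OF i] ae]
  show "set_integrable lebesgue (ivl P) (\<lambda>t. blinfun_apply (wderiv P w t) (rep_l2 v t))"
    unfolding set_integrable_def by (rule integrable_cong_AE_imp[OF i m ae])
  have "(LINT t:ivl P|lebesgue. blinfun_apply (wderiv P w t) (rep_l2 v t)) = (LINT t|lebesgue. rep_l2 y t \<bullet> rep_l2 v t)"
    unfolding set_lebesgue_integral_def
    by (rule integral_cong_AE[OF m borel_measurable_integrable[OF i]]) (use ae in \<open>eventually_elim, simp\<close>)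
  also have "\<dots> = y \<bullet> v" unfolding inner_rep by (rule integral_completion) simp
  finally show "(LINT t:ivl P|lebesgue. blinfun_apply (wderiv P w t) (rep_l2 v t)) = y \<bullet> v" .
qed

lemma dt_op_eq: "wd w y \<Longrightarrow> dt_op P w = restr Y (\<lambda>v. y \<bullet> v)"
  using wderiv_integral(2) by (simp add: dt_op_def)

lemma B_op_eq:
  assumes "wd w y" "v \<in> Y" shows "B_op P w v = y \<bullet> v + A_op P w v"
  using wderiv_integral[OF assms(1), of v] aform_integrable[of w v] assms(2)
  by (simp add: B_op_def A_op_def restr_def set_integral_add(2))

end

section \<open>Traces\<close>

lemma primitive_bounded_linear:
  assumes L: "bounded_linear L" and f: "integrable lborel f"
  shows "primitive (\<lambda>t. L (f t)) t = L (primitive f t)"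
proof -
  interpret L: bounded_linear L by (rule L)
  have "primitive (\<lambda>t. L (f t)) t = (LINT s|lborel. L (indicator {0..t} s *\<^sub>R f s))"
    by (simp add: primitive_def set_lebesgue_integral_def L.scaleR)
  also have "\<dots> = L (primitive f t)"
    unfolding primitive_def set_lebesgue_integral_def using f
    by (intro integral_bounded_linear[OF L] integrable_mult_indicator) auto
  finally show ?thesis .
qed

lemma sq_integrable_bounded_linear:
  assumes L: "bounded_linear L" and f: "sq_integrable f"
  shows "sq_integrable (\<lambda>t. L (f t))"
proof -
  obtain K where K: "\<forall>x. norm (L x) \<le> norm x * K" using bounded_linear.bounded[OF L] by blast
  have [measurable]: "L \<in> borel_measurable borel"
    by (intro borel_measurable_continuous_onI linear_continuous_on L)
  have [measurable]: "f \<in> borel_measurable borel" using f by (simp add: sq_integrable_def)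
  show ?thesis
    by (rule sq_integrable_bound[OF f, where C = K]) (use K in \<open>auto simp: mult.commute\<close>)
qed

context parabolic
begin

text \<open>Energy identity after smoothing. \<open>L\<close> will be an approximate inverse of
  \<open>emb_sq\<close>, or a difference of two, applied to \<open>emb_sq\<close> of
  \<open>w\<close>, which is a primitive in \<open>V\<close>. For primitives the product rule is
  available, while for \<open>w\<close> itself it is not.\<close>

lemma energy_regular:
  assumes L: "bounded_linear L" and Lsym: "\<And>x y. L x \<bullet> y = x \<bullet> L y" and LC: "\<And>x. L (emb_sq x) = emb_sq (L x)"
    and wd: "wd w y" and z: "AE t in lborel. t \<in> ivl P \<longrightarrow> emb_sq (rep_l2 w t) = z0 + primitive (rep_l2 y) t"
    and t: "t \<in> {0..T}"
  shows "(norm (emb P (L (z0 + primitive (rep_l2 y) t))))\<^sup>2 = (norm (emb P (L z0)))\<^sup>2 +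
    2 * (LINT s:{0..t}|lborel. emb_sq (L (rep_l2 w s)) \<bullet> emb_sq (L (rep_l2 y s)))"
proof -
  let ?y = "rep_l2 y" and ?w = "rep_l2 w"
  define p where "p = primitive ?y"
  interpret L: bounded_linear L by (rule L)
  have CL: "bounded_linear (\<lambda>x. emb_sq (L x))"
    using bounded_linear_compose[OF bounded_linear_emb_sq L] .
  interpret CL: bounded_linear "\<lambda>x. emb_sq (L x)" by (rule CL)
  have csym: "emb_sq x \<bullet> x' = x \<bullet> emb_sq x'" for x x' by (simp add: emb_sq_inner emb_sq_inner')
  have yi: "integrable lborel ?y" using Y_integrable wd wd_mem by blast
  have f: "integrable lborel (\<lambda>s. emb_sq (L (?y s)))" by (rule integrable_bounded_linear[OF CL yi])
  have g: "integrable lborel (\<lambda>s. L (?y s))" by (rule integrable_bounded_linear[OF L yi])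
  have pf: "primitive (\<lambda>s. emb_sq (L (?y s))) s = emb_sq (L (p s))" for s
    unfolding p_def by (rule primitive_bounded_linear[OF CL yi])
  have pg: "primitive (\<lambda>s. L (?y s)) s = L (p s)" for s
    unfolding p_def by (rule primitive_bounded_linear[OF L yi])
  have [measurable]: "(\<lambda>s. L (?y s)) \<in> borel_measurable borel" using borel_measurable_integrable[OF g] by simp
  have [measurable]: "(\<lambda>s. L (?w s)) \<in> borel_measurable borel"
    using borel_measurable_integrable[OF integrable_bounded_linear[OF L Y_integrable[OF wd_mem(1)[OF wd]]]] by simp
  have [measurable]: "p \<in> borel_measurable borel" unfolding p_def by (rule primitive_measurable[OF yi])
  have [measurable]: "L \<in> borel_measurable borel"
    by (intro borel_measurable_continuous_onI linear_continuous_on L)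
  have parts: "(LINT s:{0..t}|lborel. emb_sq (L (?y s)) \<bullet> L (p s)) + (LINT s:{0..t}|lborel. emb_sq (L (p s)) \<bullet> L (?y s)) =
      emb_sq (L (p t)) \<bullet> L (p t)"
    using integral_by_parts_primitives[OF f g, of t] t unfolding pf pg by simp
  have same: "emb_sq (L (?y s)) \<bullet> L (p s) = emb_sq (L (p s)) \<bullet> L (?y s)" for s
    by (metis csym inner_commute)
  \<comment> \<open>Self-adjointness makes the two integrals in the product rule equal.\<close>
  have quad: "emb_sq (L (p t)) \<bullet> L (p t) = 2 * (LINT s:{0..t}|lborel. emb_sq (L (p s)) \<bullet> L (?y s))"
    using parts unfolding same by simp
  have lin: "emb_sq (L z0) \<bullet> L (p t) = (LINT s:{0..t}|lborel. emb_sq (L z0) \<bullet> L (?y s))"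
    unfolding pg[symmetric] primitive_def set_lebesgue_integral_def
    using g by (subst integral_inner_right[symmetric]) (auto intro!: integrable_mult_indicator)
  have pb: "norm (p s) \<le> (LINT s|lborel. norm (?y s))" for s unfolding p_def by (rule norm_primitive_le[OF yi])
  have i1: "set_integrable lborel {0..t} (\<lambda>s. emb_sq (L z0) \<bullet> L (?y s))"
    unfolding set_integrable_def using g by (intro integrable_mult_indicator integrable_inner_right) auto
  have i2: "set_integrable lborel {0..t} (\<lambda>s. emb_sq (L (p s)) \<bullet> L (?y s))"
    unfolding set_integrable_def
  proof (intro integrable_mult_indicator)
    obtain K where K: "\<forall>x. norm (emb_sq (L x)) \<le> norm x * K" "K > 0" using CL.pos_bounded by blast
    show "integrable lborel (\<lambda>s. emb_sq (L (p s)) \<bullet> L (?y s))"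
    proof (rule Bochner_Integration.integrable_bound)
      show "integrable lborel (\<lambda>s. ((LINT s|lborel. norm (?y s)) * K) * norm (L (?y s)))"
        by (intro integrable_mult_right integrable_norm[OF g])
      show "AE s in lborel. norm (emb_sq (L (p s)) \<bullet> L (?y s)) \<le> norm (((LINT s|lborel. norm (?y s)) * K) * norm (L (?y s)))"
      proof (rule AE_I2)
        fix s
        have "\<bar>emb_sq (L (p s)) \<bullet> L (?y s)\<bar> \<le> norm (emb_sq (L (p s))) * norm (L (?y s))"
          by (rule Cauchy_Schwarz_ineq2)
        also have "norm (emb_sq (L (p s))) \<le> norm (p s) * K" using K by blast
        also have "\<dots> \<le> (LINT s|lborel. norm (?y s)) * K" using pb K(2) by (intro mult_right_mono) auto
        finally have "\<bar>emb_sq (L (p s)) \<bullet> L (?y s)\<bar> \<le> ((LINT s|lborel. norm (?y s)) * K) * norm (L (?y s))"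
          by (simp add: mult_right_mono)
        then show "norm (emb_sq (L (p s)) \<bullet> L (?y s)) \<le> norm (((LINT s|lborel. norm (?y s)) * K) * norm (L (?y s)))"
          by (metis abs_ge_self order_trans real_norm_def)
      qed
    qed measurable
  qed simp
  have "(norm (emb P (L (z0 + p t))))\<^sup>2 = emb_sq (L (z0 + p t)) \<bullet> L (z0 + p t)"
    by (simp add: emb_sq_inner power2_norm_eq_inner)
  also have "\<dots> = emb_sq (L z0) \<bullet> L z0 + 2 * (emb_sq (L z0) \<bullet> L (p t)) + emb_sq (L (p t)) \<bullet> L (p t)"
    using csym[of "L (p t)" "L z0"] by (simp add: L.add emb_sq.add inner_add_left inner_add_right inner_commute)
  also have "\<dots> = (norm (emb P (L z0)))\<^sup>2 + 2 * ((LINT s:{0..t}|lborel. emb_sq (L z0) \<bullet> L (?y s)) +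
      (LINT s:{0..t}|lborel. emb_sq (L (p s)) \<bullet> L (?y s)))"
    unfolding lin quad by (simp add: emb_sq_inner power2_norm_eq_inner)
  also have "(LINT s:{0..t}|lborel. emb_sq (L z0) \<bullet> L (?y s)) + (LINT s:{0..t}|lborel. emb_sq (L (p s)) \<bullet> L (?y s)) =
      (LINT s:{0..t}|lborel. emb_sq (L z0) \<bullet> L (?y s) + emb_sq (L (p s)) \<bullet> L (?y s))"
    by (rule set_integral_add(2)[OF i1 i2, symmetric])
  also have "\<dots> = (LINT s:{0..t}|lborel. emb_sq (L (?w s)) \<bullet> emb_sq (L (?y s)))"
    unfolding set_lebesgue_integral_def
  proof (rule integral_cong_AE)
    show "AE s in lborel. indicator {0..t} s *\<^sub>R (emb_sq (L z0) \<bullet> L (?y s) + emb_sq (L (p s)) \<bullet> L (?y s)) =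
        indicator {0..t} s *\<^sub>R (emb_sq (L (?w s)) \<bullet> emb_sq (L (?y s)))"
      using z AE_lborel_singleton[of 0] AE_lborel_singleton[of T]
    proof eventually_elim
      case (elim s)
      show ?case
      proof (cases "s \<in> {0..t}")
        case True
        then have "s \<in> ivl P" using elim t by auto
        then have e: "emb_sq (?w s) = z0 + p s" using elim by (simp add: p_def)
        have "emb_sq (L z0) \<bullet> L (?y s) + emb_sq (L (p s)) \<bullet> L (?y s) = emb_sq (L (emb_sq (?w s))) \<bullet> L (?y s)"
          unfolding e by (simp add: L.add emb_sq.add inner_add_left)
        also have "\<dots> = emb_sq (L (?w s)) \<bullet> emb_sq (L (?y s))" by (simp add: LC csym)
        finally show ?thesis by simp
      qed simp
    qed
  qed measurable
  finally show ?thesis unfolding p_def .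
qed

text \<open>A Landweber step size: with \<open>K\<close> a bound of the embedding,
  \<open>tau\<close> times \<open>emb_sq\<close> lies between 0 and the identity.\<close>

definition "tau = 1 / (SOME K. K > 0 \<and> (\<forall>\<eta>. norm (emb P \<eta>) \<le> K * norm \<eta>))\<^sup>2"

lemma tau: "tau > 0" "tau * (norm (emb_sq \<eta>))\<^sup>2 \<le> (norm (emb P \<eta>))\<^sup>2" "tau * (norm (emb P \<eta>))\<^sup>2 \<le> (norm \<eta>)\<^sup>2"
proof -
  define K where "K = (SOME K. K > 0 \<and> (\<forall>\<eta>. norm (emb P \<eta>) \<le> K * norm \<eta>))"
  have "\<exists>K. K > 0 \<and> (\<forall>\<eta>. norm (emb P \<eta>) \<le> K * norm \<eta>)" using norm_emb by blast
  from someI_ex[OF this] have K: "K > 0" "\<And>\<eta>. norm (emb P \<eta>) \<le> K * norm \<eta>"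
    unfolding K_def[symmetric] by auto
  have t: "tau = 1 / K\<^sup>2" by (simp add: tau_def K_def)
  show "tau > 0" using K by (simp add: t)
  have a: "(norm (emb P \<eta>))\<^sup>2 \<le> K\<^sup>2 * (norm \<eta>)\<^sup>2" for \<eta>
    using power_mono[OF K(2)[of \<eta>] norm_ge_zero, of 2] by (simp add: power_mult_distrib)
  then show "tau * (norm (emb P \<eta>))\<^sup>2 \<le> (norm \<eta>)\<^sup>2" using K(1) by (simp add: t field_simps)
  have "norm (emb_sq \<eta>) \<le> K * norm (emb P \<eta>)"
  proof (cases "emb_sq \<eta> = 0")
    case False
    have "norm (emb_sq \<eta>) * norm (emb_sq \<eta>) = emb P \<eta> \<bullet> emb P (emb_sq \<eta>)"
      by (simp add: emb_sq_inner[symmetric] norm_eq_sqrt_inner)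
    also have "\<dots> \<le> norm (emb P \<eta>) * norm (emb P (emb_sq \<eta>))" by (rule norm_cauchy_schwarz)
    also have "\<dots> \<le> norm (emb P \<eta>) * (K * norm (emb_sq \<eta>))" by (intro mult_left_mono K) auto
    finally have "norm (emb_sq \<eta>) * norm (emb_sq \<eta>) \<le> (K * norm (emb P \<eta>)) * norm (emb_sq \<eta>)"
      by (simp add: ac_simps)
    then show ?thesis using False by simp
  qed (use K in simp)
  then show "tau * (norm (emb_sq \<eta>))\<^sup>2 \<le> (norm (emb P \<eta>))\<^sup>2"
    using power_mono[of "norm (emb_sq \<eta>)" "K * norm (emb P \<eta>)" 2] K(1)
    by (simp add: t power_mult_distrib field_simps)
qed

text \<open>Landweber iteration for \<open>emb_sq\<close>: \<open>lw n\<close> is the error propagation and \<open>lk n\<close> the bounded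
  approximate inverse, so that \<open>emb_sq \<circ> lk n = id - lw n\<close> tends strongly to the identity.\<close>

definition lw :: "nat \<Rightarrow> 'v \<Rightarrow> 'v" where
  "lw n = ((\<lambda>x. x - tau *\<^sub>R emb_sq x) ^^ n)"

definition lk :: "nat \<Rightarrow> 'v \<Rightarrow> 'v" where
  "lk n x = tau *\<^sub>R (\<Sum>k<n. lw k x)"

lemma lw_0 [simp]: "lw 0 x = x" by (simp add: lw_def)

lemma lw_Suc: "lw (Suc n) x = lw n x - tau *\<^sub>R emb_sq (lw n x)"
  by (simp add: lw_def)

lemma lw_Suc': "lw (Suc n) x = lw n (x - tau *\<^sub>R emb_sq x)"
  by (simp add: lw_def funpow_Suc_right del: funpow.simps)

lemma bounded_linear_lw: "bounded_linear (lw n)"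
proof (induction n)
  case 0
  have "lw 0 = (\<lambda>x. x)" by auto
  then show ?case by (simp add: bounded_linear_ident)
next
  case (Suc n)
  have "lw (Suc n) = (\<lambda>x. lw n x - tau *\<^sub>R emb_sq (lw n x))" by (auto simp: lw_Suc)
  then show ?case
    using Suc bounded_linear_compose[OF bounded_linear_emb_sq Suc]
    by (simp add: bounded_linear_sub bounded_linear_compose[OF bounded_linear_scaleR_right])
qed

lemma bounded_linear_lk: "bounded_linear (lk n)"
  unfolding lk_def[abs_def]
  by (intro bounded_linear_compose[OF bounded_linear_scaleR_right] bounded_linear_sum bounded_linear_lw)

lemma emb_sq_sym: "emb_sq x \<bullet> y = x \<bullet> emb_sq y"
  by (simp add: emb_sq_inner emb_sq_inner')

lemma lw_sym: "lw n x \<bullet> y = x \<bullet> lw n y"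
proof (induction n arbitrary: x y)
  case (Suc n)
  have "lw (Suc n) x \<bullet> y = lw n x \<bullet> (y - tau *\<^sub>R emb_sq y)"
    by (simp add: lw_Suc inner_diff_left inner_diff_right emb_sq_sym)
  also have "\<dots> = x \<bullet> lw (Suc n) y" by (simp only: Suc lw_Suc')
  finally show ?case .
qed simp

lemma lw_emb_sq: "lw n (emb_sq x) = emb_sq (lw n x)"
  by (induction n) (auto simp: lw_Suc emb_sq.diff emb_sq.scaleR)

lemma lw_add: "lw (m + n) x = lw m (lw n x)"
  by (simp add: lw_def funpow_add)

lemma lk_sym: "lk n x \<bullet> y = x \<bullet> lk n y"
  by (simp add: lk_def inner_sum_left inner_sum_right lw_sym)

lemma lk_emb_sq: "lk n (emb_sq x) = emb_sq (lk n x)"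
  by (simp add: lk_def lw_emb_sq emb_sq.sum emb_sq.scaleR)

lemma emb_sq_lk: "emb_sq (lk n x) = x - lw n x"
proof (induction n)
  case (Suc n)
  have "lk (Suc n) x = lk n x + tau *\<^sub>R lw n x" by (simp add: lk_def scaleR_add_right)
  then show ?case using Suc by (simp add: emb_sq.add emb_sq.scaleR lw_Suc)
qed (simp add: lk_def emb_sq.zero)

text \<open>One step applies an operator between 0 and the identity: the first inequality rests on
  \<open>tau(2)\<close>, the second on the sign of \<open>tau\<close>. Together they interlace the
  even and odd moments in \<open>lw_tendsto\<close>.\<close>

lemma lw_step: "(norm (lw (Suc n) x))\<^sup>2 \<le> lw (Suc n) x \<bullet> lw n x" "lw (Suc n) x \<bullet> lw n x \<le> (norm (lw n x))\<^sup>2"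
proof -
  define v where "v = lw n x"
  have c: "emb_sq v \<bullet> v = (norm (emb P v))\<^sup>2" by (simp add: emb_sq_inner power2_norm_eq_inner)
  have "(norm (v - tau *\<^sub>R emb_sq v))\<^sup>2 = (norm v)\<^sup>2 - 2 * tau * (norm (emb P v))\<^sup>2 + tau * (tau * (norm (emb_sq v))\<^sup>2)"
    unfolding c[symmetric] by (simp add: power2_norm_eq_inner inner_diff_left inner_diff_right inner_commute)
  also have "\<dots> \<le> (norm v)\<^sup>2 - 2 * tau * (norm (emb P v))\<^sup>2 + tau * (norm (emb P v))\<^sup>2"
    using tau(1) tau(2)[of v] by simp
  also have "\<dots> = (v - tau *\<^sub>R emb_sq v) \<bullet> v"
    by (simp add: inner_diff_left c power2_norm_eq_inner)
  finally show "(norm (lw (Suc n) x))\<^sup>2 \<le> lw (Suc n) x \<bullet> lw n x" by (simp add: lw_Suc v_def)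
  have "(v - tau *\<^sub>R emb_sq v) \<bullet> v = (norm v)\<^sup>2 - tau * (norm (emb P v))\<^sup>2"
    by (simp add: inner_diff_left c power2_norm_eq_inner)
  then show "lw (Suc n) x \<bullet> lw n x \<le> (norm (lw n x))\<^sup>2" using tau(1) by (simp add: lw_Suc v_def)
qed

lemma norm_lw_le: "norm (lw n x) \<le> norm x"
proof (induction n)
  case (Suc n)
  have "(norm (lw (Suc n) x))\<^sup>2 \<le> (norm (lw n x))\<^sup>2" using lw_step[of n x] by linarith
  then have "norm (lw (Suc n) x) \<le> norm (lw n x)" by (rule power2_le_imp_le) simp
  then show ?case using Suc by linarith
qed simp

text \<open>Strong convergence without spectral theory. The moments \<open>a k\<close> decrease and
  are nonnegative, hence converge, and squared distances of iterates are combinations of moments, so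
  the iterates are Cauchy. Their limit is fixed by the step, thus annihilated by
  \<open>emb_sq\<close>, and is 0 because the embedding is injective.\<close>

lemma lw_tendsto: "(\<lambda>n. lw n x) \<longlonglongrightarrow> 0"
proof -
  define a where "a k = lw k x \<bullet> x" for k
  have aa: "lw n x \<bullet> lw m x = a (n + m)" for n m
    using lw_sym[of n "lw m x" x] inner_commute[of "lw m x" "lw n x"] by (simp add: a_def lw_add)
  have even: "a (n + n) = (norm (lw n x))\<^sup>2" for n by (simp add: aa[symmetric] power2_norm_eq_inner)
  have nn: "0 \<le> a k \<and> a (Suc k) \<le> a k" for k
  proof (cases "even k")
    case True
    then obtain n where k: "k = n + n" by (auto simp: mult_2 elim!: evenE)
    have "a (Suc k) = lw (Suc n) x \<bullet> lw n x" using aa[of "Suc n" n] by (simp add: k)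
    then show ?thesis using lw_step(2)[of n x] even[of n] by (simp add: k)
  next
    case False
    then obtain n where k: "k = Suc n + n" by (auto simp: mult_2 elim!: oddE)
    have "a k = lw (Suc n) x \<bullet> lw n x" using aa[of "Suc n" n] by (simp add: k)
    moreover have "a (Suc k) = (norm (lw (Suc n) x))\<^sup>2" using even[of "Suc n"] by (simp add: k)
    ultimately show ?thesis using lw_step(1)[of n x] zero_le_power2[of "norm (lw (Suc n) x)"] by linarith
  qed
  then have "decseq a" "\<And>k. 0 \<le> a k" by (auto simp: decseq_Suc_iff)
  then obtain l where l: "a \<longlonglongrightarrow> l" using decseq_convergent[of a 0] by blast
  have "Cauchy (\<lambda>n. lw n x)"
  proof (rule metric_CauchyI)
    fix e :: real assume "e > 0"
    then obtain N where N: "\<And>n. n \<ge> N \<Longrightarrow> \<bar>a n - l\<bar> < e\<^sup>2 / 4"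
      using LIMSEQ_D[OF l, of "e\<^sup>2 / 4"] by auto
    have "dist (lw m x) (lw n x) < e" if "m \<ge> N" "n \<ge> N" for m n
    proof -
      \<comment> \<open>The weights 1, -2, 1 cancel the limit \<open>l\<close>; what remains are
        four errors below \<open>e\<^sup>2 / 4\<close>.\<close>
      have "(norm (lw m x - lw n x))\<^sup>2 = a (m + m) - 2 * a (m + n) + a (n + n)"
        by (simp add: power2_norm_eq_inner inner_diff_left inner_diff_right aa add.commute)
      also have "\<dots> < e\<^sup>2" using N[of "m + m"] N[of "m + n"] N[of "n + n"] that by (simp add: abs_if split: if_splits)
      finally show ?thesis using \<open>e > 0\<close> by (simp add: dist_norm power2_less_imp_less)
    qed
    then show "\<exists>N. \<forall>m\<ge>N. \<forall>n\<ge>N. dist (lw m x) (lw n x) < e" by blast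
  qed
  then obtain v where v: "(\<lambda>n. lw n x) \<longlonglongrightarrow> v" using Cauchy_convergent_iff convergent_def by blast
  have "(\<lambda>n. lw (Suc n) x) \<longlonglongrightarrow> v - tau *\<^sub>R emb_sq v"
    unfolding lw_Suc by (intro tendsto_intros v emb_sq.tendsto)
  then have "v - tau *\<^sub>R emb_sq v = v" using LIMSEQ_Suc[OF v] LIMSEQ_unique by blast
  then have "emb_sq v = 0" using tau(1) by simp
  then have "emb P v \<bullet> emb P v = 0" using emb_sq_inner[of v v] by simp
  then have "emb P v = emb P 0" by (simp add: emb.zero)
  then have "v = 0" by (rule injD[OF emb_facts(2)])
  with v show ?thesis by simp
qed

lemma lw_integral_tendsto: "(\<lambda>n. LINT t|lborel. (norm (lw n (rep_l2 w t)))\<^sup>2) \<longlonglongrightarrow> 0"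
proof -
  have [measurable]: "lw n \<in> borel_measurable borel" for n
    by (intro borel_measurable_continuous_onI linear_continuous_on bounded_linear_lw)
  have "(\<lambda>n. LINT t|lborel. (norm (lw n (rep_l2 w t)))\<^sup>2) \<longlonglongrightarrow> (LINT t|(lborel :: real measure). 0)"
  proof (rule integral_dominated_convergence[where w = "\<lambda>t. (norm (rep_l2 w t))\<^sup>2"])
    show "AE t in lborel. (\<lambda>n. (norm (lw n (rep_l2 w t)))\<^sup>2) \<longlonglongrightarrow> 0"
      using tendsto_power[OF tendsto_norm[OF lw_tendsto], of _ 2] by simp
    show "AE t in lborel. norm ((norm (lw n (rep_l2 w t)))\<^sup>2) \<le> (norm (rep_l2 w t))\<^sup>2" for n
      by (intro AE_I2) (simp add: norm_lw_le power_mono)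
  qed (use integrable_norm_sq_rep in auto)
  then show ?thesis by simp
qed

text \<open>The functions \<open>u n\<close> are continuous and equal the embedded
  \<open>w - lw n w\<close> almost everywhere. Uniform convergence follows from the energy identity
  for differences of two of them, because its integrals involve only Landweber errors of
  \<open>w\<close> and \<open>y\<close>, which vanish in mean square.\<close>

theorem continuous_representative:
  assumes wd: "wd w y"
  shows "\<exists>\<omega>. continuous_on {0..T} \<omega> \<and> (AE t in lborel. t \<in> ivl P \<longrightarrow> \<omega> t = emb P (rep_l2 w t)) \<and>
    (norm (\<omega> T))\<^sup>2 - (norm (\<omega> 0))\<^sup>2 = 2 * (w \<bullet> y)"
proof -
  let ?y = "rep_l2 y" and ?w = "rep_l2 w"
  obtain z0 where z: "AE t in lborel. t \<in> ivl P \<longrightarrow> emb_sq (?w t) = z0 + primitive ?y t"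
    using wd_emb_sq[OF wd] by blast
  have yi: "integrable lborel ?y" using Y_integrable wd wd_mem by blast
  define p where "p t = z0 + primitive ?y t" for t
  define u where "u n t = emb P (lk n (p t))" for n t
  have [measurable]: "lw n \<in> borel_measurable borel" for n
    by (intro borel_measurable_continuous_onI linear_continuous_on bounded_linear_lw)
  define A where "A n = (LINT t|lborel. (norm (lw n (?w t)))\<^sup>2)" for n
  define B where "B n = (LINT t|lborel. (norm (lw n (?y t)))\<^sup>2)" for n
  have Ai: "integrable lborel (\<lambda>t. (norm (lw n (?w t)))\<^sup>2)" for n
    using sq_integrable_bounded_linear[OF bounded_linear_lw[of n] sq_integrable_rep[of w]] by (simp add: sq_integrable_def)
  have Bi: "integrable lborel (\<lambda>t. (norm (lw n (?y t)))\<^sup>2)" for n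
    using sq_integrable_bounded_linear[OF bounded_linear_lw[of n] sq_integrable_rep[of y]] by (simp add: sq_integrable_def)
  have A0: "A n \<ge> 0" and B0: "B n \<ge> 0" for n by (auto simp: A_def B_def)
  have lim: "(\<lambda>n. A n + B n) \<longlonglongrightarrow> 0"
    using tendsto_add[OF lw_integral_tendsto[of w] lw_integral_tendsto[of y]] by (simp add: A_def B_def)
  have diff: "(norm (u n t - u m t))\<^sup>2 \<le> (2 / (tau * T) + 4) * ((A n + B n) + (A m + B m))" if t: "t \<in> {0..T}" for n m t
  proof -
    \<comment> \<open>Composed with \<open>emb_sq\<close>, this is a difference of two Landweber
      error operators.\<close>
    define L where "L x = lk n x - lk m x" for x
    have L: "bounded_linear L" unfolding L_def[abs_def] by (intro bounded_linear_sub bounded_linear_lk)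
    have Lsym: "L x \<bullet> x' = x \<bullet> L x'" for x x' by (simp add: L_def inner_diff_left inner_diff_right lk_sym)
    have LC: "L (emb_sq x) = emb_sq (L x)" for x by (simp add: L_def lk_emb_sq emb_sq.diff)
    have CL: "emb_sq (L x) = lw m x - lw n x" for x by (simp add: L_def emb_sq.diff emb_sq_lk)
    define F where "F s = (norm (emb P (L (p s))))\<^sup>2" for s
    define k where "k s = emb_sq (L (?w s)) \<bullet> emb_sq (L (?y s))" for s
    define G where "G = A n + B n + (A m + B m)"
    have F: "F s = F 0 + 2 * (LINT r:{0..s}|lborel. k r)" if "s \<in> {0..T}" for s
      using energy_regular[OF L Lsym LC wd z that] by (simp add: F_def k_def p_def)
    have kb: "\<bar>k s\<bar> \<le> (norm (lw n (?w s)))\<^sup>2 + (norm (lw n (?y s)))\<^sup>2 + ((norm (lw m (?w s)))\<^sup>2 + (norm (lw m (?y s)))\<^sup>2)" for s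
    proof -
      have q: "(norm (a - b))\<^sup>2 \<le> 2 * (norm a)\<^sup>2 + 2 * (norm b)\<^sup>2" for a b :: 'v
      proof -
        have "(norm (a - b))\<^sup>2 + (norm (a + b))\<^sup>2 = 2 * (norm a)\<^sup>2 + 2 * (norm b)\<^sup>2"
          by (simp add: power2_norm_eq_inner inner_diff_left inner_diff_right inner_add_left inner_add_right inner_commute)
        then show ?thesis using zero_le_power2[of "norm (a + b)"] by linarith
      qed
      have "\<bar>k s\<bar> \<le> norm (lw m (?w s) - lw n (?w s)) * norm (lw m (?y s) - lw n (?y s))"
        unfolding k_def CL by (rule Cauchy_Schwarz_ineq2)
      moreover have "2 * (norm (lw m (?w s) - lw n (?w s)) * norm (lw m (?y s) - lw n (?y s)))
          \<le> (norm (lw m (?w s) - lw n (?w s)))\<^sup>2 + (norm (lw m (?y s) - lw n (?y s)))\<^sup>2"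
        using sum_squares_bound[of "norm (lw m (?w s) - lw n (?w s))" "norm (lw m (?y s) - lw n (?y s))"] by simp
      ultimately show ?thesis using q[of "lw m (?w s)" "lw n (?w s)"] q[of "lw m (?y s)" "lw n (?y s)"] by linarith
    qed
    have Gi: "integrable lborel (\<lambda>s. (norm (lw n (?w s)))\<^sup>2 + (norm (lw n (?y s)))\<^sup>2 + ((norm (lw m (?w s)))\<^sup>2 + (norm (lw m (?y s)))\<^sup>2))"
      by (intro Bochner_Integration.integrable_add Ai Bi)
    have GG: "(LINT s|lborel. (norm (lw n (?w s)))\<^sup>2 + (norm (lw n (?y s)))\<^sup>2 + ((norm (lw m (?w s)))\<^sup>2 + (norm (lw m (?y s)))\<^sup>2)) = G"
      unfolding G_def A_def B_def using Ai Bi by (simp add: Bochner_Integration.integrable_add)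
    have km: "k \<in> borel_measurable borel" unfolding k_def[abs_def] CL by measurable
    have ki: "integrable lborel (\<lambda>r. indicator {0..s} r *\<^sub>R k r)" for s
      by (rule Bochner_Integration.integrable_bound[OF Gi])
        (use km kb in \<open>auto intro!: AE_I2 simp: indicator_def abs_of_nonneg intro: order_trans[OF _ abs_ge_self]\<close>)
    have kG: "\<bar>LINT r:{0..s}|lborel. k r\<bar> \<le> G" for s
    proof -
      have "\<bar>LINT r:{0..s}|lborel. k r\<bar> \<le> (LINT r|lborel. norm (indicator {0..s} r *\<^sub>R k r))"
        unfolding set_lebesgue_integral_def real_norm_def[symmetric] by (rule integral_norm_bound)
      also have "\<dots> \<le> G" unfolding GG[symmetric]
      proof (rule integral_mono[OF integrable_norm[OF ki] Gi])
        fix r show "norm (indicator {0..s} r *\<^sub>R k r) \<le> (norm (lw n (?w r)))\<^sup>2 + (norm (lw n (?y r)))\<^sup>2 + ((norm (lw m (?w r)))\<^sup>2 + (norm (lw m (?y r)))\<^sup>2)"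
          using kb[of r] by (cases "r \<in> {0..s}") auto
      qed
      finally show ?thesis .
    qed
    \<comment> \<open>The value at time 0 is not known to be small, but it cancels between two
      times.\<close>
    have FF: "F t \<le> F s + 4 * G" if "s \<in> {0..T}" for s
      using F[OF t] F[OF that] kG[of t] kG[of s] by linarith
    \<comment> \<open>For almost every \<open>s\<close> the value \<open>F s\<close> is bounded by
      the Landweber errors of \<open>w\<close> at \<open>s\<close>. Averaging \<open>FF\<close> over
      \<open>s\<close> therefore bounds \<open>F t\<close>, and division by the horizon produces the
      constant \<open>2 / (tau * T) + 4\<close>.\<close>
    have ae: "AE s in lborel. indicator (ivl P) s * F t \<le>
        (2 / tau) * ((norm (lw n (?w s)))\<^sup>2 + (norm (lw m (?w s)))\<^sup>2) + indicator (ivl P) s * (4 * G)"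
      using z
    proof eventually_elim
      case (elim s)
      show ?case
      proof (cases "s \<in> ivl P")
        case True
        then have "p s = emb_sq (?w s)" using elim by (simp add: p_def)
        then have Fs: "F s = (norm (emb P (lw m (?w s) - lw n (?w s))))\<^sup>2" by (simp add: F_def LC CL)
        have "tau * F s \<le> (norm (lw m (?w s) - lw n (?w s)))\<^sup>2" unfolding Fs by (rule tau(3))
        also have "\<dots> \<le> 2 * ((norm (lw n (?w s)))\<^sup>2 + (norm (lw m (?w s)))\<^sup>2)"
        proof -
          have "(norm (a - b))\<^sup>2 + (norm (a + b))\<^sup>2 = 2 * (norm a)\<^sup>2 + 2 * (norm b)\<^sup>2" for a b :: 'v
            by (simp add: power2_norm_eq_inner inner_diff_left inner_diff_right inner_add_left inner_add_right inner_commute)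
          from this[of "lw m (?w s)" "lw n (?w s)"] show ?thesis
            using zero_le_power2[of "norm (lw m (?w s) + lw n (?w s))"] unfolding distrib_left by linarith
        qed
        finally have "F s \<le> (2 / tau) * ((norm (lw n (?w s)))\<^sup>2 + (norm (lw m (?w s)))\<^sup>2)"
          using tau(1) by (simp add: field_simps)
        then show ?thesis using FF[of s] True by simp
      qed (use tau(1) in simp)
    qed
    have Ii: "integrable lborel (\<lambda>s. indicator (ivl P) s * c)" for c :: real
      using T_pos by (intro integrable_mult_left) (simp add: integrable_indicator_iff)
    have Ic: "(LINT s|lborel. indicator (ivl P) s * c) = T * c" for c :: real
      using T_pos by simp
    have "T * F t = (LINT s|lborel. indicator (ivl P) s * F t)" by (simp only: Ic)
    also have "\<dots> \<le> (LINT s|lborel. (2 / tau) * ((norm (lw n (?w s)))\<^sup>2 + (norm (lw m (?w s)))\<^sup>2) + indicator (ivl P) s * (4 * G))"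
      by (intro integral_mono_AE Ii ae Bochner_Integration.integrable_add integrable_mult_right Ai)
    also have "\<dots> = (2 / tau) * (A n + A m) + T * (4 * G)"
    proof -
      have "integrable lborel (\<lambda>s. (2 / tau) * ((norm (lw n (?w s)))\<^sup>2 + (norm (lw m (?w s)))\<^sup>2))"
        by (intro Bochner_Integration.integrable_add integrable_mult_right Ai)
      from Bochner_Integration.integral_add[OF this Ii[of "4 * G"]] show ?thesis
        unfolding Ic integral_mult_right_zero A_def by (simp only: Bochner_Integration.integral_add[OF Ai Ai])
    qed
    also have "\<dots> \<le> (2 / tau) * G + T * (4 * G)"
      using tau(1) B0[of n] B0[of m] by (intro add_right_mono mult_left_mono) (auto simp: G_def)
    finally have "F t \<le> (2 / (tau * T) + 4) * G" using T_pos tau(1) by (simp add: field_simps)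
    moreover have "u n t - u m t = emb P (L (p t))" by (simp add: u_def L_def emb.diff)
    ultimately show ?thesis by (simp add: F_def G_def)
  qed
  have "uniformly_Cauchy_on {0..T} u"
    unfolding uniformly_Cauchy_on_def
  proof (intro allI impI)
    fix e :: real assume "e > 0"
    define c where "c = 2 / (tau * T) + 4"
    have "c > 0" using tau(1) T_pos by (simp add: c_def add_pos_pos)
    then obtain N where N: "\<And>n. n \<ge> N \<Longrightarrow> A n + B n < e\<^sup>2 / (2 * c)"
      using order_tendstoD(2)[OF lim, of "e\<^sup>2 / (2 * c)"] \<open>e > 0\<close> by (auto simp: eventually_sequentially)
    have "dist (u m t) (u n t) < e" if "t \<in> {0..T}" "m \<ge> N" "n \<ge> N" for t m n
    proof -
      have "(norm (u m t - u n t))\<^sup>2 \<le> c * ((A m + B m) + (A n + B n))"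
        using diff[OF that(1), of m n] by (simp add: c_def)
      also have "\<dots> < c * (e\<^sup>2 / c)"
      proof (rule mult_strict_left_mono[OF _ \<open>c > 0\<close>])
        show "(A m + B m) + (A n + B n) < e\<^sup>2 / c"
          using N[OF that(2)] N[OF that(3)] by (simp add: field_simps)
      qed
      finally have "(norm (u m t - u n t))\<^sup>2 < e\<^sup>2" using \<open>c > 0\<close> by simp
      then show ?thesis using \<open>e > 0\<close> by (simp add: dist_norm power2_less_imp_less)
    qed
    then show "\<exists>N. \<forall>t\<in>{0..T}. \<forall>m\<ge>N. \<forall>n\<ge>N. dist (u m t) (u n t) < e" by blast
  qed
  then obtain \<omega> where ul: "uniform_limit {0..T} u \<omega> sequentially"
    using Cauchy_uniformly_convergent uniformly_convergent_on_def by blast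
  have pc: "continuous_on {0..T} p"
    unfolding p_def by (intro continuous_intros continuous_primitive yi)
  have uc: "continuous_on {0..T} (u n)" for n
    unfolding u_def[abs_def]
    by (intro bounded_linear.continuous_on[OF emb.bounded_linear_axioms] bounded_linear.continuous_on[OF bounded_linear_lk] pc)
  have cont: "continuous_on {0..T} \<omega>"
    by (rule uniform_limit_theorem[OF always_eventually ul]) (auto intro: uc)
  have ptw: "(\<lambda>n. u n t) \<longlonglongrightarrow> \<omega> t" if "t \<in> {0..T}" for t
    by (rule tendsto_uniform_limitI[OF ul that])
  have "AE t in lborel. t \<in> ivl P \<longrightarrow> \<omega> t = emb P (?w t)"
    using z
  proof eventually_elim
    case (elim t)
    show ?case
    proof
      assume t: "t \<in> ivl P"
      then have e: "p t = emb_sq (?w t)" using elim by (simp add: p_def)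
      have "u n t = emb P (?w t - lw n (?w t))" for n
        by (simp add: u_def e lk_emb_sq emb_sq_lk)
      moreover have "(\<lambda>n. emb P (?w t - lw n (?w t))) \<longlonglongrightarrow> emb P (?w t - 0)"
        by (intro emb.tendsto tendsto_intros lw_tendsto)
      ultimately show "\<omega> t = emb P (?w t)" using ptw[of t] t LIMSEQ_unique by fastforce
    qed
  qed
  \<comment> \<open>The identity for \<open>u n\<close> has \<open>w - lw n w\<close> and
    \<open>y - lw n y\<close> under the integral; dominated convergence removes the errors.\<close>
  moreover have "(norm (\<omega> T))\<^sup>2 - (norm (\<omega> 0))\<^sup>2 = 2 * (w \<bullet> y)"
  proof (rule LIMSEQ_unique)
    show "(\<lambda>n. (norm (u n T))\<^sup>2 - (norm (u n 0))\<^sup>2) \<longlonglongrightarrow> (norm (\<omega> T))\<^sup>2 - (norm (\<omega> 0))\<^sup>2"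
      using T_pos by (intro tendsto_intros ptw) auto
    have e: "(norm (u n T))\<^sup>2 - (norm (u n 0))\<^sup>2 = 2 * (LINT s|lborel. indicator {0..T} s *\<^sub>R ((?w s - lw n (?w s)) \<bullet> (?y s - lw n (?y s))))" for n
      using energy_regular[OF bounded_linear_lk lk_sym lk_emb_sq wd z, of T n] T_pos
      by (simp add: u_def p_def emb_sq_lk set_lebesgue_integral_def)
    have "(\<lambda>n. LINT s|lborel. indicator {0..T} s *\<^sub>R ((?w s - lw n (?w s)) \<bullet> (?y s - lw n (?y s)))) \<longlonglongrightarrow>
        (LINT s|lborel. indicator {0..T} s *\<^sub>R ((?w s - 0) \<bullet> (?y s - 0)))"
    proof (rule integral_dominated_convergence[where w = "\<lambda>s. 4 * ((norm (?w s))\<^sup>2 + (norm (?y s))\<^sup>2)"])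
      show "integrable lborel (\<lambda>s. 4 * ((norm (?w s))\<^sup>2 + (norm (?y s))\<^sup>2))"
        by (intro integrable_mult_right Bochner_Integration.integrable_add integrable_norm_sq_rep)
      show "AE s in lborel. (\<lambda>n. indicator {0..T} s *\<^sub>R ((?w s - lw n (?w s)) \<bullet> (?y s - lw n (?y s)))) \<longlonglongrightarrow>
          indicator {0..T} s *\<^sub>R ((?w s - 0) \<bullet> (?y s - 0))"
        by (intro AE_I2 tendsto_intros lw_tendsto)
      fix n
      have b: "norm (x - lw n x) \<le> 2 * norm x" for x
        using norm_triangle_ineq4[of x "lw n x"] norm_lw_le[of n x] by linarith
      show "AE s in lborel. norm (indicator {0..T} s *\<^sub>R ((?w s - lw n (?w s)) \<bullet> (?y s - lw n (?y s)))) \<le>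
          4 * ((norm (?w s))\<^sup>2 + (norm (?y s))\<^sup>2)"
      proof (rule AE_I2)
        fix s
        have "\<bar>(?w s - lw n (?w s)) \<bullet> (?y s - lw n (?y s))\<bar> \<le> norm (?w s - lw n (?w s)) * norm (?y s - lw n (?y s))"
          by (rule Cauchy_Schwarz_ineq2)
        also have "\<dots> \<le> (2 * norm (?w s)) * (2 * norm (?y s))" by (intro mult_mono b) auto
        also have "\<dots> \<le> 4 * ((norm (?w s))\<^sup>2 + (norm (?y s))\<^sup>2)"
        proof -
          have "0 \<le> 2 * (a - b)\<^sup>2 + 2 * a\<^sup>2 + 2 * b\<^sup>2" for a b :: real by simp
          from this[of "norm (?w s)" "norm (?y s)"] show ?thesis
            by (simp add: power2_eq_square algebra_simps)
        qed
        finally show "norm (indicator {0..T} s *\<^sub>R ((?w s - lw n (?w s)) \<bullet> (?y s - lw n (?y s)))) \<le>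
          4 * ((norm (?w s))\<^sup>2 + (norm (?y s))\<^sup>2)" by (auto simp: indicator_def)
      qed
    qed measurable
    also have "(LINT s|lborel. indicator {0..T} s *\<^sub>R ((?w s - 0) \<bullet> (?y s - 0))) = w \<bullet> y"
      unfolding inner_rep
    proof (rule integral_cong_AE)
      show "AE s in lborel. indicator {0..T} s *\<^sub>R ((?w s - 0) \<bullet> (?y s - 0)) = ?w s \<bullet> ?y s"
        using Yspace_AE[OF wd_mem(1)[OF wd]] by eventually_elim (auto simp: indicator_def)
    qed measurable
    finally show "(\<lambda>n. (norm (u n T))\<^sup>2 - (norm (u n 0))\<^sup>2) \<longlonglongrightarrow> 2 * (w \<bullet> y)"
      unfolding e by (intro tendsto_mult tendsto_const)
  qed
  ultimately show ?thesis using cont by blast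
qed

section \<open>Traces and integration by parts in X\<close>

lemma trace_eqI:
  assumes "continuous_on {0..T} \<omega>" "AE t in lborel. t \<in> ivl P \<longrightarrow> \<omega> t = emb P (rep_l2 w t)" "s \<in> {0..T}"
  shows "trace P s w = \<omega> s"
  unfolding trace_def
proof (rule the_equality)
  show "\<exists>\<omega>'. continuous_on {0..T} \<omega>' \<and> (AE t in lborel. t \<in> ivl P \<longrightarrow> \<omega>' t = emb P (rep_l2 w t)) \<and> \<omega> s = \<omega>' s"
    using assms by blast
  fix h assume "\<exists>\<omega>'. continuous_on {0..T} \<omega>' \<and> (AE t in lborel. t \<in> ivl P \<longrightarrow> \<omega>' t = emb P (rep_l2 w t)) \<and> h = \<omega>' s"
  then obtain \<omega>' where o: "continuous_on {0..T} \<omega>'" "AE t in lborel. t \<in> ivl P \<longrightarrow> \<omega>' t = emb P (rep_l2 w t)" "h = \<omega>' s"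
    by blast
  have "AE t in lborel. t \<in> ivl P \<longrightarrow> \<omega>' t = \<omega> t" using assms(2) o(2) by eventually_elim simp
  from AE_eq_continuous[OF o(1) assms(1) this assms(3)] show "h = \<omega> s" using o(3) by simp
qed

lemma trace_add:
  assumes "wd w y" "wd w' y'" "s \<in> {0..T}"
  shows "trace P s (w + w') = trace P s w + trace P s w'"
proof -
  obtain \<omega> where o: "continuous_on {0..T} \<omega>" "AE t in lborel. t \<in> ivl P \<longrightarrow> \<omega> t = emb P (rep_l2 w t)"
    using continuous_representative[OF assms(1)] by blast
  obtain \<omega>' where o': "continuous_on {0..T} \<omega>'" "AE t in lborel. t \<in> ivl P \<longrightarrow> \<omega>' t = emb P (rep_l2 w' t)"
    using continuous_representative[OF assms(2)] by blast
  have "AE t in lborel. t \<in> ivl P \<longrightarrow> \<omega> t + \<omega>' t = emb P (rep_l2 (w + w') t)"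
    using o(2) o'(2) rep_add[of w w'] by eventually_elim (auto simp: emb.add)
  from trace_eqI[OF continuous_on_add[OF o(1) o'(1)] this assms(3)] show ?thesis
    using trace_eqI[OF o assms(3)] trace_eqI[OF o' assms(3)] by simp
qed

lemma trace_scaleR:
  assumes "wd w y" "s \<in> {0..T}"
  shows "trace P s (c *\<^sub>R w) = c *\<^sub>R trace P s w"
proof -
  obtain \<omega> where o: "continuous_on {0..T} \<omega>" "AE t in lborel. t \<in> ivl P \<longrightarrow> \<omega> t = emb P (rep_l2 w t)"
    using continuous_representative[OF assms(1)] by blast
  have "AE t in lborel. t \<in> ivl P \<longrightarrow> c *\<^sub>R \<omega> t = emb P (rep_l2 (c *\<^sub>R w) t)"
    using o(2) rep_scaleR[of c w] by eventually_elim (auto simp: emb.scaleR)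
  from trace_eqI[OF continuous_on_scaleR[OF continuous_on_const o(1)] this assms(2)] show ?thesis
    using trace_eqI[OF o assms(2)] by simp
qed

lemma ends: "0 \<in> {0..T}" "T \<in> {0..T}"
  using T_pos by auto

lemma energy_identity:
  assumes "wd w y" shows "(norm (trace P T w))\<^sup>2 - (norm (trace P 0 w))\<^sup>2 = 2 * (w \<bullet> y)"
proof -
  obtain \<omega> where o: "continuous_on {0..T} \<omega>" "AE t in lborel. t \<in> ivl P \<longrightarrow> \<omega> t = emb P (rep_l2 w t)"
    "(norm (\<omega> T))\<^sup>2 - (norm (\<omega> 0))\<^sup>2 = 2 * (w \<bullet> y)"
    using continuous_representative[OF assms(1)] by blast
  then show ?thesis using trace_eqI[OF o(1,2) ends(1)] trace_eqI[OF o(1,2) ends(2)] by simp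
qed

text \<open>Polarisation of the energy identity.\<close>

lemma trace_by_parts:
  assumes "wd w y" "wd w' y'"
  shows "y \<bullet> w' + y' \<bullet> w = trace P T w \<bullet> trace P T w' - trace P 0 w \<bullet> trace P 0 w'"
  using energy_identity[OF wd_add[OF assms]] energy_identity[OF assms(1)] energy_identity[OF assms(2)]
  by (simp add: trace_add[OF assms ends(1)] trace_add[OF assms ends(2)] power2_norm_eq_inner
      inner_add_left inner_add_right inner_commute)

text \<open>The derivative carries \<open>emb_sq\<close> because an element of \<open>V\<close> acts
  as a functional through the inner product of \<open>H\<close>.\<close>

lemma wd_tens:
  assumes d: "\<And>t. (\<psi> has_real_derivative \<psi>' t) (at t)" and c': "continuous_on UNIV \<psi>'"
  shows "wd (tens \<psi> \<zeta>) (tens \<psi>' (emb_sq \<zeta>))"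
  unfolding wd_iff
proof (intro conjI allI impI)
  have c: "continuous_on UNIV \<psi>" using d by (meson DERIV_isCont continuous_at_imp_continuous_on)
  show "tens \<psi> \<zeta> \<in> Y" "tens \<psi>' (emb_sq \<zeta>) \<in> Y" using c c' by (auto intro: tens_in_Y)
  fix \<phi> \<phi>' \<eta> assume tf: "test_function P \<phi> \<phi>'"
  note tff = test_function_facts[OF tf T_pos]
  have d\<phi>: "\<And>t. (\<phi> has_real_derivative \<phi>' t) (at t)" using tf by (simp add: test_function_def)
  have m: "continuous_on UNIV (\<lambda>t. \<phi>' t * \<psi> t + \<phi> t * \<psi>' t)" using tff(3,4) c c' by (intro continuous_intros)
  have [measurable]: "\<psi> \<in> borel_measurable borel" "\<psi>' \<in> borel_measurable borel" "\<phi> \<in> borel_measurable borel" "\<phi>' \<in> borel_measurable borel"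
    using c c' tff(3,4) by (auto intro: borel_measurable_continuous_onI)
  have si: "set_integrable lborel {0..T} f" if "continuous_on UNIV f" for f :: "real \<Rightarrow> real"
    by (rule borel_integrable_atLeastAtMost') (rule continuous_on_subset[OF that], simp)
  have "(LINT t:{0..T}|lborel. \<phi>' t * \<psi> t + \<phi> t * \<psi>' t) = integral {0..T} (\<lambda>t. \<phi>' t * \<psi> t + \<phi> t * \<psi>' t)"
    by (rule set_borel_integral_eq_integral(2)[OF si[OF m]])
  also have "\<dots> = \<phi> T * \<psi> T - \<phi> 0 * \<psi> 0"
  proof (rule integral_unique, rule fundamental_theorem_of_calculus)
    fix t
    have "((\<lambda>t. \<phi> t * \<psi> t) has_real_derivative \<phi>' t * \<psi> t + \<phi> t * \<psi>' t) (at t)"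
      using DERIV_mult[OF d\<phi>[of t] d[of t]] by (simp add: mult.commute)
    then show "((\<lambda>t. \<phi> t * \<psi> t) has_vector_derivative \<phi>' t * \<psi> t + \<phi> t * \<psi>' t) (at t within {0..T})"
      by (simp add: has_real_derivative_iff_has_vector_derivative[symmetric] has_field_derivative_at_within)
  qed (use T_pos in simp)
  finally have z: "(LINT t:{0..T}|lborel. \<phi>' t * \<psi> t) + (LINT t:{0..T}|lborel. \<phi> t * \<psi>' t) = 0"
    using set_integral_add(2)[OF si si, of "\<lambda>t. \<phi>' t * \<psi> t" "\<lambda>t. \<phi> t * \<psi>' t"] tff c c'
    by (simp add: continuous_on_mult)
  have tt: "tens \<alpha> x \<bullet> tens \<beta> x' = (LINT t:{0..T}|lborel. \<beta> t * \<alpha> t) * (x \<bullet> x')"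
    if ca: "continuous_on UNIV \<alpha>" and cb: "continuous_on UNIV \<beta>" for \<alpha> \<beta> x x'
  proof -
    have [measurable]: "\<alpha> \<in> borel_measurable borel" "\<beta> \<in> borel_measurable borel"
      using that by (auto intro: borel_measurable_continuous_onI)
    have "tens \<alpha> x \<bullet> tens \<beta> x' = (LINT t:ivl P|lborel. \<beta> t * (rep_l2 (tens \<alpha> x) t \<bullet> x'))"
      by (rule inner_tens[OF cb])
    also have "\<dots> = (LINT t:ivl P|lborel. (\<beta> t * \<alpha> t) * (x \<bullet> x'))"
      unfolding set_lebesgue_integral_def
    proof (rule integral_cong_AE)
      show "AE t in lborel. indicator (ivl P) t *\<^sub>R (\<beta> t * (rep_l2 (tens \<alpha> x) t \<bullet> x')) =
          indicator (ivl P) t *\<^sub>R ((\<beta> t * \<alpha> t) * (x \<bullet> x'))"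
        using rep_tens[OF ca, of x] by eventually_elim (auto simp: indicator_def)
    qed measurable
    also have "\<dots> = (LINT t:{0..T}|lborel. (\<beta> t * \<alpha> t) * (x \<bullet> x'))" by (rule LINT_open_closed) measurable
    finally show ?thesis by simp
  qed
  show "tens \<psi> \<zeta> \<bullet> tens \<phi>' (emb_sq \<eta>) = - (tens \<psi>' (emb_sq \<zeta>) \<bullet> tens \<phi> \<eta>)"
    using z unfolding tt[OF c tff(4)] tt[OF c' tff(3)]
    by (simp add: emb_sq_sym eq_neg_iff_add_eq_0 distrib_right[symmetric])
qed

lemma trace_tens:
  assumes c: "continuous_on UNIV \<psi>" and s: "s \<in> {0..T}"
  shows "trace P s (tens \<psi> \<zeta>) = \<psi> s *\<^sub>R emb P \<zeta>"
proof (rule trace_eqI[OF _ _ s, of "\<lambda>s. \<psi> s *\<^sub>R emb P \<zeta>"])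
  show "continuous_on {0..T} (\<lambda>s. \<psi> s *\<^sub>R emb P \<zeta>)"
    by (intro continuous_intros continuous_on_subset[OF c]) auto
  show "AE t in lborel. t \<in> ivl P \<longrightarrow> \<psi> t *\<^sub>R emb P \<zeta> = emb P (rep_l2 (tens \<psi> \<zeta>) t)"
    using rep_tens[OF c, of \<zeta>] by eventually_elim (auto simp: emb.scaleR)
qed

end

section \<open>The trial norm and well-posedness\<close>

context parabolic
begin

abbreviation "X \<equiv> Xspace P"

text \<open>The representer of the time derivative in the energy form; its energy norm is the dual
  norm occurring in \<open>Xnorm\<close>.\<close>

definition D_op :: "'v l2 \<Rightarrow> 'v l2" where
  "D_op w = A_inv P (dt_op P w)"

definition xip :: "'v l2 \<Rightarrow> 'v l2 \<Rightarrow> real" where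
  "xip w z = A_op P (D_op w) (D_op z) + A_op P w z + trace P T w \<bullet> trace P T z"

lemma dt_op_in_Ydual: "wd w y \<Longrightarrow> dt_op P w \<in> Ydual P"
  using dt_op_eq inner_in_Ydual wd_mem(2) by metis

lemma D_op_mem: "w \<in> X \<Longrightarrow> D_op w \<in> Y"
  using A_inv_mem dt_op_in_Ydual by (auto simp: Xspace_iff D_op_def)

lemma A_op_D_op:
  assumes "wd w y" "v \<in> Y" shows "A_op P (D_op w) v = y \<bullet> v"
  using A_op_A_inv[OF dt_op_in_Ydual[OF assms(1)]] dt_op_eq[OF assms(1)] assms(2)
  by (simp add: D_op_def restr_def)

lemma A_op_outside: "v \<notin> Y \<Longrightarrow> A_op P w v = 0"
  by (simp add: A_op_def restr_def)

lemma D_op_eqI: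
  assumes "wd w y" "d \<in> Y" "\<And>v. v \<in> Y \<Longrightarrow> A_op P d v = y \<bullet> v"
  shows "D_op w = d"
proof -
  have "dt_op P w = A_op P d"
  proof
    fix v show "dt_op P w v = A_op P d v"
      using assms by (cases "v \<in> Y") (auto simp: dt_op_eq restr_def A_op_outside)
  qed
  then show ?thesis by (simp add: D_op_def A_inv_A_op assms(2))
qed

lemma X_mem_Y: "w \<in> X \<Longrightarrow> w \<in> Y" using Xspace_subset_Y by blast

lemma D_op_add:
  assumes "w \<in> X" "z \<in> X" shows "D_op (w + z) = D_op w + D_op z"
proof -
  obtain y y' where "wd w y" "wd z y'" using assms by (auto simp: Xspace_iff)
  then show ?thesis
    using D_op_mem assms by (intro D_op_eqI[OF wd_add]) (auto simp: A.bilin A_op_D_op inner_add_left)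
qed

lemma D_op_scaleR:
  assumes "w \<in> X" shows "D_op (c *\<^sub>R w) = c *\<^sub>R D_op w"
proof -
  obtain y where "wd w y" using assms by (auto simp: Xspace_iff)
  then show ?thesis
    using D_op_mem assms by (intro D_op_eqI[OF wd_scaleR]) (auto simp: A.bilin A_op_D_op)
qed

lemma subspace_X: "subspace X"
proof (rule subspaceI)
  have "wd (0 :: 'v l2) 0" unfolding wd_iff by simp
  then show "0 \<in> X" by (auto simp: Xspace_iff)
qed (auto simp: Xspace_iff intro: wd_add wd_scaleR)

lemma D_op_diff:
  assumes "w \<in> X" "z \<in> X" shows "D_op (w - z) = D_op w - D_op z"
  using D_op_add[OF assms(1) subspace_scale[OF subspace_X assms(2), of "-1"]] D_op_scaleR[OF assms(2), of "-1"]
  by simp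

lemma trace_add': "w \<in> X \<Longrightarrow> z \<in> X \<Longrightarrow> s \<in> {0..T} \<Longrightarrow> trace P s (w + z) = trace P s w + trace P s z"
  using trace_add by (auto simp: Xspace_iff)

lemma trace_scaleR': "w \<in> X \<Longrightarrow> s \<in> {0..T} \<Longrightarrow> trace P s (c *\<^sub>R w) = c *\<^sub>R trace P s w"
  using trace_scaleR by (auto simp: Xspace_iff)

lemma trace_diff':
  "w \<in> X \<Longrightarrow> z \<in> X \<Longrightarrow> s \<in> {0..T} \<Longrightarrow> trace P s (w - z) = trace P s w - trace P s z"
  using trace_add'[of w "(-1) *\<^sub>R z" s] trace_scaleR'[of z s "-1"] subspace_scale[OF subspace_X, of z "-1"]
  by simp

lemmas trace_lin = trace_add'[OF _ _ ends(1)] trace_add'[OF _ _ ends(2)]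
  trace_scaleR'[OF _ ends(1)] trace_scaleR'[OF _ ends(2)]

lemma xip_form: "form_on X xip"
proof
  show "subspace X" by (rule subspace_X)
  show "xip (u + v) w = xip u w + xip v w" if "u \<in> X" "v \<in> X" "w \<in> X" for u v w
    using that by (simp add: xip_def D_op_add D_op_mem X_mem_Y A.add_left trace_lin inner_add_left)
  show "xip (c *\<^sub>R u) v = c * xip u v" if "u \<in> X" "v \<in> X" for c u v
    using that by (simp add: xip_def D_op_scaleR D_op_mem X_mem_Y A.scale_left trace_lin distrib_left)
  show "xip u v = xip v u" if "u \<in> X" "v \<in> X" for u v
    using that A.sym[of u v] A.sym[of "D_op u" "D_op v"]
    by (simp add: xip_def D_op_mem X_mem_Y inner_commute)
  show "0 \<le> xip u u" if "u \<in> X" for u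
    using that by (simp add: xip_def D_op_mem X_mem_Y A.nonneg)
qed

sublocale X: form_on X xip by (rule xip_form)

lemma Xnorm_eq: "w \<in> X \<Longrightarrow> Xnorm P w = sqrt (xip w w)"
  using dt_op_in_Ydual[THEN Ydual_norm_eq] Ynorm_sq[OF X_mem_Y]
  by (auto simp: Xnorm_def xip_def D_op_def Xspace_iff power2_norm_eq_inner)

lemma Xnorm_sq: "w \<in> X \<Longrightarrow> (Xnorm P w)\<^sup>2 = xip w w"
  by (simp add: Xnorm_eq X.nonneg)

lemma D_plus_mem: "w \<in> X \<Longrightarrow> D_op w + w \<in> Y"
  using D_op_mem X_mem_Y by simp

lemma B_op_eq_A: "w \<in> X \<Longrightarrow> B_op P w = A_op P (D_op w + w)"
proof
  fix v assume w: "w \<in> X"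
  then obtain y where y: "wd w y" by (auto simp: Xspace_iff)
  show "B_op P w v = A_op P (D_op w + w) v"
  proof (cases "v \<in> Y")
    case True
    then show ?thesis using w
      by (simp add: B_op_eq[OF y] A.add_left D_op_mem X_mem_Y A_op_D_op[OF y])
  qed (simp add: A_op_outside B_op_def restr_def)
qed

lemma B_op_in_Ydual: "w \<in> X \<Longrightarrow> B_op P w \<in> Ydual P"
  by (simp only: B_op_eq_A A_op_in_Ydual[OF D_plus_mem])

lemma A_inv_B_op: "w \<in> X \<Longrightarrow> A_inv P (B_op P w) = D_op w + w"
  by (simp only: B_op_eq_A A_inv_A_op[OF D_plus_mem])

text \<open>Integration by parts turns the mixed terms of the expanded product into boundary terms,
  so the trace at the horizon is exchanged for the trace at 0. In this shape the inner product of X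
  is the form of \<open>S_op\<close>.\<close>

lemma xip_alt:
  assumes "w \<in> X" "z \<in> X"
  shows "xip w z = A_op P (D_op w + w) (D_op z + z) + trace P 0 w \<bullet> trace P 0 z"
proof -
  obtain y y' where y: "wd w y" "wd z y'" using assms by (auto simp: Xspace_iff)
  have "A_op P (D_op w) z + A_op P w (D_op z) = y \<bullet> z + y' \<bullet> w"
    using assms A_op_D_op[OF y(1), of z] A_op_D_op[OF y(2), of w] A.sym[of w "D_op z"]
    by (simp add: X_mem_Y D_op_mem)
  then show ?thesis
    using trace_by_parts[OF y] assms by (simp add: xip_def A.bilin D_op_mem X_mem_Y)
qed

lemma S_op_eq: "w \<in> X \<Longrightarrow> z \<in> X \<Longrightarrow> S_op P w z = xip w z"
  using X.sym[of w z] by (simp add: S_op_def restr_def B_op_eq_A A_inv_A_op D_plus_mem xip_alt inner_commute)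

section \<open>Completeness of X and well-posedness\<close>

lemma dense_zero: "(\<And>\<zeta>. h \<bullet> emb P \<zeta> = 0) \<Longrightarrow> h = 0"
proof -
  assume a: "\<And>\<zeta>. h \<bullet> emb P \<zeta> = 0"
  have "closure (range (emb P)) \<subseteq> {x. h \<bullet> x = 0}"
    by (rule closure_minimal) (auto simp: a closed_hyperplane)
  then have "h \<bullet> h = 0" using emb_facts(3) by blast
  then show ?thesis by simp
qed

text \<open>Functions that separate the two traces: these vanish at time 0, while the constant ones
  of \<open>wd_const\<close> reach it.\<close>

lemma wd_linear: "wd (tens (\<lambda>t. t) \<zeta>) (tens (\<lambda>_. 1) (emb_sq \<zeta>))"
  by (rule wd_tens) (auto intro!: derivative_eq_intros)

lemma wd_const: "wd (tens (\<lambda>_. 1) \<zeta>) (tens (\<lambda>_. 0) (emb_sq \<zeta>))"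
  by (rule wd_tens) (auto intro!: derivative_eq_intros)

lemma trace_linear: "trace P 0 (tens (\<lambda>t. t) \<zeta>) = 0" "trace P T (tens (\<lambda>t. t) \<zeta>) = T *\<^sub>R emb P \<zeta>"
  using trace_tens[of "\<lambda>t. t" 0] trace_tens[of "\<lambda>t. t" T] ends by auto

text \<open>Compares the two representers of one functional: test with \<open>y\<close> and cancel a
  factor \<open>y \<bullet> y\<close>.\<close>

lemma riesz_transfer:
  obtains C where "\<And>y d. y \<in> Y \<Longrightarrow> d \<in> Y \<Longrightarrow> (\<And>v. v \<in> Y \<Longrightarrow> y \<bullet> v = A_op P d v) \<Longrightarrow> y \<bullet> y \<le> C * A_op P d d"
proof -
  obtain C where C: "\<And>v. v \<in> Y \<Longrightarrow> A_op P v v \<le> C * (v \<bullet> v)" using A_op_bounds by blast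
  show thesis
  proof (rule that)
    fix y d assume y: "y \<in> Y" and d: "d \<in> Y" and yd: "\<And>v. v \<in> Y \<Longrightarrow> y \<bullet> v = A_op P d v"
    have "(y \<bullet> y)\<^sup>2 \<le> A_op P d d * A_op P y y" using A.cauchy_schwarz_sq[OF d y] yd[OF y] by simp
    also have "\<dots> \<le> A_op P d d * (C * (y \<bullet> y))" using C[OF y] A.nonneg[OF d] by (rule mult_left_mono)
    finally have le: "(y \<bullet> y) * (y \<bullet> y) \<le> (C * A_op P d d) * (y \<bullet> y)"
      by (simp add: power2_eq_square ac_simps)
    show "y \<bullet> y \<le> C * A_op P d d"
    proof (cases "y \<bullet> y = 0")
      case True
      then have "y = 0" by simp
      have "A_op P d d = 0" using yd[OF d] \<open>y = 0\<close> by simp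
      then show ?thesis using True by simp
    next
      case False
      then have "y \<bullet> y > 0" using inner_ge_zero[of y] by linarith
      then show ?thesis using le by (rule mult_right_le_imp_le[rotated])
    qed
  qed
qed

text \<open>The three parts of the norm provide limits \<open>w\<close>, \<open>d\<close> and
  \<open>h\<close>. Closedness of the weak derivative identifies \<open>d\<close> with
  \<open>D_op w\<close>; integration by parts against functions vanishing at time 0 identifies
  \<open>h\<close> with the trace of \<open>w\<close>.\<close>

theorem X_complete: "form_complete X xip"
  unfolding form_complete_def
proof (intro allI impI, elim conjE)
  fix s :: "nat \<Rightarrow> 'v l2" assume s: "\<forall>n. s n \<in> X"
    and C: "\<forall>e>0. \<exists>N. \<forall>i\<ge>N. \<forall>j\<ge>N. xip (s i - s j) (s i - s j) < e"
  have sX: "s n \<in> X" for n using s by simp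
  note sY = X_mem_Y[OF sX] and DY = D_op_mem[OF sX]
  have parts: "A_op P v v \<le> xip v v" "A_op P (D_op v) (D_op v) \<le> xip v v" "(norm (trace P T v))\<^sup>2 \<le> xip v v"
    if "v \<in> X" for v
    using A.nonneg[OF X_mem_Y[OF that]] A.nonneg[OF D_op_mem[OF that]]
    by (auto simp: xip_def power2_norm_eq_inner)
  have small: "\<exists>N. \<forall>i\<ge>N. \<forall>j\<ge>N. F (s i - s j) < (e::real)" if "e > 0" "\<And>v. v \<in> X \<Longrightarrow> F v \<le> xip v v" for F e
  proof -
    obtain N where N: "\<forall>i\<ge>N. \<forall>j\<ge>N. xip (s i - s j) (s i - s j) < e" using C \<open>e > 0\<close> by blast
    have "F (s i - s j) < e" if "i \<ge> N" "j \<ge> N" for i j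
      using N[rule_format, OF that] \<open>\<And>v. v \<in> X \<Longrightarrow> F v \<le> xip v v\<close>[of "s i - s j"] sX by fastforce
    then show ?thesis by blast
  qed
  have "\<exists>w\<in>Y. (\<lambda>n. A_op P (s n - w) (s n - w)) \<longlonglongrightarrow> 0"
    by (rule form_completeD[OF A_complete sY]) (use small[of _ "\<lambda>v. A_op P v v"] parts(1) in blast)
  then obtain w where w: "w \<in> Y" "(\<lambda>n. A_op P (s n - w) (s n - w)) \<longlonglongrightarrow> 0" by blast
  have "\<exists>d\<in>Y. (\<lambda>n. A_op P (D_op (s n) - d) (D_op (s n) - d)) \<longlonglongrightarrow> 0"
    by (rule form_completeD[OF A_complete DY])
      (use small[of _ "\<lambda>v. A_op P (D_op v) (D_op v)"] parts(2) in \<open>simp add: D_op_diff sX\<close>)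
  then obtain d where d: "d \<in> Y" "(\<lambda>n. A_op P (D_op (s n) - d) (D_op (s n) - d)) \<longlonglongrightarrow> 0" by blast
  obtain h where h: "(\<lambda>n. trace P T (s n)) \<longlonglongrightarrow> h"
  proof -
    have "Cauchy (\<lambda>n. trace P T (s n))"
    proof (rule metric_CauchyI)
      fix e :: real assume "e > 0"
      then obtain N where N: "\<forall>i\<ge>N. \<forall>j\<ge>N. (norm (trace P T (s i - s j)))\<^sup>2 < e\<^sup>2"
        using small[of "e\<^sup>2" "\<lambda>v. (norm (trace P T v))\<^sup>2"] parts(3) by auto
      then show "\<exists>N. \<forall>i\<ge>N. \<forall>j\<ge>N. dist (trace P T (s i)) (trace P T (s j)) < e"
        using power_less_imp_less_base[of _ 2 e] \<open>e > 0\<close> sX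
        by (intro exI[of _ N]) (simp add: dist_norm trace_diff'[OF sX sX ends(2)] less_imp_le)
    qed
    then show thesis using that Cauchy_convergent_iff convergent_def by blast
  qed
  obtain y where y: "\<And>n. wd (s n) (y n)" using s unfolding Xspace_iff by metis
  note yY = wd_mem(2)[OF y]
  obtain q where q: "q \<in> Y" "\<And>v. v \<in> Y \<Longrightarrow> A_op P d v = q \<bullet> v"
    using Ydual_riesz_inner[OF A_op_in_Ydual[OF d(1)]] by blast
  obtain K where K: "\<And>y d. y \<in> Y \<Longrightarrow> d \<in> Y \<Longrightarrow> (\<And>v. v \<in> Y \<Longrightarrow> y \<bullet> v = A_op P d v) \<Longrightarrow> y \<bullet> y \<le> K * A_op P d d"
    using riesz_transfer by blast
  \<comment> \<open>The derivatives converge in \<open>L2\<close> because their representers in the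
    energy form do.\<close>
  have yq: "(\<lambda>n. (y n - q) \<bullet> (y n - q)) \<longlonglongrightarrow> 0"
  proof (rule tendsto_sandwich[OF _ _ tendsto_const tendsto_mult_right_zero[OF d(2), of K]])
    show "\<forall>\<^sub>F n in sequentially. (y n - q) \<bullet> (y n - q) \<le> K * A_op P (D_op (s n) - d) (D_op (s n) - d)"
    proof (intro always_eventually allI K)
      show "(y n - q) \<bullet> v = A_op P (D_op (s n) - d) v" if "v \<in> Y" for n v
        using that A_op_D_op[OF y that] q(2)[OF that] d(1) DY by (simp add: A.diff_left inner_diff_left)
    qed (use yY q DY d in \<open>auto simp: A.mem\<close>)
  qed simp
  obtain c where c: "c > 0" "\<And>v. v \<in> Y \<Longrightarrow> c * (v \<bullet> v) \<le> A_op P v v" using A_op_bounds by blast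
  have sw: "(\<lambda>n. (s n - w) \<bullet> (s n - w)) \<longlonglongrightarrow> 0"
  proof (rule tendsto_sandwich[OF _ _ tendsto_const tendsto_mult_right_zero[OF w(2), of "1 / c"]])
    show "\<forall>\<^sub>F n in sequentially. (s n - w) \<bullet> (s n - w) \<le> 1 / c * A_op P (s n - w) (s n - w)"
      using c(1) c(2)[of "s n - w" for n] sY w(1) by (intro always_eventually allI) (simp add: field_simps)
  qed simp
  have wd: "wd w q" by (rule wd_limit[OF y w(1) q(1) sw yq])
  then have wX: "w \<in> X" by (auto simp: Xspace_iff)
  have Dw: "D_op w = d" by (rule D_op_eqI[OF wd d(1) q(2)])
  have "trace P T w - h = 0"
  proof (rule dense_zero)
    fix \<zeta>
    let ?v = "tens (\<lambda>t. t) \<zeta>" and ?v' = "tens (\<lambda>_. 1) (emb_sq \<zeta>)"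
    have e: "yy \<bullet> ?v + ?v' \<bullet> ww = trace P T ww \<bullet> (T *\<^sub>R emb P \<zeta>)" if "wd ww yy" for ww yy
      using trace_by_parts[OF that wd_linear[of \<zeta>]] by (simp add: trace_linear)
    have l1: "(\<lambda>n. y n \<bullet> ?v + ?v' \<bullet> s n) \<longlonglongrightarrow> q \<bullet> ?v + ?v' \<bullet> w"
      unfolding inner_commute[of ?v'] by (intro tendsto_add l2_inner_tendsto yq sw)
    have l2: "(\<lambda>n. y n \<bullet> ?v + ?v' \<bullet> s n) \<longlonglongrightarrow> h \<bullet> (T *\<^sub>R emb P \<zeta>)"
      unfolding e[OF y] by (intro tendsto_inner h tendsto_const)
    have "trace P T w \<bullet> (T *\<^sub>R emb P \<zeta>) = h \<bullet> (T *\<^sub>R emb P \<zeta>)"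
      using LIMSEQ_unique[OF l1 l2] unfolding e[OF wd] .
    then show "(trace P T w - h) \<bullet> emb P \<zeta> = 0" using T_pos by (simp add: inner_diff_left)
  qed
  then have hw: "trace P T w = h" by simp
  have x: "xip (s n - w) (s n - w) = A_op P (D_op (s n) - d) (D_op (s n) - d) + A_op P (s n - w) (s n - w) +
      (trace P T (s n) - h) \<bullet> (trace P T (s n) - h)" for n
    by (simp only: xip_def D_op_diff[OF sX wX] trace_diff'[OF sX wX ends(2)] Dw hw)
  have "(\<lambda>n. xip (s n - w) (s n - w)) \<longlonglongrightarrow> 0 + 0 + (h - h) \<bullet> (h - h)"
    unfolding x by (rule tendsto_add[OF tendsto_add[OF d(2) w(2)]]) (intro tendsto_inner tendsto_diff h tendsto_const)
  then have "(\<lambda>n. xip (s n - w) (s n - w)) \<longlonglongrightarrow> 0" by simp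
  with wX show "\<exists>w\<in>X. (\<lambda>n. xip (s n - w) (s n - w)) \<longlonglongrightarrow> 0" by (rule bexI[rotated])
qed

text \<open>The solution \<open>u\<close> of the normal equations leaves a residual pair \<open>(v,h)\<close> that annihilates the range of
  \<open>w \<mapsto> (B w, \<gamma>\<^sub>0 w)\<close>. Testing with \<open>\<phi> \<otimes> \<zeta>\<close> shows that \<open>v\<close> lies in \<open>X\<close> with \<open>\<partial>\<^sub>t v = A v\<close> and
  \<open>\<gamma>\<^sub>T v = 0\<close>, and then the energy identity forces \<open>v = 0\<close>.\<close>

theorem well_posed:
  assumes g: "g \<in> Ydual P" shows "\<exists>u. solves P g u0 u"
proof -
  define G where "G = A_inv P g"
  have GY: "G \<in> Y" and AG: "A_op P G = g" unfolding G_def using A_inv[OF g] by auto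
  define F where "F z = A_op P (D_op z + z) G + u0 \<bullet> trace P 0 z" for z
  have "\<exists>u\<in>X. \<forall>z\<in>X. F z = xip u z"
  proof (rule X.riesz[OF X_complete])
    show "F (z + z') = F z + F z'" if "z \<in> X" "z' \<in> X" for z z'
      using that GY D_plus_mem[of z] D_plus_mem[of z'] A.add_left[of "D_op z + z" "D_op z' + z'" G]
      by (simp add: F_def D_op_add trace_lin inner_add_right add.assoc add.left_commute)
    show "F (c *\<^sub>R z) = c * F z" if "z \<in> X" for c z
      using that GY A.scale_left[of "D_op z + z" G c] D_plus_mem[of z]
      by (simp add: F_def D_op_scaleR trace_lin scaleR_add_right distrib_left)
    show "\<bar>F z\<bar> \<le> (sqrt (A_op P G G) + norm u0) * sqrt (xip z z)" if z: "z \<in> X" for z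
    proof -
      have x: "xip z z = A_op P (D_op z + z) (D_op z + z) + (norm (trace P 0 z))\<^sup>2"
        by (simp add: xip_alt[OF z z] power2_norm_eq_inner)
      have "\<bar>A_op P (D_op z + z) G\<bar> \<le> sqrt (A_op P (D_op z + z) (D_op z + z)) * sqrt (A_op P G G)"
        by (rule A.cauchy_schwarz[OF D_plus_mem[OF z] GY])
      also have "\<dots> \<le> sqrt (xip z z) * sqrt (A_op P G G)"
        unfolding x using A.nonneg[OF GY] by (intro mult_right_mono) auto
      finally have 1: "\<bar>A_op P (D_op z + z) G\<bar> \<le> sqrt (xip z z) * sqrt (A_op P G G)" .
      have "norm (trace P 0 z) \<le> sqrt (xip z z)"
        unfolding x using A.nonneg[OF D_plus_mem[OF z]] by (intro real_le_rsqrt) simp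
      then have "norm u0 * norm (trace P 0 z) \<le> norm u0 * sqrt (xip z z)" by (rule mult_left_mono) simp
      then have 2: "\<bar>u0 \<bullet> trace P 0 z\<bar> \<le> norm u0 * sqrt (xip z z)"
        using Cauchy_Schwarz_ineq2[of u0 "trace P 0 z"] by linarith
      show ?thesis using 1 2 unfolding F_def by (simp add: algebra_simps)
    qed
  qed
  then obtain u where u: "u \<in> X" "\<And>z. z \<in> X \<Longrightarrow> F z = xip u z" by blast
  define v where "v = D_op u + u - G"
  define h where "h = trace P 0 u - u0"
  have vY: "v \<in> Y" unfolding v_def using D_plus_mem[OF u(1)] GY by simp
  have ann: "A_op P (D_op z + z) v + h \<bullet> trace P 0 z = 0" if z: "z \<in> X" for z
    using u(2)[OF z] xip_alt[OF u(1) z] A.sym[OF D_plus_mem[OF u(1)] D_plus_mem[OF z]]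
      A.diff_right[OF D_plus_mem[OF u(1)] GY D_plus_mem[OF z]]
    by (simp add: F_def v_def h_def inner_diff_left)
  obtain q where q: "q \<in> Y" "\<And>x. x \<in> Y \<Longrightarrow> A_op P v x = q \<bullet> x"
    using Ydual_riesz_inner[OF A_op_in_Ydual[OF vY]] by blast
  have Az: "A_op P (D_op z + z) v = yz \<bullet> v + q \<bullet> z" if "wd z yz" for z yz
  proof -
    have zX: "z \<in> X" using that by (auto simp: Xspace_iff)
    then show ?thesis
      using A.add_left[OF D_op_mem[OF zX] X_mem_Y[OF zX] vY] A_op_D_op[OF that vY]
        A.sym[OF X_mem_Y[OF zX] vY] q(2)[OF X_mem_Y[OF zX]] by simp
  qed
  have wdv: "wd v q"
    unfolding wd_iff
  proof (intro conjI allI impI vY q(1))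
    fix \<phi> \<phi>' \<zeta> assume tf: "test_function P \<phi> \<phi>'"
    note tff = test_function_facts[OF tf T_pos]
    have wdz: "wd (tens \<phi> \<zeta>) (tens \<phi>' (emb_sq \<zeta>))"
      using tf tff(4) by (intro wd_tens) (auto simp: test_function_def)
    then have "tens \<phi> \<zeta> \<in> X" by (auto simp: Xspace_iff)
    from ann[OF this] Az[OF wdz] trace_tens[OF tff(3) ends(1), of \<zeta>] tff(1)
    have "tens \<phi>' (emb_sq \<zeta>) \<bullet> v + q \<bullet> tens \<phi> \<zeta> = 0" by simp
    then show "v \<bullet> tens \<phi>' (emb_sq \<zeta>) = - (q \<bullet> tens \<phi> \<zeta>)" by (simp add: inner_commute)
  qed
  have bd: "trace P T z \<bullet> trace P T v - trace P 0 z \<bullet> trace P 0 v + h \<bullet> trace P 0 z = 0" if "wd z yz" for z yz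
    using ann[of z] Az[OF that] trace_by_parts[OF that wdv] that by (auto simp: Xspace_iff)
  \<comment> \<open>A function linear in time removes every term at time 0 from
    \<open>bd\<close>.\<close>
  have "trace P T v = 0"
  proof (rule dense_zero)
    fix \<zeta> show "trace P T v \<bullet> emb P \<zeta> = 0"
      using bd[OF wd_linear[of \<zeta>]] T_pos by (simp add: trace_linear inner_commute)
  qed
  then have "2 * (v \<bullet> q) = - (norm (trace P 0 v))\<^sup>2" using energy_identity[OF wdv] by simp
  then have "A_op P v v \<le> 0"
    using q(2)[OF vY] inner_commute[of v q] zero_le_power2[of "norm (trace P 0 v)"] by linarith
  then have v0: "v = 0" using A_definite[OF vY] A.nonneg[OF vY] by simp
  have "h = 0"
  proof (rule dense_zero)
    fix \<zeta>
    have "tens (\<lambda>_. 1) \<zeta> \<in> X" using wd_const by (auto simp: Xspace_iff)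
    from ann[OF this] show "h \<bullet> emb P \<zeta> = 0"
      using trace_tens[of "\<lambda>_. 1" 0 \<zeta>] ends v0 D_plus_mem[OF \<open>tens (\<lambda>_. 1) \<zeta> \<in> X\<close>]
      by (simp add: A.zero_right)
  qed
  then have "trace P 0 u = u0" by (simp add: h_def)
  moreover have "B_op P u = g" using v0 AG by (simp add: B_op_eq_A[OF u(1)] v_def)
  ultimately show ?thesis using u(1) by (auto simp: solves_def)
qed

lemma S_rhs_eq:
  assumes "solves P g u0 u" "z \<in> X" shows "S_rhs P g u0 z = xip u z"
proof -
  have u: "u \<in> X" "B_op P u = g" "trace P 0 u = u0" using assms by (auto simp: solves_def)
  have "A_inv P g = D_op u + u" using A_inv_B_op[OF u(1)] u(2) by simp
  then show ?thesis
    using assms(2) A.sym[OF D_plus_mem[OF u(1)] D_plus_mem[OF assms(2)]] u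
    by (simp add: S_rhs_def restr_def B_op_eq_A xip_alt)
qed

text \<open>By \<open>xip_alt\<close> the squared X-norm of a solution is the sum of the squared
  norms of its two data, so stability holds with constant 1.\<close>

lemma solves_stable:
  assumes "solves P g u0 u" "solves P g' u0' u'"
  shows "Xnorm P (u - u') \<le> Ydual_norm P (\<lambda>v. g v - g' v) + norm (u0 - u0')"
    and "0 \<le> Ydual_norm P (\<lambda>v. g v - g' v)"
proof -
  have u: "u \<in> X" "B_op P u = g" "trace P 0 u = u0" "u' \<in> X" "B_op P u' = g'" "trace P 0 u' = u0'"
    using assms by (auto simp: solves_def)
  define e where "e = u - u'"
  have e: "e \<in> X" using u by (simp add: e_def)
  have De: "D_op e + e = (D_op u + u) - (D_op u' + u')"
    unfolding e_def D_op_diff[OF u(1,4)] by simp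
  have t: "trace P 0 e = u0 - u0'" unfolding e_def trace_diff'[OF u(1,4) ends(1)] u ..
  have B: "B_op P e = (\<lambda>v. g v - g' v)"
  proof
    fix v
    show "B_op P e v = g v - g' v"
      using A.diff_left[OF D_plus_mem[OF u(1)] D_plus_mem[OF u(4)], of v] u
      by (cases "v \<in> Y") (auto simp: B_op_eq_A e De A_op_outside simp flip: u(2,5))
  qed
  define n where "n = Ydual_norm P (\<lambda>v. g v - g' v)"
  have n: "n = sqrt (A_op P (D_op e + e) (D_op e + e))"
    unfolding n_def B[symmetric]
    by (rule A.dual_norm_rep[OF _ D_plus_mem[OF e]]) (auto simp: Ynorm_def B_op_eq_A e)
  then show n0: "0 \<le> Ydual_norm P (\<lambda>v. g v - g' v)" unfolding n_def[symmetric]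
    using A.nonneg[OF D_plus_mem[OF e]] by simp
  have "xip e e = n\<^sup>2 + (norm (u0 - u0'))\<^sup>2"
    using A.nonneg[OF D_plus_mem[OF e]] by (simp add: xip_alt[OF e e] n t power2_norm_eq_inner)
  also have "\<dots> \<le> (n + norm (u0 - u0'))\<^sup>2" using n0 by (simp add: power2_sum n_def)
  finally show "Xnorm P (u - u') \<le> Ydual_norm P (\<lambda>v. g v - g' v) + norm (u0 - u0')"
    using n0 X.nonneg[OF e] unfolding e_def[symmetric] Xnorm_eq[OF e] n_def[symmetric]
    by (intro real_le_lsqrt) auto
qed

end

section \<open>The discretization\<close>

context form_on
begin

lemma projection:
  assumes "form_complete Z' a" "subspace Z'" "Z' \<subseteq> Z" "x \<in> Z"
  shows "\<exists>p\<in>Z'. \<forall>v\<in>Z'. a p v = a x v"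
proof -
  interpret Z': form_on Z' a by (rule form_on_subspace[OF assms(2,3)])
  have "\<exists>p\<in>Z'. \<forall>v\<in>Z'. a x v = a p v"
  proof (rule Z'.riesz[OF assms(1)])
    show "\<bar>a x v\<bar> \<le> sqrt (a x x) * sqrt (a v v)" if "v \<in> Z'" for v
      using cauchy_schwarz[of x v] assms that by blast
  qed (use assms in \<open>auto simp: add_right scale_right subset_iff\<close>)
  then show ?thesis by metis
qed

lemma pythagoras:
  assumes "x \<in> Z" "p \<in> Z" "v \<in> Z" "a p (p - v) = a x (p - v)"
  shows "a (x - v) (x - v) = a (x - p) (x - p) + a (p - v) (p - v)"
proof -
  have "a (x - p) (p - v) = 0" using assms by (simp add: diff_left)
  then show ?thesis using sq_add[of "x - p" "p - v"] assms by simp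
qed

text \<open>\<open>p\<close> and \<open>k\<close> represent the same functional in the two forms, so
  the mixed term \<open>a p k\<close> equals \<open>b k k\<close>. The squared gap is of first order
  in \<kappa> - 1, and \<kappa> \<le> 2 keeps the factor \<open>2 - \<kappa>\<close>
  nonnegative.\<close>

lemma precond_gap:
  assumes b: "form_on Z b" and \<kappa>: "1 \<le> \<kappa>" "\<kappa> \<le> 2"
    and bd: "\<And>v. v \<in> Z \<Longrightarrow> 1 / \<kappa> * a v v \<le> b v v" "\<And>v. v \<in> Z \<Longrightarrow> b v v \<le> \<kappa> * a v v"
    and pk: "p \<in> Z" "k \<in> Z" "\<And>v. v \<in> Z \<Longrightarrow> b k v = a p v"
  shows "a (p - k) (p - k) \<le> 2 * (\<kappa> - 1) * a p p"
proof -
  interpret b: form_on Z b by (rule b)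
  have 1: "a k k \<le> \<kappa> * b k k" using bd(1)[OF pk(2)] \<kappa> by (simp add: field_simps)
  \<comment> \<open>Cauchy-Schwarz in \<open>b\<close>, after which one factor \<open>a p p\<close>
    cancels.\<close>
  have 2: "a p p \<le> \<kappa> * b k k"
  proof (cases "a p p = 0")
    case True
    then show ?thesis using b.nonneg[OF pk(2)] \<kappa> by simp
  next
    case False
    then have pos: "a p p > 0" using nonneg[OF pk(1)] by simp
    have "(a p p)\<^sup>2 \<le> b k k * b p p" using b.cauchy_schwarz_sq[OF pk(2,1)] pk by simp
    also have "\<dots> \<le> b k k * (\<kappa> * a p p)" using bd(2)[OF pk(1)] b.nonneg[OF pk(2)] by (rule mult_left_mono)
    finally have "a p p * a p p \<le> (\<kappa> * b k k) * a p p" by (simp add: power2_eq_square ac_simps)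
    then show ?thesis using pos by (simp only: mult_le_cancel_right_pos)
  qed
  have "a (p - k) (p - k) = a p p - 2 * b k k + a k k" using sq_diff[OF pk(1,2)] pk(3)[OF pk(2)] by simp
  also have "\<dots> \<le> a p p - (2 - \<kappa>) * b k k" using 1 by (simp add: algebra_simps)
  also have "\<dots> \<le> 2 * (\<kappa> - 1) * a p p"
  proof -
    have "(2 - \<kappa>) * a p p \<le> (2 - \<kappa>) * (\<kappa> * b k k)" using 2 \<kappa> by (intro mult_left_mono) auto
    then have "(2 - \<kappa>) * a p p \<le> \<kappa> * ((2 - \<kappa>) * b k k)" by (simp add: ac_simps)
    then have "(2 - \<kappa>) * a p p / \<kappa> \<le> (2 - \<kappa>) * b k k" using \<kappa> by (simp add: field_simps)
    moreover have "a p p - (2 - \<kappa>) * a p p / \<kappa> = 2 * (\<kappa> - 1) * a p p / \<kappa>"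
      using \<kappa> by (simp add: field_simps)
    moreover have "2 * (\<kappa> - 1) * a p p / \<kappa> \<le> 2 * (\<kappa> - 1) * a p p"
      using divide_left_mono[of 1 \<kappa> "2 * (\<kappa> - 1) * a p p"] \<kappa> nonneg[OF pk(1)] by simp
    ultimately show ?thesis by linarith
  qed
  finally show ?thesis .
qed

end

text \<open>The bounds for the test preconditioner are quotients and leave out the zero vector,
  which is supplied here.\<close>

lemma dual_inv_zero:
  assumes "sym_bdd_invertible N Z K" "0 \<in> Z"
  shows "dual_inv N Z K 0 0 = 0"
proof -
  have "bij_betw K (dual_space N Z) Z" using assms(1) by (simp add: sym_bdd_invertible_def)
  then have "dual_inv N Z K 0 \<in> dual_space N Z"
    using bij_betwE[OF bij_betw_the_inv_into] assms(2) by blast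
  then have "dual_inv N Z K 0 (0 *\<^sub>R 0) = 0 * dual_inv N Z K 0 0"
    using assms(2) unfolding dual_space_def by blast
  then show ?thesis by simp
qed

lemma dual_space_subset:
  assumes "F \<in> dual_space N Z" "Z' \<subseteq> Z" "subspace Z'"
  shows "restr Z' F \<in> dual_space N Z'"
proof -
  have lin: "\<forall>v\<in>Z. \<forall>w\<in>Z. F (v + w) = F v + F w" "\<forall>c. \<forall>v\<in>Z. F (c *\<^sub>R v) = c * F v"
    using assms(1) unfolding dual_space_def by blast+
  obtain C where "\<forall>v\<in>Z. \<bar>F v\<bar> \<le> C * N v" using assms(1) unfolding dual_space_def by blast
  then have "\<forall>v\<in>Z'. \<bar>restr Z' F v\<bar> \<le> C * N v" using assms(2) by (auto simp: restr_def)
  moreover have "restr Z' F (v + w) = restr Z' F v + restr Z' F w" if "v \<in> Z'" "w \<in> Z'" for v w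
    using lin(1) subsetD[OF assms(2)] that subspace_add[OF assms(3) that] by (simp add: restr_def)
  moreover have "restr Z' F (c *\<^sub>R v) = c * restr Z' F v" if "v \<in> Z'" for v c
    using lin(2) subsetD[OF assms(2)] that subspace_scale[OF assms(3) that] by (simp add: restr_def)
  moreover have "restr Z' F v = 0" if "v \<notin> Z'" for v using that by (simp add: restr_def)
  ultimately show ?thesis unfolding dual_space_def by blast
qed

section \<open>The discrete form and its distance from the inner product of X\<close>

locale discretized = parabolic P
  for P :: "('v::{real_inner, banach, second_countable_topology},
    'h::{real_inner, banach, second_countable_topology}) evolution" +
  fixes D :: "('d, 'l, 'v, 'h) discretization" and \<kappa> k1 k2 \<zeta> m M :: real
  assumes spaces: "trial_test_spaces P D" and KY: "test_preconditioner P D \<kappa>"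
    and KX: "trial_preconditioner P D k1 k2" and sat: "saturation P D \<zeta>"
    and compl: "complement_functions P D" and stable: "stable_complement P D m M"
    and m_pos: "0 < m" and mM: "m \<le> M" and \<zeta>: "\<zeta> < 1" and k1: "0 < k1" and k12: "k1 \<le> k2"
begin

definition "\<gamma> = real_of_ereal (gamma_const P D)"
text \<open>The quantity whose smallness is assumed; \<open>del\<close> is the relative perturbation
  that it causes in \<open>st_close\<close>.\<close>

definition "q = \<kappa> / \<gamma> - 1"
definition "del = sqrt (4 * q)"

lemma trial_facts:
  "trial D \<delta> \<subseteq> X" "subspace (trial D \<delta>)" "test D \<delta> \<subseteq> Y" "subspace (test D \<delta>)"
  "trial D \<delta> \<subseteq> test D \<delta>" "trial D \<delta> \<subseteq> trial D (up D \<delta>)"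
  using spaces unfolding trial_test_spaces_def by blast+

lemma gamma_eq: "gamma_const P D = ereal \<gamma>" and gamma_pos: "0 < \<gamma>" and gamma_le: "\<gamma> \<le> 1"
proof -
  have g: "0 < gamma_const P D" "gamma_const P D \<le> 1" using spaces by (auto simp: trial_test_spaces_def)
  then show *: "gamma_const P D = ereal \<gamma>"
    unfolding \<gamma>_def by (cases "gamma_const P D") (auto simp: one_ereal_def)
  show "0 < \<gamma>" "\<gamma> \<le> 1" using g unfolding * by (auto simp: one_ereal_def)
qed

lemma kappa_ge: "1 \<le> \<kappa>" using KY by (simp add: test_preconditioner_def)

text \<open>From \<kappa> = \<gamma> (1 + q) and \<gamma> \<le> 1 \<le> \<kappa>, the single number
  \<open>q\<close> bounds the defects of both constants.\<close>

lemma q_facts: "0 \<le> q" "\<kappa> - 1 \<le> q" "1 - \<gamma> \<le> q"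
proof -
  have e: "\<kappa> = \<gamma> * (1 + q)" using gamma_pos by (simp add: q_def)
  have "\<kappa> / \<gamma> \<ge> 1" using kappa_ge gamma_pos gamma_le by (simp add: le_divide_eq)
  then show "0 \<le> q" by (simp add: q_def)
  then have "\<gamma> * (1 + q) \<le> 1 * (1 + q)" using gamma_le by (intro mult_right_mono) auto
  then show "\<kappa> - 1 \<le> q" using e by simp
  have "1 \<le> \<gamma> + \<gamma> * q" using e kappa_ge by (simp add: distrib_left)
  moreover have "\<gamma> * q \<le> 1 * q" using gamma_le \<open>0 \<le> q\<close> by (intro mult_right_mono)
  ultimately show "1 - \<gamma> \<le> q" by simp
qed

abbreviation bY :: "'d \<Rightarrow> 'v l2 \<Rightarrow> 'v l2 \<Rightarrow> real" where
  "bY \<delta> \<equiv> dual_inv (Ynorm P) (test D \<delta>) (KY D \<delta>)"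

lemma KY_inv: "sym_bdd_invertible (Ynorm P) (test D \<delta>) (KY D \<delta>)"
  using KY by (simp add: test_preconditioner_def)

lemma bY_bounds:
  assumes v: "v \<in> test D \<delta>"
  shows "1 / \<kappa> * A_op P v v \<le> bY \<delta> v v" "bY \<delta> v v \<le> \<kappa> * A_op P v v"
proof -
  have vY: "v \<in> Y" using v trial_facts(3) by blast
  have "1 / \<kappa> * A_op P v v \<le> bY \<delta> v v \<and> bY \<delta> v v \<le> \<kappa> * A_op P v v"
  proof (cases "v = 0")
    case True
    then show ?thesis
      using dual_inv_zero[OF KY_inv[of \<delta>]] subspace_0[OF trial_facts(4)[of \<delta>]] by (simp add: A.zero_left)
  next
    case False
    then have p: "A_op P v v > 0" using A_definite[OF vY] A.nonneg[OF vY] by fastforce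
    have "bY \<delta> v v / A_op P v v \<in> {1 / \<kappa>..\<kappa>}"
      using KY v False unfolding test_preconditioner_def by blast
    then have "1 / \<kappa> \<le> bY \<delta> v v / A_op P v v" "bY \<delta> v v / A_op P v v \<le> \<kappa>" by simp_all
    then show ?thesis using p by (simp add: pos_le_divide_eq pos_divide_le_eq del: divide_const_simps)
  qed
  then show "1 / \<kappa> * A_op P v v \<le> bY \<delta> v v" "bY \<delta> v v \<le> \<kappa> * A_op P v v" by blast+
qed

lemma Atest: "form_on (test D \<delta>) (A_op P)"
  by (rule A.form_on_subspace[OF trial_facts(4,3)])

lemma kappa_pos: "0 < 1 / \<kappa>" using kappa_ge by simp

lemma bY_form: "form_on (test D \<delta>) (bY \<delta>)"
  by (rule form_on.precond_form(1)[OF Atest _ KY_inv kappa_pos bY_bounds(1)]) (simp add: Ynorm_def)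

lemma test_complete: "form_complete (test D \<delta>) (A_op P)"
  by (rule form_on.precond_complete[OF Atest _ KY_inv kappa_pos bY_bounds(1) bY_bounds(2)]) (simp add: Ynorm_def)

lemma KY_facts:
  assumes "F \<in> Ydual P"
  shows "KY D \<delta> (restr (test D \<delta>) F) \<in> test D \<delta>"
    and "v \<in> test D \<delta> \<Longrightarrow> bY \<delta> (KY D \<delta> (restr (test D \<delta>) F)) v = F v"
proof -
  have r: "restr (test D \<delta>) F \<in> dual_space (Ynorm P) (test D \<delta>)"
    by (rule dual_space_subset[OF assms trial_facts(3,4)])
  show "KY D \<delta> (restr (test D \<delta>) F) \<in> test D \<delta>"
    by (rule form_on.precond_form(2)[OF Atest _ KY_inv kappa_pos bY_bounds(1) r]) (simp add: Ynorm_def)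
  have "bY \<delta> (KY D \<delta> (restr (test D \<delta>) F)) = restr (test D \<delta>) F"
    by (rule form_on.precond_form(3)[OF Atest _ KY_inv kappa_pos bY_bounds(1) r]) (simp add: Ynorm_def)
  then show "v \<in> test D \<delta> \<Longrightarrow> bY \<delta> (KY D \<delta> (restr (test D \<delta>) F)) v = F v"
    by (simp add: restr_def)
qed

text \<open>The preconditioned substitute for \<open>D_op z + z\<close>, which is what the exact
  inverse of \<open>A\<close> makes of \<open>B_op P z\<close>.\<close>

definition kz :: "'d \<Rightarrow> 'v l2 \<Rightarrow> 'v l2" where
  "kz \<delta> z = KY D (up D \<delta>) (restr (test D (up D \<delta>)) (B_op P z))"

lemma kz_mem: "z \<in> X \<Longrightarrow> kz \<delta> z \<in> test D (up D \<delta>)"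
  unfolding kz_def by (rule KY_facts(1)[OF B_op_in_Ydual])

lemma kz_mem_Y: "z \<in> X \<Longrightarrow> kz \<delta> z \<in> Y"
  using kz_mem trial_facts(3) by blast

lemma bY_kz:
  "z \<in> X \<Longrightarrow> v \<in> test D (up D \<delta>) \<Longrightarrow> bY (up D \<delta>) (kz \<delta> z) v = A_op P (D_op z + z) v"
  unfolding kz_def using KY_facts(2)[OF B_op_in_Ydual] by (simp add: B_op_eq_A)

text \<open>Symmetry moves the preconditioner from \<open>F\<close>, about which nothing discrete is
  known, to \<open>z\<close>.\<close>

lemma lift_res_eq:
  assumes F: "F \<in> Ydual P" and z: "z \<in> X"
  shows "lift_res P D \<delta> F z = F (kz \<delta> z)"
proof -
  let ?Z = "test D (up D \<delta>)"
  let ?k = "KY D (up D \<delta>) (restr ?Z F)"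
  have "lift_res P D \<delta> F z = A_op P (D_op z + z) ?k" by (simp add: lift_res_def B_op_eq_A z)
  also have "\<dots> = bY (up D \<delta>) (kz \<delta> z) ?k" by (rule bY_kz[OF z KY_facts(1)[OF F], symmetric])
  also have "\<dots> = bY (up D \<delta>) ?k (kz \<delta> z)"
    by (rule form_on.sym[OF bY_form kz_mem[OF z] KY_facts(1)[OF F]])
  also have "\<dots> = F (kz \<delta> z)" by (rule KY_facts(2)[OF F kz_mem[OF z]])
  finally show ?thesis .
qed

text \<open>The bilinear form of the discrete operator \<open>S\<close> at \<open>\<delta>\<close>, extended to all of \<open>X\<close>.\<close>

definition st :: "'d \<Rightarrow> 'v l2 \<Rightarrow> 'v l2 \<Rightarrow> real" where
  "st \<delta> w z = A_op P (D_op w + w) (kz \<delta> z) + trace P 0 w \<bullet> trace P 0 z"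

lemma st_alt:
  "w \<in> X \<Longrightarrow> z \<in> X \<Longrightarrow> st \<delta> w z = bY (up D \<delta>) (kz \<delta> w) (kz \<delta> z) + trace P 0 w \<bullet> trace P 0 z"
  by (simp add: st_def bY_kz kz_mem)

lemma st_form: "form_on X (st \<delta>)"
proof
  interpret b: form_on "test D (up D \<delta>)" "bY (up D \<delta>)" by (rule bY_form)
  show "subspace X" by (rule subspace_X)
  show "st \<delta> (u + v) w = st \<delta> u w + st \<delta> v w" if "u \<in> X" "v \<in> X" "w \<in> X" for u v w
    using A.add_left[OF D_plus_mem[OF that(1)] D_plus_mem[OF that(2)] kz_mem_Y[OF that(3), of \<delta>]] that
    by (simp add: st_def D_op_add trace_lin inner_add_left add_ac)
  show "st \<delta> (c *\<^sub>R u) v = c * st \<delta> u v" if "u \<in> X" "v \<in> X" for c u v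
    using A.scale_left[OF D_plus_mem[OF that(1)] kz_mem_Y[OF that(2), of \<delta>], of c] that
    by (simp add: st_def D_op_scaleR trace_lin scaleR_add_right distrib_left)
  show "st \<delta> u v = st \<delta> v u" if "u \<in> X" "v \<in> X" for u v
    using b.sym[OF kz_mem[OF that(1)] kz_mem[OF that(2)]] that by (simp add: st_alt inner_commute)
  show "0 \<le> st \<delta> u u" if "u \<in> X" for u
    using b.nonneg[OF kz_mem[OF that]] that by (simp add: st_alt)
qed

text \<open>On the test space the time derivative is represented by the projection \<open>p\<close>,
  so by Cauchy-Schwarz the supremum in \<open>gamma_const\<close> is at most the quotient of the
  energy norms of \<open>p\<close> and \<open>D_op z\<close>.\<close>

lemma gamma_projection:
  assumes z: "z \<in> trial D \<delta>" and p: "p \<in> test D \<delta>" "\<And>v. v \<in> test D \<delta> \<Longrightarrow> A_op P p v = A_op P (D_op z) v"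
  shows "\<gamma>\<^sup>2 * A_op P (D_op z) (D_op z) \<le> A_op P p p"
proof -
  have zX: "z \<in> X" using z trial_facts(1) by blast
  have DY: "D_op z \<in> Y" by (rule D_op_mem[OF zX])
  have pY: "p \<in> Y" using p trial_facts(3) by blast
  obtain y where y: "wd z y" using zX by (auto simp: Xspace_iff)
  have dt: "dt_op P z = A_op P (D_op z)"
    unfolding D_op_def using A_op_A_inv[OF dt_op_in_Ydual[OF y]] by simp
  show ?thesis
  proof (cases "A_op P (D_op z) (D_op z) = 0")
    case True
    then show ?thesis using A.nonneg[OF pY] by simp
  next
    case False
    define d where "d = sqrt (A_op P (D_op z) (D_op z))"
    have d: "d > 0" using False A.nonneg[OF DY] by (simp add: d_def)
    have dn: "Ydual_norm P (dt_op P z) = d"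
      unfolding dt d_def by (rule A.dual_norm_rep[OF _ DY]) (auto simp: Ynorm_def)
    have "dt_op P z (D_op z) \<noteq> 0" using False dt by simp
    then have nz: "dt_op P z \<noteq> (\<lambda>_. 0)" by auto
    have "gamma_const P D \<le> (SUP v\<in>test D \<delta> - {0}. ereal (dt_op P z v / (Ydual_norm P (dt_op P z) * Ynorm P v)))"
      unfolding gamma_const_def using z nz by (intro INF_lower2[of \<delta>] INF_lower2[of z]) auto
    also have "\<dots> \<le> ereal (sqrt (A_op P p p) / d)"
    proof (rule SUP_least)
      fix v assume v: "v \<in> test D \<delta> - {0}"
      then have vY: "v \<in> Y" using trial_facts(3) by blast
      have vp: "Ynorm P v > 0" using v A_definite[OF vY] A.nonneg[OF vY] by (auto simp: Ynorm_def less_le)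
      have "dt_op P z v = A_op P p v" using p(2)[of v] v dt by simp
      also have "\<dots> \<le> sqrt (A_op P p p) * Ynorm P v"
        using A.cauchy_schwarz[OF pY vY] by (simp add: Ynorm_def)
      finally have "dt_op P z v / (d * Ynorm P v) \<le> sqrt (A_op P p p) / d"
        using d vp by (simp add: field_simps)
      then show "ereal (dt_op P z v / (Ydual_norm P (dt_op P z) * Ynorm P v)) \<le> ereal (sqrt (A_op P p p) / d)"
        unfolding dn by simp
    qed
    finally have "\<gamma> \<le> sqrt (A_op P p p) / d" unfolding gamma_eq by simp
    then have "\<gamma> * d \<le> sqrt (A_op P p p)" using d by (simp add: field_simps)
    then have "(\<gamma> * d)\<^sup>2 \<le> (sqrt (A_op P p p))\<^sup>2" using gamma_pos d by (intro power_mono) auto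
    then show ?thesis using A.nonneg[OF pY] A.nonneg[OF DY] by (simp add: power_mult_distrib d_def)
  qed
qed

text \<open>Two orthogonal errors add up: projecting onto the test space, and preconditioning there.
  As \<open>z\<close> is itself a test function, only \<open>D_op z\<close> is really projected, and
  the inf-sup constant controls what is lost. Each error contributes \<open>2 * q\<close>.\<close>

lemma kz_close:
  assumes q1: "q \<le> 1" and z: "z \<in> trial D (up D \<delta>)"
  shows "A_op P (D_op z + z - kz \<delta> z) (D_op z + z - kz \<delta> z) \<le> 4 * q * xip z z"
proof -
  let ?Z = "test D (up D \<delta>)"
  interpret Z: form_on ?Z "A_op P" by (rule Atest)
  have zX: "z \<in> X" using z trial_facts(1) by blast
  have zZ: "z \<in> ?Z" using z trial_facts(5) by blast
  define f where "f = D_op z + z"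
  define k where "k = kz \<delta> z"
  have fY: "f \<in> Y" unfolding f_def by (rule D_plus_mem[OF zX])
  have kZ: "k \<in> ?Z" unfolding k_def by (rule kz_mem[OF zX])
  have DY: "D_op z \<in> Y" by (rule D_op_mem[OF zX])
  have ZY: "v \<in> ?Z \<Longrightarrow> v \<in> Y" for v using trial_facts(3) by blast
  obtain p where p: "p \<in> ?Z" "\<And>v. v \<in> ?Z \<Longrightarrow> A_op P p v = A_op P (D_op z) v"
    using A.projection[OF test_complete trial_facts(4,3) DY] by blast
  have pf: "A_op P (p + z) v = A_op P f v" if "v \<in> ?Z" for v
    using p that ZY DY zZ by (simp add: f_def A.add_left)
  have pzY: "p + z \<in> Y" using p(1) zZ ZY by simp
  have "A_op P (f - k) (f - k) = A_op P (f - (p + z)) (f - (p + z)) + A_op P (p + z - k) (p + z - k)"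
    using p(1) zZ kZ by (intro A.pythagoras fY pzY ZY kZ pf) auto
  moreover have "A_op P (f - (p + z)) (f - (p + z)) \<le> 2 * q * A_op P (D_op z) (D_op z)"
  proof -
    have "A_op P (D_op z - 0) (D_op z - 0) = A_op P (D_op z - p) (D_op z - p) + A_op P (p - 0) (p - 0)"
      using p by (intro A.pythagoras DY ZY) auto
    then have "A_op P (D_op z - p) (D_op z - p) = A_op P (D_op z) (D_op z) - A_op P p p" by simp
    also have "\<dots> \<le> (1 - \<gamma>\<^sup>2) * A_op P (D_op z) (D_op z)"
      using gamma_projection[OF z p] by (simp add: left_diff_distrib)
    also have "\<dots> \<le> 2 * q * A_op P (D_op z) (D_op z)"
    proof (rule mult_right_mono[OF _ A.nonneg[OF DY]])
      have "1 - \<gamma>\<^sup>2 = (1 - \<gamma>) * (1 + \<gamma>)" by (simp add: power2_eq_square algebra_simps)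
      also have "\<dots> \<le> q * 2" using q_facts gamma_le gamma_pos by (intro mult_mono) auto
      finally show "1 - \<gamma>\<^sup>2 \<le> 2 * q" by simp
    qed
    finally show ?thesis by (simp add: f_def)
  qed
  moreover have "A_op P (p + z - k) (p + z - k) \<le> 2 * (\<kappa> - 1) * A_op P (p + z) (p + z)"
  proof (rule Z.precond_gap[OF bY_form])
    show "1 \<le> \<kappa>" "\<kappa> \<le> 2" using kappa_ge q_facts(2) q1 by auto
    show "bY (up D \<delta>) k v = A_op P (p + z) v" if "v \<in> ?Z" for v
      using bY_kz[OF zX that] pf[OF that] by (simp add: k_def f_def)
  qed (use bY_bounds p zZ kZ in auto)
  moreover have "2 * (\<kappa> - 1) * A_op P (p + z) (p + z) \<le> 2 * q * A_op P f f"
  proof -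
    have "A_op P (f - 0) (f - 0) = A_op P (f - (p + z)) (f - (p + z)) + A_op P (p + z - 0) (p + z - 0)"
      using p(1) zZ by (intro A.pythagoras fY pzY pf) auto
    then have "A_op P (p + z) (p + z) \<le> A_op P f f"
      using A.nonneg[of "f - (p + z)"] fY pzY by simp
    then show ?thesis using q_facts(2) kappa_ge A.nonneg[OF pzY] by (intro mult_mono) auto
  qed
  moreover have "A_op P (D_op z) (D_op z) \<le> xip z z"
    using A.nonneg[OF X_mem_Y[OF zX]] by (simp add: xip_def)
  moreover have "A_op P f f \<le> xip z z" by (simp add: xip_alt[OF zX zX] f_def)
  ultimately have "A_op P (f - k) (f - k) \<le> 2 * q * xip z z + 2 * q * xip z z"
    using q_facts(1) by (smt (verit) mult_left_mono)
  also have "\<dots> = 4 * q * xip z z" by simp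
  finally show ?thesis unfolding f_def k_def .
qed

text \<open>Only \<open>z\<close> has to be discrete; \<open>w\<close> enters by Cauchy-Schwarz and
  can be an exact error.\<close>

lemma st_close:
  assumes q1: "q \<le> 1" and w: "w \<in> X" and z: "z \<in> trial D (up D \<delta>)"
  shows "\<bar>xip w z - st \<delta> w z\<bar> \<le> del * Xnorm P w * Xnorm P z"
proof -
  have zX: "z \<in> X" using z trial_facts(1) by blast
  let ?g = "D_op z + z - kz \<delta> z"
  have gY: "?g \<in> Y" using D_plus_mem[OF zX] kz_mem_Y[OF zX] by simp
  have "xip w z - st \<delta> w z = A_op P (D_op w + w) ?g"
    using A.diff_right[OF D_plus_mem[OF zX] kz_mem_Y[OF zX] D_plus_mem[OF w]]
    by (simp add: xip_alt[OF w zX] st_def)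
  also have "\<bar>\<dots>\<bar> \<le> sqrt (A_op P (D_op w + w) (D_op w + w)) * sqrt (A_op P ?g ?g)"
    by (rule A.cauchy_schwarz[OF D_plus_mem[OF w] gY])
  also have "\<dots> \<le> Xnorm P w * sqrt (4 * q * xip z z)"
    unfolding Xnorm_eq[OF w] using X.nonneg[OF w] A.nonneg[OF gY] kz_close[OF q1 z]
    by (intro mult_mono real_sqrt_le_mono) (auto simp: xip_alt[OF w w])
  also have "\<dots> = del * Xnorm P w * Xnorm P z"
    unfolding Xnorm_eq[OF zX] del_def real_sqrt_mult by simp
  finally show ?thesis .
qed

end

lemma in_span_image_finite:
  assumes "finite I" "y \<in> span (f ` I)"
  shows "\<exists>c. y = (\<Sum>i\<in>I. c i *\<^sub>R f i)"
proof -
  have "span (f ` I) \<subseteq> {y. \<exists>c. y = (\<Sum>i\<in>I. c i *\<^sub>R f i)}"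
  proof (rule span_minimal)
    show "f ` I \<subseteq> {y. \<exists>c. y = (\<Sum>i\<in>I. c i *\<^sub>R f i)}"
    proof
      fix y assume "y \<in> f ` I"
      then obtain j where j: "j \<in> I" "y = f j" by blast
      have "(\<Sum>i\<in>I. (if i = j then 1 else 0) *\<^sub>R f i) = (\<Sum>i\<in>I. if i = j then f i else 0)"
        by (rule sum.cong) auto
      also have "\<dots> = f j" using j assms(1) by simp
      finally have "y = (\<Sum>i\<in>I. (if i = j then 1 else 0) *\<^sub>R f i)" using j(2) by simp
      then show "y \<in> {y. \<exists>c. y = (\<Sum>i\<in>I. c i *\<^sub>R f i)}"
        by (intro CollectI exI[of _ "\<lambda>i. if i = j then 1 else 0"])
    qed
    show "subspace {y. \<exists>c. y = (\<Sum>i\<in>I. c i *\<^sub>R f i)}"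
    proof (rule subspaceI)
      show "0 \<in> {y. \<exists>c. y = (\<Sum>i\<in>I. c i *\<^sub>R f i)}"
        by (intro CollectI exI[of _ "\<lambda>_. 0"]) simp
      fix x y assume "x \<in> {y. \<exists>c. y = (\<Sum>i\<in>I. c i *\<^sub>R f i)}" "y \<in> {y. \<exists>c. y = (\<Sum>i\<in>I. c i *\<^sub>R f i)}"
      then obtain c d where "x = (\<Sum>i\<in>I. c i *\<^sub>R f i)" "y = (\<Sum>i\<in>I. d i *\<^sub>R f i)" by blast
      then show "x + y \<in> {y. \<exists>c. y = (\<Sum>i\<in>I. c i *\<^sub>R f i)}"
        by (intro CollectI exI[of _ "\<lambda>i. c i + d i"]) (simp add: scaleR_add_left sum.distrib)
    next
      fix r x assume "x \<in> {y. \<exists>c. y = (\<Sum>i\<in>I. c i *\<^sub>R f i)}"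
      then obtain c where "x = (\<Sum>i\<in>I. c i *\<^sub>R f i)" by blast
      then show "r *\<^sub>R x \<in> {y. \<exists>c. y = (\<Sum>i\<in>I. c i *\<^sub>R f i)}"
        by (intro CollectI exI[of _ "\<lambda>i. r * c i"]) (simp add: scaleR_sum_right)
    qed
  qed
  then show ?thesis using assms(2) by blast
qed

context form_on
begin

lemma sum_mem: "(\<And>i. i \<in> I \<Longrightarrow> f i \<in> Z) \<Longrightarrow> (\<Sum>i\<in>I. c i *\<^sub>R f i) \<in> Z"
  using sub by (intro subspace_sum subspace_scale)

lemma sum_right:
  assumes "w \<in> Z" "\<And>i. i \<in> I \<Longrightarrow> f i \<in> Z"
  shows "a w (\<Sum>i\<in>I. c i *\<^sub>R f i) = (\<Sum>i\<in>I. c i * a w (f i))"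
  using assms(2)
proof (induction I rule: infinite_finite_induct)
  case (insert x I)
  have "(\<Sum>i\<in>I. c i *\<^sub>R f i) \<in> Z" by (rule sum_mem) (use insert in auto)
  then show ?case using insert assms(1) by (simp add: add_right scale_right)
qed (auto simp: zero_right assms(1))

end

section \<open>Trial spaces, their preconditioner and the complement functions\<close>

context discretized
begin

lemma Xtrial: "form_on (trial D \<delta>) xip"
  by (rule X.form_on_subspace[OF trial_facts(2,1)])

lemma trial_X: "z \<in> trial D \<delta> \<Longrightarrow> z \<in> X"
  using trial_facts(1) by blast

abbreviation bX :: "'d \<Rightarrow> 'v l2 \<Rightarrow> 'v l2 \<Rightarrow> real" where
  "bX \<delta> \<equiv> dual_inv (Xnorm P) (trial D \<delta>) (KX D \<delta>)"

lemma KX_inv: "sym_bdd_invertible (Xnorm P) (trial D \<delta>) (KX D \<delta>)"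
  using KX unfolding trial_preconditioner_def by blast

lemma bX_bounds:
  assumes "v \<in> trial D \<delta>" shows "k1 * xip v v \<le> bX \<delta> v v" "bX \<delta> v v \<le> k2 * xip v v"
  using KX assms Xnorm_sq[OF trial_X[OF assms]] unfolding trial_preconditioner_def by metis+

lemma bX_form: "form_on (trial D \<delta>) (bX \<delta>)"
  by (rule form_on.precond_form(1)[OF Xtrial _ KX_inv k1 bX_bounds(1)]) (rule Xnorm_eq[OF trial_X])

lemma trial_complete: "form_complete (trial D \<delta>) xip"
  by (rule form_on.precond_complete[OF Xtrial _ KX_inv k1 bX_bounds(1) bX_bounds(2)]) (rule Xnorm_eq[OF trial_X])

lemma KX_facts:
  assumes "F \<in> dual_space (Xnorm P) (trial D \<delta>)"
  shows "KX D \<delta> F \<in> trial D \<delta>" "bX \<delta> (KX D \<delta> F) = F"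
proof -
  show "KX D \<delta> F \<in> trial D \<delta>"
    by (rule form_on.precond_form(2)[OF Xtrial _ KX_inv k1 bX_bounds(1) assms]) (rule Xnorm_eq[OF trial_X])
  show "bX \<delta> (KX D \<delta> F) = F"
    by (rule form_on.precond_form(3)[OF Xtrial _ KX_inv k1 bX_bounds(1) assms]) (rule Xnorm_eq[OF trial_X])
qed

lemma compl_facts:
  "finite (ind D \<delta>)" "l \<in> ind D \<delta> \<Longrightarrow> compl_fun D \<delta> l \<in> trial D (up D \<delta>)"
proof -
  have c: "{z + y |z y. z \<in> trial D \<delta> \<and> y \<in> span (compl_fun D \<delta> ` ind D \<delta>)} = trial D (up D \<delta>)"
    and "finite (ind D \<delta>)" using compl unfolding complement_functions_def by blast+
  then show "finite (ind D \<delta>)" by blast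
  assume "l \<in> ind D \<delta>"
  then have "0 + compl_fun D \<delta> l \<in> {z + y |z y. z \<in> trial D \<delta> \<and> y \<in> span (compl_fun D \<delta> ` ind D \<delta>)}"
    using subspace_0[OF trial_facts(2)[of \<delta>]] by (blast intro: span_base)
  then show "compl_fun D \<delta> l \<in> trial D (up D \<delta>)" using c by simp
qed

lemma compl_X: "l \<in> ind D \<delta> \<Longrightarrow> compl_fun D \<delta> l \<in> X"
  using compl_facts(2) trial_X by blast

lemma decompose:
  assumes "y \<in> trial D (up D \<delta>)"
  obtains z c where "z \<in> trial D \<delta>" "y = z + (\<Sum>l\<in>ind D \<delta>. c l *\<^sub>R compl_fun D \<delta> l)"
proof -
  have "y \<in> {z + y |z y. z \<in> trial D \<delta> \<and> y \<in> span (compl_fun D \<delta> ` ind D \<delta>)}"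
    using compl assms unfolding complement_functions_def by blast
  then show thesis using that in_span_image_finite[OF compl_facts(1)] by blast
qed

lemma stable_bounds:
  assumes "z \<in> trial D \<delta>"
  shows "m\<^sup>2 * (Xnorm P (z + (\<Sum>l\<in>ind D \<delta>. c l *\<^sub>R compl_fun D \<delta> l)))\<^sup>2 \<le> (Xnorm P z)\<^sup>2 + (L2_set c (ind D \<delta>))\<^sup>2"
    and "(Xnorm P z)\<^sup>2 + (L2_set c (ind D \<delta>))\<^sup>2 \<le> M\<^sup>2 * (Xnorm P (z + (\<Sum>l\<in>ind D \<delta>. c l *\<^sub>R compl_fun D \<delta> l)))\<^sup>2"
  using stable assms unfolding stable_complement_def Let_def by blast+

lemma Xnorm_nonneg: "w \<in> X \<Longrightarrow> 0 \<le> Xnorm P w"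
  using X.nonneg by (simp add: Xnorm_eq)

lemma X_cauchy_schwarz: "w \<in> X \<Longrightarrow> z \<in> X \<Longrightarrow> \<bar>xip w z\<bar> \<le> Xnorm P w * Xnorm P z"
  using X.cauchy_schwarz by (simp add: Xnorm_eq)

lemma Xnorm_triangle:
  "u \<in> X \<Longrightarrow> v \<in> X \<Longrightarrow> w \<in> X \<Longrightarrow> Xnorm P (u - w) \<le> Xnorm P (u - v) + Xnorm P (v - w)"
  using X.norm_triangle_diff[of u v w] by (simp add: Xnorm_eq)

lemma Xnorm_minus: "u \<in> X \<Longrightarrow> v \<in> X \<Longrightarrow> Xnorm P (u - v) = Xnorm P (v - u)"
  using X.norm_minus[of u v] by (simp add: Xnorm_eq)

lemma trial_projection:
  assumes "x \<in> X"
  obtains p where "p \<in> trial D \<delta>" "\<And>v. v \<in> trial D \<delta> \<Longrightarrow> xip p v = xip x v"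
    "\<And>w. w \<in> trial D \<delta> \<Longrightarrow> (Xnorm P (x - w))\<^sup>2 = (Xnorm P (x - p))\<^sup>2 + (Xnorm P (p - w))\<^sup>2"
proof -
  obtain p where p: "p \<in> trial D \<delta>" "\<And>v. v \<in> trial D \<delta> \<Longrightarrow> xip p v = xip x v"
    using X.projection[OF trial_complete trial_facts(2,1) assms] by blast
  have "(Xnorm P (x - w))\<^sup>2 = (Xnorm P (x - p))\<^sup>2 + (Xnorm P (p - w))\<^sup>2" if "w \<in> trial D \<delta>" for w
    using X.pythagoras[OF assms trial_X[OF p(1)] trial_X[OF that]] p subspace_diff[OF trial_facts(2) p(1) that]
      assms trial_X[OF p(1)] trial_X[OF that]
    by (simp add: Xnorm_sq)
  then show thesis using that p by blast
qed

lemma B_op_diff: "u \<in> X \<Longrightarrow> w \<in> X \<Longrightarrow> (\<lambda>v. B_op P u v - B_op P w v) = B_op P (u - w)"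
proof
  fix v assume u: "u \<in> X" "w \<in> X"
  have "D_op (u - w) + (u - w) = (D_op u + u) - (D_op w + w)"
    unfolding D_op_diff[OF u] by simp
  then have e: "B_op P (u - w) = A_op P ((D_op u + u) - (D_op w + w))"
    using B_op_eq_A[OF X.mem(4)[OF u]] by (simp only:)
  show "B_op P u v - B_op P w v = B_op P (u - w) v"
  proof (cases "v \<in> Y")
    case True
    then show ?thesis
      unfolding e B_op_eq_A[OF u(1)] B_op_eq_A[OF u(2)]
      by (rule A.diff_left[OF D_plus_mem[OF u(1)] D_plus_mem[OF u(2)], symmetric])
  qed (simp add: e B_op_eq_A u A_op_outside)
qed

end

section \<open>Error estimation with approximate data\<close>

locale approximated = discretized P D \<kappa> k1 k2 \<zeta> m M
  for P :: "('v::{real_inner, banach, second_countable_topology},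
    'h::{real_inner, banach, second_countable_topology}) evolution"
    and D :: "('d, 'l, 'v, 'h) discretization" and \<kappa> k1 k2 \<zeta> m M +
  fixes dat :: "('d, 'v, 'h) data" and u :: "'v l2"
  assumes adm: "admissible_data P D dat" and sol: "solves P (rhs dat) (ini dat) u"
    and q_small: "q \<le> 1 / 16"
begin

lemma q1: "q \<le> 1" using q_small by simp

lemma del_facts: "0 \<le> del" "del \<le> 1 / 2" "del\<^sup>2 = 4 * q"
proof -
  show "0 \<le> del" "del\<^sup>2 = 4 * q" using q_facts(1) by (auto simp: del_def)
  have "del \<le> sqrt ((1/2)\<^sup>2)" unfolding del_def using q_small
    by (intro real_sqrt_le_mono) (simp add: power2_eq_square)
  then show "del \<le> 1 / 2" by simp
qed

lemma uX: "u \<in> X" using sol by (simp add: solves_def)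

text \<open>The exact solution for the approximate data at \<delta>. Saturation and the computable
  residuals refer to it rather than to \<open>u\<close>.\<close>

definition "uh \<delta> = (SOME v. solves P (rhs_appr dat \<delta>) (ini_appr dat \<delta>) v)"

lemma data_facts:
  "rhs_appr dat \<delta> \<in> Gdat D \<delta>" "ini_appr dat \<delta> \<in> Udat D \<delta>" "rhs_appr dat \<delta> \<in> Ydual P"
  "Ydual_norm P (\<lambda>v. rhs dat v - rhs_appr dat \<delta> v) + norm (ini dat - ini_appr dat \<delta>) \<le> osc dat \<delta>"
  using adm sat unfolding admissible_data_def saturation_def by blast+

lemma uh_solves: "solves P (rhs_appr dat \<delta>) (ini_appr dat \<delta>) (uh \<delta>)"
  unfolding uh_def using well_posed[OF data_facts(3)] by (rule someI_ex)

lemma uh_X: "uh \<delta> \<in> X" and uh_B: "B_op P (uh \<delta>) = rhs_appr dat \<delta>" and uh_trace: "trace P 0 (uh \<delta>) = ini_appr dat \<delta>"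
  using uh_solves[of \<delta>] by (auto simp: solves_def)

lemma uh_error: "Xnorm P (u - uh \<delta>) \<le> osc dat \<delta>"
  using solves_stable(1)[OF sol uh_solves[of \<delta>]] data_facts(4)[of \<delta>] by linarith

lemma osc_nonneg: "0 \<le> osc dat \<delta>"
  using uh_error[of \<delta>] Xnorm_nonneg[of "u - uh \<delta>"] uX uh_X[of \<delta>] by simp

lemma osc_mono: "trial D \<delta> \<subseteq> trial D \<delta>' \<Longrightarrow> osc dat \<delta>' \<le> osc dat \<delta>"
  using adm unfolding admissible_data_def by blast

lemma st_bound:
  assumes "w \<in> X" "z \<in> trial D (up D \<delta>)"
  shows "\<bar>st \<delta> w z\<bar> \<le> 2 * Xnorm P w * Xnorm P z"
proof -
  have "del * Xnorm P w * Xnorm P z \<le> 1 * Xnorm P w * Xnorm P z"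
    using del_facts assms trial_X Xnorm_nonneg by (intro mult_right_mono) auto
  then show ?thesis
    using st_close[OF q1 assms] X_cauchy_schwarz[OF assms(1) trial_X[OF assms(2)]] by linarith
qed

sublocale st: form_on X "st \<delta>" for \<delta> by (rule st_form)

text \<open>The approximate data are the image under \<open>B_op\<close> and the initial trace of
  \<open>uh \<delta>\<close>, so the computable residual is the discrete form applied to the unknown
  error.\<close>

lemma residual_eq:
  assumes "w \<in> X" "l \<in> ind D \<delta>"
  shows "residual_vec P D dat \<delta> w l = st \<delta> (uh \<delta> - w) (compl_fun D \<delta> l)"
proof -
  have d: "uh \<delta> - w \<in> X" using uh_X assms by simp
  have "(\<lambda>v. rhs_appr dat \<delta> v - B_op P w v) = B_op P (uh \<delta> - w)"
    using B_op_diff[OF uh_X assms(1), of \<delta>] by (simp add: uh_B)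
  then show ?thesis
    using lift_res_eq[OF B_op_in_Ydual[OF d] compl_X[OF assms(2)]] trace_diff'[OF uh_X assms(1) ends(1), of \<delta>]
    by (simp add: residual_vec_def st_def B_op_eq_A d uh_trace)
qed

lemma disc_res_eq:
  assumes "w \<in> X"
  shows "(\<lambda>z. f_disc P D dat \<delta> z - S_disc P D \<delta> w z) = restr (trial D \<delta>) (st \<delta> (uh \<delta> - w))"
proof
  fix z
  have d: "uh \<delta> - w \<in> X" using uh_X assms by simp
  show "f_disc P D dat \<delta> z - S_disc P D \<delta> w z = restr (trial D \<delta>) (st \<delta> (uh \<delta> - w)) z"
  proof (cases "z \<in> trial D \<delta>")
    case True
    then have z: "z \<in> X" by (rule trial_X)
    have "f_disc P D dat \<delta> z = st \<delta> (uh \<delta>) z"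
      using True lift_res_eq[OF data_facts(3) z, of \<delta>]
      by (simp add: f_disc_def restr_def st_def uh_trace flip: B_op_eq_A[OF uh_X] uh_B)
    moreover have "S_disc P D \<delta> w z = st \<delta> w z"
      using True lift_res_eq[OF B_op_in_Ydual[OF assms] z, of \<delta>]
      by (simp add: S_disc_def restr_def st_def B_op_eq_A assms)
    ultimately show ?thesis using True st.diff_left[OF uh_X assms z] by (simp add: restr_def)
  qed (simp add: f_disc_def S_disc_def restr_def)
qed

text \<open>The trial preconditioner is specified on bounded functionals, so the residual must be
  shown to be one before \<open>est\<close> can be analysed.\<close>

lemma disc_res_dual:
  assumes "e \<in> X" shows "restr (trial D \<delta>) (st \<delta> e) \<in> dual_space (Xnorm P) (trial D \<delta>)"
proof -
  have "\<bar>restr (trial D \<delta>) (st \<delta> e) v\<bar> \<le> (2 * Xnorm P e) * Xnorm P v" if "v \<in> trial D \<delta>" for v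
    using st_bound[OF assms, of v \<delta>] that trial_facts(6) by (auto simp: restr_def)
  then have 1: "\<exists>C. \<forall>v\<in>trial D \<delta>. \<bar>restr (trial D \<delta>) (st \<delta> e) v\<bar> \<le> C * Xnorm P v" by blast
  have 2: "restr (trial D \<delta>) (st \<delta> e) (v + w) = restr (trial D \<delta>) (st \<delta> e) v + restr (trial D \<delta>) (st \<delta> e) w"
    if "v \<in> trial D \<delta>" "w \<in> trial D \<delta>" for v w
    using subspace_add[OF trial_facts(2) that] that trial_X assms by (simp add: restr_def st.add_right)
  have 3: "restr (trial D \<delta>) (st \<delta> e) (c *\<^sub>R v) = c * restr (trial D \<delta>) (st \<delta> e) v"
    if "v \<in> trial D \<delta>" for v c
    using subspace_scale[OF trial_facts(2) that, of c] that trial_X assms by (simp add: restr_def st.scale_right)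
  have 4: "restr (trial D \<delta>) (st \<delta> e) v = 0" if "v \<notin> trial D \<delta>" for v using that by (simp add: restr_def)
  show ?thesis unfolding dual_space_def using 1 2 3 4 by blast
qed

abbreviation "est \<delta> w \<equiv> alg_est P D dat \<delta> w"
abbreviation "res \<delta> w \<equiv> L2_set (residual_vec P D dat \<delta> w) (ind D \<delta>)"
abbreviation "err \<delta> w \<equiv> Xnorm P (uh \<delta> - w)"

text \<open>\<open>est\<close> is the norm, in the form of the preconditioner, of the representer
  \<open>x\<close> of the discrete residual. Testing the residual with \<open>x\<close> bounds
  \<open>est\<close> by the error, and Cauchy-Schwarz in that form bounds the residual by
  \<open>est\<close>.\<close>

lemma est_facts:
  assumes w: "w \<in> X"
  shows "0 \<le> est \<delta> w" "est \<delta> w \<le> 2 / sqrt k1 * err \<delta> w"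
    "z \<in> trial D \<delta> \<Longrightarrow> \<bar>st \<delta> (uh \<delta> - w) z\<bar> \<le> sqrt k2 * est \<delta> w * Xnorm P z"
proof -
  define e where "e = uh \<delta> - w"
  have eX: "e \<in> X" using uh_X w by (simp add: e_def)
  define F where "F = restr (trial D \<delta>) (st \<delta> e)"
  have Fd: "F \<in> dual_space (Xnorm P) (trial D \<delta>)" unfolding F_def by (rule disc_res_dual[OF eX])
  define x where "x = KX D \<delta> F"
  interpret b: form_on "trial D \<delta>" "bX \<delta>" by (rule bX_form)
  have x: "x \<in> trial D \<delta>" "bX \<delta> x = F" unfolding x_def using KX_facts[OF Fd] by auto
  have t: "est \<delta> w = sqrt (bX \<delta> x x)"
    unfolding alg_est_def disc_res_eq[OF w] e_def[symmetric] F_def[symmetric] Let_def x_def[symmetric] x(2) ..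
  show t0: "0 \<le> est \<delta> w" unfolding t using b.nonneg[OF x(1)] by simp
  have t2: "(est \<delta> w)\<^sup>2 = bX \<delta> x x" unfolding t using b.nonneg[OF x(1)] by simp
  have sx: "st \<delta> e x = bX \<delta> x x" using x by (simp add: F_def restr_def)
  have xn: "sqrt k1 * Xnorm P x \<le> est \<delta> w"
    using real_sqrt_le_mono[OF bX_bounds(1)[OF x(1)]] by (simp add: t real_sqrt_mult Xnorm_eq[OF trial_X[OF x(1)]])
  have "x \<in> trial D (up D \<delta>)" using x(1) trial_facts(6) by blast
  from st_bound[OF eX this] have "(est \<delta> w)\<^sup>2 \<le> 2 * err \<delta> w * Xnorm P x" unfolding t2 sx[symmetric] e_def by linarith
  also have "\<dots> \<le> 2 * err \<delta> w * (est \<delta> w / sqrt k1)"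
    using xn k1 Xnorm_nonneg[OF eX] by (intro mult_left_mono) (auto simp: e_def field_simps)
  finally have "est \<delta> w * est \<delta> w \<le> (2 / sqrt k1 * err \<delta> w) * est \<delta> w"
    by (simp add: power2_eq_square ac_simps)
  then show "est \<delta> w \<le> 2 / sqrt k1 * err \<delta> w"
  proof (cases "est \<delta> w = 0")
    case False
    then have "est \<delta> w > 0" using t0 by simp
    then show ?thesis
      using \<open>est \<delta> w * est \<delta> w \<le> (2 / sqrt k1 * err \<delta> w) * est \<delta> w\<close> by (rule mult_right_le_imp_le[rotated])
  qed (use k1 Xnorm_nonneg[OF eX] in \<open>simp add: e_def\<close>)
  assume z: "z \<in> trial D \<delta>"
  have "\<bar>st \<delta> e z\<bar> = \<bar>bX \<delta> x z\<bar>" using x z by (simp add: F_def restr_def)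
  also have "\<dots> \<le> est \<delta> w * sqrt (bX \<delta> z z)" unfolding t by (rule b.cauchy_schwarz[OF x(1) z])
  also have "\<dots> \<le> est \<delta> w * sqrt (k2 * xip z z)" using t0 bX_bounds(2)[OF z] by (intro mult_left_mono) auto
  also have "\<dots> = sqrt k2 * est \<delta> w * Xnorm P z" by (simp add: real_sqrt_mult Xnorm_eq[OF trial_X[OF z]])
  finally show "\<bar>st \<delta> (uh \<delta> - w) z\<bar> \<le> sqrt k2 * est \<delta> w * Xnorm P z" unfolding e_def .
qed

lemma compl_sum_mem: "(\<Sum>l\<in>ind D \<delta>. c l *\<^sub>R compl_fun D \<delta> l) \<in> trial D (up D \<delta>)"
  by (intro subspace_sum subspace_scale trial_facts(2) compl_facts(2))

lemma st_compl_sum: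
  assumes "w \<in> X"
  shows "st \<delta> (uh \<delta> - w) (\<Sum>l\<in>ind D \<delta>. c l *\<^sub>R compl_fun D \<delta> l) = (\<Sum>l\<in>ind D \<delta>. c l * residual_vec P D dat \<delta> w l)"
  using st.sum_right[of "uh \<delta> - w" "ind D \<delta>" "compl_fun D \<delta>" \<delta> c] uh_X assms compl_X
  by (simp add: residual_eq)

lemma compl_sum_norm: "m * Xnorm P (\<Sum>l\<in>ind D \<delta>. c l *\<^sub>R compl_fun D \<delta> l) \<le> L2_set c (ind D \<delta>)"
proof -
  have "(m * Xnorm P (\<Sum>l\<in>ind D \<delta>. c l *\<^sub>R compl_fun D \<delta> l))\<^sup>2 \<le> (L2_set c (ind D \<delta>))\<^sup>2"
    using stable_bounds(1)[OF subspace_0[OF trial_facts(2)[of \<delta>]], of c] Xnorm_sq[of 0] X.zero_left[of 0]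
    by (simp add: power_mult_distrib)
  then show ?thesis by (rule power2_le_imp_le) simp
qed

text \<open>Taken as coefficients of the complement functions, the residual vector yields a test
  function at which the discrete form is its squared length.\<close>

lemma res_le: assumes w: "w \<in> X" shows "res \<delta> w \<le> 2 / m * err \<delta> w"
proof -
  let ?r = "residual_vec P D dat \<delta> w"
  let ?y = "\<Sum>l\<in>ind D \<delta>. ?r l *\<^sub>R compl_fun D \<delta> l"
  have e: "uh \<delta> - w \<in> X" using uh_X w by simp
  have "(res \<delta> w)\<^sup>2 = st \<delta> (uh \<delta> - w) ?y"
    unfolding st_compl_sum[OF w] L2_set_def by (simp add: power2_eq_square sum_nonneg)
  also have "\<dots> \<le> 2 * err \<delta> w * Xnorm P ?y" using st_bound[OF e compl_sum_mem] by (rule abs_le_D1)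
  also have "\<dots> \<le> 2 * err \<delta> w * (res \<delta> w / m)"
    using compl_sum_norm[of ?r \<delta>] m_pos Xnorm_nonneg[OF e] by (intro mult_left_mono) (auto simp: field_simps)
  finally have le: "res \<delta> w * res \<delta> w \<le> (2 / m * err \<delta> w) * res \<delta> w" by (simp add: power2_eq_square ac_simps)
  show ?thesis
  proof (cases "res \<delta> w = 0")
    case False
    then have "res \<delta> w > 0" using L2_set_nonneg[of ?r "ind D \<delta>"] by linarith
    with le show ?thesis by (rule mult_right_le_imp_le)
  qed (use m_pos Xnorm_nonneg[OF e] in simp)
qed

text \<open>By Pythagoras, the least fraction of the error that the larger trial space can see. A
  negative \<zeta> is cut off before squaring.\<close>

definition "z0 = sqrt (1 - (max \<zeta> 0)\<^sup>2)"

lemma z0_pos: "0 < z0" "z0 \<le> 1"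
proof -
  have "(max \<zeta> 0)\<^sup>2 < 1" using \<zeta> by (simp add: power_less_one_iff abs_square_less_1)
  then show "0 < z0" "z0 \<le> 1" by (auto simp: z0_def)
qed

lemma galerkinI:
  assumes "p \<in> trial D \<delta>'" "\<And>v. v \<in> trial D \<delta>' \<Longrightarrow> xip p v = xip (uh \<delta>) v"
  shows "galerkin P D \<delta>' (rhs_appr dat \<delta>) (ini_appr dat \<delta>) p"
  unfolding galerkin_def using assms S_op_eq S_rhs_eq[OF uh_solves[of \<delta>]] trial_X by simp

text \<open>By saturation the correction \<open>y\<close> towards the Galerkin solution in the
  larger space carries at least the fraction \<open>z0\<close> of the error. Its component in the
  trial space is measured by \<open>est\<close>, the other by the residual vector, and
  \<open>del \<le> z0 / 2\<close> allows the perturbation to be absorbed.\<close>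

lemma err_le:
  assumes w: "w \<in> trial D \<delta>" and del: "del \<le> z0 / 2"
  shows "err \<delta> w \<le> 2 * M / z0 * (1 + sqrt k2) * (res \<delta> w + est \<delta> w)"
proof -
  let ?r = "residual_vec P D dat \<delta> w"
  have wX: "w \<in> X" using w by (rule trial_X)
  have eX: "uh \<delta> - w \<in> X" using uh_X wX by simp
  obtain p0 where p0: "p0 \<in> trial D \<delta>" "\<And>v. v \<in> trial D \<delta> \<Longrightarrow> xip p0 v = xip (uh \<delta>) v"
    "\<And>w. w \<in> trial D \<delta> \<Longrightarrow> (Xnorm P (uh \<delta> - w))\<^sup>2 = (Xnorm P (uh \<delta> - p0))\<^sup>2 + (Xnorm P (p0 - w))\<^sup>2"
    using trial_projection[OF uh_X] by blast
  obtain p1 where p1: "p1 \<in> trial D (up D \<delta>)" "\<And>v. v \<in> trial D (up D \<delta>) \<Longrightarrow> xip p1 v = xip (uh \<delta>) v"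
    "\<And>w. w \<in> trial D (up D \<delta>) \<Longrightarrow> (Xnorm P (uh \<delta> - w))\<^sup>2 = (Xnorm P (uh \<delta> - p1))\<^sup>2 + (Xnorm P (p1 - w))\<^sup>2"
    using trial_projection[OF uh_X] by blast
  have d: "uh \<delta> - p0 \<in> X" "uh \<delta> - p1 \<in> X" using uh_X trial_X p0(1) p1(1) by auto
  \<comment> \<open>Saturation for the data at \<delta>; the later passage from \<open>p0\<close> to
    \<open>w\<close> uses that \<open>p0\<close> is the best approximation.\<close>
  have "Xnorm P (uh \<delta> - p1) \<le> \<zeta> * Xnorm P (uh \<delta> - p0)"
    using sat data_facts(1,2)[of \<delta>] uh_solves[of \<delta>] galerkinI[OF p0(1,2)] galerkinI[OF p1(1,2)]
    unfolding saturation_def by blast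
  also have "\<dots> \<le> max \<zeta> 0 * Xnorm P (uh \<delta> - p0)" using Xnorm_nonneg[OF d(1)] by (intro mult_right_mono) auto
  also have "\<dots> \<le> max \<zeta> 0 * err \<delta> w"
  proof (rule mult_left_mono)
    have "(Xnorm P (uh \<delta> - p0))\<^sup>2 \<le> (err \<delta> w)\<^sup>2" using p0(3)[OF w] by simp
    then show "Xnorm P (uh \<delta> - p0) \<le> err \<delta> w" using Xnorm_nonneg[OF eX] by (rule power2_le_imp_le)
  qed simp
  finally have "(Xnorm P (uh \<delta> - p1))\<^sup>2 \<le> (max \<zeta> 0 * err \<delta> w)\<^sup>2"
    using Xnorm_nonneg[OF d(2)] by (intro power_mono)
  moreover define y where "y = p1 - w"
  have wup: "w \<in> trial D (up D \<delta>)" using w trial_facts(6) by blast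
  have yt: "y \<in> trial D (up D \<delta>)" unfolding y_def by (rule subspace_diff[OF trial_facts(2) p1(1) wup])
  have yX: "y \<in> X" using yt by (rule trial_X)
  ultimately have "(z0 * err \<delta> w)\<^sup>2 \<le> (Xnorm P y)\<^sup>2"
    using p1(3)[OF wup] z0_pos(1) unfolding y_def z0_def
    by (simp add: power_mult_distrib left_diff_distrib)
  then have zy: "z0 * err \<delta> w \<le> Xnorm P y" using Xnorm_nonneg[OF yX] by (rule power2_le_imp_le)
  obtain z c where z: "z \<in> trial D \<delta>" and yz: "y = z + (\<Sum>l\<in>ind D \<delta>. c l *\<^sub>R compl_fun D \<delta> l)"
    using decompose[OF yt] by blast
  define C where "C = L2_set c (ind D \<delta>)"
  have M_pos: "M > 0" using m_pos mM by linarith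
  have zX: "z \<in> X" using z by (rule trial_X)
  have sum: "(Xnorm P z)\<^sup>2 + C\<^sup>2 \<le> (M * Xnorm P y)\<^sup>2"
    using stable_bounds(2)[OF z, of c] unfolding yz[symmetric] C_def by (simp add: power_mult_distrib)
  have My: "0 \<le> M * Xnorm P y" using M_pos Xnorm_nonneg[OF yX] by simp
  have zM: "Xnorm P z \<le> M * Xnorm P y"
    by (rule power2_le_imp_le[OF _ My]) (use sum zero_le_power2[of C] in linarith)
  have cM: "C \<le> M * Xnorm P y"
    by (rule power2_le_imp_le[OF _ My]) (use sum zero_le_power2[of "Xnorm P z"] in linarith)
  \<comment> \<open>Galerkin orthogonality in the larger space, where \<open>y\<close> lies,
    replaces \<open>uh \<delta>\<close> by \<open>p1\<close>.\<close>
  have "xip (uh \<delta> - w) y = xip y y"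
    using p1(2)[OF yt] X.diff_left[OF uh_X wX yX, of \<delta>] X.diff_left[OF trial_X[OF p1(1)] wX yX]
    by (simp add: y_def)
  then have "(Xnorm P y)\<^sup>2 = xip (uh \<delta> - w) y" by (simp add: Xnorm_sq[OF yX])
  also have "\<dots> \<le> st \<delta> (uh \<delta> - w) y + del * err \<delta> w * Xnorm P y"
    using st_close[OF q1 eX yt] by linarith
  also have "st \<delta> (uh \<delta> - w) y = st \<delta> (uh \<delta> - w) z + (\<Sum>l\<in>ind D \<delta>. c l * ?r l)"
    unfolding yz st_compl_sum[OF wX, symmetric]
    by (rule st.add_right[OF zX trial_X[OF compl_sum_mem] eX])
  also have "\<dots> \<le> sqrt k2 * est \<delta> w * Xnorm P z + C * res \<delta> w"
  proof (rule add_mono)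
    show "st \<delta> (uh \<delta> - w) z \<le> sqrt k2 * est \<delta> w * Xnorm P z"
      using est_facts(3)[OF wX z] by linarith
    have "(\<Sum>l\<in>ind D \<delta>. c l * ?r l) \<le> (\<Sum>l\<in>ind D \<delta>. \<bar>c l\<bar> * \<bar>?r l\<bar>)"
      by (rule sum_mono) (metis abs_ge_self abs_mult)
    also have "\<dots> \<le> C * res \<delta> w" unfolding C_def by (rule L2_set_mult_ineq)
    finally show "(\<Sum>l\<in>ind D \<delta>. c l * ?r l) \<le> C * res \<delta> w" .
  qed
  also have "\<dots> \<le> sqrt k2 * est \<delta> w * (M * Xnorm P y) + M * Xnorm P y * res \<delta> w"
    using zM cM est_facts(1)[OF wX] k1 k12 by (intro add_mono mult_left_mono mult_right_mono) auto
  finally have "Xnorm P y * Xnorm P y \<le> (M * (sqrt k2 * est \<delta> w + res \<delta> w) + del * err \<delta> w) * Xnorm P y"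
    by (simp add: power2_eq_square algebra_simps)
  moreover have nn: "0 \<le> M * (sqrt k2 * est \<delta> w + res \<delta> w) + del * err \<delta> w"
    using M_pos k1 k12 est_facts(1)[OF wX] del_facts Xnorm_nonneg[OF eX] by (simp add: add_nonneg_nonneg)
  ultimately have "Xnorm P y \<le> M * (sqrt k2 * est \<delta> w + res \<delta> w) + del * err \<delta> w"
    using Xnorm_nonneg[OF yX] by (cases "Xnorm P y = 0") auto
  then have "z0 * err \<delta> w \<le> M * (sqrt k2 * est \<delta> w + res \<delta> w) + z0 / 2 * err \<delta> w"
    using zy mult_right_mono[OF del Xnorm_nonneg[OF eX]] by linarith
  then have "err \<delta> w \<le> 2 * M / z0 * (sqrt k2 * est \<delta> w + res \<delta> w)"
    using z0_pos(1) by (simp add: field_simps)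
  also have "\<dots> \<le> 2 * M / z0 * ((1 + sqrt k2) * (res \<delta> w + est \<delta> w))"
    using M_pos z0_pos(1) k1 k12 est_facts(1)[OF wX, of \<delta>] by (intro mult_left_mono) (auto simp: algebra_simps)
  finally show ?thesis by (simp add: mult.assoc)
qed

end

section \<open>Contraction\<close>

text \<open>Constants in the equivalence of the error and its estimator: \<open>reliability\<close> bounds the error by
  the estimator, \<open>efficiency\<close> the estimator by the error, and \<open>slack\<close> is the factor with which the
  inexactness of a Galerkin solution enters when it passes the until-clause.\<close>

definition "sat_gap \<zeta> = sqrt (1 - (max \<zeta> 0)\<^sup>2)" for \<zeta> :: real
definition "reliability m M \<zeta> k2 = 2 * M / sat_gap \<zeta> * (1 + sqrt k2)" for m M \<zeta> k2 :: real
definition "efficiency m k1 = 2 / m + 2 / sqrt k1" for m k1 :: real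
definition "slack m k1 k2 = sqrt k2 * (2 * efficiency m k1 + 1)" for m k1 k2 :: real
text \<open>Both rates come from reliability. If the data error dominates, \<omega> times the error
  is at most \<open>3 * reliability + 1\<close> data errors. Otherwise the error is at most
  \<open>2 * reliability\<close> residuals, and \<open>bulk_rate\<close> is the third of the
  resulting gain that survives the perturbation.\<close>

definition "osc_rate m M \<zeta> k2 = 1 / (3 * reliability m M \<zeta> k2 + 1)" for m M \<zeta> k2 :: real
definition "bulk_rate m M \<zeta> k2 = m / (6 * reliability m M \<zeta> k2)" for m M \<zeta> k2 :: real

text \<open>One number for all demands. The bounds by \<open>sat_gap\<close> and
  \<open>1 / 64\<close> control \<open>del\<close>; the next two keep the deviation of passing
  approximations below a half and the growth \<open>3 + 4 * b\<close> harmless under the weight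
  \<theta>. Those with \<open>c0\<close> and \<open>c1\<close> keep the losses small against the
  gains in the two cases of step 2.\<close>

definition small_const :: "real \<Rightarrow> real \<Rightarrow> real \<Rightarrow> real \<Rightarrow> real \<Rightarrow> real \<Rightarrow> bool" where
  "small_const m M \<zeta> k1 k2 c \<longleftrightarrow>
     (let b = slack m k1 k2; e = efficiency m k1; c0 = osc_rate m M \<zeta> k2; c1 = bulk_rate m M \<zeta> k2 in
     0 < c \<and> 16 * c \<le> (sat_gap \<zeta>)\<^sup>2 \<and> 64 * c \<le> 1 \<and> b * c \<le> 1 / 4 \<and> (3 + 4 * b) * c \<le> 1 / 2 \<and>
     (16 + 4 * b\<^sup>2) * c \<le> c0 / 8 \<and> c \<le> c1\<^sup>2 \<and> (16 + 4 * b\<^sup>2) * c \<le> c1\<^sup>2 / 4 \<and>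
     2 * e * (7 + 4 * b + c1\<^sup>2) * c \<le> c1\<^sup>2 / 8 \<and> e * c \<le> 1 / 2)"

lemma constants_pos:
  assumes "0 < m" "m \<le> M" "\<zeta> < 1" "0 < k1" "k1 \<le> k2"
  shows "0 < sat_gap \<zeta>" "sat_gap \<zeta> \<le> 1" "0 < reliability m M \<zeta> k2" "0 < efficiency m k1" "0 < slack m k1 k2"
    "0 < osc_rate m M \<zeta> k2" "0 < bulk_rate m M \<zeta> k2" "bulk_rate m M \<zeta> k2 \<le> 1"
proof -
  have "(max \<zeta> 0)\<^sup>2 < 1" using assms(3) by (simp add: power_less_one_iff abs_square_less_1)
  then show g: "0 < sat_gap \<zeta>" "sat_gap \<zeta> \<le> 1" by (auto simp: sat_gap_def)
  have k2: "0 < sqrt k2" using assms by simp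
  \<comment> \<open>This bound is what makes \<open>bulk_rate\<close> at most 1.\<close>
  have "2 * m \<le> 2 * M / sat_gap \<zeta>" using g assms by (simp add: le_divide_eq) (smt (verit) mult_left_le)
  also have "\<dots> \<le> reliability m M \<zeta> k2" unfolding reliability_def
    using mult_left_mono[of 1 "1 + sqrt k2" "2 * M / sat_gap \<zeta>"] g assms k2 by simp
  finally have r: "2 * m \<le> reliability m M \<zeta> k2" .
  then show r0: "0 < reliability m M \<zeta> k2" using assms by linarith
  show e: "0 < efficiency m k1" using assms by (simp add: efficiency_def add_pos_pos)
  show "0 < slack m k1 k2" using k2 e by (simp add: slack_def)
  show "0 < osc_rate m M \<zeta> k2" using r0 by (simp add: osc_rate_def)
  show "0 < bulk_rate m M \<zeta> k2" using r0 assms by (simp add: bulk_rate_def)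
  show "bulk_rate m M \<zeta> k2 \<le> 1" using r r0 assms by (simp add: bulk_rate_def divide_le_eq)
qed

text \<open>Apart from positivity, each demand compares a multiple of \<open>c\<close> with a
  positive number, so all of them hold close to 0 from the right.\<close>

lemma small_const_exists:
  assumes "0 < m" "m \<le> M" "\<zeta> < 1" "0 < k1" "k1 \<le> k2"
  shows "\<exists>c. small_const m M \<zeta> k1 k2 c"
proof -
  note p = constants_pos[OF assms]
  have ev: "\<forall>\<^sub>F c in at_right 0. a * c \<le> y" if "y > 0" for a y :: real
  proof -
    have "((\<lambda>c. a * c) \<longlongrightarrow> a * 0) (at_right 0)" by (intro tendsto_intros)
    then have "\<forall>\<^sub>F c in at_right 0. a * c < y" using order_tendstoD(2)[of _ "a * 0" _ y] that by simp
    then show ?thesis by eventually_elim simp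
  qed
  have "\<forall>\<^sub>F c in at_right 0. small_const m M \<zeta> k1 k2 c"
    unfolding small_const_def Let_def using p ev[of _ 1] ev[of _ "bulk_rate m M \<zeta> k2 ^ 2"]
    by (intro eventually_conj ev eventually_at_right_less) (auto intro!: ev[where a = 1, simplified])
  then show ?thesis using eventually_happens[of _ "at_right (0::real)"] by auto
qed

text \<open>For \<open>x \<le> 1 / 2\<close> the factor \<open>1 + x\<close> is at least the inverse
  root of \<open>1 - x\<close>, and \<open>16 * (1 - x)\<close> exceeds 2.\<close>

lemma inexact_numeric:
  fixes e G s x :: real
  assumes "0 \<le> e" "0 \<le> G" "0 \<le> s" "0 \<le> x" "x \<le> 1 / 2" "(1 - x) * e\<^sup>2 \<le> G\<^sup>2 + 2 * s\<^sup>2"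
  shows "e \<le> (1 + x) * G + 4 * s"
proof (rule ccontr)
  assume "\<not> ?thesis"
  then have lt: "(1 + x) * G + 4 * s < e" by simp
  have nn: "0 \<le> (1 + x) * G + 4 * s" using assms by simp
  have "((1 + x) * G + 4 * s)\<^sup>2 < e\<^sup>2" using lt nn by (intro power_strict_mono) auto
  moreover have "((1 + x) * G)\<^sup>2 + (4 * s)\<^sup>2 \<le> ((1 + x) * G + 4 * s)\<^sup>2"
    using assms by (simp add: power2_sum)
  ultimately have "((1 + x) * G)\<^sup>2 + (4 * s)\<^sup>2 < e\<^sup>2" by linarith
  then have "(1 - x) * (((1 + x) * G)\<^sup>2 + (4 * s)\<^sup>2) < (1 - x) * e\<^sup>2"
    using assms(5) by (intro mult_strict_left_mono) auto
  moreover have "G\<^sup>2 \<le> (1 - x) * ((1 + x) * G)\<^sup>2"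
  proof -
    have "x * (1 - x - x\<^sup>2) \<ge> 0"
    proof (rule mult_nonneg_nonneg[OF assms(4)])
      have "x * x \<le> (1/2) * (1/2)" using assms(4,5) by (intro mult_mono) auto
      then show "0 \<le> 1 - x - x\<^sup>2" using assms(5) by (simp add: power2_eq_square)
    qed
    then have "1 \<le> (1 - x) * (1 + x)\<^sup>2" by (simp add: power2_eq_square algebra_simps)
    then have "1 * G\<^sup>2 \<le> (1 - x) * (1 + x)\<^sup>2 * G\<^sup>2" by (rule mult_right_mono) simp
    then show ?thesis by (simp add: power_mult_distrib ac_simps)
  qed
  moreover have "2 * s\<^sup>2 \<le> (1 - x) * (4 * s)\<^sup>2"
  proof -
    have "(1/2) * (16 * s\<^sup>2) \<le> (1 - x) * (16 * s\<^sup>2)" using assms(5) by (intro mult_right_mono) auto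
    then show ?thesis by (simp add: power_mult_distrib) (use zero_le_power2[of s] in linarith)
  qed
  ultimately show False using assms(6) by (simp add: distrib_left)
qed

text \<open>A quarter of \<eta> is available. One eighth pays for the growth \<open>x * p\<close>;
  the other eighth is a fixed fraction of the total because
  \<open>y * p \<le> \<eta>\<close>.\<close>

lemma osc_numeric:
  fixes p \<eta> x y :: real
  assumes "0 \<le> p" "0 \<le> \<eta>" "0 < y" "y * p \<le> \<eta>" "x \<le> y / 8"
  shows "(1 + x) * p + 3 / 4 * \<eta> \<le> (1 - y / (8 * (1 + y))) * (p + \<eta>)"
proof -
  have "x * p \<le> y / 8 * p" using assms by (intro mult_right_mono)
  then have xp: "x * p \<le> \<eta> / 8" using assms(4) by simp
  have "y * (p + \<eta>) \<le> (1 + y) * \<eta>" using assms(4) by (simp add: algebra_simps)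
  then have le: "y * (p + \<eta>) / (1 + y) \<le> \<eta>" using assms(3) by (simp add: divide_le_eq mult.commute)
  have eq: "y / (8 * (1 + y)) * (p + \<eta>) = y * (p + \<eta>) / (1 + y) / 8"
    by (simp only: times_divide_eq_left divide_divide_eq_left mult.commute[of 8])
  have "y / (8 * (1 + y)) * (p + \<eta>) \<le> \<eta> / 8"
    unfolding eq by (rule divide_right_mono[OF le]) simp
  then show ?thesis using xp by (simp add: left_diff_distrib distrib_right)
qed

text \<open>Of the reduction \<open>s / 2\<close>, one half is lost to the factor
  \<open>1 + x\<close>. Of the remaining \<open>s / 4\<close>, one half pays for the terms with
  \<eta>, and \<open>s / 8\<close> is kept.\<close>

lemma bulk_numeric:
  fixes \<theta> x s Ds \<eta> a :: real
  assumes "0 \<le> Ds" "0 \<le> \<eta>" "0 < \<theta>" "0 < s" "0 \<le> x" "x \<le> s / 4" "(\<theta> * a + s / 8) * \<eta> \<le> \<theta> * (s / 8) * Ds" "s \<le> 2"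
  shows "\<theta> * ((1 + x) * (1 - s / 2) * Ds) + \<theta> * a * \<eta> + \<eta> \<le> (1 - s / 8) * (\<theta> * Ds + \<eta>)"
proof -
  have "(1 + x) * (1 - s / 2) \<le> (1 + s / 4) * (1 - s / 2)" using assms by (intro mult_right_mono) auto
  also have "\<dots> \<le> 1 - s / 4" using zero_le_power2[of s] by (simp add: power2_eq_square algebra_simps)
  finally have "\<theta> * ((1 + x) * (1 - s / 2) * Ds) \<le> \<theta> * ((1 - s / 4) * Ds)"
    using assms by (intro mult_left_mono mult_right_mono) auto
  moreover have "(1 - s / 8) * (\<theta> * Ds + \<eta>) = \<theta> * ((1 - s / 4) * Ds) + \<theta> * (s / 8) * Ds + \<eta> - s / 8 * \<eta>"
    by (simp add: algebra_simps)
  moreover have "(\<theta> * a + s / 8) * \<eta> = \<theta> * a * \<eta> + s / 8 * \<eta>" by (rule distrib_right)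
  ultimately show ?thesis using assms(7) by linarith
qed

section \<open>Gain from bulk selection and quasi-optimality at a passing\<close>

context approximated
begin

lemma z0_eq: "z0 = sat_gap \<zeta>" by (simp add: z0_def sat_gap_def)

abbreviation "Cr \<equiv> reliability m M \<zeta> k2"
abbreviation "Ce \<equiv> efficiency m k1"
abbreviation "b \<equiv> slack m k1 k2"

lemmas const_pos = constants_pos[OF m_pos mM \<zeta> k1 k12]

lemma err_reliable:
  assumes "w \<in> trial D \<delta>" "del \<le> z0 / 2" shows "err \<delta> w \<le> Cr * (res \<delta> w + est \<delta> w)"
  using err_le[OF assms] by (simp add: reliability_def z0_eq)

lemma err_nonneg: "w \<in> X \<Longrightarrow> 0 \<le> err \<delta> w"
  using Xnorm_nonneg uh_X by simp

lemma res_efficient: assumes "w \<in> X" shows "res \<delta> w \<le> Ce * err \<delta> w"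
proof -
  have "2 / m * err \<delta> w \<le> Ce * err \<delta> w"
    using err_nonneg[OF assms] k1 by (intro mult_right_mono) (auto simp: efficiency_def)
  then show ?thesis using res_le[OF assms, of \<delta>] by linarith
qed

lemma est_efficient: assumes "w \<in> X" shows "est \<delta> w \<le> Ce * err \<delta> w"
proof -
  have "2 / sqrt k1 * err \<delta> w \<le> Ce * err \<delta> w"
    using err_nonneg[OF assms] m_pos by (intro mult_right_mono) (auto simp: efficiency_def)
  then show ?thesis using est_facts(2)[OF assms, of \<delta>] by linarith
qed

lemma true_error: assumes "w \<in> X"
  shows "Xnorm P (u - w) \<le> err \<delta> w + osc dat \<delta>" "err \<delta> w \<le> Xnorm P (u - w) + osc dat \<delta>"
  using Xnorm_triangle[OF uX uh_X assms, of \<delta>] Xnorm_triangle[OF uh_X uX assms, of \<delta>]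
    Xnorm_minus[OF uX uh_X, of \<delta>] uh_error[of \<delta>] by auto

lemma uh_diff: "Xnorm P (uh \<delta>' - uh \<delta>) \<le> osc dat \<delta>' + osc dat \<delta>"
  using Xnorm_triangle[OF uh_X uX uh_X, of \<delta>' \<delta>] Xnorm_minus[OF uX uh_X, of \<delta>'] uh_error[of \<delta>] uh_error[of \<delta>']
  by simp

text \<open>The test function \<open>y\<close>, whose coefficients are the residual entries in
  \<open>J\<close>, lies in two spaces: in the new trial space, so that \<open>uh \<delta>\<close>
  may be replaced by \<open>v\<close>, and in the one at \<open>up D \<delta>\<close>, so that
  \<open>st_close\<close> applies.\<close>

lemma bulk_gain:
  assumes w: "w \<in> trial D \<delta>" and J: "J \<subseteq> ind D \<delta>"
    and ext: "{z + y |z y. z \<in> trial D \<delta> \<and> y \<in> span (compl_fun D \<delta> ` J)} \<subseteq> trial D \<delta>'"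
    and v: "v \<in> trial D \<delta>'" "\<And>x. x \<in> trial D \<delta>' \<Longrightarrow> xip v x = xip (uh \<delta>) x"
  shows "m * L2_set (residual_vec P D dat \<delta> w) J - del * err \<delta> w \<le> Xnorm P (v - w)"
proof -
  let ?r = "residual_vec P D dat \<delta> w"
  have wX: "w \<in> X" using w by (rule trial_X)
  have eX: "uh \<delta> - w \<in> X" using uh_X wX by simp
  have vX: "v \<in> X" using v(1) by (rule trial_X)
  define c where "c l = (if l \<in> J then ?r l else 0)" for l
  define y where "y = (\<Sum>l\<in>ind D \<delta>. c l *\<^sub>R compl_fun D \<delta> l)"
  define R where "R = L2_set ?r J"
  have fin: "finite (ind D \<delta>)" by (rule compl_facts(1))
  have "y = (\<Sum>l\<in>J. ?r l *\<^sub>R compl_fun D \<delta> l)"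
    unfolding y_def using fin J by (intro sum.mono_neutral_cong_right) (auto simp: c_def)
  then have "y \<in> span (compl_fun D \<delta> ` J)" by (auto intro!: span_sum span_scale intro: span_base)
  then have "0 + y \<in> trial D \<delta>'" using ext subspace_0[OF trial_facts(2)[of \<delta>]] by blast
  then have yt: "y \<in> trial D \<delta>'" by simp
  have yup: "y \<in> trial D (up D \<delta>)" unfolding y_def by (rule compl_sum_mem)
  have yX: "y \<in> X" using yup by (rule trial_X)
  have cR: "L2_set c (ind D \<delta>) = R"
    unfolding R_def L2_set_def using fin J
    by (intro arg_cong[of _ _ sqrt] sum.mono_neutral_cong_right) (auto simp: c_def)
  have R0: "0 \<le> R" by (simp add: R_def)
  have my: "m * Xnorm P y \<le> R" using compl_sum_norm[of c \<delta>] by (simp add: cR y_def)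
  have "R\<^sup>2 = (\<Sum>l\<in>J. (?r l)\<^sup>2)" by (simp add: R_def L2_set_def sum_nonneg)
  also have "\<dots> = (\<Sum>l\<in>ind D \<delta>. c l * ?r l)"
    using fin J by (intro sum.mono_neutral_cong_left) (auto simp: c_def power2_eq_square)
  also have "\<dots> = st \<delta> (uh \<delta> - w) y" unfolding y_def st_compl_sum[OF wX] ..
  finally have R2: "R\<^sup>2 = st \<delta> (uh \<delta> - w) y" .
  have "xip (uh \<delta> - w) y = xip (v - w) y"
    using v(2)[OF yt] X.diff_left[OF uh_X wX yX, of \<delta>] X.diff_left[OF vX wX yX] by simp
  then have "R\<^sup>2 \<le> xip (v - w) y + del * err \<delta> w * Xnorm P y"
    using st_close[OF q1 eX yup] R2 by linarith
  also have "xip (v - w) y \<le> Xnorm P (v - w) * Xnorm P y"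
    using X_cauchy_schwarz[of "v - w" y] vX wX yX by simp
  finally have main: "R\<^sup>2 \<le> (Xnorm P (v - w) + del * err \<delta> w) * Xnorm P y" by (simp add: distrib_right)
  have nn: "0 \<le> Xnorm P (v - w) + del * err \<delta> w"
    using Xnorm_nonneg[of "v - w"] vX wX err_nonneg[OF wX] del_facts(1) by simp
  have "m * R\<^sup>2 \<le> (Xnorm P (v - w) + del * err \<delta> w) * (m * Xnorm P y)"
    using mult_left_mono[OF main, of m] m_pos by (simp add: ac_simps)
  also have "\<dots> \<le> (Xnorm P (v - w) + del * err \<delta> w) * R" using my nn by (rule mult_left_mono)
  finally have "(m * R) * R \<le> (Xnorm P (v - w) + del * err \<delta> w) * R" by (simp add: power2_eq_square)
  then have "m * R \<le> Xnorm P (v - w) + del * err \<delta> w"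
    using R0 nn by (cases "R = 0") (auto dest: mult_right_le_imp_le)
  then show ?thesis by (simp add: R_def)
qed

text \<open>Passing the until-clause makes \<open>est\<close> a small multiple of error and data
  error, and so is the distance from the approximation to the Galerkin solution \<open>p\<close>.
  That distance is orthogonal to \<open>uh \<delta> - p\<close>, hence enters squared.\<close>

lemma passing_quasi_optimal:
  assumes w: "w \<in> trial D \<delta>" and pass: "est \<delta> w \<le> \<xi> * (res \<delta> w + osc dat \<delta> + est \<delta> w)"
    and \<xi>: "0 < \<xi>" "\<xi> < 1" and half: "del + b * \<xi> \<le> 1 / 2"
    and p: "p \<in> trial D \<delta>" "\<And>v. v \<in> trial D \<delta> \<Longrightarrow> xip p v = xip (uh \<delta>) v"
  shows "err \<delta> w \<le> (1 + 2 * (del + b * \<xi>)\<^sup>2) * Xnorm P (uh \<delta> - p) + 4 * b * osc dat \<delta>"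
proof -
  have wX: "w \<in> X" using w by (rule trial_X)
  have pX: "p \<in> X" using p(1) by (rule trial_X)
  define e where "e = err \<delta> w"
  define \<eta> where "\<eta> = osc dat \<delta>"
  define y where "y = del + b * \<xi>"
  have e0: "0 \<le> e" unfolding e_def by (rule err_nonneg[OF wX])
  have \<eta>0: "0 \<le> \<eta>" unfolding \<eta>_def by (rule osc_nonneg)
  have b0: "0 < b" by (rule const_pos)
  have sk: "0 < sqrt k2" using k1 k12 by simp
  have y0: "0 \<le> y" using del_facts(1) b0 \<xi> by (simp add: y_def)
  have "est \<delta> w \<le> \<xi> * (2 * Ce * e + \<eta>)"
    using res_efficient[OF wX, of \<delta>] est_efficient[OF wX, of \<delta>] \<xi>
    by (intro order_trans[OF pass] mult_left_mono) (auto simp: e_def \<eta>_def)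
  then have "sqrt k2 * est \<delta> w \<le> sqrt k2 * (\<xi> * (2 * Ce * e + \<eta>))" using sk by simp
  also have "\<dots> \<le> b * \<xi> * e + b * \<xi> * \<eta>"
  proof -
    have "b * \<xi> * e + b * \<xi> * \<eta> - sqrt k2 * (\<xi> * (2 * Ce * e + \<eta>)) = sqrt k2 * \<xi> * e + 2 * (sqrt k2 * \<xi> * Ce * \<eta>)"
      by (simp add: slack_def algebra_simps)
    moreover have "0 \<le> sqrt k2 * \<xi> * e + 2 * (sqrt k2 * \<xi> * Ce * \<eta>)"
      using sk \<xi> e0 \<eta>0 const_pos(4) by simp
    ultimately show ?thesis by linarith
  qed
  finally have t: "sqrt k2 * est \<delta> w \<le> b * \<xi> * e + b * \<xi> * \<eta>" .
  have d: "p - w \<in> trial D \<delta>" by (rule subspace_diff[OF trial_facts(2) p(1) w])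
  have dX: "p - w \<in> X" and eX: "uh \<delta> - w \<in> X" using pX wX uh_X by auto
  have dn: "0 \<le> Xnorm P (p - w)" by (rule Xnorm_nonneg[OF dX])
  have "(Xnorm P (p - w))\<^sup>2 = xip (uh \<delta> - w) (p - w)"
    using p(2)[OF d] X.diff_left[OF uh_X wX dX, of \<delta>] X.diff_left[OF pX wX dX] by (simp add: Xnorm_sq[OF dX])
  also have "\<dots> \<le> sqrt k2 * est \<delta> w * Xnorm P (p - w) + del * e * Xnorm P (p - w)"
    using st_close[OF q1 eX, of "p - w" \<delta>] est_facts(3)[OF wX d] d trial_facts(6)[of \<delta>] unfolding e_def by auto
  finally have "Xnorm P (p - w) * Xnorm P (p - w) \<le> (sqrt k2 * est \<delta> w + del * e) * Xnorm P (p - w)"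
    by (simp add: power2_eq_square distrib_right)
  moreover have "0 \<le> sqrt k2 * est \<delta> w + del * e" using sk est_facts(1)[OF wX] del_facts(1) e0 by simp
  ultimately have "Xnorm P (p - w) \<le> sqrt k2 * est \<delta> w + del * e"
    using dn by (cases "Xnorm P (p - w) = 0") (auto dest: mult_right_le_imp_le)
  also have "\<dots> \<le> y * e + b * \<eta>"
  proof -
    have "b * \<xi> * \<eta> \<le> b * 1 * \<eta>" using b0 \<xi> \<eta>0 by (intro mult_right_mono mult_left_mono) auto
    then show ?thesis using t by (simp add: y_def distrib_right)
  qed
  finally have "(Xnorm P (p - w))\<^sup>2 \<le> (y * e + b * \<eta>)\<^sup>2" using dn by (intro power_mono)
  also have "\<dots> \<le> 2 * (y * e)\<^sup>2 + 2 * (b * \<eta>)\<^sup>2"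
    using sum_squares_bound[of "y * e" "b * \<eta>"] by (simp add: power2_sum)
  finally have pw: "(Xnorm P (p - w))\<^sup>2 \<le> 2 * y\<^sup>2 * e\<^sup>2 + 2 * (b * \<eta>)\<^sup>2" by (simp add: power_mult_distrib)
  have "xip p (p - w) = xip (uh \<delta>) (p - w)" by (rule p(2)[OF d])
  then have "e\<^sup>2 = (Xnorm P (uh \<delta> - p))\<^sup>2 + (Xnorm P (p - w))\<^sup>2"
    using X.pythagoras[OF uh_X pX wX] uh_X pX wX by (simp add: e_def Xnorm_sq)
  then have "(1 - 2 * y\<^sup>2) * e\<^sup>2 \<le> (Xnorm P (uh \<delta> - p))\<^sup>2 + 2 * (b * \<eta>)\<^sup>2"
    using pw by (simp add: left_diff_distrib)
  moreover have "2 * y\<^sup>2 \<le> 1 / 2"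
    using power_mono[OF half[folded y_def] y0, of 2] by (simp add: power2_eq_square)
  ultimately have "e \<le> (1 + 2 * y\<^sup>2) * Xnorm P (uh \<delta> - p) + 4 * (b * \<eta>)"
    using e0 b0 \<eta>0 Xnorm_nonneg[of "uh \<delta> - p"] uh_X pX by (intro inexact_numeric) auto
  then show ?thesis by (simp add: e_def \<eta>_def y_def)
qed

text \<open>With \<open>del \<le> 1 / 2\<close> the discrete form is coercive, so the discrete
  system is solvable. Its solution meets every nonnegative tolerance of the inner loop.\<close>

lemma discrete_solution_exists: "\<exists>w\<in>trial D \<delta>. est \<delta> w = 0"
proof -
  interpret t: form_on "trial D \<delta>" "st \<delta>" by (rule st.form_on_subspace[OF trial_facts(2,1)])
  have cl: "\<bar>xip v v - st \<delta> v v\<bar> \<le> 1 / 2 * xip v v" if "v \<in> trial D \<delta>" for v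
  proof -
    have vX: "v \<in> X" by (rule trial_X[OF that])
    have "\<bar>xip v v - st \<delta> v v\<bar> \<le> del * (Xnorm P v * Xnorm P v)"
      using st_close[OF q1 vX, of v \<delta>] that trial_facts(6) by (simp add: mult.assoc subset_iff)
    also have "\<dots> \<le> 1 / 2 * (Xnorm P v * Xnorm P v)" using del_facts Xnorm_nonneg[OF vX] by (intro mult_right_mono) auto
    finally show ?thesis using Xnorm_sq[OF vX] by (simp add: power2_eq_square)
  qed
  have low: "1 / 2 * xip v v \<le> st \<delta> v v" if "v \<in> trial D \<delta>" for v using cl[OF that] by linarith
  have tc: "form_complete (trial D \<delta>) (st \<delta>)"
  proof (rule form_complete_equiv[OF trial_facts(2) trial_complete, of "1 / 2" _ _ "3 / 2"])
    show "1 / 2 * xip v v \<le> st \<delta> v v" if "v \<in> trial D \<delta>" for v by (rule low[OF that])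
    show "st \<delta> v v \<le> 3 / 2 * xip v v" if "v \<in> trial D \<delta>" for v using cl[OF that] by linarith
  qed (auto intro: t.nonneg)
  obtain w where w: "w \<in> trial D \<delta>" "\<And>v. v \<in> trial D \<delta> \<Longrightarrow> st \<delta> w v = st \<delta> (uh \<delta>) v"
    using st.projection[OF tc trial_facts(2,1) uh_X] by blast
  have wX: "w \<in> X" by (rule trial_X[OF w(1)])
  have "restr (trial D \<delta>) (st \<delta> (uh \<delta> - w)) = (\<lambda>_. 0)"
  proof
    fix v show "restr (trial D \<delta>) (st \<delta> (uh \<delta> - w)) v = 0"
      using w(2)[of v] st.diff_left[OF uh_X wX, of v \<delta> \<delta>] trial_X by (simp add: restr_def)
  qed
  then have "est \<delta> w = 0" by (simp add: alg_est_def disc_res_eq[OF wX])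
  with w(1) show ?thesis by blast
qed

end

section \<open>Contraction for admissible parameters\<close>

locale adaptive = approximated P D \<kappa> k1 k2 \<zeta> m M dat u
  for P :: "('v::{real_inner, banach, second_countable_topology},
    'h::{real_inner, banach, second_countable_topology}) evolution"
    and D :: "('d, 'l, 'v, 'h) discretization" and \<kappa> k1 k2 \<zeta> m M
    and dat :: "('d, 'v, 'h) data" and u +
  fixes c \<theta> \<omega> \<xi> :: real
  assumes c: "small_const m M \<zeta> k1 k2 c"
    and \<theta>: "0 < \<theta>" "\<theta> \<le> 1" "\<theta> \<le> c" and \<omega>: "0 < \<omega>" "\<omega> \<le> c * \<theta>\<^sup>2"
    and \<xi>: "0 < \<xi>" "\<xi> < 1" "\<xi> \<le> c * \<omega>" and q: "q \<le> c * \<omega>" "q \<le> c * \<theta>\<^sup>2"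
begin

abbreviation "c0 \<equiv> osc_rate m M \<zeta> k2"
abbreviation "c1 \<equiv> bulk_rate m M \<zeta> k2"

text \<open>The least ratio of data error to weighted error when the former dominates.
  \<open>s_rate\<close> is the fraction of the squared error gained in the bulk case,
  \<open>x_rate\<close> the excess over best approximation at a passing.\<close>

definition "y_rate = c0 * \<omega> / \<theta>"
definition "s_rate = c1\<^sup>2 * \<theta>\<^sup>2"
definition "x_rate = 2 * (del + b * \<xi>)\<^sup>2"
definition "\<rho> = max (1 - y_rate / (8 * (1 + y_rate))) (1 - s_rate / 8)"

lemma c_facts: "0 < c" "16 * c \<le> z0\<^sup>2" "64 * c \<le> 1" "b * c \<le> 1 / 4" "(3 + 4 * b) * c \<le> 1 / 2"
  "(16 + 4 * b\<^sup>2) * c \<le> c0 / 8" "c \<le> c1\<^sup>2" "(16 + 4 * b\<^sup>2) * c \<le> c1\<^sup>2 / 4"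
  "2 * Ce * (7 + 4 * b + c1\<^sup>2) * c \<le> c1\<^sup>2 / 8" "Ce * c \<le> 1 / 2"
  using c unfolding small_const_def Let_def z0_eq by blast+

lemma theta_sq: "\<theta>\<^sup>2 \<le> 1" "\<theta>\<^sup>2 \<le> \<theta>" "0 < \<theta>\<^sup>2"
  using \<theta> by (auto simp: power2_eq_square mult_le_one mult_left_le)

lemma param_facts: "\<omega> \<le> c" "\<omega> \<le> \<theta>\<^sup>2" "\<omega> \<le> 1" "\<xi> \<le> c" "\<xi> \<le> 1 / 4" "\<xi> \<le> \<omega>"
proof -
  show w: "\<omega> \<le> c" using \<omega>(2) theta_sq(1) c_facts(1) mult_left_le[of "\<theta>\<^sup>2" c] by linarith
  show "\<omega> \<le> \<theta>\<^sup>2" using \<omega>(2) mult_right_mono[of c 1 "\<theta>\<^sup>2"] c_facts(3) theta_sq(3) by linarith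
  show "\<omega> \<le> 1" using w c_facts(3) by linarith
  show xw: "\<xi> \<le> \<omega>" using \<xi>(3) mult_right_mono[of c 1 \<omega>] c_facts(3) \<omega>(1) by linarith
  show "\<xi> \<le> c" "\<xi> \<le> 1 / 4" using xw w c_facts(3) by linarith+
qed

lemma q_le_c: "q \<le> c"
  using q(2) theta_sq(1) c_facts(1) mult_left_le[of "\<theta>\<^sup>2" c] by linarith

lemma del_small: "del \<le> z0 / 2" "del \<le> 1 / 4" "del \<le> 2 * c1 * \<theta>"
proof -
  have d: "del\<^sup>2 \<le> 4 * c" using del_facts(3) q_le_c by simp
  show "del \<le> z0 / 2"
    by (rule power2_le_imp_le) (use d c_facts(2) z0_pos(1) in \<open>auto simp: power_divide\<close>)
  show "del \<le> 1 / 4"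
    by (rule power2_le_imp_le) (use d c_facts(3) in \<open>auto simp: power2_eq_square\<close>)
  have "c * \<theta>\<^sup>2 \<le> c1\<^sup>2 * \<theta>\<^sup>2" using c_facts(7) by (intro mult_right_mono) auto
  then have "del\<^sup>2 \<le> (2 * c1 * \<theta>)\<^sup>2" using del_facts(3) q(2) by (simp add: power_mult_distrib)
  then show "del \<le> 2 * c1 * \<theta>" by (rule power2_le_imp_le) (use const_pos(7) \<theta> in simp)
qed

lemma half: "del + b * \<xi> \<le> 1 / 2"
  using del_small(2) mult_left_mono[OF param_facts(4), of b] const_pos(5) c_facts(4) by linarith

text \<open>\<open>del\<^sup>2 = 4 * q\<close> and \<open>\<xi>\<^sup>2 \<le> \<xi>\<close> turn the
  squares into terms linear in \<open>q\<close> and \<xi>. These are weighed against \<omega> for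
  the data case and against \<open>\<theta>\<^sup>2\<close> for the bulk case.\<close>

lemma x_rate_le: "0 \<le> x_rate" "x_rate \<le> 1" "x_rate \<le> y_rate / 8" "x_rate \<le> s_rate / 4"
proof -
  show "0 \<le> x_rate" by (simp add: x_rate_def)
  have nn: "0 \<le> del + b * \<xi>" using del_facts(1) const_pos(5) \<xi>(1) by simp
  show "x_rate \<le> 1" using power_mono[OF half nn, of 2] by (simp add: x_rate_def power2_eq_square)
  have "x_rate \<le> 2 * (2 * del\<^sup>2 + 2 * (b * \<xi>)\<^sup>2)"
    unfolding x_rate_def using sum_squares_bound[of del "b * \<xi>"] by (simp add: power2_sum)
  also have "(b * \<xi>)\<^sup>2 \<le> b\<^sup>2 * \<xi>"
  proof -
    have "\<xi>\<^sup>2 \<le> \<xi>" using \<xi> by (simp add: power2_eq_square mult_left_le)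
    then show ?thesis by (simp add: power_mult_distrib mult_left_mono)
  qed
  finally have x: "x_rate \<le> 16 * q + 4 * b\<^sup>2 * \<xi>" using del_facts(3) by simp
  have "4 * b\<^sup>2 * \<xi> \<le> 4 * b\<^sup>2 * (c * \<omega>)" using \<xi>(3) by (intro mult_left_mono) auto
  then have "x_rate \<le> ((16 + 4 * b\<^sup>2) * c) * \<omega>" using x q(1) by (simp add: algebra_simps)
  also have "\<dots> \<le> c0 / 8 * \<omega>" using c_facts(6) \<omega>(1) by (intro mult_right_mono) auto
  also have "\<dots> \<le> c0 / 8 * (\<omega> / \<theta>)"
    using \<omega>(1) \<theta> const_pos(6) by (intro mult_left_mono) (auto simp: le_divide_eq mult_left_le)
  finally show "x_rate \<le> y_rate / 8" by (simp add: y_rate_def)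
  have "\<xi> \<le> c * \<theta>\<^sup>2"
    by (rule order_trans[OF \<xi>(3) mult_left_mono[OF param_facts(2)]]) (use c_facts(1) in simp)
  then have "4 * b\<^sup>2 * \<xi> \<le> 4 * b\<^sup>2 * (c * \<theta>\<^sup>2)" by (rule mult_left_mono) simp
  then have "x_rate \<le> ((16 + 4 * b\<^sup>2) * c) * \<theta>\<^sup>2" using x q(2) by (simp add: algebra_simps)
  also have "\<dots> \<le> c1\<^sup>2 / 4 * \<theta>\<^sup>2" using c_facts(8) by (intro mult_right_mono) auto
  finally show "x_rate \<le> s_rate / 4" by (simp add: s_rate_def)
qed

lemma y_pos: "0 < y_rate"
  using const_pos(6) \<omega>(1) \<theta>(1) by (simp add: y_rate_def)

lemma s_pos: "0 < s_rate" "s_rate \<le> 1"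
proof -
  show "0 < s_rate" using const_pos(7) theta_sq(3) by (simp add: s_rate_def)
  have "c1\<^sup>2 * \<theta>\<^sup>2 \<le> 1 * 1"
    using const_pos(7,8) theta_sq by (intro mult_mono) (auto simp: power_le_one)
  then show "s_rate \<le> 1" by (simp add: s_rate_def)
qed

lemma rho_facts: "0 \<le> \<rho>" "\<rho> < 1"
proof -
  show "\<rho> < 1" using y_pos s_pos by (simp add: \<rho>_def add_pos_pos)
  have "0 \<le> 1 - s_rate / 8" using s_pos by simp
  then show "0 \<le> \<rho>" by (simp add: \<rho>_def le_max_iff_disj)
qed

abbreviation "passing \<delta> w \<equiv> est \<delta> w \<le> \<xi> * (res \<delta> w + osc dat \<delta> + est \<delta> w)"

text \<open>The until-clause has \<open>est\<close> on both sides; since \<xi> \<le> 1/4 it can be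
  absorbed.\<close>

lemma passing_est:
  assumes "w \<in> X" "passing \<delta> w" shows "est \<delta> w \<le> 2 * \<xi> * (res \<delta> w + osc dat \<delta>)"
proof -
  have "\<xi> * est \<delta> w \<le> 1 / 2 * est \<delta> w"
    using param_facts(5) est_facts(1)[OF assms(1)] by (intro mult_right_mono) auto
  then show ?thesis using assms(2) by (simp add: distrib_left)
qed

lemma best_approx:
  assumes "p \<in> trial D \<delta>'" "\<And>v. v \<in> trial D \<delta>' \<Longrightarrow> xip p v = xip x v" "x \<in> X" "w \<in> trial D \<delta>'"
  shows "Xnorm P (x - p) \<le> Xnorm P (x - w)"
    and "(Xnorm P (x - w))\<^sup>2 = (Xnorm P (x - p))\<^sup>2 + (Xnorm P (p - w))\<^sup>2"
proof -
  have pX: "p \<in> X" and wX: "w \<in> X" using assms trial_X by auto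
  show e: "(Xnorm P (x - w))\<^sup>2 = (Xnorm P (x - p))\<^sup>2 + (Xnorm P (p - w))\<^sup>2"
    using X.pythagoras[OF assms(3) pX wX] assms(2)[OF subspace_diff[OF trial_facts(2) assms(1,4)]] assms(3) pX wX
    by (simp add: Xnorm_sq)
  show "Xnorm P (x - p) \<le> Xnorm P (x - w)"
    by (rule power2_le_imp_le) (use e zero_le_power2[of "Xnorm P (p - w)"] Xnorm_nonneg[of "x - w"] assms(3) wX in auto)
qed

theorem contraction:
  assumes w: "w \<in> trial D \<delta>" and pass: "passing \<delta> w" and ref: "refines P D dat \<omega> \<theta> \<delta> w \<delta>'"
    and w': "w' \<in> trial D \<delta>'" and pass': "passing \<delta>' w'"
  shows "\<theta> * Xnorm P (u - w') + osc dat \<delta>' \<le> \<rho> * (\<theta> * Xnorm P (u - w) + osc dat \<delta>)"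
proof -
  let ?r = "residual_vec P D dat \<delta> w"
  have wX: "w \<in> X" and w'X: "w' \<in> X" using w w' trial_X by auto
  define Da where "Da = Xnorm P (u - w)"
  define Db where "Db = Xnorm P (u - w')"
  define e where "e = err \<delta> w"
  define r where "r = res \<delta> w"
  define t where "t = est \<delta> w"
  define \<eta> where "\<eta> = osc dat \<delta>"
  define \<eta>' where "\<eta>' = osc dat \<delta>'"
  have nn: "0 \<le> Da" "0 \<le> e" "0 \<le> r" "0 \<le> t" "0 \<le> \<eta>" "0 \<le> \<eta>'"
    using Xnorm_nonneg[of "u - w"] uX wX err_nonneg[OF wX] est_facts(1)[OF wX] osc_nonneg
    by (auto simp: Da_def e_def r_def t_def \<eta>_def \<eta>'_def)
  have sub: "trial D \<delta> \<subseteq> trial D \<delta>'" using ref unfolding refines_def Let_def by (auto split: if_splits)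
  have wd': "w \<in> trial D \<delta>'" using w sub by blast
  have b0: "0 < b" and Cr0: "0 < Cr" and Ce0: "0 < Ce" and c1: "0 < c1" by (rule const_pos)+
  have t_le: "t \<le> 2 * \<xi> * (r + \<eta>)" using passing_est[OF wX pass] by (simp add: t_def r_def \<eta>_def)
  have e_le: "e \<le> Cr * (r + t)" using err_reliable[OF w del_small(1)] by (simp add: e_def r_def t_def)
  have r_le: "r \<le> Ce * e" using res_efficient[OF wX, of \<delta>] by (simp add: e_def r_def)
  have De: "Da \<le> e + \<eta>" "e \<le> Da + \<eta>" using true_error[OF wX, of \<delta>] by (auto simp: Da_def e_def \<eta>_def)
  \<comment> \<open>The Galerkin solution for the new data in the new space, to which
    \<open>passing_quasi_optimal\<close> compares the new approximation.\<close>
  obtain p where p: "p \<in> trial D \<delta>'" "\<And>v. v \<in> trial D \<delta>' \<Longrightarrow> xip p v = xip (uh \<delta>') v"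
    using trial_projection[OF uh_X] by blast
  define G where "G = Xnorm P (uh \<delta>' - p)"
  have "err \<delta>' w' \<le> (1 + x_rate) * G + 4 * b * \<eta>'"
    using passing_quasi_optimal[OF w' pass' \<xi>(1,2) half p] by (simp add: x_rate_def G_def \<eta>'_def)
  then have Db: "Db \<le> (1 + x_rate) * G + (4 * b + 1) * \<eta>'"
    using true_error(1)[OF w'X, of \<delta>'] by (simp add: Db_def \<eta>'_def distrib_right)
  show ?thesis
  proof (cases "\<eta> > \<omega> * r")
    case True
    have \<eta>'_le: "\<eta>' \<le> \<eta> / 2"
      using ref True unfolding refines_def Let_def by (auto simp: \<eta>_def \<eta>'_def r_def split: if_splits)
    \<comment> \<open>No gain on the error is available in this case: the old approximation is
      merely a competitor in the new space.\<close>
    have "G \<le> Da + \<eta>'"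
      using best_approx(1)[OF p uh_X wd'] true_error(2)[OF wX, of \<delta>'] by (simp add: G_def Da_def \<eta>'_def)
    then have "(1 + x_rate) * G \<le> (1 + x_rate) * (Da + \<eta>')" using x_rate_le(1) by (intro mult_left_mono) auto
    moreover have "x_rate * \<eta>' \<le> \<eta>'" using x_rate_le(1,2) nn(6) by (simp add: mult_left_le_one_le)
    ultimately have Db': "Db \<le> (1 + x_rate) * Da + (3 + 4 * b) * \<eta>'" using Db by (simp add: algebra_simps)
    \<comment> \<open>The weight makes the growth of the error harmless: together with \<eta>'
      itself it costs at most \<open>3 / 2 * \<eta>'\<close>, which is \<open>3 / 4 * \<eta>\<close>
      after halving.\<close>
    have "\<theta> * (3 + 4 * b) \<le> 1 / 2"
    proof -
      have "\<theta> * (3 + 4 * b) \<le> c * (3 + 4 * b)" using \<theta>(3) b0 by (intro mult_right_mono) auto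
      then show ?thesis using c_facts(5) unfolding mult.commute[of c] by linarith
    qed
    then have "\<theta> * (3 + 4 * b) * \<eta>' \<le> 1 / 2 * \<eta>'" using nn(6) by (rule mult_right_mono)
    moreover have "\<theta> * Db \<le> \<theta> * ((1 + x_rate) * Da + (3 + 4 * b) * \<eta>')" using Db' \<theta> by (intro mult_left_mono) auto
    ultimately have "\<theta> * Db + \<eta>' \<le> (1 + x_rate) * (\<theta> * Da) + 3 / 4 * \<eta>"
      using \<eta>'_le by (simp add: algebra_simps)
    also have "\<dots> \<le> (1 - y_rate / (8 * (1 + y_rate))) * (\<theta> * Da + \<eta>)"
    proof (rule osc_numeric)
      \<comment> \<open>Reliability bounds \<open>Da\<close> by residual and data error, and
        \<omega> times the residual is below \<eta> in this case; this is where \<open>c0\<close>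
        comes from.\<close>
      have "2 * \<xi> * (r + \<eta>) \<le> 1 * (r + \<eta>)" using param_facts(5) nn by (intro mult_right_mono) auto
      from order_trans[OF t_le this] have "r + t \<le> 2 * r + \<eta>" by simp
      then have "Cr * (r + t) \<le> Cr * (2 * r + \<eta>)" using Cr0 by simp
      then have "Da \<le> Cr * (2 * r + \<eta>) + \<eta>" using e_le De(1) by linarith
      then have "\<omega> * Da \<le> \<omega> * (Cr * (2 * r + \<eta>) + \<eta>)" using \<omega>(1) by simp
      also have "\<dots> = Cr * (2 * (\<omega> * r) + \<omega> * \<eta>) + \<omega> * \<eta>" by (simp add: algebra_simps)
      also have "\<dots> \<le> Cr * (2 * \<eta> + \<eta>) + \<eta>"
      proof -
        have "\<omega> * \<eta> \<le> \<eta>" using param_facts(3) \<omega>(1) nn(5) by (simp add: mult_left_le_one_le)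
        then show ?thesis using True Cr0 by (intro add_mono mult_left_mono) auto
      qed
      also have "\<dots> = (3 * Cr + 1) * \<eta>" by (simp add: algebra_simps)
      finally show "y_rate * (\<theta> * Da) \<le> \<eta>"
        using \<theta>(1) Cr0 by (simp add: y_rate_def osc_rate_def divide_le_eq mult.commute)
    qed (use nn \<theta> y_pos x_rate_le in auto)
    also have "\<dots> \<le> \<rho> * (\<theta> * Da + \<eta>)"
      using nn \<theta> by (intro mult_right_mono) (auto simp: \<rho>_def)
    finally show ?thesis by (simp add: Da_def Db_def \<eta>_def \<eta>'_def)
  next
    case False
    then have \<eta>r: "\<eta> \<le> \<omega> * r" by simp
    have \<eta>\<eta>: "\<eta>' \<le> \<eta>" unfolding \<eta>_def \<eta>'_def by (rule osc_mono[OF sub])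
    obtain J where J: "J \<subseteq> ind D \<delta>" "\<theta> * r \<le> L2_set ?r J"
      "{z + y |z y. z \<in> trial D \<delta> \<and> y \<in> span (compl_fun D \<delta> ` J)} \<subseteq> trial D \<delta>'"
      using ref False unfolding refines_def Let_def \<eta>_def r_def by auto
    \<comment> \<open>Still the data of the old index, but already the new space: the residual
      selected by \<open>J\<close> belongs to the old data.\<close>
    obtain v where v: "v \<in> trial D \<delta>'" "\<And>x. x \<in> trial D \<delta>' \<Longrightarrow> xip v x = xip (uh \<delta>) x"
      using trial_projection[OF uh_X] by blast
    have vX: "v \<in> X" by (rule trial_X[OF v(1)])
    have "2 * \<xi> * (r + \<eta>) \<le> 1 / 2 * (r + \<eta>)" using param_facts(5) nn by (intro mult_right_mono) auto
    from order_trans[OF t_le this] have t': "t \<le> 1 / 2 * (r + \<eta>)" .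
    have "\<omega> * r \<le> r" using param_facts(3) \<omega>(1) nn(3) by (simp add: mult_left_le_one_le)
    then have "r + t \<le> 2 * r" using t' \<eta>r by simp
    then have "Cr * (r + t) \<le> Cr * (2 * r)" using Cr0 by simp
    then have er: "e \<le> 2 * Cr * r" using e_le by linarith
    \<comment> \<open>Three shares of \<open>c1\<close>: two will be spent on \<open>del\<close>,
      one remains as gain.\<close>
    have "3 * c1 * e \<le> m * r"
      using er Cr0 m_pos by (simp add: bulk_rate_def field_simps)
    then have "\<theta> * (3 * c1 * e) \<le> \<theta> * (m * r)" using \<theta>(1) by simp
    also have "\<dots> \<le> m * L2_set ?r J" using J(2) m_pos by (simp add: mult.left_commute)
    also have "\<dots> \<le> Xnorm P (v - w) + del * e" using bulk_gain[OF w J(1,3) v] by (simp add: e_def)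
    also have "\<dots> \<le> Xnorm P (v - w) + 2 * c1 * \<theta> * e"
      using mult_right_mono[OF del_small(3) nn(2)] by simp
    finally have gain: "c1 * \<theta> * e \<le> Xnorm P (v - w)" by (simp add: algebra_simps)
    have "(c1 * \<theta> * e)\<^sup>2 \<le> (Xnorm P (v - w))\<^sup>2" using gain c1 \<theta> nn by (intro power_mono) auto
    then have "(Xnorm P (uh \<delta> - v))\<^sup>2 \<le> (1 - s_rate) * e\<^sup>2"
      using best_approx(2)[OF v uh_X wd'] by (simp add: e_def s_rate_def power_mult_distrib left_diff_distrib)
    \<comment> \<open>The root of \<open>1 - s_rate\<close> is at most
      \<open>1 - s_rate / 2\<close>.\<close>
    also have "\<dots> \<le> ((1 - s_rate / 2) * e)\<^sup>2"
    proof -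
      have "1 - s_rate \<le> (1 - s_rate / 2)\<^sup>2" using zero_le_power2[of s_rate] by (simp add: power2_eq_square algebra_simps)
      then have "(1 - s_rate) * e\<^sup>2 \<le> (1 - s_rate / 2)\<^sup>2 * e\<^sup>2" by (rule mult_right_mono) simp
      then show ?thesis by (simp add: power_mult_distrib)
    qed
    finally have uv: "Xnorm P (uh \<delta> - v) \<le> (1 - s_rate / 2) * e"
      by (rule power2_le_imp_le) (use s_pos nn in simp)
    \<comment> \<open>Only now the data are changed, at the price of both data errors.\<close>
    have "G \<le> Xnorm P (uh \<delta>' - v)" unfolding G_def by (rule best_approx(1)[OF p uh_X v(1)])
    also have "\<dots> \<le> (\<eta>' + \<eta>) + (1 - s_rate / 2) * e"
      using Xnorm_triangle[OF uh_X uh_X vX, of \<delta>' \<delta>] uh_diff[of \<delta>' \<delta>] uv by (simp add: \<eta>_def \<eta>'_def)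
    also have "\<dots> \<le> 2 * \<eta> + ((1 - s_rate / 2) * Da + \<eta>)"
    proof -
      have "(1 - s_rate / 2) * e \<le> (1 - s_rate / 2) * (Da + \<eta>)" using De(2) s_pos by (intro mult_left_mono) auto
      also have "\<dots> \<le> (1 - s_rate / 2) * Da + \<eta>" using s_pos nn by (simp add: algebra_simps)
      finally show ?thesis using \<eta>\<eta> by simp
    qed
    finally have G: "G \<le> (1 - s_rate / 2) * Da + 3 * \<eta>" by simp
    have "(1 + x_rate) * G \<le> (1 + x_rate) * ((1 - s_rate / 2) * Da + 3 * \<eta>)"
      using G x_rate_le(1) by (intro mult_left_mono) auto
    moreover have "x_rate * (3 * \<eta>) \<le> 3 * \<eta>" using x_rate_le(1,2) nn(5) by (simp add: mult_left_le_one_le)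
    moreover have "(4 * b + 1) * \<eta>' \<le> (4 * b + 1) * \<eta>" using \<eta>\<eta> b0 by (intro mult_left_mono) auto
    ultimately have "Db \<le> (1 + x_rate) * (1 - s_rate / 2) * Da + (7 + 4 * b) * \<eta>"
      using Db by (simp add: distrib_left distrib_right mult.assoc)
    then have "\<theta> * Db \<le> \<theta> * ((1 + x_rate) * (1 - s_rate / 2) * Da + (7 + 4 * b) * \<eta>)"
      using \<theta>(1) by simp
    then have "\<theta> * Db + \<eta>' \<le> \<theta> * ((1 + x_rate) * (1 - s_rate / 2) * Da) + \<theta> * (7 + 4 * b) * \<eta> + \<eta>"
      using \<eta>\<eta> unfolding distrib_left[of \<theta> "(1 + x_rate) * (1 - s_rate / 2) * Da"] mult.assoc[of \<theta> "7 + 4 * b"]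
      by linarith
    also have "\<dots> \<le> (1 - s_rate / 8) * (\<theta> * Da + \<eta>)"
    proof (rule bulk_numeric)
      have "\<omega> * Ce \<le> c * Ce" using param_facts(1) Ce0 by (intro mult_right_mono) auto
      then have "\<omega> * Ce \<le> 1 / 2" using c_facts(10) unfolding mult.commute[of c] by linarith
      then have "\<omega> * Ce * \<eta> \<le> 1 / 2 * \<eta>" using nn(5) by (rule mult_right_mono)
      moreover have "\<eta> \<le> \<omega> * Ce * (Da + \<eta>)"
      proof -
        have "\<omega> * r \<le> \<omega> * (Ce * e)" using r_le \<omega>(1) by simp
        also have "\<dots> \<le> \<omega> * (Ce * (Da + \<eta>))" using De(2) \<omega>(1) Ce0 by simp
        finally show ?thesis using \<eta>r by (simp add: mult.assoc)
      qed
      \<comment> \<open>The data error is at most a multiple of \<omega> times the error; as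
        \<omega> is at most \<open>c * \<theta>\<^sup>2\<close>, this is small against the gain
        \<open>s_rate\<close>.\<close>
      ultimately have \<eta>D: "\<eta> \<le> 2 * (Ce * \<omega>) * Da" by (simp add: algebra_simps)
      have "s_rate \<le> \<theta> * c1\<^sup>2"
        unfolding s_rate_def mult.commute[of \<theta>] using theta_sq(2) by (rule mult_left_mono) simp
      then have s8: "s_rate / 8 \<le> \<theta> * c1\<^sup>2" using s_pos(1) by linarith
      have a0: "0 < 7 + 4 * b + c1\<^sup>2" using b0 by (simp add: add_pos_nonneg)
      have "(\<theta> * (7 + 4 * b) + s_rate / 8) * \<eta> \<le> (\<theta> * (7 + 4 * b + c1\<^sup>2)) * \<eta>"
        using s8 nn(5) by (intro mult_right_mono) (auto simp: distrib_left)
      also have "\<dots> \<le> (\<theta> * (7 + 4 * b + c1\<^sup>2)) * (2 * (Ce * \<omega>) * Da)"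
        using \<eta>D \<theta>(1) a0 by (intro mult_left_mono) auto
      also have "\<dots> = \<theta> * ((2 * Ce * (7 + 4 * b + c1\<^sup>2)) * \<omega>) * Da" by (simp add: ac_simps)
      also have "\<dots> \<le> \<theta> * (s_rate / 8) * Da"
      proof (intro mult_right_mono mult_left_mono)
        have "(2 * Ce * (7 + 4 * b + c1\<^sup>2)) * \<omega> \<le> (2 * Ce * (7 + 4 * b + c1\<^sup>2)) * (c * \<theta>\<^sup>2)"
          using \<omega>(2) a0 Ce0 by (intro mult_left_mono) auto
        also have "\<dots> = (2 * Ce * (7 + 4 * b + c1\<^sup>2) * c) * \<theta>\<^sup>2" by (simp add: ac_simps)
        also have "\<dots> \<le> c1\<^sup>2 / 8 * \<theta>\<^sup>2" using c_facts(9) by (intro mult_right_mono) auto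
        finally show "(2 * Ce * (7 + 4 * b + c1\<^sup>2)) * \<omega> \<le> s_rate / 8" by (simp add: s_rate_def)
      qed (use nn \<theta> in auto)
      finally show "(\<theta> * (7 + 4 * b) + s_rate / 8) * \<eta> \<le> \<theta> * (s_rate / 8) * Da" .
    qed (use nn \<theta> s_pos x_rate_le in auto)
    also have "\<dots> \<le> \<rho> * (\<theta> * Da + \<eta>)"
      using nn \<theta> by (intro mult_right_mono) (auto simp: \<rho>_def)
    finally show ?thesis by (simp add: Da_def Db_def \<eta>_def \<eta>'_def)
  qed
qed

end

section \<open>The adaptive algorithm\<close>

context adaptive
begin

abbreviation "energy i \<equiv> \<theta> * Xnorm P (u - app i) + osc dat (idx i)"

lemma total_eq: "total_est P D dat \<delta> w = res \<delta> w + osc dat \<delta> + est \<delta> w"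
  by (simp add: total_est_def)

text \<open>While the algorithm runs, the estimator exceeds \<epsilon>; this bound keeps the energy
  away from 0 as well.\<close>

lemma total_le_energy:
  assumes "app i \<in> X"
  shows "total_est P D dat (idx i) (app i) \<le> (2 * Ce / \<theta> + 2 * Ce + 1) * energy i"
proof -
  let ?\<delta> = "idx i" and ?w = "app i"
  let ?D = "Xnorm P (u - ?w)" and ?\<eta> = "osc dat (idx i)"
  have nn: "0 \<le> ?D" "0 \<le> ?\<eta>" using Xnorm_nonneg[of "u - ?w"] uX assms osc_nonneg by auto
  have Ce0: "0 < Ce" by (rule const_pos)
  have "total_est P D dat ?\<delta> ?w \<le> 2 * Ce * err ?\<delta> ?w + ?\<eta>"
    using res_efficient[OF assms, of ?\<delta>] est_efficient[OF assms, of ?\<delta>] by (simp add: total_eq)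
  also have "\<dots> \<le> 2 * Ce * (?D + ?\<eta>) + ?\<eta>"
    using true_error(2)[OF assms, of ?\<delta>] Ce0 by (intro add_right_mono mult_left_mono) auto
  also have "\<dots> \<le> (2 * Ce / \<theta> + 2 * Ce + 1) * energy i"
  proof -
    have "(2 * Ce / \<theta> + 2 * Ce + 1) * energy i - (2 * Ce * (?D + ?\<eta>) + ?\<eta>) =
        2 * Ce / \<theta> * ?\<eta> + (2 * Ce + 1) * (\<theta> * ?D)"
      using \<theta>(1) by (simp add: field_simps)
    moreover have "0 \<le> 2 * Ce / \<theta> * ?\<eta> + (2 * Ce + 1) * (\<theta> * ?D)"
      using nn Ce0 \<theta>(1) by (intro add_nonneg_nonneg mult_nonneg_nonneg) auto
    ultimately show ?thesis by linarith
  qed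
  finally show ?thesis .
qed

lemma error_le_total:
  assumes "w \<in> trial D \<delta>"
  shows "Xnorm P (u - w) + osc dat \<delta> \<le> (Cr + 2) * total_est P D dat \<delta> w"
proof -
  have wX: "w \<in> X" using assms by (rule trial_X)
  have Cr0: "0 < Cr" by (rule const_pos)
  have "Xnorm P (u - w) + osc dat \<delta> \<le> Cr * (res \<delta> w + est \<delta> w) + 2 * osc dat \<delta>"
    using true_error(1)[OF wX, of \<delta>] err_reliable[OF assms del_small(1)] by linarith
  also have "\<dots> \<le> (Cr + 2) * total_est P D dat \<delta> w"
  proof -
    have "(Cr + 2) * total_est P D dat \<delta> w - (Cr * (res \<delta> w + est \<delta> w) + 2 * osc dat \<delta>) =
        Cr * osc dat \<delta> + 2 * (res \<delta> w + est \<delta> w)"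
      by (simp add: total_eq algebra_simps)
    moreover have "0 \<le> Cr * osc dat \<delta> + 2 * (res \<delta> w + est \<delta> w)"
      using Cr0 osc_nonneg est_facts(1)[OF wX] by (simp add: add_nonneg_nonneg)
    ultimately show ?thesis by linarith
  qed
  finally show ?thesis .
qed

abbreviation "run \<epsilon> \<delta>0 t0 s n \<equiv> alg_run P D dat \<omega> \<theta> \<xi> \<epsilon> \<delta>0 t0 s n"
abbreviation "passes \<epsilon> i \<equiv> passes_until P D dat \<xi> \<epsilon> i"

lemma run_valid: "run \<epsilon> \<delta>0 t0 s n \<Longrightarrow> k \<le> n \<Longrightarrow> app (s k) \<in> trial D (idx (s k))"
  by (auto simp: alg_run_def valid_iterate_def)

lemma run_next: "run \<epsilon> \<delta>0 t0 s n \<Longrightarrow> k < n \<Longrightarrow> next_iterate P D dat \<omega> \<theta> \<xi> \<epsilon> (s k) (s (Suc k))"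
  by (auto simp: alg_run_def)

lemma passes_passing: "passes \<epsilon> i \<Longrightarrow> passing (idx i) (app i)"
  by (simp add: passes_until_def total_eq)

text \<open>Between the two passings only the inner loop runs, which keeps the index chosen by the
  refinement after \<open>i\<close>.\<close>

theorem run_contraction:
  assumes run: "run \<epsilon> \<delta>0 t0 s n" and ij: "i < j" "j \<le> n"
    and pi: "passes \<epsilon> (s i)" and pj: "passes \<epsilon> (s j)"
    and between: "\<And>k. i < k \<Longrightarrow> k < j \<Longrightarrow> \<not> passes \<epsilon> (s k)"
  shows "energy (s j) \<le> \<rho> * energy (s i)"
proof -
  have idx: "idx (s (Suc i + k)) = idx (s (Suc i))" if "Suc i + k \<le> j" for k
    using that
  proof (induction k)
    case (Suc k)
    have "next_iterate P D dat \<omega> \<theta> \<xi> \<epsilon> (s (Suc i + k)) (s (Suc (Suc i + k)))"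
      using Suc.prems ij(2) by (intro run_next[OF run]) simp
    moreover have "\<not> passes \<epsilon> (s (Suc i + k))" using Suc.prems by (intro between) auto
    ultimately have "idx (s (Suc (Suc i + k))) = idx (s (Suc i + k))" by (simp add: next_iterate_def)
    then show ?case using Suc by simp
  qed simp
  have j: "idx (s j) = idx (s (Suc i))" using idx[of "j - Suc i"] ij(1) by simp
  have "refines P D dat \<omega> \<theta> (idx (s i)) (app (s i)) (idx (s (Suc i)))"
    using run_next[OF run, of i] ij pi by (simp add: next_iterate_def)
  then show ?thesis
    using contraction[OF run_valid[OF run, of i] passes_passing[OF pi] _ run_valid[OF run ij(2)] passes_passing[OF pj]]
      ij by (simp add: j)
qed

text \<open>Infinitely many passings would drive the energy to 0 although the estimator stays above
  \<epsilon>. Finitely many would leave an endless inner loop that halves \<open>est\<close> each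
  time, although the failed until-clause keeps it above \<open>\<xi> * \<epsilon>\<close>.\<close>

lemma no_infinite_run:
  assumes \<epsilon>: "0 < \<epsilon>" shows "\<nexists>s. \<forall>n. run \<epsilon> \<delta>0 t0 s n"
proof
  assume "\<exists>s. \<forall>n. run \<epsilon> \<delta>0 t0 s n"
  then obtain s where run: "\<And>n. run \<epsilon> \<delta>0 t0 s n" by blast
  have mem: "app (s k) \<in> trial D (idx (s k))" for k using run_valid[OF run, of k k] by simp
  have memX: "app (s k) \<in> X" for k by (rule trial_X[OF mem])
  have nxt: "next_iterate P D dat \<omega> \<theta> \<xi> \<epsilon> (s k) (s (Suc k))" for k using run_next[OF run, of k "Suc k"] by simp
  then have big: "\<epsilon> < total_est P D dat (idx (s k)) (app (s k))" for k
    by (auto simp: next_iterate_def stops_def not_le)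
  define N where "N = {k. passes \<epsilon> (s k)}"
  show False
  proof (cases "finite N")
    case False
    \<comment> \<open>Increasing enumeration makes consecutive members successive passings, as
      \<open>run_contraction\<close> requires.\<close>
    define e where "e = enumerate N"
    have eN: "passes \<epsilon> (s (e n))" for n using enumerate_in_set[OF False, of n] by (simp add: e_def N_def)
    have step: "energy (s (e (Suc n))) \<le> \<rho> * energy (s (e n))" for n
    proof (rule run_contraction[OF run _ order_refl eN eN])
      show "e n < e (Suc n)" unfolding e_def using False by (rule enumerate_step)
      fix k assume k: "e n < k" "k < e (Suc n)"
      then show "\<not> passes \<epsilon> (s k)"
        using not_less_Least[of k "\<lambda>k. k \<in> N \<and> e n < k"] enumerate_Suc''[OF False, of n]
        by (auto simp: e_def N_def)
    qed
    have pow: "energy (s (e n)) \<le> \<rho> ^ n * energy (s (e 0))" for n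
    proof (induction n)
      case (Suc n)
      have "energy (s (e (Suc n))) \<le> \<rho> * energy (s (e n))" by (rule step)
      also have "\<dots> \<le> \<rho> * (\<rho> ^ n * energy (s (e 0)))" using Suc rho_facts(1) by (rule mult_left_mono)
      finally show ?case by (simp add: mult.assoc)
    qed simp
    define K where "K = 2 * Ce / \<theta> + 2 * Ce + 1"
    have K: "0 < K" using const_pos(4) \<theta>(1) by (simp add: K_def add_pos_pos)
    have bound: "\<epsilon> \<le> K * (\<rho> ^ n * energy (s (e 0)))" for n
      using big[of "e n"] total_le_energy[OF memX, of "e n"] mult_left_mono[OF pow[of n], of K] K
      unfolding K_def by linarith
    have "(\<lambda>n. K * (\<rho> ^ n * energy (s (e 0)))) \<longlonglongrightarrow> K * (0 * energy (s (e 0)))"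
      using rho_facts by (intro tendsto_intros LIMSEQ_power_zero) simp
    then have "\<epsilon> \<le> K * (0 * energy (s (e 0)))" by (rule LIMSEQ_le_const) (use bound in blast)
    then show False using \<epsilon> by simp
  next
    case True
    then obtain k0 where "\<forall>k\<in>N. k < k0" using finite_nat_set_iff_bounded by auto
    then have np: "\<not> passes \<epsilon> (s k)" if "k \<ge> k0" for k using that by (auto simp: N_def)
    define t where "t k = est (idx (s k)) (app (s k))" for k
    have half: "t k \<le> tol (s k) / 2" for k
      using run[of k] by (auto simp: alg_run_def valid_iterate_def t_def)
    have tol: "tol (s (Suc k)) = t k" if "k \<ge> k0" for k
      using nxt[of k] np[OF that] by (simp add: next_iterate_def t_def)
    have dec: "t (k0 + n) \<le> (1 / 2) ^ n * t k0" for n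
    proof (induction n)
      case (Suc n)
      have "t (k0 + Suc n) \<le> t (k0 + n) / 2" using half[of "k0 + Suc n"] tol[of "k0 + n"] by simp
      then show ?case using Suc by simp
    qed simp
    have low: "\<xi> * \<epsilon> \<le> t k" if "k \<ge> k0" for k
    proof -
      have "\<not> stops P D dat \<epsilon> (s k)" using nxt[of k] by (simp add: next_iterate_def)
      then have "\<xi> * total_est P D dat (idx (s k)) (app (s k)) < t k"
        using np[OF that] by (simp add: passes_until_def t_def)
      moreover have "\<xi> * \<epsilon> \<le> \<xi> * total_est P D dat (idx (s k)) (app (s k))"
        using big[of k] \<xi>(1) by simp
      ultimately show ?thesis by linarith
    qed
    have bound: "\<xi> * \<epsilon> \<le> (1 / 2) ^ n * t k0" for n using low[of "k0 + n"] dec[of n] by simp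
    have "(\<lambda>n. (1 / 2) ^ n * t k0) \<longlonglongrightarrow> 0 * t k0" by (intro tendsto_intros LIMSEQ_power_zero) simp
    then have "\<xi> * \<epsilon> \<le> 0 * t k0" by (rule LIMSEQ_le_const) (use bound in blast)
    then show False using \<xi>(1) \<epsilon> by (simp add: mult_le_0_iff)
  qed
qed

lemma valid_iterate_exists:
  assumes "0 \<le> t" shows "\<exists>i. idx i = \<delta> \<and> tol i = t \<and> valid_iterate P D dat i"
proof -
  obtain w where "w \<in> trial D \<delta>" "est \<delta> w = 0" using discrete_solution_exists by blast
  then show ?thesis using assms
    by (intro exI[of _ "\<lparr>idx = \<delta>, tol = t, app = w\<rparr>"]) (simp add: valid_iterate_def)
qed

text \<open>In the bulk case \<open>up D\<close> with the full index set is always an allowed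
  choice; in the other case halving is assumed possible. The inner loop can proceed because the
  discrete system is solvable.\<close>

lemma run_extends:
  assumes halving: "osc_halving_possible D dat" and run: "run \<epsilon> \<delta>0 t0 s n" and ns: "\<not> stops P D dat \<epsilon> (s n)"
  shows "\<exists>i. run \<epsilon> \<delta>0 t0 (s(Suc n := i)) (Suc n)"
proof -
  let ?\<delta> = "idx (s n)" and ?w = "app (s n)"
  let ?r = "residual_vec P D dat ?\<delta> ?w"
  have w: "?w \<in> trial D ?\<delta>" using run_valid[OF run, of n] by simp
  have wX: "?w \<in> X" by (rule trial_X[OF w])
  have nn: "0 \<le> est ?\<delta> ?w" "0 \<le> total_est P D dat ?\<delta> ?w"
    using est_facts(1)[OF wX] osc_nonneg[of ?\<delta>] by (auto simp: total_eq add_nonneg_nonneg)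
  have ref: "\<exists>\<delta>'. refines P D dat \<omega> \<theta> ?\<delta> ?w \<delta>'"
  proof (cases "osc dat ?\<delta> > \<omega> * res ?\<delta> ?w")
    case True
    moreover have "0 \<le> \<omega> * res ?\<delta> ?w" using \<omega>(1) by simp
    ultimately have "osc dat ?\<delta> > 0" by linarith
    then show ?thesis using halving True unfolding osc_halving_possible_def refines_def Let_def by auto
  next
    case False
    have "{z + y |z y. z \<in> trial D ?\<delta> \<and> y \<in> span (compl_fun D ?\<delta> ` ind D ?\<delta>)} \<subseteq> trial D (up D ?\<delta>)"
      using compl unfolding complement_functions_def by blast
    moreover have "\<theta> * res ?\<delta> ?w \<le> res ?\<delta> ?w"
      using \<theta> by (simp add: mult_left_le_one_le)
    ultimately have "refines P D dat \<omega> \<theta> ?\<delta> ?w (up D ?\<delta>)"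
      using False trial_facts(6)[of ?\<delta>] unfolding refines_def Let_def by auto
    then show ?thesis by blast
  qed
  have "\<exists>i. valid_iterate P D dat i \<and> next_iterate P D dat \<omega> \<theta> \<xi> \<epsilon> (s n) i"
  proof (cases "passes \<epsilon> (s n)")
    case True
    obtain \<delta>' where r: "refines P D dat \<omega> \<theta> ?\<delta> ?w \<delta>'" using ref by blast
    obtain i where "idx i = \<delta>'" "tol i = total_est P D dat ?\<delta> ?w" "valid_iterate P D dat i"
      using valid_iterate_exists[OF nn(2)] by blast
    then show ?thesis using True r ns by (auto simp: next_iterate_def)
  next
    case False
    obtain i where "idx i = ?\<delta>" "tol i = est ?\<delta> ?w" "valid_iterate P D dat i"
      using valid_iterate_exists[OF nn(1)] by blast
    then show ?thesis using False ns by (auto simp: next_iterate_def)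
  qed
  then obtain i where i: "valid_iterate P D dat i" "next_iterate P D dat \<omega> \<theta> \<xi> \<epsilon> (s n) i" by blast
  have "run \<epsilon> \<delta>0 t0 (s(Suc n := i)) (Suc n)"
    using run i unfolding alg_run_def by (auto simp: le_Suc_eq less_Suc_eq)
  then show ?thesis by blast
qed

lemma Ydual_norm_nonneg: "g \<in> Ydual P \<Longrightarrow> 0 \<le> Ydual_norm P g"
  using A.dual_norm_rep[of "Ynorm P" "A_inv P g" g] A_inv[of g] A.nonneg[of "A_inv P g"]
  by (simp add: Ynorm_def)

theorem terminates:
  assumes "0 < \<epsilon>" "initial_tol P dat t0"
  shows "alg_terminates P D dat \<omega> \<theta> \<xi> \<epsilon> \<delta>0 t0"
  unfolding alg_terminates_def
proof (intro conjI impI allI no_infinite_run[OF assms(1)])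
  have "rhs dat \<in> Ydual P" using adm by (simp add: admissible_data_def)
  then have "0 \<le> Ydual_norm P (rhs dat) + norm (ini dat)" using Ydual_norm_nonneg by (simp add: add_nonneg_nonneg)
  then have "0 \<le> t0"
    using assms(2) unfolding initial_tol_def by (meson less_imp_le mult_nonneg_nonneg order_trans)
  then obtain i where "idx i = \<delta>0" "tol i = t0" "valid_iterate P D dat i"
    using valid_iterate_exists by blast
  then have "run \<epsilon> \<delta>0 t0 (\<lambda>_. i) 0" by (simp add: alg_run_def)
  then show "\<exists>s. run \<epsilon> \<delta>0 t0 s 0" by blast
next
  fix s n assume "osc_halving_possible D dat" "run \<epsilon> \<delta>0 t0 s n \<and> \<not> stops P D dat \<epsilon> (s n)"
  then show "\<exists>i. run \<epsilon> \<delta>0 t0 (s(Suc n := i)) (Suc n)" using run_extends by blast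
qed

end

text \<open>The rate and the final constant are fixed before problem and discretization, so they
  have to be expressions in \<open>m\<close>, \<open>M\<close>, \<zeta>, \<open>k\<^sub>1\<close>,
  \<open>k\<^sub>2\<close>, \<theta> and \<omega> alone.\<close>

theorem theorem4p9:
  fixes m M \<zeta> k\<^sub>1 k\<^sub>2 :: real
  assumes "0 < m" and "m \<le> M" and "\<zeta> < 1" and "0 < k\<^sub>1" and "k\<^sub>1 \<le> k\<^sub>2"
  shows "\<exists>c > 0. \<exists>d h :: real \<Rightarrow> real.
    (\<forall>x>0. 0 < d x) \<and> (\<forall>x>0. 0 < h x) \<and> (h \<longlongrightarrow> 0) (at_right 0) \<and>
    (\<forall>\<theta> \<omega> \<xi>. 0 < \<theta> \<and> \<theta> \<le> 1 \<and> 0 < \<omega> \<and> 0 < \<xi> \<and> \<xi> < 1 \<and>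
        \<theta> \<le> c \<and> \<omega> / \<theta> \<le> c \<and> \<xi> / \<theta> \<le> d (\<omega> / \<theta>) \<and> \<omega> \<le> h \<theta> \<longrightarrow>
      (\<exists>\<rho> < 1. \<exists>C.
        \<forall>(P :: ('v::{real_inner, banach, second_countable_topology},
                  'h::{real_inner, banach, second_countable_topology}) evolution)
          (D :: ('d, 'l, 'v, 'h) discretization) \<kappa>.
          evolution_problem P \<and> trial_test_spaces P D \<and> test_preconditioner P D \<kappa> \<and>
          trial_preconditioner P D k\<^sub>1 k\<^sub>2 \<and> saturation P D \<zeta> \<and>
          complement_functions P D \<and> stable_complement P D m M \<and>
          (let q = \<kappa> / real_of_ereal (gamma_const P D) - 1 in q / \<omega> \<le> c \<and> q \<le> h \<theta>) \<longrightarrow>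
          (\<forall>dat u \<epsilon> \<delta>\<^sub>0 t\<^sub>0. admissible_data P D dat \<and> solves P (rhs dat) (ini dat) u \<and>
              0 < \<epsilon> \<and> initial_tol P dat t\<^sub>0 \<longrightarrow>
            (\<forall>s n i j. alg_run P D dat \<omega> \<theta> \<xi> \<epsilon> \<delta>\<^sub>0 t\<^sub>0 s n \<and> i < j \<and> j \<le> n \<and>
                passes_until P D dat \<xi> \<epsilon> (s i) \<and> passes_until P D dat \<xi> \<epsilon> (s j) \<and>
                (\<forall>k. i < k \<and> k < j \<longrightarrow> \<not> passes_until P D dat \<xi> \<epsilon> (s k)) \<longrightarrow>
              \<theta> * Xnorm P (u - app (s j)) + osc dat (idx (s j)) \<le>
                \<rho> * (\<theta> * Xnorm P (u - app (s i)) + osc dat (idx (s i)))) \<and>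
            alg_terminates P D dat \<omega> \<theta> \<xi> \<epsilon> \<delta>\<^sub>0 t\<^sub>0 \<and>
            (\<forall>s n. alg_run P D dat \<omega> \<theta> \<xi> \<epsilon> \<delta>\<^sub>0 t\<^sub>0 s n \<and> stops P D dat \<epsilon> (s n) \<longrightarrow>
              Xnorm P (u - app (s n)) + osc dat (idx (s n)) \<le> C * \<epsilon>))))"
proof -
  note hyps = assms
  obtain c where c: "small_const m M \<zeta> k\<^sub>1 k\<^sub>2 c" using small_const_exists[OF hyps] by blast
  have c_pos: "0 < c" and c64: "64 * c \<le> 1" using c unfolding small_const_def Let_def by blast+
  \<comment> \<open>With these choices the premises become \<open>\<xi> \<le> c * \<omega>\<close>
    and \<open>\<omega> \<le> c * \<theta>\<^sup>2\<close>, the form in which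
    \<open>adaptive\<close> takes them.\<close>
  define d :: "real \<Rightarrow> real" where "d x = c * x" for x
  define h :: "real \<Rightarrow> real" where "h t = c * t\<^sup>2" for t
  have "(h \<longlongrightarrow> c * 0\<^sup>2) (at_right 0)" unfolding h_def by (intro tendsto_intros)
  then have h0: "(h \<longlongrightarrow> 0) (at_right 0)" by simp
  \<comment> \<open>The rate of \<open>adaptive\<close>, written out before any problem is
    fixed.\<close>
  define contr where "contr \<theta> \<omega> = max (1 - osc_rate m M \<zeta> k\<^sub>2 * \<omega> / \<theta> / (8 * (1 + osc_rate m M \<zeta> k\<^sub>2 * \<omega> / \<theta>)))
    (1 - (bulk_rate m M \<zeta> k\<^sub>2)\<^sup>2 * \<theta>\<^sup>2 / 8)" for \<theta> \<omega>
  have contr: "contr \<theta> \<omega> < 1" if "0 < \<theta>" "0 < \<omega>" for \<theta> \<omega>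
    using constants_pos(6,7)[OF hyps] that by (simp add: contr_def add_pos_pos)
  have main: "(\<forall>s n i j. alg_run P D dat \<omega> \<theta> \<xi> \<epsilon> \<delta>\<^sub>0 t\<^sub>0 s n \<and> i < j \<and> j \<le> n \<and>
                passes_until P D dat \<xi> \<epsilon> (s i) \<and> passes_until P D dat \<xi> \<epsilon> (s j) \<and>
                (\<forall>k. i < k \<and> k < j \<longrightarrow> \<not> passes_until P D dat \<xi> \<epsilon> (s k)) \<longrightarrow>
              \<theta> * Xnorm P (u - app (s j)) + osc dat (idx (s j)) \<le>
                contr \<theta> \<omega> * (\<theta> * Xnorm P (u - app (s i)) + osc dat (idx (s i)))) \<and>
            alg_terminates P D dat \<omega> \<theta> \<xi> \<epsilon> \<delta>\<^sub>0 t\<^sub>0 \<and>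
            (\<forall>s n. alg_run P D dat \<omega> \<theta> \<xi> \<epsilon> \<delta>\<^sub>0 t\<^sub>0 s n \<and> stops P D dat \<epsilon> (s n) \<longrightarrow>
              Xnorm P (u - app (s n)) + osc dat (idx (s n)) \<le> (reliability m M \<zeta> k\<^sub>2 + 2) * \<epsilon>)"
    if par: "0 < \<theta>" "\<theta> \<le> 1" "0 < \<omega>" "0 < \<xi>" "\<xi> < 1" "\<theta> \<le> c" "\<xi> / \<theta> \<le> d (\<omega> / \<theta>)" "\<omega> \<le> h \<theta>"
      and prob: "evolution_problem P" "trial_test_spaces P D" "test_preconditioner P D \<kappa>"
        "trial_preconditioner P D k\<^sub>1 k\<^sub>2" "saturation P D \<zeta>" "complement_functions P D" "stable_complement P D m M"
      and q: "(\<kappa> / real_of_ereal (gamma_const P D) - 1) / \<omega> \<le> c" "\<kappa> / real_of_ereal (gamma_const P D) - 1 \<le> h \<theta>"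
      and data: "admissible_data P D dat" "solves P (rhs dat) (ini dat) u" "0 < \<epsilon>" "initial_tol P dat t\<^sub>0"
    for \<theta> \<omega> \<xi> \<kappa> \<epsilon> t\<^sub>0 \<delta>\<^sub>0 u and P :: "('v, 'h) evolution" and D :: "('d, 'l, 'v, 'h) discretization"
      and dat :: "('d, 'v, 'h) data"
  proof -
    interpret discretized P D \<kappa> k\<^sub>1 k\<^sub>2 \<zeta> m M
      by unfold_locales (fact prob hyps)+
    have qd: "q \<le> c * \<omega>" "q \<le> c * \<theta>\<^sup>2"
      using q par(3) by (auto simp: q_def \<gamma>_def h_def divide_le_eq)
    have "c * \<theta>\<^sup>2 \<le> c * 1" using par(1,2) c_pos by (intro mult_left_mono) (auto simp: power_le_one)
    then have q16: "q \<le> 1 / 16" using qd(2) c64 by linarith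
    have \<xi>: "\<xi> \<le> c * \<omega>" using par(1,7) by (simp add: d_def divide_le_eq)
    have \<omega>: "\<omega> \<le> c * \<theta>\<^sup>2" using par(8) by (simp add: h_def)
    interpret adaptive P D \<kappa> k\<^sub>1 k\<^sub>2 \<zeta> m M dat u c \<theta> \<omega> \<xi>
      by unfold_locales (fact data q16 c par qd \<xi> \<omega>)+
    have r: "adaptive.\<rho> k\<^sub>2 \<zeta> m M \<theta> \<omega> = contr \<theta> \<omega>"
      by (simp only: contr_def \<rho>_def y_rate_def s_rate_def)
    show ?thesis
    proof (intro conjI allI impI)
      fix s n i j
      assume "alg_run P D dat \<omega> \<theta> \<xi> \<epsilon> \<delta>\<^sub>0 t\<^sub>0 s n \<and> i < j \<and> j \<le> n \<and>
                passes_until P D dat \<xi> \<epsilon> (s i) \<and> passes_until P D dat \<xi> \<epsilon> (s j) \<and>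
                (\<forall>k. i < k \<and> k < j \<longrightarrow> \<not> passes_until P D dat \<xi> \<epsilon> (s k))"
      then show "\<theta> * Xnorm P (u - app (s j)) + osc dat (idx (s j)) \<le>
                contr \<theta> \<omega> * (\<theta> * Xnorm P (u - app (s i)) + osc dat (idx (s i)))"
        using run_contraction[of \<epsilon> \<delta>\<^sub>0 t\<^sub>0 s n i j] unfolding r by blast
    next
      show "alg_terminates P D dat \<omega> \<theta> \<xi> \<epsilon> \<delta>\<^sub>0 t\<^sub>0" by (rule terminates[OF data(3,4)])
    next
      fix s n assume a: "alg_run P D dat \<omega> \<theta> \<xi> \<epsilon> \<delta>\<^sub>0 t\<^sub>0 s n \<and> stops P D dat \<epsilon> (s n)"
      then have "app (s n) \<in> trial D (idx (s n))" using run_valid[of \<epsilon> \<delta>\<^sub>0 t\<^sub>0 s n n] by simp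
      note error_le_total[OF this]
      also have "(reliability m M \<zeta> k\<^sub>2 + 2) * total_est P D dat (idx (s n)) (app (s n)) \<le> (reliability m M \<zeta> k\<^sub>2 + 2) * \<epsilon>"
        using a const_pos(3) by (intro mult_left_mono) (auto simp: stops_def)
      finally show "Xnorm P (u - app (s n)) + osc dat (idx (s n)) \<le> (reliability m M \<zeta> k\<^sub>2 + 2) * \<epsilon>" .
    qed
  qed
  show ?thesis
    unfolding Let_def
    apply (rule exI[of _ c], intro conjI c_pos, rule exI[of _ d], rule exI[of _ h], intro conjI h0)
      apply (simp add: d_def c_pos)
     apply (simp add: h_def c_pos)
    apply (intro allI impI)
    subgoal premises a for \<theta> \<omega> \<xi>
      by (rule exI[of _ "contr \<theta> \<omega>"], rule conjI[OF contr], use a in blast, use a in blast,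
          rule exI[of _ "reliability m M \<zeta> k\<^sub>2 + 2"], intro allI impI, rule main) (use a in blast)+
    done
qed

end
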